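(* There are PPT states $\rho_{d_s}\in\mathcal B(\mathbb C^2\otimes\mathbb C^2\otimes\mathbb C^{d_s}\otimes\mathbb C^{d_s})$ satisfying $$K_D(\rho_{d_s})=1-2h(p)\quad\text{with}\quad p=\frac1{\sqrt{d_s}+1}$$ and $h$ the binary Shannon entropy, such that $$K_{A\leftrightarrow C\leftrightarrow B}(\rho_{d_s}\otimes\rho_{d_s})\le 2p\log(2d_s)+\eta(p),$$ where $\eta(p)=-p\log p$. In summary, there exist states $\rho$ with $$1\approx K_D(\rho)>K_{A\leftrightarrow C\leftrightarrow B}(\rho\otimes\rho)\approx0.$$
   Context: All systems are finite-dimensional; $\log$ is base 2. The states $\rho_{d_s}$ form a family of increasing dimension, indexed by the dimension $d_s$; the symbols $\approx$ in the summary are informal and refer to large $d_s$ (so that $p\to0$). The state $\rho_{d_s}$ lives on systems $A,B,A',B'$ (dimensions $2,2,d_s,d_s$) and is viewed as bipartite in the cut $AA':BB'$; PPT means positive partial transpose with respect to this cut. In $\rho_{d_s}\otimes\rho_{d_s}$, the first copy is shared between Alice and Charlie (Charlie's part is $C_A$) and the second between Charlie (part $C_B$) and Bob; Charlie holds $C=C_AC_B$. $\alpha\approx_\epsilon\beta$ means $\|\alpha-\beta\|_1\le\epsilon$. LOCC means local operations and classical communication. Private states: an $m$-bit private state $\gamma_m$ is a bipartite state (cut $AA':BB'$), with key systems $A,B$ of dimension $2^m$ and shield systems $A',B'$ of arbitrary finite dimension, of the form $\gamma_m=2^{-m}\sum_{i,j=0}^{2^m-1}|ii\rangle\langle jj|_{AB}\otimes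 U_i\,\sigma_{A'B'}\,U_j^\dagger$ with $\sigma_{A'B'}$ a state and $U_i$ unitaries on $A'B'$. Distillable key: $K_D(\rho)=\inf_{\epsilon>0}\limsup_{n\to\infty}\sup_{\Lambda_n\,\mathrm{LOCC},\,\gamma_m}\{\frac mn:\Lambda_n(\rho^{\otimes n})\approx_\epsilon\gamma_m\}$. Quantum key repeater rate: $$K_{A\leftrightarrow C\leftrightarrow B}(\rho_{AC_A}\otimes\tilde\rho_{C_BB})=\inf_{\epsilon>0}\limsup_{n\to\infty}\sup_{\Lambda_n,\gamma_m}\Big\{\tfrac mn:\ \mathrm{Tr}_C\Lambda_n\big((\rho_{AC_A}\otimes\tilde\rho_{C_BB})^{\otimes n}\big)\approx_\epsilon\gamma_m\Big\},$$ with $\Lambda_n$ ranging over tripartite LOCC protocols among Alice, Bob and Charlie, and $\gamma_m$ over $m$-bit private states between Alice and Bob.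
   Formalization: The equality K_D = 1-2h(p) is claimed only for those d_s with 1-2h(p) ≥ 0, which includes all large d_s; for small d_s (e.g. d_s = 1, p = 1/2) the right side is negative and the equality is impossible, since K_D ≥ 0. *)

theory Defs
  imports "HOL-Analysis.Analysis"
begin

section \<open>Operators on finite-dimensional spaces\<close>

text \<open>
  An operator from \<open>\<complex>\<^sup>T\<close> to \<open>\<complex>\<^sup>S\<close> is its matrix with respect to the standard bases, extended
  by zero outside \<open>S \<times> T\<close>; hence operators are equal iff they are equal as functions. Explicit
  index sets are used instead of index types because dimensions (of shields, and of the systems
  occurring in a protocol) are quantified inside the definitions below.
\<close>

type_synonym ('i, 'j) operator = "'i \<Rightarrow> 'j \<Rightarrow> complex"

definition operators :: "'i set \<Rightarrow> 'j set \<Rightarrow> ('i, 'j) operator set" where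
  "operators S T = {A. \<forall>i j. A i j \<noteq> 0 \<longrightarrow> i \<in> S \<and> j \<in> T}"

definition op_mult :: "'j set \<Rightarrow> ('i, 'j) operator \<Rightarrow> ('j, 'k) operator \<Rightarrow> ('i, 'k) operator" where
  "op_mult S A B = (\<lambda>i k. \<Sum>j\<in>S. A i j * B j k)"

definition op_id :: "'i set \<Rightarrow> ('i, 'i) operator" where
  "op_id S = (\<lambda>i j. if i = j \<and> i \<in> S then 1 else 0)"

definition op_adj :: "('i, 'j) operator \<Rightarrow> ('j, 'i) operator" where
  "op_adj A = (\<lambda>i j. cnj (A j i))"

definition op_trace :: "'i set \<Rightarrow> ('i, 'i) operator \<Rightarrow> complex" where
  "op_trace S A = (\<Sum>i\<in>S. A i i)"

definition unitary_op :: "'i set \<Rightarrow> ('i, 'i) operator \<Rightarrow> bool" where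
  "unitary_op S U \<longleftrightarrow> U \<in> operators S S
     \<and> op_mult S (op_adj U) U = op_id S \<and> op_mult S U (op_adj U) = op_id S"

definition positive_op :: "'i set \<Rightarrow> ('i, 'i) operator \<Rightarrow> bool" where
  "positive_op S A \<longleftrightarrow> A \<in> operators S S
     \<and> (\<forall>v :: 'i \<Rightarrow> complex. (\<Sum>i\<in>S. \<Sum>j\<in>S. cnj (v i) * A i j * v j) \<in> \<real>\<^sub>\<ge>\<^sub>0)"

definition density_op :: "'i set \<Rightarrow> ('i, 'i) operator \<Rightarrow> bool" where
  "density_op S \<rho> \<longleftrightarrow> positive_op S \<rho> \<and> op_trace S \<rho> = 1"

definition op_abs :: "'i set \<Rightarrow> ('i, 'i) operator \<Rightarrow> ('i, 'i) operator" where
  "op_abs S A = (THE R. positive_op S R \<and> op_mult S R R = op_mult S (op_adj A) A)"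

definition trace_norm :: "'i set \<Rightarrow> ('i, 'i) operator \<Rightarrow> real" where
  "trace_norm S A = Re (op_trace S (op_abs S A))"


section \<open>Multipartite systems\<close>

text \<open>
  Each party holds a list of subsystems, given by the list of their dimensions; the empty list is
  the trivial system \<open>\<complex>\<close>. A basis vector of the joint space assigns to each party
  the list of the basis indices of her subsystems. States shared by Alice and Bob
  only are those on a space in which Charlie's list is empty.
\<close>

datatype party = Alice | Bob | Charlie

type_synonym dims = "party \<Rightarrow> nat list"
type_synonym index = "party \<Rightarrow> nat list"
type_synonym joint_op = "(index, index) operator"

definition party_basis :: "nat list \<Rightarrow> nat list set" where
  "party_basis ds = listset (map lessThan ds)"

definition joint_basis :: "dims \<Rightarrow> index set" where
  "joint_basis D = {x. \<forall>p. x p \<in> party_basis (D p)}"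

text \<open>
  The tensor product merges the systems party by party: party \<open>p\<close> holds \<open>D p @ E p\<close> if the first
  factor lives on \<open>D\<close> and the second on \<open>E\<close>.
\<close>

definition tensor :: "dims \<Rightarrow> joint_op \<Rightarrow> joint_op \<Rightarrow> joint_op" where
  "tensor D \<rho> \<tau> = (\<lambda>x y.
     \<rho> (\<lambda>p. take (length (D p)) (x p)) (\<lambda>p. take (length (D p)) (y p))
   * \<tau> (\<lambda>p. drop (length (D p)) (x p)) (\<lambda>p. drop (length (D p)) (y p)))"

primrec tensor_power :: "dims \<Rightarrow> joint_op \<Rightarrow> nat \<Rightarrow> joint_op" where
  "tensor_power D \<rho> 0 = op_id {\<lambda>p. []}"
| "tensor_power D \<rho> (Suc n) = tensor D \<rho> (tensor_power D \<rho> n)"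

definition power_dims :: "dims \<Rightarrow> nat \<Rightarrow> dims" where
  "power_dims D n = (\<lambda>p. concat (replicate n (D p)))"

definition trace_out_Charlie :: "dims \<Rightarrow> joint_op \<Rightarrow> joint_op" where
  "trace_out_Charlie D \<rho> = (\<lambda>x y. if x Charlie = [] \<and> y Charlie = []
     then \<Sum>c\<in>party_basis (D Charlie). \<rho> (x(Charlie := c)) (y(Charlie := c)) else 0)"

definition transpose_Bob :: "joint_op \<Rightarrow> joint_op" where
  "transpose_Bob \<rho> = (\<lambda>x y. \<rho> (x(Bob := y Bob)) (y(Bob := x Bob)))"

definition PPT :: "dims \<Rightarrow> joint_op \<Rightarrow> bool" where
  "PPT D \<rho> \<longleftrightarrow> positive_op (joint_basis D) (transpose_Bob \<rho>)"


section \<open>LOCC\<close>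

text \<open>\<open>local_conj D p K \<rho>\<close> is \<open>(K \<otimes> 1) \<rho> (K \<otimes> 1)\<^sup>\<dagger>\<close>, where \<open>K\<close> acts on the system of party \<open>p\<close>.\<close>

definition local_conj ::
  "dims \<Rightarrow> party \<Rightarrow> (nat list, nat list) operator \<Rightarrow> joint_op \<Rightarrow> joint_op" where
  "local_conj D p K \<rho> = (\<lambda>x y. \<Sum>u\<in>party_basis (D p). \<Sum>v\<in>party_basis (D p).
     K (x p) u * \<rho> (x(p := u)) (y(p := v)) * cnj (K (y p) v))"

text \<open>
  A quantum instrument on the system with dimensions \<open>ds\<close>, in Kraus form: outcome \<open>k < r\<close> leaves
  a system with dimensions \<open>es k\<close> and has the Kraus operators \<open>K k l\<close>, \<open>l < s k\<close>.
\<close>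

definition instrument ::
  "nat list \<Rightarrow> nat \<Rightarrow> (nat \<Rightarrow> nat) \<Rightarrow> (nat \<Rightarrow> nat list)
    \<Rightarrow> (nat \<Rightarrow> nat \<Rightarrow> (nat list, nat list) operator) \<Rightarrow> bool" where
  "instrument ds r s es K \<longleftrightarrow>
     (\<forall>k<r. \<forall>l<s k. K k l \<in> operators (party_basis (es k)) (party_basis ds))
   \<and> (\<lambda>u v. \<Sum>k<r. \<Sum>l<s k. op_mult (party_basis (es k)) (op_adj (K k l)) (K k l) u v)
       = op_id (party_basis ds)"

text \<open>
  \<open>locc P D E \<Lambda>\<close>: the map \<open>\<Lambda>\<close> is implemented by a finite LOCC protocol
  among the parties in \<open>P\<close>. In each round some party applies an instrument and announces
  its outcome \<open>k\<close>, on which the remaining protocol may depend.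
\<close>

inductive locc :: "party set \<Rightarrow> dims \<Rightarrow> dims \<Rightarrow> (joint_op \<Rightarrow> joint_op) \<Rightarrow> bool"
  for P :: "party set" where
  stop: "locc P D D (\<lambda>\<rho>. \<rho>)"
| round: "\<lbrakk>p \<in> P; instrument (D p) r s es K; \<forall>k<r. locc P (D(p := es k)) E (\<Lambda> k)\<rbrakk>
    \<Longrightarrow> locc P D E (\<lambda>\<rho> x y. \<Sum>k<r. \<Lambda> k (\<lambda>x' y'. \<Sum>l<s k. local_conj D p (K k l) \<rho> x' y') x y)"


section \<open>Private states, distillable key and key repeater rate\<close>

text \<open>Alice holds \<open>AA'\<close>, Bob holds \<open>BB'\<close>; the key systems \<open>A\<close>, \<open>B\<close> come first.\<close>

definition key_shield :: "nat \<Rightarrow> nat \<Rightarrow> nat \<Rightarrow> dims" where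
  "key_shield k a b = (\<lambda>p. case p of Alice \<Rightarrow> [k, a] | Bob \<Rightarrow> [k, b] | Charlie \<Rightarrow> [])"

definition shield_index :: "index \<Rightarrow> nat \<times> nat" where
  "shield_index x = (x Alice ! 1, x Bob ! 1)"

definition private_states :: "nat \<Rightarrow> nat \<Rightarrow> nat \<Rightarrow> joint_op set" where
  "private_states m a b = {\<gamma>. \<exists>\<sigma> U. density_op ({..<a} \<times> {..<b}) \<sigma>
     \<and> (\<forall>i<2 ^ m. unitary_op ({..<a} \<times> {..<b}) (U i))
     \<and> \<gamma> = (\<lambda>x y. if x \<in> joint_basis (key_shield (2 ^ m) a b) \<and> y \<in> joint_basis (key_shield (2 ^ m) a b)
          then 1 / 2 ^ m * (\<Sum>i<2 ^ m. \<Sum>j<2 ^ m.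
            of_bool (x Alice ! 0 = i \<and> x Bob ! 0 = i \<and> y Alice ! 0 = j \<and> y Bob ! 0 = j)
            * op_mult ({..<a} \<times> {..<b}) (op_mult ({..<a} \<times> {..<b}) (U i) \<sigma>) (op_adj (U j))
                (shield_index x) (shield_index y))
          else 0)}"

text \<open>
  The rates are extended real numbers because the inner suprema can be infinite
  (they are for \<open>\<epsilon> \<ge> 2\<close>).
\<close>

definition distillable_key :: "dims \<Rightarrow> joint_op \<Rightarrow> ereal" where
  "distillable_key D \<rho> = (INF \<epsilon>\<in>{0<..}. limsup (\<lambda>n.
     SUP m\<in>{m. \<exists>a b \<Lambda>. \<exists>\<gamma>\<in>private_states m a b.
         locc {Alice, Bob} (power_dims D n) (key_shield (2 ^ m) a b) \<Lambda>
       \<and> trace_norm (joint_basis (key_shield (2 ^ m) a b))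
           (\<lambda>x y. \<Lambda> (tensor_power D \<rho> n) x y - \<gamma> x y) \<le> \<epsilon>}.
     ereal (real m / real n)))"

text \<open>
  \<open>chain D\<^sub>1 D\<^sub>2 \<rho> \<tau>\<close> is \<open>\<rho>\<^sub>A\<^sub>C\<^sub>A \<otimes> \<tau>\<^sub>C\<^sub>B\<^sub>B\<close>: Charlie plays the role of Bob in \<open>\<rho>\<close> and the role of
  Alice in \<open>\<tau>\<close>.
\<close>

definition chain_dims :: "dims \<Rightarrow> dims \<Rightarrow> dims" where
  "chain_dims D\<^sub>1 D\<^sub>2 = (\<lambda>p. case p of
     Alice \<Rightarrow> D\<^sub>1 Alice | Charlie \<Rightarrow> D\<^sub>1 Bob @ D\<^sub>2 Alice | Bob \<Rightarrow> D\<^sub>2 Bob)"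

definition chain :: "dims \<Rightarrow> dims \<Rightarrow> joint_op \<Rightarrow> joint_op \<Rightarrow> joint_op" where
  "chain D\<^sub>1 D\<^sub>2 \<rho> \<tau> =
    (let l = (\<lambda>x p. case p of Alice \<Rightarrow> x Alice | Bob \<Rightarrow> take (length (D\<^sub>1 Bob)) (x Charlie) | Charlie \<Rightarrow> []);
         r = (\<lambda>x p. case p of Alice \<Rightarrow> drop (length (D\<^sub>1 Bob)) (x Charlie) | Bob \<Rightarrow> x Bob | Charlie \<Rightarrow> [])
     in (\<lambda>x y. \<rho> (l x) (l y) * \<tau> (r x) (r y)))"

definition repeater_rate :: "dims \<Rightarrow> dims \<Rightarrow> joint_op \<Rightarrow> joint_op \<Rightarrow> ereal" where
  "repeater_rate D\<^sub>1 D\<^sub>2 \<rho> \<tau> = (INF \<epsilon>\<in>{0<..}. limsup (\<lambda>n.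
     SUP m\<in>{m. \<exists>a b cs \<Lambda>. \<exists>\<gamma>\<in>private_states m a b.
         locc {Alice, Bob, Charlie} (power_dims (chain_dims D\<^sub>1 D\<^sub>2) n)
           ((key_shield (2 ^ m) a b)(Charlie := cs)) \<Lambda>
       \<and> trace_norm (joint_basis (key_shield (2 ^ m) a b))
           (\<lambda>x y. trace_out_Charlie ((key_shield (2 ^ m) a b)(Charlie := cs))
                    (\<Lambda> (tensor_power (chain_dims D\<^sub>1 D\<^sub>2) (chain D\<^sub>1 D\<^sub>2 \<rho> \<tau>) n)) x y - \<gamma> x y) \<le> \<epsilon>}.
     ereal (real m / real n)))"


section \<open>Entropy functions\<close>

text \<open>Since \<open>log 2 0 = 0\<close>, the convention \<open>0 log 0 = 0\<close> is built in.\<close>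

definition binary_entropy :: "real \<Rightarrow> real" where
  "binary_entropy p = - p * log 2 p - (1 - p) * log 2 (1 - p)"

definition eta :: "real \<Rightarrow> real" where
  "eta p = - p * log 2 p"

end

theory Submission
  imports Defs "Jordan_Normal_Form.Spectral_Radius" "HOL-Real_Asymp.Real_Asymp"
begin

text \<open>
  \<^emph>\<open>Repeater bound.\<close> If the partial transpose of \<open>\<rho>\<close> is dominated by a diagonal operator of trace \<open>K\<close>,
  then the partial transpose of \<open>\<rho> \<otimes> \<rho>\<close> on Charlie's side is dominated by a separable operator of trace
  \<open>K\<^sup>2\<close>. Once Charlie is traced out, an LOCC protocol cannot distinguish a state from this partial
  transpose (conjugate Charlie's Kraus operators), and the test that accepts an \<open>m\<close>-bit private state
  with certainty has value at most \<open>2\<^sup>-\<^sup>m\<close> times the trace on a separable operator. So the repeater rate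
  is at most \<open>2 log K\<close>.

  \<^emph>\<open>States.\<close> The shield is maximally mixed on \<open>N \<times> N\<close> dimensions and is twisted, conditioned on
  the key bit, by a swap with phases from the discrete Fourier transform; a bit error of probability
  \<open>1 / (\<surd>N + 1)\<close> is just what makes the state PPT, and \<open>K\<close> exceeds 1 by this probability only. Linear
  codes that meet the Gilbert-Varshamov bound correct the bit errors, and dropping the erroneous positions
  leaves an exact private state, so the key rate is close to 1.

  \<^emph>\<open>Exact key.\<close> The true key rate \<open>k\<close> of these states is not computed. Mixing with weight \<open>1 - t\<close>
  a product state that the parties can recognise locally multiplies the key rate by exactly \<open>t\<close>, so
  \<open>t = (1 - 2 h(p)) / k\<close> gives the prescribed value. The flag uses up one of the \<open>d\<close> shield dimensions, hence
  \<open>N = d - 1\<close>; the lower bound on \<open>k\<close> has enough slack for this loss.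
\<close>

subsection \<open>Operator algebra\<close>

text \<open>The number 1 / (sqrt N + 1) comes from the partial transpose, which moves the coherences
  |00><11| of the key block into the error block, as an N by N matrix with entries of modulus (1 -
  p) / (2 N^2). Fourier phases give unimodular entries the least possible operator norm sqrt N, and
  error weights p / (2 N) on the N diagonal shields dominate the matrix exactly from p sqrt N = 1 -
  p on. Doubling these weights leaves room for either sign of the off-diagonal part, hence K = (1 -
  p) + 2 p.

  The value 1 - 2 h(p) is a target and not what the codes yield. Unique decoding of a fraction q of
  errors, with q above the error probability, needs distance 2 q and leaves rate 1 - h(2 q);
  clearing the error positions costs another q. The inequality h(2 q) + q \<le> 2 h(p) puts the
  result above the target, so the rate only has to be lowered. Lowering it by an exact factor takes
  conversions in both directions between a state and its mixture, with Chernoff bounds on the number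
  of unflagged copies.

  For small d the target is negative, so no state attains it, and a product state serves.\<close>

lemma eigenvector_exists:
  fixes A :: "('i, 'i) operator"
  assumes "finite S" "S \<noteq> {}"
  shows "\<exists>v c. (\<forall>i. i \<notin> S \<longrightarrow> v i = 0) \<and> (\<exists>i\<in>S. v i \<noteq> 0)
    \<and> (\<forall>i\<in>S. (\<Sum>j\<in>S. A i j * v j) = c * v i)"
proof -
  obtain b where b: "bij_betw b {..<card S} S"
    using assms(1) ex_bij_betw_nat_finite[of S] by (auto simp: lessThan_atLeast0)
  define n where "n = card S"
  have n: "n > 0" using assms by (simp add: n_def card_gt_0_iff)
  \<comment> \<open>Numbering \<open>S\<close> gives a genuine square matrix; over the complex
    numbers its spectrum is nonempty once the dimension is positive.\<close>
  define M where "M = Matrix.mat n n (\<lambda>(i,j). A (b i) (b j))"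
  have M: "M \<in> carrier_mat n n" by (simp add: M_def)
  from spectrum_non_empty[OF M n] obtain c where "eigenvalue M c"
    by (auto simp: spectrum_def)
  then obtain w where w: "w \<in> carrier_vec n" "w \<noteq> 0\<^sub>v n" "M *\<^sub>v w = c \<cdot>\<^sub>v w"
    using M by (auto simp: eigenvalue_def eigenvector_def)
  define g where "g = inv_into {..<n} b"
  define v where "v = (\<lambda>i. if i \<in> S then vec_index w (g i) else 0)"
  have g: "g (b k) = k" "b k \<in> S" if "k < n" for k
    using b that unfolding g_def n_def
    by (auto simp: bij_betw_def inv_into_f_f)
  have bg: "b (g i) = i" "g i < n" if "i \<in> S" for i
    using b that unfolding g_def n_def
    by (auto simp: bij_betw_def f_inv_into_f inv_into_into[of _ b "{..<card S}", simplified])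
  have vb: "v (b k) = vec_index w k" if "k < n" for k
    using g[OF that] by (simp add: v_def)
  have "\<exists>i\<in>S. v i \<noteq> 0"
  proof (rule ccontr)
    assume "\<not> ?thesis"
    then have "\<forall>k<n. vec_index w k = 0" using vb g by metis
    then have "w = 0\<^sub>v n" using w(1) by (intro eq_vecI) auto
    then show False using w by simp
  qed
  moreover have "(\<Sum>j\<in>S. A i j * v j) = c * v i" if "i \<in> S" for i
  proof -
    have "(\<Sum>j\<in>S. A i j * v j) = (\<Sum>k<n. A i (b k) * v (b k))"
      unfolding n_def by (rule sum.reindex_bij_betw[OF b, symmetric])
    also have "\<dots> = (\<Sum>k<n. A (b (g i)) (b k) * vec_index w k)"
      using vb bg that by simp
    also have "\<dots> = vec_index (M *\<^sub>v w) (g i)"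
      using w(1) bg(2)[OF that] by (simp add: M_def scalar_prod_def lessThan_atLeast0)
    also have "\<dots> = c * v i"
      using w bg(2)[OF that] that by (simp add: v_def)
    finally show ?thesis .
  qed
  ultimately show ?thesis by (intro exI[of _ v] exI[of _ c]) (auto simp: v_def)
qed

lemma op_mult_assoc:
  "op_mult T (op_mult S A B) C = op_mult S A (op_mult T B C)"
proof (intro ext)
  fix i k
  have "op_mult T (op_mult S A B) C i k = (\<Sum>j\<in>T. \<Sum>l\<in>S. A i l * B l j * C j k)"
    by (simp add: op_mult_def sum_distrib_right)
  also have "\<dots> = (\<Sum>l\<in>S. \<Sum>j\<in>T. A i l * B l j * C j k)"
    by (rule sum.swap)
  also have "\<dots> = op_mult S A (op_mult T B C) i k"
    by (simp add: op_mult_def sum_distrib_left mult.assoc)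
  finally show "op_mult T (op_mult S A B) C i k = op_mult S A (op_mult T B C) i k" .
qed

lemma op_adj_mult: "op_adj (op_mult S A B) = op_mult S (op_adj B) (op_adj A)"
  by (auto simp: op_adj_def op_mult_def fun_eq_iff mult.commute)

lemma op_adj_adj[simp]: "op_adj (op_adj A) = A"
  by (simp add: op_adj_def)

lemma op_adj_id[simp]: "op_adj (op_id S) = op_id S"
  by (auto simp: op_adj_def op_id_def fun_eq_iff)

lemma operatorsD: "A \<in> operators S T \<Longrightarrow> i \<notin> S \<or> j \<notin> T \<Longrightarrow> A i j = 0"
  by (auto simp: operators_def)

lemma operatorsI: "(\<And>i j. i \<notin> S \<or> j \<notin> T \<Longrightarrow> A i j = 0) \<Longrightarrow> A \<in> operators S T"
  by (auto simp: operators_def)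

lemma op_adj_operators: "A \<in> operators S T \<Longrightarrow> op_adj A \<in> operators T S"
  by (auto simp: operators_def op_adj_def)

lemma op_id_operators[simp]: "op_id S \<in> operators S S"
  by (auto simp: operators_def op_id_def)

lemma op_mult_operators:
  assumes "A \<in> operators S T" "B \<in> operators T' R" shows "op_mult X A B \<in> operators S R"
  using assms by (auto intro!: operatorsI sum.neutral simp: op_mult_def operatorsD)

lemma op_mult_id_left:
  assumes "finite S" "A \<in> operators S T" shows "op_mult S (op_id S) A = A"
proof (intro ext)
  fix i j
  have "op_mult S (op_id S) A i j = (\<Sum>k\<in>S. if i = k then A i j else 0)"
    by (auto simp: op_mult_def op_id_def intro!: sum.cong)
  then show "op_mult S (op_id S) A i j = A i j"
    using assms by (auto simp: operatorsD)
qed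

lemma op_mult_id_right:
  assumes "finite S" "A \<in> operators T S" shows "op_mult S A (op_id S) = A"
proof (intro ext)
  fix i j
  have "op_mult S A (op_id S) i j = (\<Sum>k\<in>S. if j = k then A i j else 0)"
    by (auto simp: op_mult_def op_id_def intro!: sum.cong)
  then show "op_mult S A (op_id S) i j = A i j"
    using assms by (auto simp: operatorsD)
qed

lemma unitary_opD:
  assumes "unitary_op S U"
  shows "U \<in> operators S S" "op_mult S (op_adj U) U = op_id S" "op_mult S U (op_adj U) = op_id S"
  using assms by (auto simp: unitary_op_def)

lemma unitary_op_mult:
  assumes "finite S" "unitary_op S U" "unitary_op S V" shows "unitary_op S (op_mult S U V)"
proof -
  note u = unitary_opD[OF assms(2)] and v = unitary_opD[OF assms(3)]
  have "op_mult S (op_adj (op_mult S U V)) (op_mult S U V)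
      = op_mult S (op_adj V) (op_mult S (op_mult S (op_adj U) U) V)"
    by (simp add: op_adj_mult op_mult_assoc)
  moreover have "op_mult S (op_mult S U V) (op_adj (op_mult S U V))
      = op_mult S U (op_mult S (op_mult S V (op_adj V)) (op_adj U))"
    by (simp add: op_adj_mult op_mult_assoc)
  ultimately show ?thesis
    using u v assms(1)
    by (simp add: unitary_op_def op_mult_operators[of _ S S _ S] op_mult_id_left[of S _ S] op_adj_operators)
qed

section \<open>The spectral theorem for Hermitian operators\<close>

definition diag_op :: "'i set \<Rightarrow> ('i \<Rightarrow> complex) \<Rightarrow> ('i, 'i) operator" where
  "diag_op S l = (\<lambda>i j. if i = j \<and> i \<in> S then l i else 0)"

lemma diag_op_operators[simp]: "diag_op S l \<in> operators S S"
  by (auto simp: operators_def diag_op_def)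

lemma diag_op_mult:
  assumes "finite S" shows "op_mult S (diag_op S l) (diag_op S m) = diag_op S (\<lambda>i. l i * m i)"
proof (intro ext)
  fix i j
  have "op_mult S (diag_op S l) (diag_op S m) i j
     = (\<Sum>k\<in>S. if i = k then diag_op S (\<lambda>i. l i * m i) i j else 0)"
    by (auto simp: op_mult_def diag_op_def intro!: sum.cong)
  then show "op_mult S (diag_op S l) (diag_op S m) i j = diag_op S (\<lambda>i. l i * m i) i j"
    using assms by (auto simp: diag_op_def)
qed

lemma diag_op_conj_apply:
  assumes "finite S"
  shows "op_mult S (op_mult S U (diag_op S l)) (op_adj V) i j = (\<Sum>k\<in>S. U i k * l k * cnj (V j k))"
proof -
  have "op_mult S U (diag_op S l) i k = U i k * l k" if "k \<in> S" for k
  proof -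
    have "op_mult S U (diag_op S l) i k = (\<Sum>q\<in>S. if q = k then U i k * l k else 0)"
      using that by (auto simp: op_mult_def diag_op_def intro!: sum.cong)
    then show ?thesis using that assms by simp
  qed
  then show ?thesis by (simp add: op_mult_def[of S "op_mult S U (diag_op S l)"] op_adj_def)
qed

text \<open>Reflection in the hyperplane orthogonal to w = v - e_s; it exchanges the unit vectors v
  and e_s. For real \<open>v s\<close> the squared length of w is 2 - 2 v s, so
  \<open>c = 1 / (1 - v s)\<close> is the usual factor 2 / |w|^2, and it is real, which makes the
  reflection self-adjoint. If \<open>v s = 1\<close> then v = e_s and the identity serves.\<close>

lemma householder:
  fixes v :: "'i \<Rightarrow> complex"
  assumes fin: "finite S" and s: "s \<in> S" and supp: "\<And>i. i \<notin> S \<Longrightarrow> v i = 0"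
    and norm: "(\<Sum>i\<in>S. v i * cnj (v i)) = 1" and real: "v s \<in> \<real>"
  shows "\<exists>W. unitary_op S W \<and> op_adj W = W \<and> (\<forall>i. W i s = v i)"
proof (cases "v s = 1")
  case True
  have "(\<Sum>i\<in>S. v i * cnj (v i)) = 1 + (\<Sum>i\<in>S-{s}. v i * cnj (v i))"
    using s fin True by (subst sum.remove[of S s]) auto
  then have "(\<Sum>i\<in>S-{s}. v i * cnj (v i)) = 0" using norm by simp
  then have "complex_of_real (\<Sum>i\<in>S-{s}. (cmod (v i))\<^sup>2) = 0"
    unfolding of_real_sum complex_norm_square by simp
  then have "(\<Sum>i\<in>S-{s}. (cmod (v i))\<^sup>2) = 0" using of_real_eq_0_iff by blast
  then have "\<forall>i\<in>S-{s}. v i = 0" using fin by (subst (asm) sum_nonneg_eq_0_iff) auto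
  then have "\<forall>i. op_id S i s = v i" using supp True s by (auto simp: op_id_def)
  moreover have "unitary_op S (op_id S)"
    using fin by (simp add: unitary_op_def op_mult_id_left[of S _ S])
  ultimately show ?thesis by (intro exI[of _ "op_id S"]) simp
next
  case False
  define w where "w = (\<lambda>i. v i - (if i = s then 1 else 0))"
  define c where "c = 1 / (1 - v s)"
  have c: "c * (1 - v s) = 1" using False by (simp add: c_def)
  have cr: "cnj c = c" using real by (simp add: c_def complex_is_Real_iff complex_eq_iff)
  have vs: "cnj (v s) = v s" using real by (simp add: Reals_cnj_iff)
  have ww: "(\<Sum>i\<in>S. w i * cnj (w i)) = 2 - 2 * v s"
  proof -
    have "(\<Sum>i\<in>S. w i * cnj (w i)) = (\<Sum>i\<in>S. v i * cnj (v i)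
        - (if i = s then v s + v s - 1 else 0))"
      by (intro sum.cong) (auto simp: w_def algebra_simps vs)
    then show ?thesis using norm s fin by (simp add: sum_subtractf)
  qed
  define W where "W = (\<lambda>i j. op_id S i j - c * w i * cnj (w j))"
  have wS: "w i = 0" if "i \<notin> S" for i using that s supp by (auto simp: w_def)
  have W1: "W \<in> operators S S"
    using wS by (auto intro!: operatorsI simp: W_def op_id_def)
  have W2: "op_adj W = W"
    by (auto simp: op_adj_def W_def fun_eq_iff cr op_id_def)
  have W3: "op_mult S W W = op_id S"
  proof (intro ext)
    fix i j
    have "op_mult S W W i j = (\<Sum>k\<in>S. op_id S i k * op_id S k j) - (\<Sum>k\<in>S. op_id S i k * (c * w k * cnj (w j)))
       - (\<Sum>k\<in>S. (c * w i * cnj (w k)) * op_id S k j) + c * c * w i * cnj (w j) * (\<Sum>k\<in>S. w k * cnj (w k))"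
      unfolding op_mult_def W_def
      by (simp add: algebra_simps sum.distrib sum_subtractf sum_distrib_left)
    also have "(\<Sum>k\<in>S. op_id S i k * op_id S k j) = op_id S i j"
      using op_mult_id_left[OF fin op_id_operators] by (simp add: op_mult_def fun_eq_iff)
    also have "(\<Sum>k\<in>S. op_id S i k * (c * w k * cnj (w j))) = c * w i * cnj (w j)"
    proof -
      have "(\<Sum>k\<in>S. op_id S i k * (c * w k * cnj (w j))) = (\<Sum>k\<in>S. if k = i then c * w i * cnj (w j) else 0)"
        by (intro sum.cong) (auto simp: op_id_def)
      then show ?thesis using fin wS by simp
    qed
    also have "(\<Sum>k\<in>S. (c * w i * cnj (w k)) * op_id S k j) = c * w i * cnj (w j)"
    proof -
      have "(\<Sum>k\<in>S. (c * w i * cnj (w k)) * op_id S k j) = (\<Sum>k\<in>S. if k = j then c * w i * cnj (w j) else 0)"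
        by (intro sum.cong) (auto simp: op_id_def)
      then show ?thesis using fin wS by simp
    qed
    also have "c * c * w i * cnj (w j) * (\<Sum>k\<in>S. w k * cnj (w k)) = 2 * (c * (1 - v s)) * (c * w i * cnj (w j))"
      by (simp add: ww algebra_simps)
    finally show "op_mult S W W i j = op_id S i j" by (simp add: c)
  qed
  have "W i s = v i" for i
  proof -
    have "W i s = op_id S i s + c * (1 - v s) * w i"
      by (simp add: W_def w_def vs algebra_simps)
    also have "\<dots> = v i" using s by (simp add: c op_id_def) (simp add: w_def)
    finally show ?thesis .
  qed
  then show ?thesis using W1 W2 W3 by (intro exI[of _ W]) (simp add: unitary_op_def)
qed

lemma normalized_eigenvector_exists:
  fixes A :: "('i, 'i) operator"
  assumes fin: "finite S" and s: "s \<in> S"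
  shows "\<exists>v c. (\<forall>i. i \<notin> S \<longrightarrow> v i = 0) \<and> (\<Sum>i\<in>S. v i * cnj (v i)) = 1 \<and> v s \<in> \<real>
    \<and> (\<forall>i\<in>S. (\<Sum>j\<in>S. A i j * v j) = c * v i)"
proof -
  obtain v c where v: "\<And>i. i \<notin> S \<Longrightarrow> v i = 0" "\<exists>i\<in>S. v i \<noteq> 0"
    "\<And>i. i \<in> S \<Longrightarrow> (\<Sum>j\<in>S. A i j * v j) = c * v i"
    using eigenvector_exists[OF fin, of A] s by blast
  define r where "r = sqrt (\<Sum>i\<in>S. (cmod (v i))\<^sup>2)"
  have pos: "(\<Sum>i\<in>S. (cmod (v i))\<^sup>2) > 0"
    using v(2) fin by (auto intro!: sum_pos2 simp: zero_less_power2)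
  \<comment> \<open>Rotates the entry at \<open>s\<close> onto the nonnegative real axis, as the
    reflection requires.\<close>
  define ph where "ph = (if v s = 0 then 1 else cnj (sgn (v s)))"
  define q where "q = ph / of_real r"
  have phn: "ph * cnj ph = 1"
    unfolding ph_def by (auto simp: complex_norm_square[symmetric] norm_sgn)
  have "(\<Sum>i\<in>S. (q * v i) * cnj (q * v i)) = q * cnj q * (\<Sum>i\<in>S. v i * cnj (v i))"
    by (simp add: sum_distrib_left algebra_simps)
  also have "(\<Sum>i\<in>S. v i * cnj (v i)) = of_real (r\<^sup>2)"
  proof -
    have "r\<^sup>2 = (\<Sum>i\<in>S. (cmod (v i))\<^sup>2)" using pos by (simp add: r_def)
    then show ?thesis by (simp only: of_real_sum complex_norm_square)
  qed
  also have "q * cnj q * of_real (r\<^sup>2) = 1"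
  proof -
    have "r > 0" using pos by (simp add: r_def)
    then have "q * cnj q * of_real (r\<^sup>2) = ph * cnj ph"
      by (simp add: q_def power2_eq_square)
    then show ?thesis using phn by simp
  qed
  finally have n: "(\<Sum>i\<in>S. (q * v i) * cnj (q * v i)) = 1" .
  have "ph * v s \<in> \<real>"
  proof (cases "v s = 0")
    case False
    then have "ph * v s = of_real (cmod (v s))"
      by (simp add: ph_def sgn_eq field_simps complex_norm_square[symmetric] power2_eq_square)
    then show ?thesis by simp
  qed simp
  then have "q * v s \<in> \<real>" by (simp add: q_def)
  moreover have "(\<Sum>j\<in>S. A i j * (q * v j)) = c * (q * v i)" if "i \<in> S" for i
  proof -
    have "(\<Sum>j\<in>S. A i j * (q * v j)) = q * (\<Sum>j\<in>S. A i j * v j)"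
      by (simp add: sum_distrib_left algebra_simps)
    then show ?thesis using v(3)[OF that] by simp
  qed
  ultimately show ?thesis using n v(1)
    by (intro exI[of _ "\<lambda>i. q * v i"] exI[of _ c]) auto
qed

text \<open>Induction on the index set: a reflection W takes e_s to a unit eigenvector, so W A W
  maps e_s to a multiple of itself. Its column s vanishes off the diagonal, by Hermiticity its row s
  does too, and what remains is a Hermitian operator on the smaller set.\<close>

theorem spectral_decomposition:
  fixes A :: "('i, 'i) operator"
  assumes "finite S" "A \<in> operators S S" "op_adj A = A"
  shows "\<exists>U (l :: 'i \<Rightarrow> real). unitary_op S U
    \<and> A = op_mult S (op_mult S U (diag_op S (\<lambda>i. of_real (l i)))) (op_adj U)"
  using assms
proof (induction S arbitrary: A rule: finite_induct)
  case empty
  then have "A = (\<lambda>i j. 0)" by (auto simp: operators_def fun_eq_iff)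
  then show ?case
    by (intro exI[of _ "op_id {}"] exI) (auto simp: unitary_op_def op_mult_def op_id_def operators_def)
next
  case (insert s T)
  let ?S = "insert s T"
  have fin: "finite ?S" using insert by simp
  obtain v c where v: "\<And>i. i \<notin> ?S \<Longrightarrow> v i = 0" "(\<Sum>i\<in>?S. v i * cnj (v i)) = 1" "v s \<in> \<real>"
    "\<And>i. i \<in> ?S \<Longrightarrow> (\<Sum>j\<in>?S. A i j * v j) = c * v i"
    using normalized_eigenvector_exists[OF fin, of s A] by blast
  obtain W where W: "unitary_op ?S W" "op_adj W = W" "\<And>i. W i s = v i"
    using householder[OF fin _ v(1,2,3)] by blast
  note w = unitary_opD[OF W(1), unfolded W(2)]
  define B where "B = op_mult ?S W (op_mult ?S A W)"
  have B1: "B \<in> operators ?S ?S"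
    using w insert.prems by (simp add: B_def op_mult_operators[of _ ?S ?S _ ?S])
  have B2: "op_adj B = B"
    by (simp add: B_def op_adj_mult W(2) insert.prems op_mult_assoc)
  have AW: "op_mult ?S A W k s = c * W k s" for k
  proof (cases "k \<in> ?S")
    case True then show ?thesis using v(4) by (simp add: op_mult_def W(3))
  next
    case False then show ?thesis
      using w(1) insert.prems(1) by (auto simp: op_mult_def operatorsD)
  qed
  have Bs: "B i s = (if i = s then c else 0)" for i
  proof -
    have "B i s = c * op_mult ?S W W i s"
      unfolding B_def op_mult_def[of ?S W "op_mult ?S A W"] AW
      by (simp only: op_mult_def sum_distrib_left) (simp add: algebra_simps)
    then show ?thesis using w(2) by (simp add: op_id_def)
  qed
  have Bs': "B s j = (if j = s then cnj c else 0)" for j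
    using fun_cong[OF fun_cong[OF B2], of s j] Bs[of j] by (auto simp: op_adj_def)
  have cr: "cnj c = c" using Bs[of s] Bs'[of s] by simp
  define B' where "B' = (\<lambda>i j. if i \<in> T \<and> j \<in> T then B i j else 0)"
  have "B' \<in> operators T T" by (auto simp: B'_def operators_def)
  moreover have "op_adj B' = B'"
    using fun_cong[OF fun_cong[OF B2]] by (auto simp: B'_def op_adj_def fun_eq_iff)
  ultimately obtain U l where U: "unitary_op T U"
    "B' = op_mult T (op_mult T U (diag_op T (\<lambda>i. of_real (l i :: real)))) (op_adj U)"
    using insert.IH by blast
  note u = unitary_opD[OF U(1)]
  define V where "V = (\<lambda>i j. if i = s \<and> j = s then 1 else U i j)"
  define m where "m = l(s := Re c)"
  have Us: "U i s = 0" "U s i = 0" for i using u(1) insert.hyps by (auto simp: operatorsD)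
  have VV: "op_mult ?S (op_adj V) V = op_id ?S" "op_mult ?S V (op_adj V) = op_id ?S"
  proof -
    have e: "op_mult T (op_adj U) U i j = op_id T i j" "op_mult T U (op_adj U) i j = op_id T i j" for i j
      using u by simp_all
    have ns: "x = s \<longleftrightarrow> False" if "x \<in> T" for x using that insert.hyps by auto
    have "op_mult ?S (op_adj V) V i j = (if i = s \<and> j = s then 1 else op_mult T (op_adj U) U i j)" for i j
      using insert.hyps by (auto simp: op_mult_def op_adj_def V_def Us ns cong: sum.cong)
    then show "op_mult ?S (op_adj V) V = op_id ?S"
      using insert.hyps unfolding e by (auto simp: op_id_def fun_eq_iff)
    have "op_mult ?S V (op_adj V) i j = (if i = s \<and> j = s then 1 else op_mult T U (op_adj U) i j)" for i j
      using insert.hyps by (auto simp: op_mult_def op_adj_def V_def Us ns cong: sum.cong)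
    then show "op_mult ?S V (op_adj V) = op_id ?S"
      using insert.hyps unfolding e by (auto simp: op_id_def fun_eq_iff)
  qed
  have V: "unitary_op ?S V"
    using VV u(1) by (auto simp: unitary_op_def operators_def V_def split: if_splits)
  have BV: "B = op_mult ?S (op_mult ?S V (diag_op ?S (\<lambda>i. of_real (m i)))) (op_adj V)"
  proof (intro ext)
    fix i j
    have mT: "m k = l k" if "k \<in> T" for k using that insert.hyps by (auto simp: m_def)
    have ns: "x = s \<longleftrightarrow> False" if "x \<in> T" for x using that insert.hyps by auto
    have ms: "of_real (m s) = c" using cr by (simp add: m_def complex_eq_iff)
    have B'ij: "B' i j = (\<Sum>k\<in>T. U i k * of_real (l k) * cnj (U j k))"
      unfolding U(2) diag_op_conj_apply[OF insert.hyps(1)] ..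
    have "op_mult ?S (op_mult ?S V (diag_op ?S (\<lambda>i. of_real (m i)))) (op_adj V) i j
       = V i s * of_real (m s) * cnj (V j s) + (\<Sum>k\<in>T. U i k * of_real (l k) * cnj (U j k))"
      unfolding diag_op_conj_apply[OF fin] using insert.hyps
      by (simp add: V_def mT ns Us cong: sum.cong)
    also have "\<dots> = (if i = s \<and> j = s then c else 0) + B' i j"
      by (simp add: V_def ms B'ij Us)
    also have "\<dots> = B i j"
    proof (cases "i = s \<or> j = s")
      case True
      then show ?thesis using Bs[of i] Bs'[of j] cr insert.hyps by (auto simp: B'_def)
    next
      case False
      then show ?thesis using operatorsD[OF B1, of i j] by (auto simp: B'_def)
    qed
    finally show "B i j = op_mult ?S (op_mult ?S V (diag_op ?S (\<lambda>i. of_real (m i)))) (op_adj V) i j" by simp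
  qed
  \<comment> \<open>W is an involution, so the diagonalisation of B = W A W carries back to
    A.\<close>
  have "A = op_mult ?S (op_mult ?S W W) (op_mult ?S A (op_mult ?S W W))"
    using fin insert.prems by (simp only: w) (simp add: op_mult_id_left[of ?S _ ?S] op_mult_id_right[of ?S _ ?S])
  also have "\<dots> = op_mult ?S W (op_mult ?S B W)"
    by (simp add: B_def op_mult_assoc)
  also have "\<dots> = op_mult ?S (op_mult ?S (op_mult ?S W V) (diag_op ?S (\<lambda>i. of_real (m i)))) (op_adj (op_mult ?S W V))"
    by (simp add: BV op_adj_mult W(2) op_mult_assoc)
  finally show ?case using unitary_op_mult[OF fin W(1) V] by blast
qed


subsection \<open>Positive operators\<close>

text \<open>The usual way to prove positivity below: exhibit the operator as a sum of rank-one
  operators.\<close>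

lemma positive_opI:
  assumes "finite S" "\<And>k i. k \<in> I \<Longrightarrow> i \<notin> S \<Longrightarrow> v k i = 0"
  shows "positive_op S (\<lambda>i j. \<Sum>k\<in>I. v k i * cnj (v k j))"
  unfolding positive_op_def
proof (intro conjI allI)
  show "(\<lambda>i j. \<Sum>k\<in>I. v k i * cnj (v k j)) \<in> operators S S"
    using assms by (auto intro!: operatorsI sum.neutral)
  fix w :: "'a \<Rightarrow> complex"
  have "(\<Sum>i\<in>S. \<Sum>j\<in>S. cnj (w i) * (\<Sum>k\<in>I. v k i * cnj (v k j)) * w j)
     = (\<Sum>i\<in>S. \<Sum>j\<in>S. \<Sum>k\<in>I. (cnj (w i) * v k i) * cnj (cnj (w j) * v k j))"
    by (simp add: sum_distrib_left sum_distrib_right algebra_simps)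
  also have "\<dots> = (\<Sum>i\<in>S. \<Sum>k\<in>I. \<Sum>j\<in>S. (cnj (w i) * v k i) * cnj (cnj (w j) * v k j))"
    by (intro sum.cong refl sum.swap)
  also have "\<dots> = (\<Sum>k\<in>I. \<Sum>i\<in>S. \<Sum>j\<in>S. (cnj (w i) * v k i) * cnj (cnj (w j) * v k j))"
    by (rule sum.swap)
  also have "\<dots> = (\<Sum>k\<in>I. (\<Sum>i\<in>S. cnj (w i) * v k i) * cnj (\<Sum>j\<in>S. cnj (w j) * v k j))"
    by (simp only: cnj_sum sum_product)
  also have "\<dots> = of_real (\<Sum>k\<in>I. (cmod (\<Sum>i\<in>S. cnj (w i) * v k i))\<^sup>2)"
    by (simp only: complex_norm_square of_real_sum)
  finally show "(\<Sum>i\<in>S. \<Sum>j\<in>S. cnj (w i) * (\<Sum>k\<in>I. v k i * cnj (v k j)) * w j) \<in> \<real>\<^sub>\<ge>\<^sub>0"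
    by (simp add: sum_nonneg del: of_real_sum)
qed

lemma positive_opD:
  assumes "positive_op S A"
  shows "A \<in> operators S S" "(\<Sum>i\<in>S. \<Sum>j\<in>S. cnj (v i) * A i j * v j) \<in> \<real>\<^sub>\<ge>\<^sub>0"
  using assms by (auto simp: positive_op_def)

text \<open>Polarisation: positivity speaks of quadratic forms only, so the form is evaluated at e_a
  + z e_b for z = 0, 1, -1, i, -i. The vanishing imaginary parts force the two off-diagonal entries
  to be conjugate.\<close>

lemma positive_op_hermitian:
  assumes fin: "finite S" and A: "positive_op S A"
  shows "op_adj A = A"
proof -
  have "cnj (A b a) = A a b" if ab: "a \<in> S" "b \<in> S" for a b
  proof (cases "a = b")
    case True
    have "(\<Sum>i\<in>S. \<Sum>j\<in>S. cnj (of_bool (i = a)) * A i j * of_bool (j = a))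
        = (\<Sum>i\<in>S. if i = a then (\<Sum>j\<in>S. if j = a then A a a else 0) else 0)"
      by (intro sum.cong) (auto intro!: sum.cong)
    then have "A a a \<in> \<real>\<^sub>\<ge>\<^sub>0"
      using positive_opD(2)[OF A, of "\<lambda>i. of_bool (i = a)"] ab fin by simp
    then show ?thesis using True by (auto simp: nonneg_Reals_def)
  next
    case ne: False
    have q: "A a a + z * A a b + cnj z * A b a + z * cnj z * A b b \<in> \<real>\<^sub>\<ge>\<^sub>0" for z
    proof -
      let ?v = "\<lambda>i. if i = a then 1 else if i = b then z else 0"
      have ss: "(\<Sum>i\<in>S. f i) = f a + f b" if "\<And>i. i \<in> S \<Longrightarrow> i \<noteq> a \<Longrightarrow> i \<noteq> b \<Longrightarrow> f i = 0" for f :: "'a \<Rightarrow> complex"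
      proof -
        have "(\<Sum>i\<in>S. f i) = (\<Sum>i\<in>{a,b}. f i)"
          using that ab fin by (intro sum.mono_neutral_right) auto
        then show ?thesis using ne by simp
      qed
      have "(\<Sum>i\<in>S. \<Sum>j\<in>S. cnj (?v i) * A i j * ?v j)
         = A a a + z * A a b + cnj z * A b a + z * cnj z * A b b"
        by (subst ss, simp, subst ss, simp, subst ss, use ne in \<open>simp_all add: algebra_simps\<close>)
      then show ?thesis using positive_opD(2)[OF A, of ?v] by simp
    qed
    have im: "Im (A a a + z * A a b + cnj z * A b a + z * cnj z * A b b) = 0" for z
      using q[of z] unfolding complex_nonneg_Reals_iff by blast
    show ?thesis
      using im[of 0] im[of 1] im[of "-1"] im[of "\<i>"] im[of "-\<i>"]
      by (simp add: complex_eq_iff)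
  qed
  then show ?thesis using operatorsD[OF positive_opD(1)[OF A]]
    by (auto simp: op_adj_def fun_eq_iff) (metis complex_cnj_zero)
qed

lemma unitary_op_columns:
  assumes "unitary_op S U"
  shows "k \<in> S \<Longrightarrow> (\<Sum>i\<in>S. cnj (U i k) * U i l) = (if k = l then 1 else 0)"
    and "i \<in> S \<Longrightarrow> (\<Sum>k\<in>S. U i k * cnj (U j k)) = (if i = j then 1 else 0)"
  using fun_cong[OF fun_cong[OF unitary_opD(2)[OF assms]], of k l]
    fun_cong[OF fun_cong[OF unitary_opD(3)[OF assms]], of i j]
  by (auto simp: op_mult_def op_adj_def op_id_def)

lemma unitary_conj_quadratic:
  assumes fin: "finite S" and U: "unitary_op S U" and k: "k \<in> S"
    and A: "A = op_mult S (op_mult S U (diag_op S l)) (op_adj U)"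
  shows "(\<Sum>i\<in>S. \<Sum>j\<in>S. cnj (U i k) * A i j * U j k) = l k"
proof -
  have "(\<Sum>i\<in>S. \<Sum>j\<in>S. cnj (U i k) * A i j * U j k) = op_mult S (op_mult S (op_adj U) A) U k k"
    by (simp add: op_mult_def op_adj_def sum_distrib_right) (rule sum.swap)
  also have "op_mult S (op_mult S (op_adj U) A) U
     = op_mult S (op_mult S (op_mult S (op_adj U) U) (diag_op S l)) (op_mult S (op_adj U) U)"
    by (simp add: A op_mult_assoc)
  also have "\<dots> = diag_op S l"
    using fin by (simp add: unitary_opD[OF U] op_mult_id_left[of S _ S] op_mult_id_right[of S _ S])
  finally show ?thesis using k by (simp add: diag_op_def)
qed

lemma positive_op_spectral:
  assumes fin: "finite S" and A: "positive_op S A"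
  shows "\<exists>U (l :: 'i \<Rightarrow> real). unitary_op S U \<and> (\<forall>k\<in>S. l k \<ge> 0)
    \<and> A = op_mult S (op_mult S U (diag_op S (\<lambda>i. of_real (l i)))) (op_adj U)"
proof -
  obtain U and l :: "'i \<Rightarrow> real" where U: "unitary_op S U"
    and AU: "A = op_mult S (op_mult S U (diag_op S (\<lambda>i. of_real (l i)))) (op_adj U)"
    using spectral_decomposition[OF fin positive_opD(1)[OF A] positive_op_hermitian[OF fin A]] by blast
  have "l k \<ge> 0" if "k \<in> S" for k
    using positive_opD(2)[OF A, of "\<lambda>i. U i k"] unitary_conj_quadratic[OF fin U that AU] by simp
  then show ?thesis using U AU by blast
qed

text \<open>Converse of \<open>positive_opI\<close>: eigenvectors scaled by the roots of their
  eigenvalues. It reduces statements about linear maps on positive operators to rank-one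
  operators.\<close>

lemma positive_op_decomp:
  fixes A :: "('i, 'i) operator"
  assumes fin: "finite S" and A: "positive_op S A"
  shows "\<exists>v :: 'i \<Rightarrow> 'i \<Rightarrow> complex. (\<forall>k i. i \<notin> S \<longrightarrow> v k i = 0)
    \<and> A = (\<lambda>i j. \<Sum>k\<in>S. v k i * cnj (v k j))"
proof -
  obtain U and l :: "'i \<Rightarrow> real" where U: "unitary_op S U" "\<forall>k\<in>S. l k \<ge> 0"
    and AU: "A = op_mult S (op_mult S U (diag_op S (\<lambda>i. of_real (l i)))) (op_adj U)"
    using positive_op_spectral[OF fin A] by blast
  define v where "v = (\<lambda>k i. U i k * of_real (sqrt (l k)))"
  have "A i j = (\<Sum>k\<in>S. v k i * cnj (v k j))" for i j
  proof -
    have "of_real (l k) = complex_of_real (sqrt (l k)) * of_real (sqrt (l k))" if "k \<in> S" for k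
      using U(2) that by (simp flip: of_real_mult)
    then show ?thesis
      unfolding AU diag_op_conj_apply[OF fin] v_def
      by (auto intro!: sum.cong)
  qed
  moreover have "v k i = 0" if "i \<notin> S" for k i
    using unitary_opD(1)[OF U(1)] that by (simp add: v_def operatorsD)
  ultimately show ?thesis by (intro exI[of _ v]) auto
qed

lemma positive_op_add:
  assumes "positive_op S A" "positive_op S B"
  shows "positive_op S (\<lambda>i j. A i j + B i j)"
  unfolding positive_op_def
proof (intro conjI allI)
  show "(\<lambda>i j. A i j + B i j) \<in> operators S S"
    using assms[THEN positive_opD(1)] by (auto intro!: operatorsI simp: operatorsD)
  fix v
  have "(\<Sum>i\<in>S. \<Sum>j\<in>S. cnj (v i) * (A i j + B i j) * v j)
    = (\<Sum>i\<in>S. \<Sum>j\<in>S. cnj (v i) * A i j * v j) + (\<Sum>i\<in>S. \<Sum>j\<in>S. cnj (v i) * B i j * v j)"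
    by (simp add: algebra_simps sum.distrib)
  then show "(\<Sum>i\<in>S. \<Sum>j\<in>S. cnj (v i) * (A i j + B i j) * v j) \<in> \<real>\<^sub>\<ge>\<^sub>0"
    using assms[THEN positive_opD(2), of v] by (simp add: nonneg_Reals_add_I)
qed

lemma positive_op_zero: "positive_op S (\<lambda>i j. 0)"
  by (simp add: positive_op_def operators_def)

lemma positive_op_sum:
  assumes "\<And>k. k \<in> I \<Longrightarrow> positive_op S (A k)"
  shows "positive_op S (\<lambda>i j. \<Sum>k\<in>I. A k i j)"
  using assms by (induction I rule: infinite_finite_induct) (auto intro: positive_op_zero positive_op_add)

lemma positive_op_scale:
  assumes "positive_op S A" "c \<ge> 0"
  shows "positive_op S (\<lambda>i j. of_real c * A i j)"
  unfolding positive_op_def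
proof (intro conjI allI)
  show "(\<lambda>i j. of_real c * A i j) \<in> operators S S"
    using assms(1)[THEN positive_opD(1)] by (auto intro!: operatorsI simp: operatorsD)
  fix v
  have "(\<Sum>i\<in>S. \<Sum>j\<in>S. cnj (v i) * (of_real c * A i j) * v j)
    = of_real c * (\<Sum>i\<in>S. \<Sum>j\<in>S. cnj (v i) * A i j * v j)"
    by (simp add: algebra_simps sum_distrib_left)
  then show "(\<Sum>i\<in>S. \<Sum>j\<in>S. cnj (v i) * (of_real c * A i j) * v j) \<in> \<real>\<^sub>\<ge>\<^sub>0"
    using positive_opD(2)[OF assms(1), of v] assms(2) by (simp add: nonneg_Reals_mult_I)
qed

lemma positive_diag_op:
  assumes fin: "finite S" and l: "\<And>k. k \<in> S \<Longrightarrow> l k \<ge> 0"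
  shows "positive_op S (diag_op S (\<lambda>i. complex_of_real (l i)))"
proof -
  define v where "v = (\<lambda>k i. if i = k then complex_of_real (sqrt (l k)) else 0)"
  have "diag_op S (\<lambda>i. complex_of_real (l i)) i j = (\<Sum>k\<in>S. v k i * cnj (v k j))" for i j
  proof -
    have "(\<Sum>k\<in>S. v k i * cnj (v k j)) = (\<Sum>k\<in>S. if k = i then diag_op S (\<lambda>i. complex_of_real (l i)) i j else 0)"
      using l by (intro sum.cong refl) (auto simp: v_def diag_op_def simp flip: of_real_mult)
    then show ?thesis using fin by (auto simp: diag_op_def)
  qed
  then have "diag_op S (\<lambda>i. complex_of_real (l i)) = (\<lambda>i j. \<Sum>k\<in>S. v k i * cnj (v k j))"
    by (intro ext)
  moreover have "positive_op S (\<lambda>i j. \<Sum>k\<in>S. v k i * cnj (v k j))"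
    using fin by (intro positive_opI) (auto simp: v_def)
  ultimately show ?thesis by simp
qed

lemma op_id_eq_diag_op: "op_id S = diag_op S (\<lambda>i. of_real 1)"
  by (auto simp: op_id_def diag_op_def fun_eq_iff)

lemma positive_op_id: "finite S \<Longrightarrow> positive_op S (op_id S)"
  unfolding op_id_eq_diag_op by (rule positive_diag_op) auto

lemma positive_op_diag_entry:
  assumes fin: "finite S" and A: "positive_op S A"
  shows "A i i \<in> \<real>" "Re (A i i) \<ge> 0"
proof -
  obtain v :: "'a \<Rightarrow> 'a \<Rightarrow> complex" where v: "A = (\<lambda>i j. \<Sum>k\<in>S. v k i * cnj (v k j))"
    using positive_op_decomp[OF fin A] by (elim exE conjE) (rule that)
  have "A i i = of_real (\<Sum>k\<in>S. (cmod (v k i))\<^sup>2)"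
    unfolding v by (simp only: complex_norm_square of_real_sum)
  then show "A i i \<in> \<real>" "Re (A i i) \<ge> 0" by (auto simp: sum_nonneg simp del: of_real_sum)
qed

lemma positive_op_trace:
  assumes fin: "finite S" and A: "positive_op S A"
  shows "op_trace S A \<in> \<real>" "Re (op_trace S A) \<ge> 0" "op_trace S A = of_real (Re (op_trace S A))"
proof -
  show 1: "op_trace S A \<in> \<real>" "Re (op_trace S A) \<ge> 0"
    using positive_op_diag_entry[OF assms] by (auto simp: op_trace_def intro!: sum_in_Reals sum_nonneg)
  show "op_trace S A = of_real (Re (op_trace S A))"
    using 1(1) by simp
qed

text \<open>The columns of U form an orthonormal basis, and the trace does not depend on the
  basis.\<close>

lemma op_trace_unitary_quadratic:
  assumes fin: "finite S" and U: "unitary_op S U"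
  shows "(\<Sum>k\<in>S. \<Sum>i\<in>S. \<Sum>j\<in>S. cnj (U i k) * A i j * U j k) = op_trace S A"
proof -
  have "(\<Sum>k\<in>S. \<Sum>i\<in>S. \<Sum>j\<in>S. cnj (U i k) * A i j * U j k)
    = (\<Sum>i\<in>S. \<Sum>k\<in>S. \<Sum>j\<in>S. cnj (U i k) * A i j * U j k)" by (rule sum.swap)
  also have "\<dots> = (\<Sum>i\<in>S. \<Sum>j\<in>S. \<Sum>k\<in>S. cnj (U i k) * A i j * U j k)"
    by (intro sum.cong refl sum.swap)
  also have "\<dots> = (\<Sum>i\<in>S. \<Sum>j\<in>S. A i j * (\<Sum>k\<in>S. U j k * cnj (U i k)))"
    by (simp add: sum_distrib_left mult_ac)
  also have "\<dots> = (\<Sum>i\<in>S. \<Sum>j\<in>S. if j = i then A i i else 0)"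
    by (intro sum.cong refl) (simp add: unitary_op_columns(2)[OF U])
  also have "\<dots> = op_trace S A" using fin by (simp add: op_trace_def)
  finally show ?thesis .
qed


subsection \<open>The trace norm\<close>

text \<open>For D = R - T one has D R + T D = R^2 - T^2 = 0, so tr(D R D) + tr(D T D) = tr((D R + T
  D) D) = 0. All columns of D then have vanishing quadratic form under R and under T, hence R D = T
  D = 0 and D^2 = 0; as D is Hermitian, D = 0. Uniqueness is what gives the \<open>THE\<close> in
  \<open>op_abs\<close> its value.\<close>

lemma positive_sqrt_unique:
  fixes R T :: "('i, 'i) operator"
  assumes fin: "finite S" and R: "positive_op S R" and T: "positive_op S T"
    and eq: "op_mult S R R = op_mult S T T"
  shows "R = T"
proof -
  define D where "D = (\<lambda>i j. R i j - T i j)"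
  have D1: "D \<in> operators S S"
    using positive_opD(1)[OF R] positive_opD(1)[OF T] by (auto intro!: operatorsI simp: D_def operatorsD)
  have Dh: "cnj (D i j) = D j i" for i j
    using fun_cong[OF fun_cong[OF positive_op_hermitian[OF fin R]], of j i]
     fun_cong[OF fun_cong[OF positive_op_hermitian[OF fin T]], of j i]
    by (simp add: D_def op_adj_def)
  define q where "q = (\<lambda>(X :: ('i,'i) operator) k. \<Sum>i\<in>S. \<Sum>j\<in>S. cnj (D i k) * X i j * D j k)"
  have nn: "q R k \<in> \<real>\<^sub>\<ge>\<^sub>0" "q T k \<in> \<real>\<^sub>\<ge>\<^sub>0" for k
    unfolding q_def using positive_opD(2)[OF R, of "\<lambda>i. D i k"] positive_opD(2)[OF T, of "\<lambda>i. D i k"] by simp_all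
  have ring: "op_mult S D R i j + op_mult S T D i j = 0" for i j
    using fun_cong[OF fun_cong[OF eq], of i j]
    by (simp add: D_def op_mult_def algebra_simps sum_subtractf)
  have tr: "(\<Sum>k\<in>S. q X k) = op_trace S (op_mult S D (op_mult S X D))" for X
    unfolding q_def op_trace_def op_mult_def Dh
    by (simp add: sum_distrib_left mult.assoc)
  have "op_trace S (op_mult S D (op_mult S T D)) = op_trace S (op_mult S (op_mult S T D) D)"
    unfolding op_trace_def op_mult_def[of S D "op_mult S T D"] op_mult_def[of S "op_mult S T D" D]
    by (subst sum.swap) (simp add: mult.commute)
  moreover have "op_trace S (op_mult S D (op_mult S R D)) = op_trace S (op_mult S (op_mult S D R) D)"
    by (simp add: op_mult_assoc)
  ultimately have "(\<Sum>k\<in>S. q R k) + (\<Sum>k\<in>S. q T k)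
     = op_trace S (\<lambda>i j. \<Sum>k\<in>S. (op_mult S D R i k + op_mult S T D i k) * D k j)"
    unfolding tr by (simp add: op_trace_def op_mult_def[of S _ D] sum.distrib algebra_simps)
  then have "(\<Sum>k\<in>S. q R k + q T k) = 0" unfolding ring by (simp add: op_trace_def sum.distrib)
  then have "(\<Sum>k\<in>S. Re (q R k) + Re (q T k)) = 0" by (metis (mono_tags, lifting) Re_sum plus_complex.sel(1) sum.cong zero_complex.sel(1))
  then have 0: "\<forall>k\<in>S. Re (q R k) + Re (q T k) = 0"
    using nn fin by (subst (asm) sum_nonneg_eq_0_iff) (auto simp: complex_nonneg_Reals_iff)
  \<comment> \<open>A positive operator kills every vector on which its quadratic form vanishes, as
    a decomposition into rank-one operators shows.\<close>
  have RD: "op_mult S X D i k = 0" if X: "positive_op S X" and k: "k \<in> S" and qX: "Re (q X k) = 0" for X i k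
  proof -
    obtain v :: "'i \<Rightarrow> 'i \<Rightarrow> complex" where v: "X = (\<lambda>i j. \<Sum>k\<in>S. v k i * cnj (v k j))"
      using positive_op_decomp[OF fin X] by (elim exE conjE) (rule that)
    define z where "z = (\<lambda>l. \<Sum>j\<in>S. cnj (v l j) * D j k)"
    have "q X k = (\<Sum>i\<in>S. \<Sum>j\<in>S. \<Sum>l\<in>S. cnj (cnj (v l i) * D i k) * (cnj (v l j) * D j k))"
      unfolding q_def v by (simp add: sum_distrib_left sum_distrib_right algebra_simps)
    also have "\<dots> = (\<Sum>i\<in>S. \<Sum>l\<in>S. \<Sum>j\<in>S. cnj (cnj (v l i) * D i k) * (cnj (v l j) * D j k))"
      by (intro sum.cong refl sum.swap)
    also have "\<dots> = (\<Sum>l\<in>S. \<Sum>i\<in>S. \<Sum>j\<in>S. cnj (cnj (v l i) * D i k) * (cnj (v l j) * D j k))"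
      by (rule sum.swap)
    also have "\<dots> = (\<Sum>l\<in>S. z l * cnj (z l))"
    proof (intro sum.cong refl)
      fix l
      have "(\<Sum>i\<in>S. \<Sum>j\<in>S. cnj (cnj (v l i) * D i k) * (cnj (v l j) * D j k)) = cnj (z l) * z l"
        by (simp only: z_def cnj_sum sum_product)
      then show "(\<Sum>i\<in>S. \<Sum>j\<in>S. cnj (cnj (v l i) * D i k) * (cnj (v l j) * D j k)) = z l * cnj (z l)"
        by (simp only: mult.commute)
    qed
    also have "\<dots> = of_real (\<Sum>l\<in>S. (cmod (z l))\<^sup>2)"
      by (simp only: complex_norm_square of_real_sum)
    finally have "(\<Sum>l\<in>S. (cmod (z l))\<^sup>2) = 0" using qX by simp
    then have "\<forall>l\<in>S. z l = 0" using fin by (subst (asm) sum_nonneg_eq_0_iff) auto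
    moreover have "op_mult S X D i k = (\<Sum>l\<in>S. v l i * z l)"
      unfolding op_mult_def v z_def sum_distrib_left sum_distrib_right
      by (subst sum.swap) (simp add: mult_ac)
    ultimately show ?thesis by simp
  qed
  have "op_mult S D D i k = 0" if "k \<in> S" for i k
  proof -
    have "Re (q R k) = 0" "Re (q T k) = 0"
      using 0 that nn[of k] by (auto simp: complex_nonneg_Reals_iff add_nonneg_eq_0_iff)
    from RD[OF R that this(1), of i] RD[OF T that this(2), of i] show ?thesis
      by (simp add: op_mult_def D_def[of] algebra_simps sum_subtractf)
  qed
  then have DD: "(\<Sum>i\<in>S. D k i * cnj (D k i)) = 0" if "k \<in> S" for k
    unfolding Dh using that by (simp add: op_mult_def)
  have "D k i = 0" if "k \<in> S" "i \<in> S" for k i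
  proof -
    have "of_real (\<Sum>i\<in>S. (cmod (D k i))\<^sup>2) = (0 :: complex)"
      unfolding of_real_sum complex_norm_square by (rule DD[OF that(1)])
    then have "(\<Sum>i\<in>S. (cmod (D k i))\<^sup>2) = 0" unfolding of_real_eq_0_iff .
    then show ?thesis using fin that(2) by (subst (asm) sum_nonneg_eq_0_iff) auto
  qed
  then have "D k i = 0" for k i using operatorsD[OF D1] by metis
  then show ?thesis by (auto simp: D_def fun_eq_iff)
qed

lemma op_abs_spectral:
  assumes fin: "finite S" and U: "unitary_op S U"
    and A: "A = op_mult S (op_mult S U (diag_op S (\<lambda>i. of_real (l i)))) (op_adj U)"
  shows "op_abs S A = op_mult S (op_mult S U (diag_op S (\<lambda>i. of_real \<bar>l i\<bar>))) (op_adj U)"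
    (is "_ = ?R")
proof -
  note u = unitary_opD[OF U]
  have mult: "op_mult S (op_mult S (op_mult S U (diag_op S a)) (op_adj U))
      (op_mult S (op_mult S U (diag_op S b)) (op_adj U))
    = op_mult S (op_mult S U (diag_op S (\<lambda>i. a i * b i))) (op_adj U)" for a b
  proof -
    have "op_mult S (op_mult S (op_mult S U (diag_op S a)) (op_adj U))
        (op_mult S (op_mult S U (diag_op S b)) (op_adj U))
      = op_mult S (op_mult S U (op_mult S (diag_op S a) (op_mult S (op_mult S (op_adj U) U) (diag_op S b)))) (op_adj U)"
      by (simp add: op_mult_assoc)
    then show ?thesis using fin by (simp add: u op_mult_id_left[of S _ S] diag_op_mult)
  qed
  have "op_adj (diag_op S (\<lambda>i. complex_of_real (l i))) = diag_op S (\<lambda>i. complex_of_real (l i))"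
    by (auto simp: op_adj_def diag_op_def fun_eq_iff)
  then have "op_adj A = A" by (simp add: A op_adj_mult op_mult_assoc)
  then have sq: "op_mult S ?R ?R = op_mult S (op_adj A) A"
    unfolding mult by (simp add: A mult abs_mult_self_eq flip: of_real_mult)
  have pos: "positive_op S ?R"
  proof -
    have "?R = (\<lambda>i j. \<Sum>k\<in>S. (U i k * of_real (sqrt \<bar>l k\<bar>)) * cnj (U j k * of_real (sqrt \<bar>l k\<bar>)))"
      unfolding diag_op_conj_apply[OF fin] fun_eq_iff
      by (intro ext allI sum.cong refl) (simp add: mult_ac flip: of_real_mult)
    moreover have "positive_op S \<dots>"
      using fin u(1) by (intro positive_opI) (auto simp: operatorsD)
    ultimately show ?thesis by simp
  qed
  show ?thesis unfolding op_abs_def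
    using positive_sqrt_unique[OF fin] pos sq by (intro the_equality) auto
qed

text \<open>Splitting the eigenvalues by sign attains the trace norm. Conversely each eigenvalue is
  the difference of the quadratic forms of P and N at its eigenvector, and these forms add up to the
  two traces. With this the absolute value of an operator never has to be computed again.\<close>

theorem trace_norm_le_iff:
  assumes fin: "finite S" and A: "A \<in> operators S S" and herm: "op_adj A = A"
  shows "trace_norm S A \<le> \<epsilon> \<longleftrightarrow> (\<exists>P N. positive_op S P \<and> positive_op S N
    \<and> (\<forall>i j. A i j = P i j - N i j) \<and> Re (op_trace S P) + Re (op_trace S N) \<le> \<epsilon>)"
proof -
  obtain U and l :: "'a \<Rightarrow> real" where U: "unitary_op S U"
    and AU: "A = op_mult S (op_mult S U (diag_op S (\<lambda>i. of_real (l i)))) (op_adj U)"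
    using spectral_decomposition[OF fin A herm] by blast
  have tr: "op_trace S (op_mult S (op_mult S U (diag_op S m)) (op_adj U)) = (\<Sum>k\<in>S. m k)" for m
    unfolding op_trace_unitary_quadratic[OF fin U, symmetric]
    by (intro sum.cong refl unitary_conj_quadratic[OF fin U]) auto
  have tn: "trace_norm S A = (\<Sum>k\<in>S. \<bar>l k\<bar>)"
    unfolding trace_norm_def op_abs_spectral[OF fin U AU] tr by simp
  have pos: "positive_op S (op_mult S (op_mult S U (diag_op S (\<lambda>i. of_real (m i)))) (op_adj U))"
    if "\<And>k. m k \<ge> 0" for m
  proof -
    have "op_mult S (op_mult S U (diag_op S (\<lambda>i. of_real (m i)))) (op_adj U)
       = (\<lambda>i j. \<Sum>k\<in>S. (U i k * of_real (sqrt (m k))) * cnj (U j k * of_real (sqrt (m k))))"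
      unfolding diag_op_conj_apply[OF fin] fun_eq_iff
      using that by (intro ext allI sum.cong refl) (simp add: mult_ac flip: of_real_mult)
    moreover have "positive_op S \<dots>"
      using fin unitary_opD(1)[OF U] by (intro positive_opI) (auto simp: operatorsD)
    ultimately show ?thesis by simp
  qed
  show ?thesis
  proof
    assume le: "trace_norm S A \<le> \<epsilon>"
    define P where "P = op_mult S (op_mult S U (diag_op S (\<lambda>i. of_real (max (l i) 0)))) (op_adj U)"
    define N where "N = op_mult S (op_mult S U (diag_op S (\<lambda>i. of_real (max (- l i) 0)))) (op_adj U)"
    have "A i j = P i j - N i j" for i j
      unfolding AU P_def N_def diag_op_conj_apply[OF fin] sum_subtractf[symmetric]
      by (intro sum.cong refl) (auto simp: max_def)
    moreover have "Re (op_trace S P) + Re (op_trace S N) = (\<Sum>k\<in>S. \<bar>l k\<bar>)"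
      unfolding P_def N_def tr Re_sum sum.distrib[symmetric]
      by (intro sum.cong refl) (auto simp: max_def)
    ultimately show "\<exists>P N. positive_op S P \<and> positive_op S N
      \<and> (\<forall>i j. A i j = P i j - N i j) \<and> Re (op_trace S P) + Re (op_trace S N) \<le> \<epsilon>"
      using le tn pos[of "\<lambda>i. max (l i) 0"] pos[of "\<lambda>i. max (- l i) 0"]
      by (intro exI[of _ P] exI[of _ N]) (auto simp: P_def[symmetric] N_def[symmetric])
  next
    assume "\<exists>P N. positive_op S P \<and> positive_op S N
      \<and> (\<forall>i j. A i j = P i j - N i j) \<and> Re (op_trace S P) + Re (op_trace S N) \<le> \<epsilon>"
    then obtain P N where PN: "positive_op S P" "positive_op S N" "\<And>i j. A i j = P i j - N i j"
      "Re (op_trace S P) + Re (op_trace S N) \<le> \<epsilon>" by blast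
    define q where "q = (\<lambda>(X :: ('a,'a) operator) k. \<Sum>i\<in>S. \<Sum>j\<in>S. cnj (U i k) * X i j * U j k)"
    have "\<bar>l k\<bar> \<le> Re (q P k) + Re (q N k)" if "k \<in> S" for k
    proof -
      have "of_real (l k) = q A k"
        unfolding q_def using unitary_conj_quadratic[OF fin U that AU] by simp
      also have "\<dots> = q P k - q N k"
        unfolding q_def PN(3) by (simp add: algebra_simps sum_subtractf)
      finally have "l k = Re (q P k) - Re (q N k)" by (metis Re_complex_of_real minus_complex.sel(1))
      moreover have "Re (q P k) \<ge> 0" "Re (q N k) \<ge> 0"
        using positive_opD(2)[OF PN(1)] positive_opD(2)[OF PN(2)]
        by (auto simp: q_def complex_nonneg_Reals_iff)
      ultimately show ?thesis by linarith
    qed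
    then have "(\<Sum>k\<in>S. \<bar>l k\<bar>) \<le> (\<Sum>k\<in>S. Re (q P k) + Re (q N k))" by (rule sum_mono)
    also have "\<dots> = Re (\<Sum>k\<in>S. q P k) + Re (\<Sum>k\<in>S. q N k)" by (simp add: sum.distrib)
    also have "\<dots> = Re (op_trace S P) + Re (op_trace S N)"
      by (simp only: q_def op_trace_unitary_quadratic[OF fin U])
    finally show "trace_norm S A \<le> \<epsilon>" using tn PN(4) by simp
  qed
qed

subsection \<open>Bases of multipartite systems\<close>

lemma party_basis_iff:
  "xs \<in> party_basis ds \<longleftrightarrow> length xs = length ds \<and> (\<forall>i<length ds. xs ! i < ds ! i)"
proof (induction ds arbitrary: xs)
  case Nil
  then show ?case by (auto simp: party_basis_def)
next
  case (Cons d ds)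
  have "xs \<in> party_basis (d # ds) \<longleftrightarrow> (\<exists>y ys. xs = y # ys \<and> y < d \<and> ys \<in> party_basis ds)"
    by (auto simp: party_basis_def set_Cons_def)
  also have "\<dots> \<longleftrightarrow> length xs = length (d # ds) \<and> (\<forall>i<length (d # ds). xs ! i < (d # ds) ! i)"
    unfolding Cons.IH by (cases xs) (auto simp: less_Suc_eq_0_disj)
  finally show ?case .
qed

lemma party_basis_Nil [simp]: "party_basis [] = {[]}"
  by (simp add: party_basis_def)

lemma party_basis_length: "xs \<in> party_basis ds \<Longrightarrow> length xs = length ds"
  by (simp add: party_basis_iff)

lemma party_basis_append_iff:
  "xs \<in> party_basis (ds @ es) \<longleftrightarrow>
     take (length ds) xs \<in> party_basis ds \<and> drop (length ds) xs \<in> party_basis es"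
proof
  assume "xs \<in> party_basis (ds @ es)"
  then have l: "length xs = length ds + length es" and n: "\<And>i. i < length ds + length es \<Longrightarrow> xs ! i < (ds @ es) ! i"
    by (auto simp: party_basis_iff)
  have "take (length ds) xs ! i < ds ! i" if "i < length ds" for i
    using n[of i] that by (simp add: nth_append)
  moreover have "drop (length ds) xs ! i < es ! i" if "i < length es" for i
    using n[of "length ds + i"] that l by (simp add: nth_append)
  ultimately show "take (length ds) xs \<in> party_basis ds \<and> drop (length ds) xs \<in> party_basis es"
    using l by (auto simp: party_basis_iff)
next
  assume a: "take (length ds) xs \<in> party_basis ds \<and> drop (length ds) xs \<in> party_basis es"
  then have l: "min (length xs) (length ds) = length ds" "length xs - length ds = length es"
    by (auto simp: party_basis_iff)
  have "xs ! i < (ds @ es) ! i" if "i < length ds + length es" for i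
  proof (cases "i < length ds")
    case True
    then show ?thesis using a by (auto simp: party_basis_iff nth_append)
  next
    case False
    then have "drop (length ds) xs ! (i - length ds) < es ! (i - length ds)"
      using a that by (auto simp: party_basis_iff)
    then show ?thesis using False that l by (auto simp: nth_append)
  qed
  then show "xs \<in> party_basis (ds @ es)" using l by (auto simp: party_basis_iff)
qed

lemma append_in_party_basis:
  "xs \<in> party_basis ds \<Longrightarrow> ys \<in> party_basis es \<Longrightarrow> xs @ ys \<in> party_basis (ds @ es)"
  by (simp add: party_basis_append_iff party_basis_length)

lemma finite_party_basis [simp]: "finite (party_basis ds)"
proof (induction ds)
  case (Cons d ds)
  have "party_basis (d # ds) = (\<lambda>(y, ys). y # ys) ` ({..<d} \<times> party_basis ds)"
    by (auto simp: party_basis_def set_Cons_def)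
  then show ?case using Cons by simp
qed simp

lemma bij_betw_append_party_basis:
  "bij_betw (\<lambda>(xs, ys). xs @ ys) (party_basis ds \<times> party_basis es) (party_basis (ds @ es))"
  by (rule bij_betw_byWitness[where f' = "\<lambda>xs. (take (length ds) xs, drop (length ds) xs)"])
    (auto simp: party_basis_append_iff party_basis_length)

lemma UNIV_party: "UNIV = {Alice, Bob, Charlie}"
  by (auto intro: party.exhaust)

lemma finite_party [simp]: "finite (UNIV :: party set)"
  by (simp add: UNIV_party)

lemma party_all: "(\<forall>p. Q p) \<longleftrightarrow> Q Alice \<and> Q Bob \<and> Q Charlie"
  by (metis party.exhaust)

lemma index_eq_iff: "x = y \<longleftrightarrow> x Alice = y Alice \<and> x Bob = y Bob \<and> x Charlie = y Charlie"
  for x y :: "party \<Rightarrow> 'a"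
  by (auto simp: fun_eq_iff party_all)

lemma finite_joint_basis [simp]: "finite (joint_basis D)"
proof -
  have "joint_basis D = PiE UNIV (\<lambda>p. party_basis (D p))"
    by (auto simp: joint_basis_def PiE_def extensional_def)
  then show ?thesis by (simp add: finite_PiE)
qed

lemma joint_basis_upd_same:
  "x \<in> joint_basis D \<longleftrightarrow> x p \<in> party_basis (D p) \<and> (\<forall>q. q \<noteq> p \<longrightarrow> x q \<in> party_basis (D q))"
  by (auto simp: joint_basis_def)

lemma sum_joint_basis_upd:
  "(\<Sum>x\<in>joint_basis D. f x) = (\<Sum>z\<in>joint_basis (D(p := [])). \<Sum>u\<in>party_basis (D p). f (z(p := u)))"
proof -
  have "(\<Sum>z\<in>joint_basis (D(p := [])). \<Sum>u\<in>party_basis (D p). f (z(p := u)))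
    = (\<Sum>(z,u)\<in>joint_basis (D(p := [])) \<times> party_basis (D p). f (z(p := u)))"
    by (simp add: sum.cartesian_product)
  also have "\<dots> = (\<Sum>x\<in>joint_basis D. f x)"
    by (rule sum.reindex_bij_witness[where j = "\<lambda>(z,u). z(p := u)" and i = "\<lambda>x. (x(p := []), x p)"])
      (auto simp: joint_basis_def fun_eq_iff split: if_splits)
  finally show ?thesis ..
qed

definition join :: "dims \<Rightarrow> dims \<Rightarrow> dims" where
  "join D E = (\<lambda>p. D p @ E p)"

lemma join_apply [simp]: "join D E p = D p @ E p"
  by (simp add: join_def)

lemma joint_basis_join_iff:
  "x \<in> joint_basis (join D E) \<longleftrightarrow> (\<lambda>p. take (length (D p)) (x p)) \<in> joint_basis D
     \<and> (\<lambda>p. drop (length (D p)) (x p)) \<in> joint_basis E"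
  by (auto simp: joint_basis_def party_basis_append_iff)

lemma joint_basis_length: "x \<in> joint_basis D \<Longrightarrow> length (x p) = length (D p)"
  by (auto simp: joint_basis_def party_basis_length)

lemma sum_joint_basis_join:
  "(\<Sum>x\<in>joint_basis (join D E). f x) = (\<Sum>x\<in>joint_basis D. \<Sum>y\<in>joint_basis E. f (\<lambda>p. x p @ y p))"
proof -
  have "(\<Sum>x\<in>joint_basis D. \<Sum>y\<in>joint_basis E. f (\<lambda>p. x p @ y p))
    = (\<Sum>(x,y)\<in>joint_basis D \<times> joint_basis E. f (\<lambda>p. x p @ y p))"
    by (simp add: sum.cartesian_product)
  also have "\<dots> = (\<Sum>x\<in>joint_basis (join D E). f x)"
    by (rule sum.reindex_bij_witness[where j = "\<lambda>(x,y) p. x p @ y p"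
          and i = "\<lambda>x. (\<lambda>p. take (length (D p)) (x p), \<lambda>p. drop (length (D p)) (x p))"])
      (auto simp: joint_basis_join_iff joint_basis_length)
  finally show ?thesis ..
qed

lemma power_dims_0 [simp]: "power_dims D 0 = (\<lambda>p. [])"
  by (simp add: power_dims_def)

lemma power_dims_Suc [simp]: "power_dims D (Suc n) = join D (power_dims D n)"
  by (simp add: power_dims_def join_def)

lemma joint_basis_trivial: "joint_basis (\<lambda>p. []) = {\<lambda>p. []}"
  by (auto simp: joint_basis_def)

abbreviation joint_ops :: "dims \<Rightarrow> joint_op set" where
  "joint_ops D \<equiv> operators (joint_basis D) (joint_basis D)"

abbreviation joint_psd :: "dims \<Rightarrow> joint_op \<Rightarrow> bool" where
  "joint_psd D \<equiv> positive_op (joint_basis D)"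

abbreviation joint_trace :: "dims \<Rightarrow> joint_op \<Rightarrow> complex" where
  "joint_trace D \<equiv> op_trace (joint_basis D)"


subsection \<open>Tensor products\<close>

lemma tensor_operators:
  assumes "\<rho> \<in> joint_ops D" "\<tau> \<in> joint_ops E"
  shows "tensor D \<rho> \<tau> \<in> joint_ops (join D E)"
  using assms by (auto intro!: operatorsI simp: tensor_def joint_basis_join_iff dest: operatorsD)

lemma tensor_join_apply:
  assumes "x \<in> joint_basis D" "x' \<in> joint_basis D"
  shows "tensor D \<rho> \<tau> (\<lambda>p. x p @ y p) (\<lambda>p. x' p @ y' p) = \<rho> x x' * \<tau> y y'"
  using assms by (simp add: tensor_def joint_basis_length)

lemma tensor_trace: "joint_trace (join D E) (tensor D \<rho> \<tau>) = joint_trace D \<rho> * joint_trace E \<tau>"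
  by (simp add: op_trace_def sum_joint_basis_join tensor_join_apply sum_product)

lemma tensor_psd:
  assumes "joint_psd D \<rho>" "joint_psd E \<tau>"
  shows "joint_psd (join D E) (tensor D \<rho> \<tau>)"
proof -
  obtain v where v: "\<forall>k i. i \<notin> joint_basis D \<longrightarrow> v k i = 0"
    "\<rho> = (\<lambda>i j. \<Sum>k\<in>joint_basis D. v k i * cnj (v k j))"
    using positive_op_decomp[OF finite_joint_basis assms(1)] by (elim exE conjE) (rule that)
  obtain w where w: "\<forall>k i. i \<notin> joint_basis E \<longrightarrow> w k i = 0"
    "\<tau> = (\<lambda>i j. \<Sum>k\<in>joint_basis E. w k i * cnj (w k j))"
    using positive_op_decomp[OF finite_joint_basis assms(2)] by (elim exE conjE) (rule that)
  let ?V = "\<lambda>(k,l) x. v k (\<lambda>p. take (length (D p)) (x p)) * w l (\<lambda>p. drop (length (D p)) (x p))"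
  have "tensor D \<rho> \<tau> = (\<lambda>i j. \<Sum>k\<in>joint_basis D \<times> joint_basis E. ?V k i * cnj (?V k j))"
    unfolding tensor_def v(2) w(2) sum_product sum.cartesian_product
    by (intro ext sum.cong refl) (auto simp: mult_ac)
  moreover have "joint_psd (join D E) (\<lambda>i j. \<Sum>k\<in>joint_basis D \<times> joint_basis E. ?V k i * cnj (?V k j))"
    using v(1) w(1) by (intro positive_opI) (auto simp: joint_basis_join_iff)
  ultimately show ?thesis by simp
qed

lemma tensor_diff_right:
  "tensor D \<rho> (\<lambda>x y. \<tau> x y - \<tau>' x y) x y = tensor D \<rho> \<tau> x y - tensor D \<rho> \<tau>' x y"
  by (simp add: tensor_def algebra_simps)

lemma tensor_sum_right:
  "tensor D \<rho> (\<lambda>x y. \<Sum>k\<in>I. \<tau> k x y) x y = (\<Sum>k\<in>I. tensor D \<rho> (\<tau> k) x y)"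
  by (simp add: tensor_def sum_distrib_left)

lemma tensor_power_psd:
  assumes "joint_psd D \<rho>" shows "joint_psd (power_dims D n) (tensor_power D \<rho> n)"
proof (induction n)
  case 0
  then show ?case by (simp add: positive_op_id joint_basis_trivial)
next
  case (Suc n)
  then have "joint_psd (power_dims D (Suc n)) (tensor_power D \<rho> (Suc n))"
    using assms by (simp add: tensor_psd)
  then show ?case .
qed

lemma tensor_power_trace:
  "joint_trace (power_dims D n) (tensor_power D \<rho> n) = joint_trace D \<rho> ^ n"
proof (induction n)
  case 0
  then show ?case by (simp add: op_trace_def op_id_def joint_basis_trivial)
next
  case (Suc n)
  then have "joint_trace (power_dims D (Suc n)) (tensor_power D \<rho> (Suc n)) = joint_trace D \<rho> ^ Suc n"
    by (simp add: tensor_trace)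
  then show ?case .
qed


subsection \<open>Local operations\<close>

definition linear_map :: "(joint_op \<Rightarrow> joint_op) \<Rightarrow> bool" where
  "linear_map \<Lambda> \<longleftrightarrow> (\<forall>a b f g. \<Lambda> (\<lambda>x y. a * f x y + b * g x y) = (\<lambda>x y. a * \<Lambda> f x y + b * \<Lambda> g x y))"

lemma linear_mapD:
  assumes "linear_map \<Lambda>"
  shows "\<Lambda> (\<lambda>x y. a * f x y + b * g x y) x y = a * \<Lambda> f x y + b * \<Lambda> g x y"
  using fun_cong[OF fun_cong[OF assms[unfolded linear_map_def, rule_format]]] .

lemma linear_map_diff:
  assumes "linear_map \<Lambda>"
  shows "\<Lambda> (\<lambda>x y. f x y - g x y) x y = \<Lambda> f x y - \<Lambda> g x y"
  using linear_mapD[OF assms, of 1 f "-1" g] by simp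

lemma linear_map_sum:
  assumes "linear_map \<Lambda>"
  shows "\<Lambda> (\<lambda>x y. \<Sum>k\<in>I. f k x y) x y = (\<Sum>k\<in>I. \<Lambda> (f k) x y)"
proof -
  have z: "\<Lambda> (\<lambda>x y. 0) x y = 0" using linear_mapD[OF assms, of 0 _ 0] by simp
  show ?thesis
  proof (induction I rule: infinite_finite_induct)
    case (insert k I)
    then show ?case using linear_mapD[OF assms, of 1 "f k" 1 "\<lambda>x y. \<Sum>k\<in>I. f k x y"] by simp
  qed (simp_all add: z)
qed

lemma local_conj_linear: "linear_map (local_conj D p K)"
  unfolding linear_map_def local_conj_def
  by (simp add: algebra_simps sum.distrib sum_distrib_left)

definition local_vec :: "dims \<Rightarrow> party \<Rightarrow> (nat list, nat list) operator \<Rightarrow> (index \<Rightarrow> complex) \<Rightarrow> index \<Rightarrow> complex" where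
  "local_vec D p K v = (\<lambda>x. \<Sum>u\<in>party_basis (D p). K (x p) u * v (x(p := u)))"

lemma local_conj_outer:
  "local_conj D p K (\<lambda>x y. v x * cnj (v y)) x y = local_vec D p K v x * cnj (local_vec D p K v y)"
  by (simp add: local_conj_def local_vec_def sum_product mult_ac)

lemma local_conj_psd:
  assumes K: "K \<in> operators (party_basis es) (party_basis (D p))" and \<rho>: "joint_psd D \<rho>"
  shows "joint_psd (D(p := es)) (local_conj D p K \<rho>)"
proof -
  obtain v where v: "\<forall>k i. i \<notin> joint_basis D \<longrightarrow> v k i = 0"
    "\<rho> = (\<lambda>i j. \<Sum>k\<in>joint_basis D. v k i * cnj (v k j))"
    using positive_op_decomp[OF finite_joint_basis \<rho>] by (elim exE conjE) (rule that)
  have "local_conj D p K \<rho> = (\<lambda>x y. \<Sum>k\<in>joint_basis D. local_vec D p K (v k) x * cnj (local_vec D p K (v k) y))"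
    unfolding v(2) by (intro ext) (simp add: linear_map_sum[OF local_conj_linear] local_conj_outer)
  moreover have "local_vec D p K (v k) x = 0" if "x \<notin> joint_basis (D(p := es))" for k x
  proof -
    have "K (x p) u * v k (x(p := u)) = 0" for u
    proof (cases "x p \<in> party_basis es")
      case True
      then have "v k (x(p := u)) = 0"
        using that by (intro v(1)[rule_format]) (auto simp: joint_basis_upd_same[of _ _ p])
      then show ?thesis by simp
    qed (use K in \<open>auto simp: operatorsD\<close>)
    then show ?thesis by (simp add: local_vec_def)
  qed
  ultimately show ?thesis by (simp add: positive_opI)
qed

lemma local_conj_trace:
  "joint_trace (D(p := es)) (local_conj D p K \<rho>)
    = (\<Sum>z\<in>joint_basis (D(p := [])). \<Sum>u\<in>party_basis (D p). \<Sum>v\<in>party_basis (D p).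
        op_mult (party_basis es) (op_adj K) K v u * \<rho> (z(p := u)) (z(p := v)))"
proof -
  have "joint_trace (D(p := es)) (local_conj D p K \<rho>)
    = (\<Sum>z\<in>joint_basis (D(p := [])). \<Sum>w\<in>party_basis es. \<Sum>u\<in>party_basis (D p). \<Sum>v\<in>party_basis (D p).
        K w u * \<rho> (z(p := u)) (z(p := v)) * cnj (K w v))"
    by (simp add: op_trace_def sum_joint_basis_upd[of _ "D(p := es)" p] local_conj_def)
  also have "\<dots> = (\<Sum>z\<in>joint_basis (D(p := [])). \<Sum>u\<in>party_basis (D p). \<Sum>v\<in>party_basis (D p).
      \<Sum>w\<in>party_basis es. K w u * \<rho> (z(p := u)) (z(p := v)) * cnj (K w v))"
    by (rule sum.cong[OF refl], subst sum.swap, rule sum.cong[OF refl], rule sum.swap)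
  also have "\<dots> = (\<Sum>z\<in>joint_basis (D(p := [])). \<Sum>u\<in>party_basis (D p). \<Sum>v\<in>party_basis (D p).
        op_mult (party_basis es) (op_adj K) K v u * \<rho> (z(p := u)) (z(p := v)))"
    unfolding op_mult_def op_adj_def sum_distrib_right by (intro sum.cong refl) (simp add: mult_ac)
  finally show ?thesis .
qed

lemma instrumentD:
  assumes "instrument ds r s es K"
  shows "k < r \<Longrightarrow> l < s k \<Longrightarrow> K k l \<in> operators (party_basis (es k)) (party_basis ds)"
    and "(\<Sum>k<r. \<Sum>l<s k. op_mult (party_basis (es k)) (op_adj (K k l)) (K k l) u v) = op_id (party_basis ds) u v"
proof -
  note i = assms[unfolded instrument_def]
  show "k < r \<Longrightarrow> l < s k \<Longrightarrow> K k l \<in> operators (party_basis (es k)) (party_basis ds)"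
    using conjunct1[OF i] by simp
  show "(\<Sum>k<r. \<Sum>l<s k. op_mult (party_basis (es k)) (op_adj (K k l)) (K k l) u v) = op_id (party_basis ds) u v"
    using fun_cong[OF fun_cong[OF conjunct2[OF i]]] .
qed

lemma instrument_trace:
  assumes "instrument (D p) r s es K"
  shows "(\<Sum>k<r. joint_trace (D(p := es k)) (\<lambda>x y. \<Sum>l<s k. local_conj D p (K k l) \<rho> x y)) = joint_trace D \<rho>"
proof -
  have swap: "(\<Sum>k<r. \<Sum>l<s k. \<Sum>z\<in>Z. f k l z) = (\<Sum>z\<in>Z. \<Sum>k<r. \<Sum>l<s k. f k l z)"
    for f :: "nat \<Rightarrow> nat \<Rightarrow> 'z \<Rightarrow> complex" and Z
  proof -
    have "(\<Sum>k<r. \<Sum>l<s k. \<Sum>z\<in>Z. f k l z) = (\<Sum>k<r. \<Sum>z\<in>Z. \<Sum>l<s k. f k l z)"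
      by (intro sum.cong refl sum.swap)
    also have "\<dots> = (\<Sum>z\<in>Z. \<Sum>k<r. \<Sum>l<s k. f k l z)" by (rule sum.swap)
    finally show ?thesis .
  qed
  have "(\<Sum>k<r. joint_trace (D(p := es k)) (\<lambda>x y. \<Sum>l<s k. local_conj D p (K k l) \<rho> x y))
     = (\<Sum>k<r. \<Sum>l<s k. joint_trace (D(p := es k)) (local_conj D p (K k l) \<rho>))"
    unfolding op_trace_def by (rule sum.cong[OF refl], rule sum.swap)
  also have "\<dots> = (\<Sum>z\<in>joint_basis (D(p := [])). \<Sum>u\<in>party_basis (D p). \<Sum>v\<in>party_basis (D p).
      (\<Sum>k<r. \<Sum>l<s k. op_mult (party_basis (es k)) (op_adj (K k l)) (K k l) v u) * \<rho> (z(p := u)) (z(p := v)))"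
    unfolding local_conj_trace swap sum_distrib_right ..
  also have "\<dots> = (\<Sum>z\<in>joint_basis (D(p := [])). \<Sum>u\<in>party_basis (D p). \<Sum>v\<in>party_basis (D p).
      if v = u then \<rho> (z(p := u)) (z(p := u)) else 0)"
    unfolding instrumentD(2)[OF assms] by (intro sum.cong refl) (auto simp: op_id_def)
  also have "\<dots> = joint_trace D \<rho>"
    by (simp add: op_trace_def sum_joint_basis_upd[of _ D p])
  finally show ?thesis .
qed


subsection \<open>LOCC protocols\<close>

lemma locc_linear: "locc P D E \<Lambda> \<Longrightarrow> linear_map \<Lambda>"
proof (induction rule: locc.induct)
  case (stop D)
  then show ?case by (simp add: linear_map_def)
next
  case (round p D r s es K E \<Lambda>)
  show ?case unfolding linear_map_def
  proof (intro allI ext)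
    fix a b f g x y
    have "(\<Sum>k<r. \<Lambda> k (\<lambda>x y. \<Sum>l<s k. local_conj D p (K k l) (\<lambda>x y. a * f x y + b * g x y) x y) x y)
     = (\<Sum>k<r. \<Lambda> k (\<lambda>x y. a * (\<Sum>l<s k. local_conj D p (K k l) f x y) + b * (\<Sum>l<s k. local_conj D p (K k l) g x y)) x y)"
      by (simp add: linear_mapD[OF local_conj_linear] sum.distrib sum_distrib_left)
    also have "\<dots> = (\<Sum>k<r. a * \<Lambda> k (\<lambda>x y. \<Sum>l<s k. local_conj D p (K k l) f x y) x y
      + b * \<Lambda> k (\<lambda>x y. \<Sum>l<s k. local_conj D p (K k l) g x y) x y)"
      using round.IH by (intro sum.cong refl linear_mapD) auto
    finally show "(\<Sum>k<r. \<Lambda> k (\<lambda>x y. \<Sum>l<s k. local_conj D p (K k l) (\<lambda>x y. a * f x y + b * g x y) x y) x y)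
      = a * (\<Sum>k<r. \<Lambda> k (\<lambda>x y. \<Sum>l<s k. local_conj D p (K k l) f x y) x y)
      + b * (\<Sum>k<r. \<Lambda> k (\<lambda>x y. \<Sum>l<s k. local_conj D p (K k l) g x y) x y)"
      by (simp add: sum.distrib sum_distrib_left)
  qed
qed

lemma locc_psd: "locc P D E \<Lambda> \<Longrightarrow> joint_psd D \<rho> \<Longrightarrow> joint_psd E (\<Lambda> \<rho>)"
proof (induction arbitrary: \<rho> rule: locc.induct)
  case (round p D r s es K E \<Lambda>)
  have "joint_psd (D(p := es k)) (\<lambda>x y. \<Sum>l<s k. local_conj D p (K k l) \<rho> x y)" if "k < r" for k
    using that round.prems by (intro positive_op_sum local_conj_psd instrumentD(1)[OF round.hyps(2)]) auto
  then show ?case using round.IH by (intro positive_op_sum) blast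
qed simp

lemma locc_trace: "locc P D E \<Lambda> \<Longrightarrow> joint_trace E (\<Lambda> \<rho>) = joint_trace D \<rho>"
proof (induction arbitrary: \<rho> rule: locc.induct)
  case (round p D r s es K E \<Lambda>)
  have "joint_trace E (\<lambda>x y. \<Sum>k<r. \<Lambda> k (\<lambda>x y. \<Sum>l<s k. local_conj D p (K k l) \<rho> x y) x y)
    = (\<Sum>k<r. joint_trace E (\<Lambda> k (\<lambda>x y. \<Sum>l<s k. local_conj D p (K k l) \<rho> x y)))"
    unfolding op_trace_def by (rule sum.swap)
  also have "\<dots> = joint_trace D \<rho>"
  proof -
    have "joint_trace E (\<Lambda> k \<tau>) = joint_trace (D(p := es k)) \<tau>" if "k < r" for k \<tau>
      using round.IH[rule_format, OF that, THEN conjunct2, THEN spec, of \<tau>] .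
    then have "(\<Sum>k<r. joint_trace E (\<Lambda> k (\<lambda>x y. \<Sum>l<s k. local_conj D p (K k l) \<rho> x y)))
      = (\<Sum>k<r. joint_trace (D(p := es k)) (\<lambda>x y. \<Sum>l<s k. local_conj D p (K k l) \<rho> x y))"
      by (intro sum.cong refl) simp
    then show ?thesis by (simp only: instrument_trace[where D = D and p = p, OF round.hyps(2)])
  qed
  finally show ?case .
qed simp

lemma locc_compose:
  "locc P D E \<Lambda> \<Longrightarrow> locc P E F \<Theta> \<Longrightarrow> locc P D F (\<lambda>\<rho>. \<Theta> (\<Lambda> \<rho>))"
proof (induction rule: locc.induct)
  case (round p D r s es K E \<Lambda>)
  have "(\<lambda>\<rho>. \<Theta> (\<lambda>x y. \<Sum>k<r. \<Lambda> k (\<lambda>x y. \<Sum>l<s k. local_conj D p (K k l) \<rho> x y) x y))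
    = (\<lambda>\<rho> x y. \<Sum>k<r. \<Theta> (\<Lambda> k (\<lambda>x y. \<Sum>l<s k. local_conj D p (K k l) \<rho> x y)) x y)"
    by (intro ext) (rule linear_map_sum[OF locc_linear[OF round.prems]])
  moreover have "locc P D F (\<lambda>\<rho> x y. \<Sum>k<r. \<Theta> (\<Lambda> k (\<lambda>x y. \<Sum>l<s k. local_conj D p (K k l) \<rho> x y)) x y)"
    using round by (intro locc.round[where \<Lambda> = "\<lambda>k \<rho>. \<Theta> (\<Lambda> k \<rho>)"]) blast+
  ultimately show ?case by simp
qed simp

text \<open>Numbering arbitrary finite sets of outcomes and Kraus labels yields the initial segments
  that \<open>instrument\<close> asks for. The distillation protocol has cosets and error patterns
  as outcomes.\<close>

lemma locc_round_indexed:
  assumes p: "p \<in> P" and finI: "finite I" and finJ: "\<And>k. k \<in> I \<Longrightarrow> finite (J k)"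
    and K: "\<And>k l. k \<in> I \<Longrightarrow> l \<in> J k \<Longrightarrow> K k l \<in> operators (party_basis (es k)) (party_basis (D p))"
    and complete: "\<And>u v. (\<Sum>k\<in>I. \<Sum>l\<in>J k. op_mult (party_basis (es k)) (op_adj (K k l)) (K k l) u v)
        = op_id (party_basis (D p)) u v"
    and \<Lambda>: "\<And>k. k \<in> I \<Longrightarrow> locc P (D(p := es k)) E (\<Lambda> k)"
  shows "locc P D E (\<lambda>\<rho> x y. \<Sum>k\<in>I. \<Lambda> k (\<lambda>x y. \<Sum>l\<in>J k. local_conj D p (K k l) \<rho> x y) x y)"
proof -
  obtain b where b: "bij_betw b {..<card I} I"
    using ex_bij_betw_nat_finite[OF finI] by (auto simp: lessThan_atLeast0)
  have "\<forall>k. \<exists>c. k \<in> I \<longrightarrow> bij_betw c {..<card (J k)} (J k)"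
    using ex_bij_betw_nat_finite[OF finJ] by (auto simp: lessThan_atLeast0)
  then obtain c where c: "\<And>k. k \<in> I \<Longrightarrow> bij_betw (c k) {..<card (J k)} (J k)" by metis
  have bI: "b i \<in> I" if "i < card I" for i using b that by (auto simp: bij_betw_def)
  have cJ: "c k j \<in> J k" if "k \<in> I" "j < card (J k)" for k j using c that by (fastforce simp: bij_betw_def)
  have re: "(\<Sum>i<card I. \<Sum>j<card (J (b i)). f (b i) (c (b i) j)) = (\<Sum>k\<in>I. \<Sum>l\<in>J k. f k l)"
    for f :: "'a \<Rightarrow> 'b \<Rightarrow> complex"
  proof -
    have "(\<Sum>i<card I. \<Sum>j<card (J (b i)). f (b i) (c (b i) j)) = (\<Sum>i<card I. \<Sum>l\<in>J (b i). f (b i) l)"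
      using bI by (intro sum.cong refl sum.reindex_bij_betw c) auto
    also have "\<dots> = (\<Sum>k\<in>I. \<Sum>l\<in>J k. f k l)" by (rule sum.reindex_bij_betw[OF b])
    finally show ?thesis .
  qed
  have "instrument (D p) (card I) (\<lambda>i. card (J (b i))) (\<lambda>i. es (b i)) (\<lambda>i j. K (b i) (c (b i) j))"
    unfolding instrument_def
  proof (intro conjI allI impI ext)
    fix i j assume "i < card I" "j < card (J (b i))"
    then show "K (b i) (c (b i) j) \<in> operators (party_basis (es (b i))) (party_basis (D p))"
      using bI cJ by (intro K) auto
  next
    fix u v
    show "(\<Sum>i<card I. \<Sum>j<card (J (b i)). op_mult (party_basis (es (b i))) (op_adj (K (b i) (c (b i) j))) (K (b i) (c (b i) j)) u v)
      = op_id (party_basis (D p)) u v"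
      unfolding re[of "\<lambda>k l. op_mult (party_basis (es k)) (op_adj (K k l)) (K k l) u v"] by (rule complete)
  qed
  then have "locc P D E (\<lambda>\<rho> x y. \<Sum>i<card I. \<Lambda> (b i) (\<lambda>x y. \<Sum>j<card (J (b i)). local_conj D p (K (b i) (c (b i) j)) \<rho> x y) x y)"
    using bI \<Lambda> by (intro locc.round[OF p]) auto
  also have "(\<lambda>\<rho> x y. \<Sum>i<card I. \<Lambda> (b i) (\<lambda>x y. \<Sum>j<card (J (b i)). local_conj D p (K (b i) (c (b i) j)) \<rho> x y) x y)
    = (\<lambda>\<rho> x y. \<Sum>k\<in>I. \<Lambda> k (\<lambda>x y. \<Sum>l\<in>J k. local_conj D p (K k l) \<rho> x y) x y)"
  proof (intro ext)
    fix \<rho> x y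
    have "(\<Sum>i<card I. \<Lambda> (b i) (\<lambda>x y. \<Sum>j<card (J (b i)). local_conj D p (K (b i) (c (b i) j)) \<rho> x y) x y)
      = (\<Sum>i<card I. \<Lambda> (b i) (\<lambda>x y. \<Sum>l\<in>J (b i). local_conj D p (K (b i) l) \<rho> x y) x y)"
    proof (intro sum.cong refl)
      fix i assume "i \<in> {..<card I}"
      then have "(\<lambda>x y. \<Sum>j<card (J (b i)). local_conj D p (K (b i) (c (b i) j)) \<rho> x y)
        = (\<lambda>x y. \<Sum>l\<in>J (b i). local_conj D p (K (b i) l) \<rho> x y)"
        using bI by (intro ext sum.reindex_bij_betw c) auto
      then show "\<Lambda> (b i) (\<lambda>x y. \<Sum>j<card (J (b i)). local_conj D p (K (b i) (c (b i) j)) \<rho> x y) x y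
        = \<Lambda> (b i) (\<lambda>x y. \<Sum>l\<in>J (b i). local_conj D p (K (b i) l) \<rho> x y) x y" by simp
    qed
    also have "\<dots> = (\<Sum>k\<in>I. \<Lambda> k (\<lambda>x y. \<Sum>l\<in>J k. local_conj D p (K k l) \<rho> x y) x y)"
      by (rule sum.reindex_bij_betw[OF b])
    finally show "(\<Sum>i<card I. \<Lambda> (b i) (\<lambda>x y. \<Sum>j<card (J (b i)). local_conj D p (K (b i) (c (b i) j)) \<rho> x y) x y)
      = (\<Sum>k\<in>I. \<Lambda> k (\<lambda>x y. \<Sum>l\<in>J k. local_conj D p (K k l) \<rho> x y) x y)" .
  qed
  finally show ?thesis .
qed

section \<open>Rounds that relabel basis vectors\<close>

definition pull :: "party \<Rightarrow> nat list set \<Rightarrow> (nat list \<Rightarrow> nat list) \<Rightarrow> joint_op \<Rightarrow> joint_op" where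
  "pull p V g \<rho> = (\<lambda>x y. if x p \<in> V \<and> y p \<in> V then \<rho> (x(p := g (x p))) (y(p := g (y p))) else 0)"

text \<open>Rounds whose Kraus operators are weighted partial relabellings of the standard basis:
  the operator with label \<open>k, l\<close> sends \<open>g k l w\<close> to \<open>w\<close> for \<open>w \<in> V k\<close> and kills all other basis vectors.\<close>

lemma locc_pull:
  assumes p: "p \<in> P" and finI: "finite I" and finJ: "\<And>k. k \<in> I \<Longrightarrow> finite (J k)"
    and V: "\<And>k. k \<in> I \<Longrightarrow> V k \<subseteq> party_basis (es k)"
    and g: "\<And>k l. k \<in> I \<Longrightarrow> l \<in> J k \<Longrightarrow> inj_on (g k l) (V k) \<and> g k l ` V k \<subseteq> party_basis (D p)"
    and q: "\<And>k. k \<in> I \<Longrightarrow> q k \<ge> 0"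
    and complete: "\<And>u. u \<in> party_basis (D p) \<Longrightarrow> (\<Sum>k\<in>I. \<Sum>l\<in>J k. if u \<in> g k l ` V k then q k else 0) = (1 :: real)"
    and \<Lambda>: "\<And>k. k \<in> I \<Longrightarrow> locc P (D(p := es k)) E (\<Lambda> k)"
  shows "locc P D E (\<lambda>\<rho> x y. \<Sum>k\<in>I. \<Lambda> k (\<lambda>x y. of_real (q k) * (\<Sum>l\<in>J k. pull p (V k) (g k l) \<rho> x y)) x y)"
proof -
  \<comment> \<open>The root compensates for the operator entering twice, so that \<open>q k\<close>
    is the weight of the branch.\<close>
  define K where "K = (\<lambda>k l w u. if w \<in> V k \<and> u = g k l w then complex_of_real (sqrt (q k)) else 0)"
  have sq: "complex_of_real (sqrt (q k)) * complex_of_real (sqrt (q k)) = of_real (q k)" if "k \<in> I" for k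
    using q[OF that] by (simp flip: of_real_mult)
  \<comment> \<open>Injectivity of \<open>g k l\<close> makes the adjoint of \<open>K k l\<close>
    times \<open>K k l\<close> diagonal; completeness becomes a weighted count of the images that
    contain \<open>u\<close>.\<close>
  have KK: "op_mult (party_basis (es k)) (op_adj (K k l)) (K k l) u v
     = (if u = v \<and> u \<in> g k l ` V k then of_real (q k) else 0)" if kl: "k \<in> I" "l \<in> J k" for k l u v
  proof (cases "\<exists>w\<in>V k. u = g k l w \<and> v = g k l w")
    case True
    then obtain w where w: "w \<in> V k" "u = g k l w" "v = g k l w" by blast
    have "op_mult (party_basis (es k)) (op_adj (K k l)) (K k l) u v
      = (\<Sum>w'\<in>party_basis (es k). if w' = w then of_real (q k) else 0)"
      unfolding op_mult_def op_adj_def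
    proof (intro sum.cong refl)
      fix w' assume "w' \<in> party_basis (es k)"
      have "w' = w" if "w' \<in> V k" "g k l w' = g k l w"
        using that w(1) g[OF kl] by (auto simp: inj_on_def)
      then show "cnj (K k l w' u) * K k l w' v = (if w' = w then of_real (q k) else 0)"
        using w by (auto simp: K_def sq[OF kl(1)])
    qed
    then show ?thesis using w V[OF kl(1)] by auto
  next
    case False
    then have "cnj (K k l w u) * K k l w v = 0" for w by (auto simp: K_def)
    then show ?thesis using False by (auto simp: op_mult_def op_adj_def)
  qed
  have lc: "local_conj D p (K k l) \<rho> x y = of_real (q k) * pull p (V k) (g k l) \<rho> x y"
    if kl: "k \<in> I" "l \<in> J k" for k l \<rho> x y
  proof (cases "x p \<in> V k \<and> y p \<in> V k")
    case True
    have "local_conj D p (K k l) \<rho> x y = (\<Sum>u\<in>party_basis (D p). \<Sum>v\<in>party_basis (D p).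
       if v = g k l (y p) then (if u = g k l (x p) then of_real (q k) * \<rho> (x(p := u)) (y(p := v)) else 0) else 0)"
      unfolding local_conj_def using True sq[OF kl(1)] by (intro sum.cong refl) (auto simp: K_def)
    also have "\<dots> = of_real (q k) * \<rho> (x(p := g k l (x p))) (y(p := g k l (y p)))"
    proof -
      have "g k l (x p) \<in> party_basis (D p)" "g k l (y p) \<in> party_basis (D p)"
        using g[OF kl] True by blast+
      then show ?thesis by simp
    qed
    finally show ?thesis using True by (simp add: pull_def)
  next
    case False
    then have "K k l (x p) u * \<rho> (x(p := u)) (y(p := v)) * cnj (K k l (y p) v) = 0" for u v
      by (auto simp: K_def)
    then show ?thesis using False by (auto simp: local_conj_def pull_def)
  qed
  have "locc P D E (\<lambda>\<rho> x y. \<Sum>k\<in>I. \<Lambda> k (\<lambda>x y. \<Sum>l\<in>J k. local_conj D p (K k l) \<rho> x y) x y)"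
  proof (rule locc_round_indexed[OF p finI finJ _ _ \<Lambda>])
    fix k l assume "k \<in> I" "l \<in> J k"
    then show "K k l \<in> operators (party_basis (es k)) (party_basis (D p))"
      using V g by (auto intro!: operatorsI simp: K_def) blast+
  next
    fix u v
    have "(\<Sum>k\<in>I. \<Sum>l\<in>J k. op_mult (party_basis (es k)) (op_adj (K k l)) (K k l) u v)
      = (\<Sum>k\<in>I. \<Sum>l\<in>J k. if u = v \<and> u \<in> g k l ` V k then of_real (q k) else 0)"
      using KK by (intro sum.cong refl) auto
    also have "\<dots> = of_real (if u = v then (\<Sum>k\<in>I. \<Sum>l\<in>J k. if u \<in> g k l ` V k then q k else 0) else 0)"
      by (auto simp: if_distrib cong: if_cong)
    also have "\<dots> = op_id (party_basis (D p)) u v"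
    proof (cases "u \<in> party_basis (D p)")
      case False
      then have "u \<notin> g k l ` V k" if "k \<in> I" "l \<in> J k" for k l using g[OF that] by blast
      then have "(\<Sum>k\<in>I. \<Sum>l\<in>J k. if u \<in> g k l ` V k then q k else 0) = 0"
        by (intro sum.neutral ballI) simp
      then have "(if u = v then (\<Sum>k\<in>I. \<Sum>l\<in>J k. if u \<in> g k l ` V k then q k else 0) else 0) = 0"
        by (simp only: if_cancel)
      then show ?thesis using False by (simp only: op_id_def) simp
    next
      case True
      then have "(if u = v then (\<Sum>k\<in>I. \<Sum>l\<in>J k. if u \<in> g k l ` V k then q k else 0) else 0) = (if u = v then 1 else 0)"
        by (simp only: complete)
      then show ?thesis using True by (simp only: op_id_def) simp
    qed
    finally show "(\<Sum>k\<in>I. \<Sum>l\<in>J k. op_mult (party_basis (es k)) (op_adj (K k l)) (K k l) u v)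
      = op_id (party_basis (D p)) u v" .
  qed auto
  also have "(\<lambda>\<rho> x y. \<Sum>k\<in>I. \<Lambda> k (\<lambda>x y. \<Sum>l\<in>J k. local_conj D p (K k l) \<rho> x y) x y)
    = (\<lambda>\<rho> x y. \<Sum>k\<in>I. \<Lambda> k (\<lambda>x y. of_real (q k) * (\<Sum>l\<in>J k. pull p (V k) (g k l) \<rho> x y)) x y)"
    by (intro ext sum.cong refl) (simp add: lc sum_distrib_left)
  finally show ?thesis .
qed

text \<open>Every Kraus operator is tensored with the identity on the prefix \<open>R\<close>. Kraus
  operators must vanish off the basis, so this identity is cut off outside the basis of
  \<open>R\<close>; on a \<rho> supported there the cut is invisible.\<close>

lemma locc_context:
  assumes "locc P D E \<Lambda>"
  shows "\<exists>\<Lambda>'. locc P (join R D) (join R E) \<Lambda>'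
    \<and> (\<forall>\<rho>\<in>joint_ops R. \<forall>\<tau>. \<Lambda>' (tensor R \<rho> \<tau>) = tensor R \<rho> (\<Lambda> \<tau>))"
  using assms
proof (induction rule: locc.induct)
  case (stop D)
  show ?case by (intro exI[of _ "\<lambda>\<rho>. \<rho>"]) (auto intro: locc.stop)
next
  case (round p D r s es K E \<Lambda>)
  define K' where "K' = (\<lambda>k l a b. if take (length (R p)) a = take (length (R p)) b \<and> take (length (R p)) a \<in> party_basis (R p)
    then K k l (drop (length (R p)) a) (drop (length (R p)) b) else 0)"
  have "\<exists>\<Lambda>'. \<forall>k<r. locc P (join R (D(p := es k))) (join R E) (\<Lambda>' k)
    \<and> (\<forall>\<rho>\<in>joint_ops R. \<forall>\<tau>. \<Lambda>' k (tensor R \<rho> \<tau>) = tensor R \<rho> (\<Lambda> k \<tau>))"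
    using round.IH by (intro choice) blast
  then obtain \<Lambda>' where \<Lambda>': "\<And>k. k < r \<Longrightarrow> locc P (join R (D(p := es k))) (join R E) (\<Lambda>' k)"
    "\<And>k \<rho> \<tau>. k < r \<Longrightarrow> \<rho> \<in> joint_ops R \<Longrightarrow> \<Lambda>' k (tensor R \<rho> \<tau>) = tensor R \<rho> (\<Lambda> k \<tau>)" by blast
  have upd: "(join R D)(p := R p @ es k) = join R (D(p := es k))" for k
    by (auto simp: join_def)
  have inst: "instrument (join R D p) r s (\<lambda>k. R p @ es k) K'"
    unfolding instrument_def
  proof (intro conjI allI impI ext)
    fix k l assume "k < r" "l < s k"
    then have "K k l \<in> operators (party_basis (es k)) (party_basis (D p))"
      by (rule instrumentD(1)[OF round.hyps(2)])
    then show "K' k l \<in> operators (party_basis (R p @ es k)) (party_basis (join R D p))"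
      by (auto intro!: operatorsI simp: K'_def party_basis_append_iff dest: operatorsD)
  next
    fix u v :: "nat list"
    let ?n = "length (R p)"
    have F: "op_mult (party_basis (R p @ es k)) (op_adj (K' k l)) (K' k l) u v
      = (if take ?n u = take ?n v \<and> take ?n u \<in> party_basis (R p)
         then op_mult (party_basis (es k)) (op_adj (K k l)) (K k l) (drop ?n u) (drop ?n v) else 0)" for k l
    proof -
      have "op_mult (party_basis (R p @ es k)) (op_adj (K' k l)) (K' k l) u v
        = (\<Sum>a\<in>party_basis (R p). \<Sum>b\<in>party_basis (es k). cnj (K' k l (a @ b) u) * K' k l (a @ b) v)"
        unfolding op_mult_def op_adj_def
        by (subst sum.reindex_bij_betw[OF bij_betw_append_party_basis, symmetric])
          (simp add: sum.cartesian_product case_prod_unfold)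
      also have "\<dots> = (\<Sum>a\<in>party_basis (R p). if a = take ?n u then (if take ?n u = take ?n v
          then op_mult (party_basis (es k)) (op_adj (K k l)) (K k l) (drop ?n u) (drop ?n v) else 0) else 0)"
      proof (intro sum.cong refl)
        fix a assume a: "a \<in> party_basis (R p)"
        then have td: "take ?n (a @ b) = a" "drop ?n (a @ b) = b" for b by (simp_all add: party_basis_length)
        show "(\<Sum>b\<in>party_basis (es k). cnj (K' k l (a @ b) u) * K' k l (a @ b) v)
          = (if a = take ?n u then (if take ?n u = take ?n v
          then op_mult (party_basis (es k)) (op_adj (K k l)) (K k l) (drop ?n u) (drop ?n v) else 0) else 0)"
          using a unfolding K'_def op_mult_def op_adj_def td by (cases "a = take ?n u"; cases "a = take ?n v") auto
      qed
      finally show ?thesis by simp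
    qed
    have KK: "op_mult (party_basis (R p @ es k)) (op_adj (K' k l)) (K' k l) u v
      = of_bool (take ?n u = take ?n v \<and> take ?n u \<in> party_basis (R p))
         * op_mult (party_basis (es k)) (op_adj (K k l)) (K k l) (drop ?n u) (drop ?n v)" for k l
      unfolding F by auto
    have "(\<Sum>k<r. \<Sum>l<s k. op_mult (party_basis (R p @ es k)) (op_adj (K' k l)) (K' k l) u v)
      = (if take ?n u = take ?n v \<and> take ?n u \<in> party_basis (R p)
         then op_id (party_basis (D p)) (drop ?n u) (drop ?n v) else 0)"
      unfolding KK sum_distrib_left[symmetric] instrumentD(2)[OF round.hyps(2)] by auto
    also have "\<dots> = op_id (party_basis (join R D p)) u v"
    proof -
      have "u = v" if "take ?n u = take ?n v" "drop ?n u = drop ?n v"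
        using that by (metis append_take_drop_id)
      then show ?thesis by (auto simp: op_id_def party_basis_append_iff)
    qed
    finally show "(\<Sum>k<r. \<Sum>l<s k. op_mult (party_basis (R p @ es k)) (op_adj (K' k l)) (K' k l) u v)
      = op_id (party_basis (join R D p)) u v" .
  qed
  have lc: "local_conj (join R D) p (K' k l) (tensor R \<rho> \<tau>) x y = tensor R \<rho> (local_conj D p (K k l) \<tau>) x y"
    if \<rho>: "\<rho> \<in> joint_ops R" for k l \<rho> \<tau> x y
  proof -
    let ?n = "length (R p)"
    let ?t = "\<lambda>x q. take (length (R q)) (x q)" and ?d = "\<lambda>x q. drop (length (R q)) (x q)"
    have re: "(\<Sum>u\<in>party_basis (join R D p). f u) = (\<Sum>a\<in>party_basis (R p). \<Sum>b\<in>party_basis (D p). f (a @ b))" for f :: "nat list \<Rightarrow> complex"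
      unfolding join_apply by (subst sum.reindex_bij_betw[OF bij_betw_append_party_basis, symmetric])
          (simp add: sum.cartesian_product case_prod_unfold)
    have t: "?t (x(p := a @ b)) = (?t x)(p := a)" "?d (x(p := a @ b)) = (?d x)(p := b)"
      if "a \<in> party_basis (R p)" for a b and x :: index
      using that by (auto simp: party_basis_length)
    have KR: "K' k l w (a @ b) = (if a = take ?n w then K k l (drop ?n w) b else 0)"
      if a: "a \<in> party_basis (R p)" and w: "take ?n w \<in> party_basis (R p)" for a b w
    proof -
      have td: "take ?n (a @ b) = a" "drop ?n (a @ b) = b" using a by (simp_all add: party_basis_length)
      show ?thesis unfolding K'_def td using w by auto
    qed
    have up: "(?t z)(p := take ?n (z p)) = ?t z" for z :: index by (rule fun_upd_triv)
    show ?thesis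
    proof (cases "take ?n (x p) \<in> party_basis (R p) \<and> take ?n (y p) \<in> party_basis (R p)")
      case True
      have "local_conj (join R D) p (K' k l) (tensor R \<rho> \<tau>) x y
        = (\<Sum>a\<in>party_basis (R p). \<Sum>b\<in>party_basis (D p). \<Sum>a'\<in>party_basis (R p). \<Sum>b'\<in>party_basis (D p).
            K' k l (x p) (a @ b) * (\<rho> ((?t x)(p := a)) ((?t y)(p := a')) * \<tau> ((?d x)(p := b)) ((?d y)(p := b'))) * cnj (K' k l (y p) (a' @ b')))"
        unfolding local_conj_def re tensor_def by (intro sum.cong refl) (simp only: t)
      also have "\<dots> = (\<Sum>a\<in>party_basis (R p). \<Sum>b\<in>party_basis (D p). \<Sum>a'\<in>party_basis (R p).
          if a' = take ?n (y p) then (if a = take ?n (x p) then \<Sum>b'\<in>party_basis (D p). K k l (?d x p) b * (\<rho> (?t x) (?t y) * \<tau> ((?d x)(p := b)) ((?d y)(p := b'))) * cnj (K k l (?d y p) b')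
          else 0) else 0)"
        using True by (intro sum.cong refl) (simp add: KR up)
      also have "\<dots> = (\<Sum>a\<in>party_basis (R p). if a = take ?n (x p) then \<Sum>b\<in>party_basis (D p). \<Sum>b'\<in>party_basis (D p). K k l (?d x p) b * (\<rho> (?t x) (?t y) * \<tau> ((?d x)(p := b)) ((?d y)(p := b'))) * cnj (K k l (?d y p) b')
          else 0)"
        using True by (intro sum.cong refl) (auto simp: sum.delta)
      also have "\<dots> = tensor R \<rho> (local_conj D p (K k l) \<tau>) x y"
        using True by (simp add: tensor_def local_conj_def sum_distrib_left mult_ac)
      finally show ?thesis .
    next
      case False
      then have "\<rho> (?t x) (?t y) = 0"
        by (intro operatorsD[OF \<rho>]) (auto simp: joint_basis_def)
      then have "tensor R \<rho> (local_conj D p (K k l) \<tau>) x y = 0" by (simp add: tensor_def)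
      moreover have z: "K' k l (x p) u * z * cnj (K' k l (y p) v) = 0" for u v z
        using False by (auto simp: K'_def)
      have "local_conj (join R D) p (K' k l) (tensor R \<rho> \<tau>) x y = 0"
        unfolding local_conj_def by (intro sum.neutral ballI) (rule z)
      ultimately show ?thesis by simp
    qed
  qed
  define \<Theta> where "\<Theta> = (\<lambda>\<rho> x y. \<Sum>k<r. \<Lambda>' k (\<lambda>x y. \<Sum>l<s k. local_conj (join R D) p (K' k l) \<rho> x y) x y)"
  have "locc P (join R D) (join R E) \<Theta>"
    unfolding \<Theta>_def using \<Lambda>'(1) upd by (intro locc.round[where D = "join R D" and p = p, OF round.hyps(1) inst]) (simp only: upd, blast)
  moreover have "\<Theta> (tensor R \<rho> \<tau>) = tensor R \<rho> (\<lambda>x y. \<Sum>k<r. \<Lambda> k (\<lambda>x y. \<Sum>l<s k. local_conj D p (K k l) \<tau> x y) x y)"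
    if \<rho>: "\<rho> \<in> joint_ops R" for \<rho> \<tau>
  proof -
    have "(\<lambda>x y. \<Sum>l<s k. tensor R \<rho> (local_conj D p (K k l) \<tau>) x y) = tensor R \<rho> (\<lambda>x y. \<Sum>l<s k. local_conj D p (K k l) \<tau> x y)" for k
      by (intro ext) (simp add: tensor_sum_right)
    then show ?thesis
      unfolding \<Theta>_def lc[OF \<rho>] using \<Lambda>'(2)[OF _ \<rho>] by (intro ext) (simp add: tensor_sum_right)
  qed
  ultimately show ?case by blast
qed


subsection \<open>Approximation in trace norm\<close>

text \<open>A trace distance bound in the form supplied by \<open>trace_norm_le_iff\<close>. It
  passes easily through protocols, mixtures and tensor products because it involves only positivity
  and traces.\<close>

definition close_ops :: "dims \<Rightarrow> real \<Rightarrow> joint_op \<Rightarrow> joint_op \<Rightarrow> bool" where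
  "close_ops D \<epsilon> A B \<longleftrightarrow> (\<exists>P N. joint_psd D P \<and> joint_psd D N \<and> (\<forall>x y. A x y - B x y = P x y - N x y)
     \<and> Re (joint_trace D P) + Re (joint_trace D N) \<le> \<epsilon>)"

lemma trace_norm_le_iff_close_ops:
  assumes "joint_psd D A" "joint_psd D B"
  shows "trace_norm (joint_basis D) (\<lambda>x y. A x y - B x y) \<le> \<epsilon> \<longleftrightarrow> close_ops D \<epsilon> A B"
  unfolding close_ops_def
proof (rule trace_norm_le_iff[OF finite_joint_basis])
  show "(\<lambda>x y. A x y - B x y) \<in> joint_ops D"
    using assms[THEN positive_opD(1)] by (auto intro!: operatorsI simp: operatorsD)
  show "op_adj (\<lambda>x y. A x y - B x y) = (\<lambda>x y. A x y - B x y)"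
    using assms[THEN positive_op_hermitian[OF finite_joint_basis]]
    by (auto simp: op_adj_def fun_eq_iff)
qed

lemma close_ops_refl: "\<epsilon> \<ge> 0 \<Longrightarrow> close_ops D \<epsilon> A A"
  unfolding close_ops_def
  by (intro exI[of _ "\<lambda>x y. 0"]) (auto simp: positive_op_zero op_trace_def)

lemma close_ops_mono: "close_ops D \<epsilon> A B \<Longrightarrow> \<epsilon> \<le> \<epsilon>' \<Longrightarrow> close_ops D \<epsilon>' A B"
  unfolding close_ops_def by force

lemma close_ops_trans:
  assumes "close_ops D \<epsilon> A B" "close_ops D \<delta> B C" shows "close_ops D (\<epsilon> + \<delta>) A C"
proof -
  obtain P N P' N' where *: "joint_psd D P" "joint_psd D N" "\<forall>x y. A x y - B x y = P x y - N x y"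
     "Re (joint_trace D P) + Re (joint_trace D N) \<le> \<epsilon>"
     "joint_psd D P'" "joint_psd D N'" "\<forall>x y. B x y - C x y = P' x y - N' x y"
     "Re (joint_trace D P') + Re (joint_trace D N') \<le> \<delta>"
    using assms unfolding close_ops_def by metis
  have e: "A x y - C x y = (P x y + P' x y) - (N x y + N' x y)" for x y
  proof -
    have "A x y - C x y = (A x y - B x y) + (B x y - C x y)" by simp
    then show ?thesis using *(3,7) by simp
  qed
  show ?thesis
    unfolding close_ops_def
    by (rule exI[of _ "\<lambda>x y. P x y + P' x y"], rule exI[of _ "\<lambda>x y. N x y + N' x y"])
      (use * e in \<open>auto intro!: positive_op_add simp: op_trace_def sum.distrib\<close>)
qed

text \<open>The protocol is linear, so it acts on the witnesses P and N separately; it keeps them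
  positive and their traces fixed.\<close>

lemma close_ops_locc:
  assumes "locc Q D E \<Lambda>" "close_ops D \<epsilon> A B" shows "close_ops E \<epsilon> (\<Lambda> A) (\<Lambda> B)"
proof -
  obtain P N where *: "joint_psd D P" "joint_psd D N" "\<And>x y. A x y - B x y = P x y - N x y"
     "Re (joint_trace D P) + Re (joint_trace D N) \<le> \<epsilon>"
    using assms(2) unfolding close_ops_def by blast
  have "\<Lambda> A x y - \<Lambda> B x y = \<Lambda> P x y - \<Lambda> N x y" for x y
    using *(3) by (simp flip: linear_map_diff[OF locc_linear[OF assms(1)]])
  then show ?thesis
    unfolding close_ops_def
    using * locc_psd[OF assms(1)] locc_trace[OF assms(1)]
    by (intro exI[of _ "\<Lambda> P"] exI[of _ "\<Lambda> N"]) auto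
qed

lemma close_ops_convex:
  assumes "close_ops D \<epsilon> A B" "close_ops D \<delta> A' B'" "s \<ge> 0" "t \<ge> 0"
  shows "close_ops D (s * \<epsilon> + t * \<delta>) (\<lambda>x y. of_real s * A x y + of_real t * A' x y) (\<lambda>x y. of_real s * B x y + of_real t * B' x y)"
proof -
  obtain P N P' N' where *: "joint_psd D P" "joint_psd D N" "\<forall>x y. A x y - B x y = P x y - N x y"
     "Re (joint_trace D P) + Re (joint_trace D N) \<le> \<epsilon>"
     "joint_psd D P'" "joint_psd D N'" "\<forall>x y. A' x y - B' x y = P' x y - N' x y"
     "Re (joint_trace D P') + Re (joint_trace D N') \<le> \<delta>"
    using assms unfolding close_ops_def by metis
  have e: "(of_real s * A x y + of_real t * A' x y) - (of_real s * B x y + of_real t * B' x y)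
     = (of_real s * P x y + of_real t * P' x y) - (of_real s * N x y + of_real t * N' x y)" for x y
  proof -
    have "(of_real s * A x y + of_real t * A' x y) - (of_real s * B x y + of_real t * B' x y)
      = of_real s * (A x y - B x y) + of_real t * (A' x y - B' x y)" by (simp add: algebra_simps)
    then show ?thesis using *(3,7) by (simp add: algebra_simps)
  qed
  have "s * (Re (joint_trace D P) + Re (joint_trace D N)) + t * (Re (joint_trace D P') + Re (joint_trace D N')) \<le> s * \<epsilon> + t * \<delta>"
    using *(4,8) assms(3,4) by (intro add_mono mult_left_mono) auto
  then have tr: "Re (joint_trace D (\<lambda>x y. of_real s * P x y + of_real t * P' x y))
      + Re (joint_trace D (\<lambda>x y. of_real s * N x y + of_real t * N' x y)) \<le> s * \<epsilon> + t * \<delta>"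
    by (simp add: op_trace_def sum.distrib algebra_simps sum_distrib_left)
  show ?thesis
    unfolding close_ops_def
    by (rule exI[of _ "\<lambda>x y. of_real s * P x y + of_real t * P' x y"], rule exI[of _ "\<lambda>x y. of_real s * N x y + of_real t * N' x y"])
      (use * e tr assms(3,4) in \<open>auto intro!: positive_op_add positive_op_scale\<close>)
qed

lemma close_ops_tensor:
  assumes "joint_psd D \<rho>" "joint_trace D \<rho> = 1" "close_ops E \<epsilon> A B"
  shows "close_ops (join D E) \<epsilon> (tensor D \<rho> A) (tensor D \<rho> B)"
proof -
  obtain P N where *: "joint_psd E P" "joint_psd E N" "\<And>x y. A x y - B x y = P x y - N x y"
     "Re (joint_trace E P) + Re (joint_trace E N) \<le> \<epsilon>"
    using assms(3) unfolding close_ops_def by blast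
  have "tensor D \<rho> A x y - tensor D \<rho> B x y = tensor D \<rho> P x y - tensor D \<rho> N x y" for x y
    using *(3) by (simp flip: tensor_diff_right)
  then show ?thesis
    unfolding close_ops_def using * assms
    by (intro exI[of _ "tensor D \<rho> P"] exI[of _ "tensor D \<rho> N"]) (auto simp: tensor_psd tensor_trace)
qed

subsection \<open>Domination by product vectors\<close>

definition transpose_Charlie :: "joint_op \<Rightarrow> joint_op" where
  "transpose_Charlie \<rho> = (\<lambda>x y. \<rho> (x(Charlie := y Charlie)) (y(Charlie := x Charlie)))"

definition product_vec :: "(party \<Rightarrow> nat list \<Rightarrow> complex) \<Rightarrow> index \<Rightarrow> complex" where
  "product_vec f x = (\<Prod>p\<in>UNIV. f p (x p))"

text \<open>Squared norm of \<open>product_vec f\<close> on the space \<open>D\<close>, that is, the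
  trace of its rank-one operator, written as a product over the parties.\<close>

definition product_weight :: "dims \<Rightarrow> (party \<Rightarrow> nat list \<Rightarrow> complex) \<Rightarrow> real" where
  "product_weight D f = (\<Prod>p\<in>UNIV. \<Sum>u\<in>party_basis (D p). (cmod (f p u))\<^sup>2)"

definition sep_op :: "(party \<Rightarrow> nat list \<Rightarrow> complex) list \<Rightarrow> joint_op" where
  "sep_op fs = (\<lambda>x y. \<Sum>f\<leftarrow>fs. product_vec f x * cnj (product_vec f y))"

definition supported :: "dims \<Rightarrow> (party \<Rightarrow> nat list \<Rightarrow> complex) \<Rightarrow> bool" where
  "supported D f \<longleftrightarrow> (\<forall>p u. u \<notin> party_basis (D p) \<longrightarrow> f p u = 0)"

text \<open>The partial transpose of \<open>\<omega>\<close> on Charlie's side, rather than \<open>\<omega>\<close> itself, is bounded by a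
  separable operator. LOCC protocols cannot see the difference: conjugating Charlie's Kraus operators
  turns a protocol for \<open>\<omega>\<close> into one for its partial transpose, with the same state of Alice and Bob.\<close>

definition sep_bound :: "dims \<Rightarrow> real \<Rightarrow> joint_op \<Rightarrow> bool" where
  "sep_bound D K \<omega> \<longleftrightarrow> (\<exists>fs. (\<forall>f\<in>set fs. supported D f)
     \<and> joint_psd D (\<lambda>x y. sep_op fs x y - transpose_Charlie \<omega> x y) \<and> (\<Sum>f\<leftarrow>fs. product_weight D f) \<le> K)"

lemma product_vec_split:
  "product_vec f x = f p (x p) * (\<Prod>q\<in>UNIV - {p}. f q (x q))"
  unfolding product_vec_def by (rule prod.remove) auto

lemma product_weight_split:
  "product_weight D f = (\<Sum>u\<in>party_basis (D p). (cmod (f p u))\<^sup>2)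
     * (\<Prod>q\<in>UNIV - {p}. \<Sum>u\<in>party_basis (D q). (cmod (f q u))\<^sup>2)"
  unfolding product_weight_def by (rule prod.remove) auto

lemma sum_list_map_nth: "(\<Sum>f\<leftarrow>fs. F f) = (\<Sum>i<length fs. F (fs ! i))"
  by (simp add: sum_list_sum_nth lessThan_atLeast0)

lemma sep_op_nth: "sep_op fs = (\<lambda>x y. \<Sum>i<length fs. product_vec (fs ! i) x * cnj (product_vec (fs ! i) y))"
  by (simp add: sep_op_def sum_list_map_nth)

lemma sep_bound_mono: "sep_bound D K \<omega> \<Longrightarrow> K \<le> K' \<Longrightarrow> sep_bound D K' \<omega>"
  unfolding sep_bound_def by (meson order_trans)

lemma sep_bound_zero: "sep_bound D 0 (\<lambda>x y. 0)"
  unfolding sep_bound_def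
  by (rule exI[of _ "[]"]) (simp add: sep_op_def transpose_Charlie_def positive_op_zero)

lemma sep_bound_add:
  assumes "sep_bound D K \<omega>" "sep_bound D L \<tau>"
  shows "sep_bound D (K + L) (\<lambda>x y. \<omega> x y + \<tau> x y)"
proof -
  obtain fs where f: "\<forall>f\<in>set fs. supported D f" "joint_psd D (\<lambda>x y. sep_op fs x y - transpose_Charlie \<omega> x y)"
    "(\<Sum>f\<leftarrow>fs. product_weight D f) \<le> K"
    using assms(1) unfolding sep_bound_def by (elim exE conjE) (rule that)
  obtain gs where g: "\<forall>f\<in>set gs. supported D f" "joint_psd D (\<lambda>x y. sep_op gs x y - transpose_Charlie \<tau> x y)"
    "(\<Sum>f\<leftarrow>gs. product_weight D f) \<le> L"
    using assms(2) unfolding sep_bound_def by (elim exE conjE) (rule that)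
  have "joint_psd D (\<lambda>x y. sep_op (fs @ gs) x y - transpose_Charlie (\<lambda>x y. \<omega> x y + \<tau> x y) x y)"
    using positive_op_add[OF f(2) g(2)] by (simp add: sep_op_def transpose_Charlie_def algebra_simps)
  then show ?thesis
    unfolding sep_bound_def using f g by (intro exI[of _ "fs @ gs"]) auto
qed

lemma sep_bound_sum:
  assumes "\<And>k. k < (r :: nat) \<Longrightarrow> sep_bound D (K k) (\<omega> k)"
  shows "sep_bound D (\<Sum>k<r. K k) (\<lambda>x y. \<Sum>k<r. \<omega> k x y)"
  using assms
proof (induction r)
  case 0
  show ?case by (simp add: sep_bound_zero)
next
  case (Suc r)
  then have "sep_bound D ((\<Sum>k<r. K k) + K r) (\<lambda>x y. (\<Sum>k<r. \<omega> k x y) + \<omega> r x y)"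
    by (intro sep_bound_add) auto
  then show ?case by simp
qed

text \<open>The transpose of K X K^dagger is conj(K) X^T conj(K)^dagger, and operators of the other
  parties do not touch Charlie's indices.\<close>

lemma transpose_local_conj:
  "transpose_Charlie (local_conj D p K \<omega>) x y
    = local_conj D p (if p = Charlie then \<lambda>u v. cnj (K u v) else K) (transpose_Charlie \<omega>) x y"
proof (cases "p = Charlie")
  case True
  show ?thesis unfolding True local_conj_def transpose_Charlie_def
    by (subst sum.swap) (simp add: mult_ac)
next
  case False
  then have "(x(Charlie := z))(p := u) = (x(p := u))(Charlie := z)" for x :: index and z u
    by (auto simp: fun_eq_iff)
  then show ?thesis using False unfolding local_conj_def transpose_Charlie_def by simp
qed

lemma instrument_cnj:
  assumes "instrument ds r s es K"
  shows "instrument ds r s es (\<lambda>k l u v. cnj (K k l u v))"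
  unfolding instrument_def
proof (intro conjI allI impI ext)
  fix k l assume "k < r" "l < s k"
  from instrumentD(1)[OF assms this] show "(\<lambda>u v. cnj (K k l u v)) \<in> operators (party_basis (es k)) (party_basis ds)"
    by (auto intro!: operatorsI dest: operatorsD)
next
  fix u v
  have "(\<Sum>k<r. \<Sum>l<s k. op_mult (party_basis (es k)) (op_adj (\<lambda>u v. cnj (K k l u v))) (\<lambda>u v. cnj (K k l u v)) u v)
    = cnj (\<Sum>k<r. \<Sum>l<s k. op_mult (party_basis (es k)) (op_adj (K k l)) (K k l) u v)"
    by (simp add: op_mult_def op_adj_def)
  also have "\<dots> = op_id (party_basis ds) u v"
    unfolding instrumentD(2)[OF assms] by (simp add: op_id_def)
  finally show "(\<Sum>k<r. \<Sum>l<s k. op_mult (party_basis (es k)) (op_adj (\<lambda>u v. cnj (K k l u v))) (\<lambda>u v. cnj (K k l u v)) u v)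
    = op_id (party_basis ds) u v" .
qed

text \<open>Completeness read as an isometry. This is what keeps the total weight of a separable
  bound constant during a round.\<close>

lemma instrument_norm:
  assumes "instrument ds r s es K"
  shows "(\<Sum>k<r. \<Sum>l<s k. \<Sum>w\<in>party_basis (es k). (cmod (\<Sum>u\<in>party_basis ds. K k l w u * g u))\<^sup>2)
    = (\<Sum>u\<in>party_basis ds. (cmod (g u))\<^sup>2)"
proof -
  let ?B = "party_basis ds"
  have 1: "(\<Sum>w\<in>party_basis (es k). complex_of_real ((cmod (\<Sum>u\<in>?B. K k l w u * g u))\<^sup>2))
    = (\<Sum>u\<in>?B. \<Sum>v\<in>?B. op_mult (party_basis (es k)) (op_adj (K k l)) (K k l) v u * (g u * cnj (g v)))" for k l
  proof -
    have "(\<Sum>w\<in>party_basis (es k). complex_of_real ((cmod (\<Sum>u\<in>?B. K k l w u * g u))\<^sup>2))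
      = (\<Sum>w\<in>party_basis (es k). \<Sum>u\<in>?B. \<Sum>v\<in>?B. (cnj (K k l w v) * K k l w u) * (g u * cnj (g v)))"
      unfolding complex_norm_square cnj_sum sum_product by (intro sum.cong refl) (simp add: mult_ac)
    also have "\<dots> = (\<Sum>u\<in>?B. \<Sum>w\<in>party_basis (es k). \<Sum>v\<in>?B. (cnj (K k l w v) * K k l w u) * (g u * cnj (g v)))"
      by (rule sum.swap)
    also have "\<dots> = (\<Sum>u\<in>?B. \<Sum>v\<in>?B. \<Sum>w\<in>party_basis (es k). (cnj (K k l w v) * K k l w u) * (g u * cnj (g v)))"
      by (intro sum.cong refl sum.swap)
    finally show ?thesis by (simp add: op_mult_def op_adj_def sum_distrib_right)
  qed
  have "complex_of_real (\<Sum>k<r. \<Sum>l<s k. \<Sum>w\<in>party_basis (es k). (cmod (\<Sum>u\<in>?B. K k l w u * g u))\<^sup>2)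
    = (\<Sum>k<r. \<Sum>l<s k. \<Sum>u\<in>?B. \<Sum>v\<in>?B. op_mult (party_basis (es k)) (op_adj (K k l)) (K k l) v u * (g u * cnj (g v)))"
    unfolding of_real_sum 1 ..
  also have "\<dots> = (\<Sum>k<r. \<Sum>u\<in>?B. \<Sum>v\<in>?B. \<Sum>l<s k. op_mult (party_basis (es k)) (op_adj (K k l)) (K k l) v u * (g u * cnj (g v)))"
    by (rule sum.cong[OF refl], subst sum.swap, rule sum.cong[OF refl], rule sum.swap)
  also have "\<dots> = (\<Sum>u\<in>?B. \<Sum>v\<in>?B. \<Sum>k<r. \<Sum>l<s k. op_mult (party_basis (es k)) (op_adj (K k l)) (K k l) v u * (g u * cnj (g v)))"
    by (subst sum.swap, rule sum.cong[OF refl], rule sum.swap)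
  also have "\<dots> = (\<Sum>u\<in>?B. \<Sum>v\<in>?B. op_id ?B v u * (g u * cnj (g v)))"
    unfolding sum_distrib_right[symmetric] instrumentD(2)[OF assms] ..
  also have "\<dots> = (\<Sum>u\<in>?B. \<Sum>v\<in>?B. if v = u then g u * cnj (g u) else 0)"
    by (intro sum.cong refl) (auto simp: op_id_def)
  also have "\<dots> = complex_of_real (\<Sum>u\<in>?B. (cmod (g u))\<^sup>2)"
    unfolding of_real_sum complex_norm_square by simp
  finally show ?thesis by (simp only: of_real_eq_iff)
qed

lemma local_vec_product:
  "local_vec D p K (product_vec f) = product_vec (f(p := \<lambda>w. \<Sum>u\<in>party_basis (D p). K w u * f p u))"
proof
  fix x
  have "(\<Prod>q\<in>UNIV - {p}. f q ((x(p := u)) q)) = (\<Prod>q\<in>UNIV - {p}. f q (x q))" for u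
    by (intro prod.cong) auto
  moreover have "(\<Prod>q\<in>UNIV - {p}. (f(p := g)) q (x q)) = (\<Prod>q\<in>UNIV - {p}. f q (x q))" for g
    by (intro prod.cong) auto
  ultimately show "local_vec D p K (product_vec f) x
      = product_vec (f(p := \<lambda>w. \<Sum>u\<in>party_basis (D p). K w u * f p u)) x"
    unfolding local_vec_def product_vec_split[of _ _ p] by (simp add: sum_distrib_right mult.assoc)
qed

text \<open>Local operators map product vectors to product vectors, so each branch inherits the
  images of all of them together with the image of the positive remainder. By
  \<open>instrument_norm\<close> the branch weights sum to the old weight; single branches may carry
  very different shares, hence the existentially quantified \<open>L\<close>.\<close>

lemma sep_bound_round:
  assumes inst: "instrument (D p) r s es A" and b: "sep_bound D K \<omega>"
  shows "\<exists>L. (\<forall>k<r. sep_bound (D(p := es k)) (L k) (\<lambda>x y. \<Sum>l<s k. local_conj D p (A k l) \<omega> x y)) \<and> (\<Sum>k<r. L k) \<le> K"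
proof -
  obtain fs where f: "\<forall>f\<in>set fs. supported D f" "joint_psd D (\<lambda>x y. sep_op fs x y - transpose_Charlie \<omega> x y)"
    "(\<Sum>f\<leftarrow>fs. product_weight D f) \<le> K"
    using b unfolding sep_bound_def by (elim exE conjE) (rule that)
  \<comment> \<open>The Kraus operators seen by the partial transpose.\<close>
  define B where "B = (\<lambda>k l. if p = Charlie then \<lambda>u v. cnj (A k l u v) else A k l)"
  have instB: "instrument (D p) r s es B"
  proof (cases "p = Charlie")
    case True then show ?thesis using instrument_cnj[OF inst] by (simp add: B_def)
  next
    case False then show ?thesis using inst by (simp add: B_def)
  qed
  define h where "h = (\<lambda>k l (f :: party \<Rightarrow> nat list \<Rightarrow> complex). f(p := \<lambda>w. \<Sum>u\<in>party_basis (D p). B k l w u * f p u))"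
  define gs where "gs = (\<lambda>k. concat (map (\<lambda>l. map (h k l) fs) [0..<s k]))"
  define L where "L = (\<lambda>k. \<Sum>f\<leftarrow>gs k. product_weight (D(p := es k)) f)"
  have ls: "(\<Sum>f\<leftarrow>gs k. F f) = (\<Sum>l<s k. \<Sum>f\<leftarrow>fs. F (h k l f))" for F :: "_ \<Rightarrow> 'z::comm_monoid_add" and k
  proof -
    have "(\<Sum>f\<leftarrow>concat (map (\<lambda>l. map (h k l) fs) ls). F f) = (\<Sum>l\<leftarrow>ls. \<Sum>f\<leftarrow>fs. F (h k l f))" for ls
      by (induction ls) (auto simp: comp_def)
    then have "(\<Sum>f\<leftarrow>gs k. F f) = (\<Sum>l\<leftarrow>[0..<s k]. \<Sum>f\<leftarrow>fs. F (h k l f))"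
      by (simp only: gs_def)
    then show ?thesis by (simp add: interv_sum_list_conv_sum_set_nat lessThan_atLeast0)
  qed
  have "sep_bound (D(p := es k)) (L k) (\<lambda>x y. \<Sum>l<s k. local_conj D p (A k l) \<omega> x y)" if k: "k < r" for k
    unfolding sep_bound_def
  proof (intro exI conjI)
    show "\<forall>f\<in>set (gs k). supported (D(p := es k)) f"
    proof
      fix g assume "g \<in> set (gs k)"
      then obtain l f' where l: "l < s k" "f' \<in> set fs" "g = h k l f'" by (auto simp: gs_def)
      have "supported D f'" using f(1) l by blast
      then show "supported (D(p := es k)) g"
        using operatorsD[OF instrumentD(1)[OF instB k l(1)]] by (auto simp: supported_def l(3) h_def)
    qed
    have eq: "sep_op (gs k) x y - transpose_Charlie (\<lambda>x y. \<Sum>l<s k. local_conj D p (A k l) \<omega> x y) x y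
      = (\<Sum>l<s k. local_conj D p (B k l) (\<lambda>x y. sep_op fs x y - transpose_Charlie \<omega> x y) x y)" for x y
    proof -
      have 1: "local_conj D p (B k l) (sep_op fs) x y = (\<Sum>f\<leftarrow>fs. product_vec (h k l f) x * cnj (product_vec (h k l f) y))" for l
        unfolding sep_op_nth sum_list_map_nth linear_map_sum[OF local_conj_linear]
        by (simp add: local_conj_outer local_vec_product h_def)
      have "transpose_Charlie (\<lambda>x y. \<Sum>l<s k. local_conj D p (A k l) \<omega> x y) x y
        = (\<Sum>l<s k. transpose_Charlie (local_conj D p (A k l) \<omega>) x y)"
        by (simp add: transpose_Charlie_def)
      also have "\<dots> = (\<Sum>l<s k. local_conj D p (B k l) (transpose_Charlie \<omega>) x y)"
        by (simp add: transpose_local_conj B_def)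
      finally show ?thesis
        unfolding linear_map_diff[OF local_conj_linear] sum_subtractf 1 sep_op_def[of "gs k"] ls by simp
    qed
    show "joint_psd (D(p := es k)) (\<lambda>x y. sep_op (gs k) x y - transpose_Charlie (\<lambda>x y. \<Sum>l<s k. local_conj D p (A k l) \<omega> x y) x y)"
      unfolding eq by (intro positive_op_sum local_conj_psd[OF _ f(2)] instrumentD(1)[OF instB k]) simp
    show "(\<Sum>f\<leftarrow>gs k. product_weight (D(p := es k)) f) \<le> L k" by (simp add: L_def)
  qed
  moreover have "(\<Sum>k<r. L k) \<le> K"
  proof -
    have w: "(\<Sum>k<r. \<Sum>l<s k. product_weight (D(p := es k)) (h k l f)) = product_weight D f" for f
    proof -
      have "(\<Prod>q\<in>UNIV - {p}. \<Sum>u\<in>party_basis ((D(p := es k)) q). (cmod (h k l f q u))\<^sup>2)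
         = (\<Prod>q\<in>UNIV - {p}. \<Sum>u\<in>party_basis (D q). (cmod (f q u))\<^sup>2)" for k l
        by (intro prod.cong) (auto simp: h_def)
      then have "(\<Sum>k<r. \<Sum>l<s k. product_weight (D(p := es k)) (h k l f))
        = (\<Sum>k<r. \<Sum>l<s k. (\<Sum>w\<in>party_basis (es k). (cmod (\<Sum>u\<in>party_basis (D p). B k l w u * f p u))\<^sup>2))
         * (\<Prod>q\<in>UNIV - {p}. \<Sum>u\<in>party_basis (D q). (cmod (f q u))\<^sup>2)"
        unfolding product_weight_split[of _ _ p] by (simp add: h_def sum_distrib_right)
      then show ?thesis unfolding instrument_norm[OF instB] product_weight_split[of D f p] .
    qed
    have "(\<Sum>k<r. L k) = (\<Sum>f\<leftarrow>fs. \<Sum>k<r. \<Sum>l<s k. product_weight (D(p := es k)) (h k l f))"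
    proof -
      have "(\<Sum>k<r. L k) = (\<Sum>k<r. \<Sum>l<s k. \<Sum>i<length fs. product_weight (D(p := es k)) (h k l (fs ! i)))"
        by (simp only: L_def ls) (simp only: sum_list_map_nth)
      also have "\<dots> = (\<Sum>k<r. \<Sum>i<length fs. \<Sum>l<s k. product_weight (D(p := es k)) (h k l (fs ! i)))"
        by (intro sum.cong refl sum.swap)
      also have "\<dots> = (\<Sum>i<length fs. \<Sum>k<r. \<Sum>l<s k. product_weight (D(p := es k)) (h k l (fs ! i)))"
        by (rule sum.swap)
      finally show ?thesis by (simp only: sum_list_map_nth)
    qed
    then show ?thesis unfolding w using f(3) by simp
  qed
  ultimately show ?thesis by blast
qed

lemma locc_sep_bound: "locc P D E \<Lambda> \<Longrightarrow> sep_bound D K \<omega> \<Longrightarrow> sep_bound E K (\<Lambda> \<omega>)"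
proof (induction arbitrary: K \<omega> rule: locc.induct)
  case (round p D r s es A E \<Lambda>)
  obtain L where L: "\<forall>k<r. sep_bound (D(p := es k)) (L k) (\<lambda>x y. \<Sum>l<s k. local_conj D p (A k l) \<omega> x y)"
    "(\<Sum>k<r. L k) \<le> K"
    using sep_bound_round[where D = D and p = p, OF round.hyps(2) round.prems] by (elim exE conjE) (rule that)
  have "sep_bound E (L k) (\<Lambda> k (\<lambda>x y. \<Sum>l<s k. local_conj D p (A k l) \<omega> x y))" if "k < r" for k
    using round.IH that L(1) by blast
  from sep_bound_mono[OF sep_bound_sum[OF this] L(2)] show ?case by simp
qed

text \<open>The partial trace is a single-outcome round with the Kraus operators <l|. It can thus be
  appended to a protocol, and what holds for protocols holds for the state left to Alice and
  Bob.\<close>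

lemma locc_trace_out_Charlie:
  assumes "Charlie \<in> P"
  shows "locc P E (E(Charlie := [])) (trace_out_Charlie E)"
proof -
  have "locc P E (E(Charlie := [])) (\<lambda>\<rho> x y. \<Sum>k\<in>{()}. (\<lambda>\<rho>. \<rho>)
      (\<lambda>x y. of_real 1 * (\<Sum>l\<in>party_basis (E Charlie). pull Charlie {[]} (\<lambda>w. l) \<rho> x y)) x y)"
  proof (rule locc_pull[OF assms, where es = "\<lambda>k. []"])
    show "locc P (E(Charlie := [])) (E(Charlie := [])) (\<lambda>\<rho>. \<rho>)" by (rule locc.stop)
  qed auto
  also have "(\<lambda>\<rho> x y. \<Sum>k\<in>{()}. (\<lambda>\<rho>. \<rho>)
      (\<lambda>x y. of_real 1 * (\<Sum>l\<in>party_basis (E Charlie). pull Charlie {[]} (\<lambda>w. l) \<rho> x y)) x y) = trace_out_Charlie E"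
    by (auto simp: fun_eq_iff trace_out_Charlie_def pull_def)
  finally show ?thesis .
qed


subsection \<open>Private states and separable operators\<close>

definition ks_index :: "nat \<Rightarrow> nat \<Rightarrow> nat \<times> nat \<Rightarrow> index" where
  "ks_index i j s = (\<lambda>p. case p of Alice \<Rightarrow> [i, fst s] | Bob \<Rightarrow> [j, snd s] | Charlie \<Rightarrow> [])"

lemma ks_index_simps [simp]:
  "ks_index i j s Alice = [i, fst s]" "ks_index i j s Bob = [j, snd s]" "ks_index i j s Charlie = []"
  "shield_index (ks_index i j s) = s"
  by (simp_all add: ks_index_def shield_index_def)

lemma key_shield_simps [simp]:
  "key_shield k a b Alice = [k, a]" "key_shield k a b Bob = [k, b]" "key_shield k a b Charlie = []"
  by (simp_all add: key_shield_def)

lemma party_basis_pair_iff: "xs \<in> party_basis [k, a] \<longleftrightarrow> (\<exists>i s. xs = [i, s] \<and> i < k \<and> s < a)"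
  by (auto simp: party_basis_def set_Cons_def)

lemma joint_basis_key_shield_iff:
  "x \<in> joint_basis (key_shield k a b) \<longleftrightarrow> (\<exists>i<k. \<exists>j<k. \<exists>s\<in>{..<a} \<times> {..<b}. x = ks_index i j s)"
proof
  assume "x \<in> joint_basis (key_shield k a b)"
  then have "x Alice \<in> party_basis [k, a]" "x Bob \<in> party_basis [k, b]" "x Charlie = []"
    by (auto simp: joint_basis_def dest: spec[of _ Alice] spec[of _ Bob] spec[of _ Charlie])
  then obtain i s j s' where "x Alice = [i, s]" "i < k" "s < a" "x Bob = [j, s']" "j < k" "s' < b" "x Charlie = []"
    by (auto simp: party_basis_pair_iff)
  then show "\<exists>i<k. \<exists>j<k. \<exists>s\<in>{..<a} \<times> {..<b}. x = ks_index i j s"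
    by (intro exI[of _ i] conjI exI[of _ j] bexI[of _ "(s, s')"]) (auto simp: index_eq_iff)
qed (auto simp: joint_basis_def party_all party_basis_pair_iff)

lemma ks_index_inject [simp]: "ks_index i j s = ks_index i' j' s' \<longleftrightarrow> i = i' \<and> j = j' \<and> s = s'"
  by (auto simp: index_eq_iff prod_eq_iff)

lemma sum_joint_basis_key_shield:
  "(\<Sum>x\<in>joint_basis (key_shield k a b). f x) = (\<Sum>i<k. \<Sum>j<k. \<Sum>s\<in>{..<a} \<times> {..<b}. f (ks_index i j s))"
proof -
  have "(\<Sum>i<k. \<Sum>j<k. \<Sum>s\<in>{..<a} \<times> {..<b}. f (ks_index i j s))
    = (\<Sum>(i, j, s)\<in>{..<k} \<times> {..<k} \<times> ({..<a} \<times> {..<b}). f (ks_index i j s))"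
    by (simp add: sum.cartesian_product case_prod_unfold)
  also have "\<dots> = (\<Sum>x\<in>(\<lambda>(i, j, s). ks_index i j s) ` ({..<k} \<times> {..<k} \<times> ({..<a} \<times> {..<b})). f x)"
    by (subst sum.reindex) (auto simp: inj_on_def case_prod_unfold)
  also have "(\<lambda>(i, j, s). ks_index i j s) ` ({..<k} \<times> {..<k} \<times> ({..<a} \<times> {..<b})) = joint_basis (key_shield k a b)"
    by (auto simp: joint_basis_key_shield_iff image_iff)
  finally show ?thesis ..
qed

text \<open>The values \<open>\<langle>t\<^sub>r| A |t\<^sub>r\<rangle>\<close> summed over the orthonormal vectors \<open>t\<^sub>r = N\<^sup>-\<^sup>1\<^sup>/\<^sup>2 \<Sum>\<^sub>i |ii\<rangle> \<otimes> U\<^sub>i|r\<rangle>\<close>.\<close>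

definition private_test :: "nat \<Rightarrow> (nat \<times> nat) set \<Rightarrow> (nat \<Rightarrow> (nat \<times> nat, nat \<times> nat) operator) \<Rightarrow> joint_op \<Rightarrow> complex" where
  "private_test N S U A = (\<Sum>r\<in>S. \<Sum>i<N. \<Sum>s\<in>S. \<Sum>j<N. \<Sum>s'\<in>S.
     cnj (U i s r) * A (ks_index i i s) (ks_index j j s') * U j s' r) / N"

lemma private_test_add: "private_test N S U (\<lambda>x y. A x y + B x y) = private_test N S U A + private_test N S U B"
  by (simp add: private_test_def algebra_simps sum.distrib add_divide_distrib)

lemma private_test_diff: "private_test N S U (\<lambda>x y. A x y - B x y) = private_test N S U A - private_test N S U B"
  by (simp add: private_test_def algebra_simps sum_subtractf diff_divide_distrib)

lemma private_test_sum: "private_test N S U (\<lambda>x y. \<Sum>k\<in>I. A k x y) = (\<Sum>k\<in>I. private_test N S U (A k))"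
proof (induction I rule: infinite_finite_induct)
  case (insert k I)
  then show ?case by (simp add: private_test_add)
qed (simp_all add: private_test_def)

lemma private_test_outer:
  "private_test N S U (\<lambda>x y. v x * cnj (v y))
    = of_real ((\<Sum>r\<in>S. (cmod (\<Sum>i<N. \<Sum>s\<in>S. cnj (U i s r) * v (ks_index i i s)))\<^sup>2) / N)"
proof -
  have "(\<Sum>i<N. \<Sum>s\<in>S. \<Sum>j<N. \<Sum>s'\<in>S. cnj (U i s r) * (v (ks_index i i s) * cnj (v (ks_index j j s'))) * U j s' r)
     = of_real ((cmod (\<Sum>i<N. \<Sum>s\<in>S. cnj (U i s r) * v (ks_index i i s)))\<^sup>2)" for r
  proof -
    let ?z = "\<Sum>i<N. \<Sum>s\<in>S. cnj (U i s r) * v (ks_index i i s)"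
    have "of_real ((cmod ?z)\<^sup>2) = ?z * (\<Sum>j<N. \<Sum>s'\<in>S. U j s' r * cnj (v (ks_index j j s')))"
      unfolding complex_norm_square by (simp add: mult_ac)
    also have "\<dots> = (\<Sum>i<N. \<Sum>s\<in>S. \<Sum>j<N. \<Sum>s'\<in>S.
        (cnj (U i s r) * v (ks_index i i s)) * (U j s' r * cnj (v (ks_index j j s'))))"
      by (simp only: sum_distrib_right) (simp only: sum_distrib_left)
    finally show ?thesis by (simp add: mult_ac)
  qed
  then show ?thesis by (simp add: private_test_def)
qed

lemma L2_set_sum_le: "L2_set (\<lambda>r. \<Sum>i\<in>I. g i r) S \<le> (\<Sum>i\<in>I. L2_set (g i) S)"
proof (induction I rule: infinite_finite_induct)
  case (insert k I)
  have "L2_set (\<lambda>r. \<Sum>i\<in>insert k I. g i r) S \<le> L2_set (g k) S + L2_set (\<lambda>r. \<Sum>i\<in>I. g i r) S"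
    using insert L2_set_triangle_ineq[of "g k" "\<lambda>r. \<Sum>i\<in>I. g i r" S] by simp
  then show ?case using insert by simp
qed (simp_all add: L2_set_0')

lemma unitary_norm:
  assumes fin: "finite S" and U: "unitary_op S U"
  shows "(\<Sum>r\<in>S. (cmod (\<Sum>s\<in>S. cnj (U s r) * v s))\<^sup>2) = (\<Sum>s\<in>S. (cmod (v s))\<^sup>2)"
proof -
  have "complex_of_real (\<Sum>r\<in>S. (cmod (\<Sum>s\<in>S. cnj (U s r) * v s))\<^sup>2)
    = (\<Sum>r\<in>S. \<Sum>s\<in>S. \<Sum>s'\<in>S. cnj (U s r) * (v s * cnj (v s')) * U s' r)"
    unfolding of_real_sum complex_norm_square cnj_sum sum_product by (intro sum.cong refl) (simp add: mult_ac)
  also have "\<dots> = op_trace S (\<lambda>s s'. v s * cnj (v s'))"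
    by (rule op_trace_unitary_quadratic[OF fin U])
  also have "\<dots> = complex_of_real (\<Sum>s\<in>S. (cmod (v s))\<^sup>2)"
    unfolding of_real_sum complex_norm_square op_trace_def ..
  finally show ?thesis by (simp only: of_real_eq_iff)
qed

text \<open>For each r the test sums amplitudes over the keys i. The triangle inequality in the
  shield space separates the keys, and each U_i preserves the norm and drops out.\<close>

lemma private_test_outer_le:
  assumes fin: "finite S" and U: "\<And>i. i < N \<Longrightarrow> unitary_op S (U i)"
  shows "Re (private_test N S U (\<lambda>x y. v x * cnj (v y)))
    \<le> (\<Sum>i<N. L2_set (\<lambda>s. cmod (v (ks_index i i s))) S)\<^sup>2 / N"
proof -
  let ?w = "\<lambda>i r. \<Sum>s\<in>S. cnj (U i s r) * v (ks_index i i s)"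
  have "L2_set (\<lambda>r. cmod (\<Sum>i<N. ?w i r)) S \<le> L2_set (\<lambda>r. \<Sum>i<N. cmod (?w i r)) S"
    by (intro L2_set_mono norm_sum) auto
  also have "\<dots> \<le> (\<Sum>i<N. L2_set (\<lambda>r. cmod (?w i r)) S)" by (rule L2_set_sum_le)
  also have "\<dots> = (\<Sum>i<N. L2_set (\<lambda>s. cmod (v (ks_index i i s))) S)"
  proof (rule sum.cong[OF refl])
    fix i assume "i \<in> {..<N}"
    then have "unitary_op S (U i)" using U by simp
    from unitary_norm[OF fin this]
    show "L2_set (\<lambda>r. cmod (?w i r)) S = L2_set (\<lambda>s. cmod (v (ks_index i i s))) S"
      by (simp only: L2_set_def)
  qed
  finally have "(L2_set (\<lambda>r. cmod (\<Sum>i<N. ?w i r)) S)\<^sup>2 \<le> (\<Sum>i<N. L2_set (\<lambda>s. cmod (v (ks_index i i s))) S)\<^sup>2"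
    by (intro power_mono) auto
  then have "(\<Sum>r\<in>S. (cmod (\<Sum>i<N. ?w i r))\<^sup>2) \<le> (\<Sum>i<N. L2_set (\<lambda>s. cmod (v (ks_index i i s))) S)\<^sup>2"
    by (simp add: L2_set_def sum_nonneg)
  then show ?thesis unfolding private_test_outer by (simp add: divide_right_mono)
qed

lemma private_test_outer_nonneg: "Re (private_test N S U (\<lambda>x y. v x * cnj (v y))) \<ge> 0"
  unfolding private_test_outer by (simp add: sum_nonneg)

text \<open>Cauchy-Schwarz over the N keys cancels the factor 1 / N; in effect the test is bounded
  by the identity.\<close>

lemma private_test_outer_le_norm:
  assumes N: "N > 0" and S: "S = {..<a} \<times> {..<b}" and U: "\<And>i. i < N \<Longrightarrow> unitary_op S (U i)"
  shows "Re (private_test N S U (\<lambda>x y. v x * cnj (v y))) \<le> (\<Sum>x\<in>joint_basis (key_shield N a b). (cmod (v x))\<^sup>2)"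
proof -
  let ?n = "\<lambda>i. L2_set (\<lambda>s. cmod (v (ks_index i i s))) S"
  have "(\<Sum>i<N. ?n i) = (\<Sum>i<N. \<bar>1\<bar> * \<bar>?n i\<bar>)" by simp
  also have "\<dots> \<le> L2_set (\<lambda>i. 1) {..<N} * L2_set ?n {..<N}" by (rule L2_set_mult_ineq)
  finally have "(\<Sum>i<N. ?n i)\<^sup>2 \<le> (L2_set (\<lambda>i. 1) {..<N} * L2_set ?n {..<N})\<^sup>2"
    by (intro power_mono sum_nonneg) auto
  also have "\<dots> = N * (\<Sum>i<N. \<Sum>s\<in>S. (cmod (v (ks_index i i s)))\<^sup>2)"
    by (simp add: L2_set_def power_mult_distrib sum_nonneg)
  also have "(\<Sum>i<N. \<Sum>s\<in>S. (cmod (v (ks_index i i s)))\<^sup>2)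
      \<le> (\<Sum>i<N. \<Sum>j<N. \<Sum>s\<in>S. (cmod (v (ks_index i j s)))\<^sup>2)"
    by (intro sum_mono member_le_sum) (auto intro: sum_nonneg)
  finally have "(\<Sum>i<N. ?n i)\<^sup>2 \<le> N * (\<Sum>x\<in>joint_basis (key_shield N a b). (cmod (v x))\<^sup>2)"
    by (simp add: sum_joint_basis_key_shield S mult_left_mono)
  then have "(\<Sum>i<N. ?n i)\<^sup>2 / N \<le> (\<Sum>x\<in>joint_basis (key_shield N a b). (cmod (v x))\<^sup>2)"
    using N by (simp add: field_simps)
  then show ?thesis using private_test_outer_le[of S N U v] U S by fastforce
qed

lemma private_test_psd:
  assumes N: "N > 0" and S: "S = {..<a} \<times> {..<b}" and U: "\<And>i. i < N \<Longrightarrow> unitary_op S (U i)"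
    and A: "joint_psd (key_shield N a b) A"
  shows "Re (private_test N S U A) \<ge> 0" "Re (private_test N S U A) \<le> Re (joint_trace (key_shield N a b) A)"
proof -
  let ?J = "joint_basis (key_shield N a b)"
  obtain v where v: "A = (\<lambda>i j. \<Sum>k\<in>?J. v k i * cnj (v k j))"
    using positive_op_decomp[OF finite_joint_basis A] by (elim exE conjE) (rule that)
  have e: "Re (private_test N S U A) = (\<Sum>k\<in>?J. Re (private_test N S U (\<lambda>x y. v k x * cnj (v k y))))"
    unfolding v private_test_sum by simp
  show "Re (private_test N S U A) \<ge> 0"
    unfolding e by (intro sum_nonneg private_test_outer_nonneg)
  have "Re (private_test N S U A) \<le> (\<Sum>k\<in>?J. \<Sum>x\<in>?J. (cmod (v k x))\<^sup>2)"
    unfolding e by (intro sum_mono private_test_outer_le_norm[OF N S U])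
  also have "\<dots> = Re (joint_trace (key_shield N a b) A)"
  proof -
    have "Re (z * cnj z) = (cmod z)\<^sup>2" for z by (simp add: complex_mult_cnj cmod_power2)
    then show ?thesis unfolding v op_trace_def Re_sum by (subst sum.swap) simp
  qed
  finally show "Re (private_test N S U A) \<le> Re (joint_trace (key_shield N a b) A)" .
qed

text \<open>On a product vector the norm at key i factors into an Alice part and a Bob part.
  Cauchy-Schwarz applied to these two families already gives the full squared norm, so the factor 1
  / N survives, in contrast to \<open>private_test_outer_le_norm\<close>.\<close>

lemma private_test_product_le:
  assumes N: "N > 0" and S: "S = {..<a} \<times> {..<b}" and U: "\<And>i. i < N \<Longrightarrow> unitary_op S (U i)"
  shows "Re (private_test N S U (\<lambda>x y. product_vec f x * cnj (product_vec f y))) \<le> product_weight (key_shield N a b) f / N"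
proof -
  define al where "al = (\<lambda>i. L2_set (\<lambda>s. cmod (f Alice [i, s])) {..<a})"
  define be where "be = (\<lambda>i. L2_set (\<lambda>s. cmod (f Bob [i, s])) {..<b})"
  define c where "c = cmod (f Charlie [])"
  have pv: "cmod (product_vec f x) = cmod (f Alice (x Alice)) * cmod (f Bob (x Bob)) * cmod (f Charlie (x Charlie))" for x
    by (simp add: product_vec_def UNIV_party norm_mult)
  have n: "L2_set (\<lambda>s. cmod (product_vec f (ks_index i i s))) S = c * (al i * be i)" for i
  proof -
    have "(\<Sum>s\<in>S. (cmod (product_vec f (ks_index i i s)))\<^sup>2)
      = c\<^sup>2 * ((\<Sum>s<a. (cmod (f Alice [i, s]))\<^sup>2) * (\<Sum>s<b. (cmod (f Bob [i, s]))\<^sup>2))"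
    proof -
      have "(\<Sum>s<a. (cmod (f Alice [i, s]))\<^sup>2) * (\<Sum>s<b. (cmod (f Bob [i, s]))\<^sup>2)
        = (\<Sum>s\<in>S. (cmod (f Alice [i, fst s]))\<^sup>2 * (cmod (f Bob [i, snd s]))\<^sup>2)"
        by (simp add: S sum_product sum.cartesian_product case_prod_unfold)
      then show ?thesis
        by (simp add: pv sum_distrib_left c_def power_mult_distrib mult_ac)
    qed
    then show ?thesis by (simp add: L2_set_def al_def be_def real_sqrt_mult c_def)
  qed
  have "(\<Sum>i<N. \<bar>al i\<bar> * \<bar>be i\<bar>) \<le> L2_set al {..<N} * L2_set be {..<N}" by (rule L2_set_mult_ineq)
  then have "c * (\<Sum>i<N. al i * be i) \<le> c * (L2_set al {..<N} * L2_set be {..<N})"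
    by (intro mult_left_mono) (auto simp: al_def be_def c_def)
  then have "(\<Sum>i<N. c * (al i * be i))\<^sup>2 \<le> (c * (L2_set al {..<N} * L2_set be {..<N}))\<^sup>2"
    unfolding sum_distrib_left[symmetric]
    by (intro power_mono mult_nonneg_nonneg sum_nonneg) (auto simp: al_def be_def c_def)
  also have "\<dots> = product_weight (key_shield N a b) f"
  proof -
    have P: "(\<Sum>u\<in>party_basis [N, d]. F u) = (\<Sum>i<N. \<Sum>s<d. F [i, s])" for d and F :: "nat list \<Rightarrow> real"
    proof -
      have "(\<Sum>i<N. \<Sum>s<d. F [i, s]) = (\<Sum>(i,s)\<in>{..<N} \<times> {..<d}. F [i, s])"
        by (simp add: sum.cartesian_product)
      also have "\<dots> = (\<Sum>u\<in>party_basis [N, d]. F u)"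
        by (rule sum.reindex_bij_witness[where j = "\<lambda>(i,s). [i,s]" and i = "\<lambda>u. (u!0, u!1)"])
          (auto simp: party_basis_pair_iff)
      finally show ?thesis ..
    qed
    show ?thesis
      by (simp add: product_weight_def UNIV_party P L2_set_def power_mult_distrib sum_nonneg al_def be_def c_def)
  qed
  finally have "(\<Sum>i<N. L2_set (\<lambda>s. cmod (product_vec f (ks_index i i s))) S)\<^sup>2 \<le> product_weight (key_shield N a b) f"
    unfolding n .
  then have "(\<Sum>i<N. L2_set (\<lambda>s. cmod (product_vec f (ks_index i i s))) S)\<^sup>2 / N \<le> product_weight (key_shield N a b) f / N"
    by (intro divide_right_mono) auto
  moreover have "finite S" using S by simp
  ultimately show ?thesis using private_test_outer_le[of S N U "product_vec f"] U by fastforce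
qed

text \<open>Undoing U_i on the left and U_j on the right turns each of the N^2 key blocks into
  \<sigma> / N, of trace 1 / N; the normalisation of the test supplies the other 1 / N.\<close>

lemma private_test_private:
  assumes N: "N = 2 ^ m" and S: "S = {..<a} \<times> {..<b}" and U: "\<And>i. i < N \<Longrightarrow> unitary_op S (U i)"
    and \<sigma>: "density_op S \<sigma>"
    and \<gamma>: "\<gamma> = (\<lambda>x y. if x \<in> joint_basis (key_shield (2 ^ m) a b) \<and> y \<in> joint_basis (key_shield (2 ^ m) a b)
          then 1 / 2 ^ m * (\<Sum>i<2 ^ m. \<Sum>j<2 ^ m.
            of_bool (x Alice ! 0 = i \<and> x Bob ! 0 = i \<and> y Alice ! 0 = j \<and> y Bob ! 0 = j)
            * op_mult S (op_mult S (U i) \<sigma>) (op_adj (U j)) (shield_index x) (shield_index y)) else 0)"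
  shows "private_test N S U \<gamma> = 1"
proof -
  have fin: "finite S" using S by simp
  have \<sigma>1: "\<sigma> \<in> operators S S" "op_trace S \<sigma> = 1" using \<sigma> by (auto simp: density_op_def positive_op_def)
  have g: "\<gamma> (ks_index i i s) (ks_index j j s') = op_mult S (op_mult S (U i) \<sigma>) (op_adj (U j)) s s' / N"
    if "i < N" "j < N" "s \<in> S" "s' \<in> S" for i j s s'
  proof -
    have "ks_index i i s \<in> joint_basis (key_shield (2 ^ m) a b)" "ks_index j j s' \<in> joint_basis (key_shield (2 ^ m) a b)"
      using that by (auto simp: joint_basis_key_shield_iff N S)
    then have "\<gamma> (ks_index i i s) (ks_index j j s') = 1 / 2 ^ m * (\<Sum>i'<2 ^ m. \<Sum>j'<2 ^ m.
            of_bool (i = i' \<and> j = j') * op_mult S (op_mult S (U i') \<sigma>) (op_adj (U j')) s s')"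
      unfolding \<gamma> by simp
    also have "(\<Sum>i'<2 ^ m. \<Sum>j'<2 ^ m. of_bool (i = i' \<and> j = j') * op_mult S (op_mult S (U i') \<sigma>) (op_adj (U j')) s s')
      = (\<Sum>i'<N. if i' = i then (\<Sum>j'<N. if j' = j then op_mult S (op_mult S (U i) \<sigma>) (op_adj (U j)) s s' else 0) else 0)"
      unfolding N by (intro sum.cong refl) (auto intro!: sum.cong)
    also have "\<dots> = op_mult S (op_mult S (U i) \<sigma>) (op_adj (U j)) s s'" using that by simp
    finally show ?thesis by (simp add: N)
  qed
  have q: "(\<Sum>r\<in>S. \<Sum>s\<in>S. \<Sum>s'\<in>S. cnj (U i s r) * op_mult S (op_mult S (U i) \<sigma>) (op_adj (U j)) s s' * U j s' r) = 1"
    if ij: "i < N" "j < N" for i j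
  proof -
    have "(\<Sum>s\<in>S. \<Sum>s'\<in>S. cnj (U i s r) * X s s' * U j s' r) = op_mult S (op_mult S (op_adj (U i)) X) (U j) r r" for X r
      by (simp add: op_mult_def op_adj_def sum_distrib_right) (rule sum.swap)
    moreover have "op_mult S (op_mult S (op_adj (U i)) (op_mult S (op_mult S (U i) \<sigma>) (op_adj (U j)))) (U j)
      = op_mult S (op_mult S (op_mult S (op_adj (U i)) (U i)) \<sigma>) (op_mult S (op_adj (U j)) (U j))"
      by (simp add: op_mult_assoc)
    moreover have "\<dots> = \<sigma>"
      using fin \<sigma>1 by (simp add: unitary_opD[OF U[OF ij(1)]] unitary_opD[OF U[OF ij(2)]] op_mult_id_left[of S _ S] op_mult_id_right[of S _ S])
    ultimately show ?thesis using \<sigma>1 by (simp add: op_trace_def)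
  qed
  have "private_test N S U \<gamma> = (\<Sum>r\<in>S. \<Sum>i<N. \<Sum>s\<in>S. \<Sum>j<N. \<Sum>s'\<in>S.
      cnj (U i s r) * op_mult S (op_mult S (U i) \<sigma>) (op_adj (U j)) s s' * U j s' r / N) / N"
    unfolding private_test_def by (intro arg_cong2[where f = "(/)"] sum.cong refl) (simp add: g)
  also have "\<dots> = (\<Sum>i<N. \<Sum>r\<in>S. \<Sum>j<N. \<Sum>s\<in>S. \<Sum>s'\<in>S.
      cnj (U i s r) * op_mult S (op_mult S (U i) \<sigma>) (op_adj (U j)) s s' * U j s' r / N) / N"
    by (subst sum.swap, intro arg_cong2[where f = "(/)"] sum.cong refl sum.swap)
  also have "\<dots> = (\<Sum>i<N. \<Sum>j<N. \<Sum>r\<in>S. \<Sum>s\<in>S. \<Sum>s'\<in>S.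
      cnj (U i s r) * op_mult S (op_mult S (U i) \<sigma>) (op_adj (U j)) s s' * U j s' r / N) / N"
    by (intro arg_cong2[where f = "(/)"] sum.cong refl sum.swap)
  also have "\<dots> = (\<Sum>i<N. \<Sum>j<N. 1 / N) / N"
    unfolding sum_divide_distrib[symmetric] using q by simp
  also have "\<dots> = 1" by (simp add: N)
  finally show ?thesis .
qed

text \<open>The test is at least 1 - \<epsilon> on \<alpha>, it is monotone, and it cannot see the
  transposition because Charlie's system is trivial here. On the dominating separable operator it is
  at most K / 2^m.\<close>

theorem sep_bound_private:
  assumes E: "sep_bound (key_shield (2 ^ m) a b) K \<alpha>" and \<alpha>: "\<alpha> \<in> joint_ops (key_shield (2 ^ m) a b)"
    and \<gamma>: "\<gamma> \<in> private_states m a b"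
    and c: "close_ops (key_shield (2 ^ m) a b) \<epsilon> \<alpha> \<gamma>"
  shows "1 - \<epsilon> \<le> K / 2 ^ m"
proof -
  let ?E = "key_shield (2 ^ m) a b"
  define S where "S = {..<a} \<times> {..<b}"
  obtain \<sigma> U where U: "density_op S \<sigma>" "\<forall>i<2 ^ m. unitary_op S (U i)"
    and \<gamma>eq: "\<gamma> = (\<lambda>x y. if x \<in> joint_basis ?E \<and> y \<in> joint_basis ?E
          then 1 / 2 ^ m * (\<Sum>i<2 ^ m. \<Sum>j<2 ^ m.
            of_bool (x Alice ! 0 = i \<and> x Bob ! 0 = i \<and> y Alice ! 0 = j \<and> y Bob ! 0 = j)
            * op_mult S (op_mult S (U i) \<sigma>) (op_adj (U j)) (shield_index x) (shield_index y)) else 0)"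
    using \<gamma> unfolding private_states_def S_def[symmetric] mem_Collect_eq by (elim exE conjE) (rule that)
  define N :: nat where "N = 2 ^ m"
  have N: "N > 0" "N = 2 ^ m" by (simp_all add: N_def)
  have UU: "unitary_op S (U i)" if "i < N" for i using U that by (simp add: N_def)
  let ?Q = "\<lambda>A. Re (private_test N S U A)"
  have Q\<gamma>: "?Q \<gamma> = 1" using private_test_private[OF N(2) S_def UU U(1) \<gamma>eq] by simp
  obtain P R where PR: "joint_psd ?E P" "joint_psd ?E R" "\<forall>x y. \<alpha> x y - \<gamma> x y = P x y - R x y"
     "Re (joint_trace ?E P) + Re (joint_trace ?E R) \<le> \<epsilon>"
    using c unfolding close_ops_def by (elim exE conjE) (rule that)
  have "?Q \<alpha> - ?Q \<gamma> = ?Q P - ?Q R"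
    using PR(3) by (simp flip: private_test_diff minus_complex.sel(1))
  moreover have "?Q P \<ge> 0" "?Q R \<le> Re (joint_trace ?E R)"
    using private_test_psd[OF N(1) S_def UU, where A = P] private_test_psd[OF N(1) S_def UU, where A = R] PR by (simp_all add: N_def)
  moreover have "Re (joint_trace ?E P) \<ge> 0" using positive_op_trace(2)[OF finite_joint_basis PR(1)] .
  ultimately have lower: "1 - \<epsilon> \<le> ?Q \<alpha>" using Q\<gamma> PR(4) by linarith
  obtain fs where f: "\<forall>f\<in>set fs. supported ?E f" "joint_psd ?E (\<lambda>x y. sep_op fs x y - transpose_Charlie \<alpha> x y)"
    "(\<Sum>f\<leftarrow>fs. product_weight ?E f) \<le> K"
    using E unfolding sep_bound_def by (elim exE conjE) (rule that)
  have "transpose_Charlie \<alpha> (ks_index i j s) (ks_index i' j' s') = \<alpha> (ks_index i j s) (ks_index i' j' s')" for i j s i' j' s'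
  proof -
    have "(ks_index i j s)(Charlie := []) = ks_index i j s" for i j s by (auto simp: index_eq_iff)
    then show ?thesis by (simp add: transpose_Charlie_def)
  qed
  then have "?Q (transpose_Charlie \<alpha>) = ?Q \<alpha>" by (simp add: private_test_def)
  moreover have "?Q (\<lambda>x y. sep_op fs x y - transpose_Charlie \<alpha> x y) \<ge> 0"
    using private_test_psd(1)[OF N(1) S_def UU, where A = "\<lambda>x y. sep_op fs x y - transpose_Charlie \<alpha> x y"] f(2) by (simp add: N_def)
  ultimately have "?Q \<alpha> \<le> ?Q (sep_op fs)" by (simp add: private_test_diff)
  also have "?Q (sep_op fs) = (\<Sum>f\<leftarrow>fs. ?Q (\<lambda>x y. product_vec f x * cnj (product_vec f y)))"
    unfolding sep_op_nth sum_list_map_nth private_test_sum by simp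
  also have "\<dots> \<le> (\<Sum>f\<leftarrow>fs. product_weight ?E f / N)"
    using private_test_product_le[OF N(1) S_def UU] by (intro sum_list_mono) (simp add: N_def)
  also have "\<dots> = (\<Sum>f\<leftarrow>fs. product_weight ?E f) / N"
    by (simp add: sum_list_sum_nth sum_divide_distrib)
  also have "\<dots> \<le> K / N" using f(3) by (intro divide_right_mono) auto
  finally show ?thesis using lower by (simp add: N_def)
qed

subsection \<open>Rates\<close>

text \<open>Common shape of both rates: \<open>A n \<epsilon>\<close> holds the key lengths
  achievable from n copies with error \<epsilon>.\<close>

definition rate :: "(nat \<Rightarrow> real \<Rightarrow> nat set) \<Rightarrow> ereal" where
  "rate A = (INF \<epsilon>\<in>{0<..}. limsup (\<lambda>n. SUP m\<in>A n \<epsilon>. ereal (real m / real n)))"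

lemma rate_le_strict:
  assumes "\<epsilon> > 0" "\<forall>\<^sub>F n in sequentially. \<forall>m\<in>A n \<epsilon>. real m \<le> R * real n"
  shows "rate A \<le> ereal R"
proof -
  have "limsup (\<lambda>n. SUP m\<in>A n \<epsilon>. ereal (real m / real n)) \<le> ereal R"
  proof (rule Limsup_bounded)
    show "\<forall>\<^sub>F n in sequentially. (SUP m\<in>A n \<epsilon>. ereal (real m / real n)) \<le> ereal R"
      using assms(2) eventually_gt_at_top[of 0]
      by eventually_elim (auto intro!: SUP_least simp: field_simps)
  qed
  then show ?thesis unfolding rate_def using assms(1) by (intro INF_lower2[of \<epsilon>]) auto
qed

text \<open>A value strictly above an infimum is already beaten at some \<epsilon>, and a value
  strictly above a limsup bounds the sequence eventually.\<close>

lemma rate_less: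
  assumes "rate A < ereal R"
  shows "\<exists>\<epsilon>>0. \<forall>\<^sub>F n in sequentially. \<forall>m\<in>A n \<epsilon>. real m \<le> R * real n"
proof -
  obtain \<epsilon> where e: "\<epsilon> > 0" "limsup (\<lambda>n. SUP m\<in>A n \<epsilon>. ereal (real m / real n)) < ereal R"
    using assms unfolding rate_def INF_less_iff by auto
  have "\<forall>\<^sub>F n in sequentially. (SUP m\<in>A n \<epsilon>. ereal (real m / real n)) < ereal R"
    using Limsup_lessD[OF e(2)] .
  then have "\<forall>\<^sub>F n in sequentially. \<forall>m\<in>A n \<epsilon>. real m \<le> R * real n"
    using eventually_gt_at_top[of 0]
  proof eventually_elim
    case (elim n)
    show ?case
    proof
      fix m assume "m \<in> A n \<epsilon>"
      then have "ereal (real m / real n) \<le> (SUP m\<in>A n \<epsilon>. ereal (real m / real n))" by (rule SUP_upper)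
      also have "\<dots> < ereal R" by (rule elim(1))
      finally show "real m \<le> R * real n" using elim(2) by (simp add: field_simps)
    qed
  qed
  then show ?thesis using e(1) by blast
qed

lemma rate_ge:
  assumes "\<And>\<epsilon>. \<epsilon> > 0 \<Longrightarrow> \<forall>\<^sub>F n in sequentially. \<exists>m\<in>A n \<epsilon>. R * real n \<le> real m"
  shows "ereal R \<le> rate A"
  unfolding rate_def
proof (rule INF_greatest)
  fix \<epsilon> :: real assume "\<epsilon> \<in> {0<..}"
  then have "\<epsilon> > 0" by simp
  have "\<forall>\<^sub>F n in sequentially. ereal R \<le> (SUP m\<in>A n \<epsilon>. ereal (real m / real n))"
    using assms[OF \<open>\<epsilon> > 0\<close>] eventually_gt_at_top[of 0]
  proof eventually_elim
    case (elim n)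
    then obtain m where m: "m \<in> A n \<epsilon>" "R * real n \<le> real m" by blast
    have "ereal R \<le> ereal (real m / real n)" using m(2) elim(2) by (simp add: field_simps)
    also have "\<dots> \<le> (SUP m\<in>A n \<epsilon>. ereal (real m / real n))" using m(1) by (rule SUP_upper)
    finally show ?case .
  qed
  then have "ereal R \<le> liminf (\<lambda>n. SUP m\<in>A n \<epsilon>. ereal (real m / real n))" by (rule Liminf_bounded)
  also have "\<dots> \<le> limsup (\<lambda>n. SUP m\<in>A n \<epsilon>. ereal (real m / real n))" by (simp add: Liminf_le_Limsup)
  finally show "ereal R \<le> limsup (\<lambda>n. SUP m\<in>A n \<epsilon>. ereal (real m / real n))" .
qed

lemma rate_le:
  assumes "\<epsilon> > 0" "\<forall>\<^sub>F n in sequentially. \<forall>m\<in>A n \<epsilon>. real m \<le> R * real n + C"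
  shows "rate A \<le> ereal R"
proof (rule ereal_le_epsilon2)
  fix e :: real assume e: "e > 0"
  have "filterlim (\<lambda>n. e * real n) at_top sequentially"
    using e by (intro filterlim_tendsto_pos_mult_at_top[OF tendsto_const e] filterlim_real_sequentially)
  then have "\<forall>\<^sub>F n in sequentially. C \<le> e * real n" by (simp add: filterlim_at_top)
  then have "\<forall>\<^sub>F n in sequentially. \<forall>m\<in>A n \<epsilon>. real m \<le> (R + e) * real n"
    using assms(2)
  proof eventually_elim
    case (elim n)
    show ?case
    proof
      fix m assume "m \<in> A n \<epsilon>"
      then have "real m \<le> R * real n + C" using elim(2) by blast
      then show "real m \<le> (R + e) * real n" using elim(1) by (simp add: algebra_simps)
    qed
  qed
  from rate_le_strict[where A = A and \<epsilon> = \<epsilon> and R = "R + e", OF assms(1) this] show "rate A \<le> ereal R + ereal e" by simp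
qed

text \<open>If whatever n copies achieve in A is achieved by \<open>g n\<close> copies in B, about c
  n of them, then the rates compare by the factor c. The growth of \<open>g\<close> matters because
  bounds for B hold only eventually.\<close>

lemma rate_compare:
  assumes sub: "\<And>\<epsilon>. \<epsilon> > 0 \<Longrightarrow> \<exists>\<delta>>0. \<forall>\<^sub>F n in sequentially. A n \<delta> \<subseteq> B (g n) \<epsilon>"
    and g: "filterlim g at_top sequentially" and gc: "\<forall>\<^sub>F n in sequentially. real (g n) \<le> c * real n + C"
    and B: "rate B \<le> ereal r" and r: "r \<ge> 0" and c: "c \<ge> 0"
  shows "rate A \<le> ereal (r * c)"
proof -
  \<comment> \<open>Extracting an \<epsilon> from the rate of B takes a bound strictly above r; R is
    sent to r at the end.\<close>
  have "rate A \<le> ereal (R * c)" if R: "R > r" for R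
  proof -
    have "rate B < ereal R" using B R by (meson ereal_less(3) le_less_trans less_ereal.simps(1))
    then obtain \<epsilon> where e: "\<epsilon> > 0" "\<forall>\<^sub>F n in sequentially. \<forall>m\<in>B n \<epsilon>. real m \<le> R * real n"
      using rate_less by blast
    obtain \<delta> where d: "\<delta> > 0" "\<forall>\<^sub>F n in sequentially. A n \<delta> \<subseteq> B (g n) \<epsilon>" using sub[OF e(1)] by blast
    have "\<forall>\<^sub>F n in sequentially. \<forall>m\<in>B (g n) \<epsilon>. real m \<le> R * real (g n)"
      using g e(2) by (rule eventually_compose_filterlim[rotated])
    then have "\<forall>\<^sub>F n in sequentially. \<forall>m\<in>A n \<delta>. real m \<le> (R * c) * real n + R * C"
      using d(2) gc
    proof eventually_elim
      case (elim n)
      have "R * real (g n) \<le> R * (c * real n + C)" using elim(3) R r by (intro mult_left_mono) auto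
      then show ?case using elim(1,2) by (fastforce simp: algebra_simps)
    qed
    from rate_le[where A = A and \<epsilon> = \<delta> and R = "R * c", OF d(1) this] show ?thesis .
  qed
  then have *: "rate A \<le> ereal ((r + e) * c)" if "e > 0" for e using that by simp
  show ?thesis
  proof (rule ereal_le_epsilon2)
    fix e :: real assume e: "e > 0"
    have "rate A \<le> ereal ((r + e / (c + 1)) * c)" using e c by (intro *) auto
    also have "(r + e / (c + 1)) * c \<le> r * c + e"
      using e c by (simp add: field_simps)
    finally show "rate A \<le> ereal (r * c) + ereal e" by simp
  qed
qed

section \<open>Achievable key lengths without the trace norm\<close>

definition key_achievable :: "dims \<Rightarrow> joint_op \<Rightarrow> nat \<Rightarrow> real \<Rightarrow> nat set" where
  "key_achievable D \<rho> n \<epsilon> = {m. \<exists>a b \<Lambda>. \<exists>\<gamma>\<in>private_states m a b.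
         locc {Alice, Bob} (power_dims D n) (key_shield (2 ^ m) a b) \<Lambda>
       \<and> trace_norm (joint_basis (key_shield (2 ^ m) a b))
           (\<lambda>x y. \<Lambda> (tensor_power D \<rho> n) x y - \<gamma> x y) \<le> \<epsilon>}"

lemma distillable_key_eq: "distillable_key D \<rho> = rate (key_achievable D \<rho>)"
  by (simp add: distillable_key_def rate_def key_achievable_def)

definition repeater_achievable :: "dims \<Rightarrow> joint_op \<Rightarrow> nat \<Rightarrow> real \<Rightarrow> nat set" where
  "repeater_achievable D \<omega> n \<epsilon> = {m. \<exists>a b cs \<Lambda>. \<exists>\<gamma>\<in>private_states m a b.
         locc {Alice, Bob, Charlie} (power_dims D n) ((key_shield (2 ^ m) a b)(Charlie := cs)) \<Lambda>
       \<and> trace_norm (joint_basis (key_shield (2 ^ m) a b))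
           (\<lambda>x y. trace_out_Charlie ((key_shield (2 ^ m) a b)(Charlie := cs))
                    (\<Lambda> (tensor_power D \<omega> n)) x y - \<gamma> x y) \<le> \<epsilon>}"

lemma repeater_rate_eq:
  "repeater_rate D\<^sub>1 D\<^sub>2 \<rho> \<tau> = rate (repeater_achievable (chain_dims D\<^sub>1 D\<^sub>2) (chain D\<^sub>1 D\<^sub>2 \<rho> \<tau>))"
  by (simp add: repeater_rate_def rate_def repeater_achievable_def)

text \<open>If \<sigma> is the sum of the rank-one operators of vectors v_k, the private state is
  the sum of those of 2^(-m/2) sum_i |ii> U_i v_k. Positivity is needed to pass from the trace norm
  to \<open>close_ops\<close>.\<close>

lemma private_state_psd:
  assumes "\<gamma> \<in> private_states m a b"
  shows "joint_psd (key_shield (2 ^ m) a b) \<gamma>"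
proof -
  let ?E = "key_shield (2 ^ m) a b"
  define S where "S = {..<a} \<times> {..<b}"
  have fin: "finite S" by (simp add: S_def)
  obtain \<sigma> U where U: "density_op S \<sigma>" "\<forall>i<2 ^ m. unitary_op S (U i)"
    and \<gamma>eq: "\<gamma> = (\<lambda>x y. if x \<in> joint_basis ?E \<and> y \<in> joint_basis ?E
          then 1 / 2 ^ m * (\<Sum>i<2 ^ m. \<Sum>j<2 ^ m.
            of_bool (x Alice ! 0 = i \<and> x Bob ! 0 = i \<and> y Alice ! 0 = j \<and> y Bob ! 0 = j)
            * op_mult S (op_mult S (U i) \<sigma>) (op_adj (U j)) (shield_index x) (shield_index y)) else 0)"
    using assms unfolding private_states_def S_def[symmetric] mem_Collect_eq by (elim exE conjE) (rule that)
  have "positive_op S \<sigma>" using U(1) by (simp add: density_op_def)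
  from positive_op_decomp[OF fin this]
  obtain v where v: "\<sigma> = (\<lambda>i j. \<Sum>k\<in>S. v k i * cnj (v k j))"
    by (elim exE conjE) (rule that)
  define w where "w = (\<lambda>k x. if x \<in> joint_basis ?E then complex_of_real (1 / sqrt (2 ^ m)) *
     (\<Sum>i<2 ^ m. of_bool (x Alice ! 0 = i \<and> x Bob ! 0 = i) * (\<Sum>s\<in>S. U i (shield_index x) s * v k s)) else 0)"
  have sq: "complex_of_real (1 / sqrt (2 ^ m)) * complex_of_real (1 / sqrt (2 ^ m)) = 1 / 2 ^ m"
    by (simp flip: of_real_mult)
  have om: "op_mult S (op_mult S (U i) \<sigma>) (op_adj (U j)) s s'
      = (\<Sum>k\<in>S. (\<Sum>q\<in>S. U i s q * v k q) * cnj (\<Sum>q\<in>S. U j s' q * v k q))" for i j s s'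
  proof -
    have "op_mult S (op_mult S (U i) \<sigma>) (op_adj (U j)) s s'
      = (\<Sum>q'\<in>S. \<Sum>q\<in>S. \<Sum>k\<in>S. (U i s q * v k q) * cnj (U j s' q' * v k q'))"
      unfolding op_mult_def op_adj_def v sum_distrib_left sum_distrib_right by (simp add: mult_ac)
    also have "\<dots> = (\<Sum>q'\<in>S. \<Sum>k\<in>S. \<Sum>q\<in>S. (U i s q * v k q) * cnj (U j s' q' * v k q'))"
      by (intro sum.cong refl sum.swap)
    also have "\<dots> = (\<Sum>k\<in>S. \<Sum>q'\<in>S. \<Sum>q\<in>S. (U i s q * v k q) * cnj (U j s' q' * v k q'))"
      by (rule sum.swap)
    also have "\<dots> = (\<Sum>k\<in>S. (\<Sum>q\<in>S. U i s q * v k q) * cnj (\<Sum>q\<in>S. U j s' q * v k q))"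
      unfolding cnj_sum sum_product by (intro sum.cong refl sum.swap)
    finally show ?thesis .
  qed
  have "\<gamma> = (\<lambda>x y. \<Sum>k\<in>S. w k x * cnj (w k y))"
  proof (intro ext)
    fix x y
    show "\<gamma> x y = (\<Sum>k\<in>S. w k x * cnj (w k y))"
    proof (cases "x \<in> joint_basis ?E \<and> y \<in> joint_basis ?E")
      case True
      let ?f = "\<lambda>i k. of_bool (x Alice ! 0 = i \<and> x Bob ! 0 = i) * (\<Sum>s\<in>S. U i (shield_index x) s * v k s)"
      let ?g = "\<lambda>i k. of_bool (y Alice ! 0 = i \<and> y Bob ! 0 = i) * (\<Sum>s\<in>S. U i (shield_index y) s * v k s)"
      have "(\<Sum>k\<in>S. w k x * cnj (w k y)) = (\<Sum>k\<in>S. 1 / 2 ^ m * ((\<Sum>i<2 ^ m. ?f i k) * cnj (\<Sum>j<2 ^ m. ?g j k)))"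
        unfolding w_def sq[symmetric] using True by (intro sum.cong refl) (simp add: mult_ac)
      also have "\<dots> = 1 / 2 ^ m * (\<Sum>k\<in>S. \<Sum>i<2 ^ m. \<Sum>j<2 ^ m. ?f i k * cnj (?g j k))"
        unfolding sum_distrib_left[symmetric] cnj_sum sum_product ..
      also have "(\<Sum>k\<in>S. \<Sum>i<2 ^ m. \<Sum>j<2 ^ m. ?f i k * cnj (?g j k))
        = (\<Sum>i<2 ^ m. \<Sum>j<2 ^ m. \<Sum>k\<in>S. ?f i k * cnj (?g j k))"
        by (subst sum.swap, rule sum.cong[OF refl], rule sum.swap)
      also have "\<dots> = (\<Sum>i<2 ^ m. \<Sum>j<2 ^ m.
            of_bool (x Alice ! 0 = i \<and> x Bob ! 0 = i \<and> y Alice ! 0 = j \<and> y Bob ! 0 = j)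
            * op_mult S (op_mult S (U i) \<sigma>) (op_adj (U j)) (shield_index x) (shield_index y))"
        unfolding om sum_distrib_left by (intro sum.cong refl) auto
      finally show ?thesis using True unfolding \<gamma>eq by simp
    next
      case False
      then show ?thesis by (auto simp: \<gamma>eq w_def)
    qed
  qed
  moreover have "joint_psd ?E (\<lambda>x y. \<Sum>k\<in>S. w k x * cnj (w k y))"
    by (rule positive_opI) (auto simp: w_def)
  ultimately show ?thesis by simp
qed

lemma key_achievable_iff:
  assumes "joint_psd D \<rho>"
  shows "m \<in> key_achievable D \<rho> n \<epsilon> \<longleftrightarrow> (\<exists>a b \<Lambda>. \<exists>\<gamma>\<in>private_states m a b.
         locc {Alice, Bob} (power_dims D n) (key_shield (2 ^ m) a b) \<Lambda>
       \<and> close_ops (key_shield (2 ^ m) a b) \<epsilon> (\<Lambda> (tensor_power D \<rho> n)) \<gamma>)"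
proof -
  have "trace_norm (joint_basis (key_shield (2 ^ m) a b)) (\<lambda>x y. \<Lambda> (tensor_power D \<rho> n) x y - \<gamma> x y) \<le> \<epsilon>
     \<longleftrightarrow> close_ops (key_shield (2 ^ m) a b) \<epsilon> (\<Lambda> (tensor_power D \<rho> n)) \<gamma>"
    if "\<gamma> \<in> private_states m a b" "locc {Alice, Bob} (power_dims D n) (key_shield (2 ^ m) a b) \<Lambda>" for a b \<gamma> \<Lambda>
    using that by (intro trace_norm_le_iff_close_ops locc_psd[OF that(2)] tensor_power_psd assms private_state_psd)
  then show ?thesis unfolding key_achievable_def mem_Collect_eq by (intro iff_exI bex_cong refl conj_cong) auto
qed

lemma repeater_achievable_iff:
  assumes "joint_psd D \<omega>"
  shows "m \<in> repeater_achievable D \<omega> n \<epsilon> \<longleftrightarrow> (\<exists>a b cs \<Lambda>. \<exists>\<gamma>\<in>private_states m a b.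
         locc {Alice, Bob, Charlie} (power_dims D n) ((key_shield (2 ^ m) a b)(Charlie := cs)) \<Lambda>
       \<and> close_ops (key_shield (2 ^ m) a b) \<epsilon>
          (trace_out_Charlie ((key_shield (2 ^ m) a b)(Charlie := cs)) (\<Lambda> (tensor_power D \<omega> n))) \<gamma>)"
proof -
  have e: "((key_shield (2 ^ m) a b)(Charlie := cs))(Charlie := []) = key_shield (2 ^ m) a b" for a b cs
    by (auto simp: fun_eq_iff)
  have "trace_norm (joint_basis (key_shield (2 ^ m) a b)) (\<lambda>x y. trace_out_Charlie ((key_shield (2 ^ m) a b)(Charlie := cs))
                    (\<Lambda> (tensor_power D \<omega> n)) x y - \<gamma> x y) \<le> \<epsilon>
     \<longleftrightarrow> close_ops (key_shield (2 ^ m) a b) \<epsilon> (trace_out_Charlie ((key_shield (2 ^ m) a b)(Charlie := cs)) (\<Lambda> (tensor_power D \<omega> n))) \<gamma>"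
    if "\<gamma> \<in> private_states m a b" "locc {Alice, Bob, Charlie} (power_dims D n) ((key_shield (2 ^ m) a b)(Charlie := cs)) \<Lambda>" for a b cs \<gamma> \<Lambda>
    using that
    by (intro trace_norm_le_iff_close_ops private_state_psd
         locc_psd[OF locc_trace_out_Charlie[of "{Charlie}" "(key_shield (2 ^ m) a b)(Charlie := cs)", unfolded e]]
         locc_psd[OF that(2)] tensor_power_psd assms) auto
  then show ?thesis unfolding repeater_achievable_def mem_Collect_eq by (intro iff_exI bex_cong refl conj_cong) auto
qed


subsection \<open>Upper bounds on the rates\<close>

text \<open>Basis vectors are product vectors, so a nonnegative diagonal operator is separable and
  its weight is its trace. The factor \<open>sqrt (w z)\<close> is put entirely on Alice's
  side.\<close>

lemma sep_bound_diag:
  assumes w: "\<And>x. x \<in> joint_basis D \<Longrightarrow> w x \<ge> 0"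
    and le: "joint_psd D (\<lambda>x y. diag_op (joint_basis D) (\<lambda>x. of_real (w x)) x y - transpose_Charlie \<omega> x y)"
  shows "sep_bound D (\<Sum>x\<in>joint_basis D. w x) \<omega>"
proof -
  obtain xs where xs: "set xs = joint_basis D" "distinct xs"
    using finite_distinct_list[OF finite_joint_basis] by blast
  define f where "f = (\<lambda>z p u. if u = z p then (if p = Alice then complex_of_real (sqrt (w z)) else 1) else 0)"
  have pv: "product_vec (f z) x = (if x = z then complex_of_real (sqrt (w z)) else 0)" for z x
    by (auto simp: product_vec_def UNIV_party f_def index_eq_iff)
  have ls: "(\<Sum>g\<leftarrow>map f xs. F g) = (\<Sum>z\<in>joint_basis D. F (f z))" for F :: "(party \<Rightarrow> nat list \<Rightarrow> complex) \<Rightarrow> 'z::comm_monoid_add"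
    using xs by (simp add: comp_def sum_list_distinct_conv_sum_set)
  have pw: "product_weight D (f z) = w z" if z: "z \<in> joint_basis D" for z
  proof -
    have zp: "z p \<in> party_basis (D p)" for p using z by (simp add: joint_basis_def)
    have "(\<Sum>u\<in>party_basis (D p). (cmod (f z p u))\<^sup>2) = (if p = Alice then w z else 1)" for p
    proof -
      have "(\<Sum>u\<in>party_basis (D p). (cmod (f z p u))\<^sup>2) = (\<Sum>u\<in>party_basis (D p). if u = z p then (if p = Alice then w z else 1) else 0)"
        using w[OF z] by (intro sum.cong refl) (auto simp: f_def)
      then show ?thesis using zp by simp
    qed
    then show ?thesis by (simp add: product_weight_def UNIV_party)
  qed
  have sd: "sep_op (map f xs) = diag_op (joint_basis D) (\<lambda>x. of_real (w x))"
  proof (intro ext)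
    fix x y
    have "sep_op (map f xs) x y = (\<Sum>z\<in>joint_basis D. product_vec (f z) x * cnj (product_vec (f z) y))"
      unfolding sep_op_def ls ..
    also have "\<dots> = (\<Sum>z\<in>joint_basis D. if z = x then diag_op (joint_basis D) (\<lambda>x. of_real (w x)) x y else 0)"
      using w by (intro sum.cong refl) (auto simp: pv diag_op_def simp flip: of_real_mult)
    also have "\<dots> = diag_op (joint_basis D) (\<lambda>x. of_real (w x)) x y" by (auto simp: diag_op_def)
    finally show "sep_op (map f xs) x y = diag_op (joint_basis D) (\<lambda>x. of_real (w x)) x y" .
  qed
  show ?thesis
    unfolding sep_bound_def
  proof (intro exI conjI)
    show "\<forall>g\<in>set (map f xs). supported D g"
      using xs by (auto simp: supported_def f_def joint_basis_def)
    show "joint_psd D (\<lambda>x y. sep_op (map f xs) x y - transpose_Charlie \<omega> x y)"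
      unfolding sd by (rule le)
    show "(\<Sum>g\<leftarrow>map f xs. product_weight D g) \<le> (\<Sum>x\<in>joint_basis D. w x)"
      unfolding ls by (simp add: pw)
  qed
qed

text \<open>The eigenvalues are nonnegative and sum to 1, so none exceeds 1.\<close>

lemma psd_le_identity:
  fixes A :: "('i, 'i) operator"
  assumes fin: "finite S" and A: "positive_op S A" and tr: "op_trace S A = 1"
  shows "positive_op S (\<lambda>i j. op_id S i j - A i j)"
proof -
  obtain U and l :: "'i \<Rightarrow> real" where U: "unitary_op S U" "\<forall>k\<in>S. l k \<ge> 0"
    and AU: "A = op_mult S (op_mult S U (diag_op S (\<lambda>i. of_real (l i)))) (op_adj U)"
    using positive_op_spectral[OF fin A] by (elim exE conjE) (rule that)
  have "op_trace S A = (\<Sum>k\<in>S. of_real (l k))"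
    unfolding op_trace_unitary_quadratic[OF fin U(1), symmetric]
    by (intro sum.cong refl unitary_conj_quadratic[OF fin U(1) _ AU])
  then have "(\<Sum>k\<in>S. l k) = 1" using tr by (metis of_real_eq_1_iff of_real_sum)
  then have l1: "l k \<le> 1" if "k \<in> S" for k using member_le_sum[of k S l] U(2) fin that by auto
  have "op_id S i j - A i j = (\<Sum>k\<in>S. (U i k * of_real (sqrt (1 - l k))) * cnj (U j k * of_real (sqrt (1 - l k))))" for i j
  proof -
    have "op_id S i j = (\<Sum>k\<in>S. U i k * cnj (U j k))"
      using fun_cong[OF fun_cong[OF unitary_opD(3)[OF U(1)]], of i j] by (simp add: op_mult_def op_adj_def)
    then have "op_id S i j - A i j = (\<Sum>k\<in>S. U i k * of_real (1 - l k) * cnj (U j k))"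
      unfolding AU diag_op_conj_apply[OF fin] by (simp add: algebra_simps sum_subtractf)
    also have "\<dots> = (\<Sum>k\<in>S. (U i k * of_real (sqrt (1 - l k))) * cnj (U j k * of_real (sqrt (1 - l k))))"
    proof (intro sum.cong refl)
      fix k assume "k \<in> S"
      then have "complex_of_real (1 - l k) = of_real (sqrt (1 - l k)) * of_real (sqrt (1 - l k))"
        using l1 by (simp flip: of_real_mult)
      then show "U i k * of_real (1 - l k) * cnj (U j k) = (U i k * of_real (sqrt (1 - l k))) * cnj (U j k * of_real (sqrt (1 - l k)))"
        by (simp add: mult_ac)
    qed
    finally show ?thesis .
  qed
  moreover have "positive_op S (\<lambda>i j. \<Sum>k\<in>S. (U i k * of_real (sqrt (1 - l k))) * cnj (U j k * of_real (sqrt (1 - l k))))"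
    using fin unitary_opD(1)[OF U(1)] by (intro positive_opI) (auto simp: operatorsD)
  ultimately show ?thesis by simp
qed

lemma joint_basis_Charlie: "x \<in> joint_basis D \<Longrightarrow> D Charlie = [] \<Longrightarrow> x Charlie = []"
  using joint_basis_length[of x D Charlie] by simp

lemma transpose_Charlie_trivial:
  assumes "D Charlie = []" "\<omega> \<in> joint_ops D" shows "transpose_Charlie \<omega> = \<omega>"
proof (intro ext)
  fix x y
  show "transpose_Charlie \<omega> x y = \<omega> x y"
  proof (cases "x Charlie = y Charlie")
    case True
    then have "x(Charlie := y Charlie) = x" "y(Charlie := x Charlie) = y" by auto
    then show ?thesis by (simp add: transpose_Charlie_def)
  next
    case False
    then have "x Charlie \<noteq> [] \<or> y Charlie \<noteq> []" by auto
    then have "x \<notin> joint_basis D \<or> y \<notin> joint_basis D"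
      "x(Charlie := y Charlie) \<notin> joint_basis D \<or> y(Charlie := x Charlie) \<notin> joint_basis D"
      using joint_basis_Charlie[where D = D, OF _ assms(1)] by fastforce+
    then show ?thesis using operatorsD[OF assms(2)] by (simp add: transpose_Charlie_def)
  qed
qed

text \<open>The left-hand 1 / 2 is 1 - \<epsilon> at \<epsilon> = 1 / 2, the error fixed in both
  upper bounds; it costs one bit, which disappears in the rate.\<close>

lemma power_two_bound:
  assumes "1 / 2 \<le> K ^ n / 2 ^ m" "K > 0"
  shows "real m \<le> log 2 K * real n + 1"
proof -
  have "2 ^ m \<le> 2 * K ^ n" using assms(1) by (simp add: field_simps)
  then have "log 2 (2 ^ m) \<le> log 2 (2 * K ^ n)" using assms(2) by (subst log_le_cancel_iff) auto
  also have "\<dots> = 1 + n * log 2 K" using assms(2) by (simp add: log_mult log_nat_power)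
  finally show ?thesis by (simp add: log_nat_power mult.commute)
qed

text \<open>A state is dominated by the identity, whose trace on n copies is the n-th power of the
  dimension. This crude bound serves only to know that the key rate is a real number.\<close>

lemma distillable_key_finite:
  assumes C: "D Charlie = []" and \<rho>: "density_op (joint_basis D) \<rho>"
  shows "distillable_key D \<rho> \<le> ereal (log 2 (card (joint_basis D)))"
proof -
  have p: "joint_psd D \<rho>" "joint_trace D \<rho> = 1" using \<rho> by (auto simp: density_op_def)
  have "joint_basis D \<noteq> {}" using p(2) by (auto simp: op_trace_def)
  then have pos: "card (joint_basis D) > 0" by (simp add: card_gt_0_iff)
  have cardn: "card (joint_basis (power_dims D n)) = card (joint_basis D) ^ n" for n
  proof (induction n)
    case (Suc n)
    have "card (joint_basis (power_dims D (Suc n))) = (\<Sum>x\<in>joint_basis (join D (power_dims D n)). 1)" by simp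
    also have "\<dots> = card (joint_basis D) * card (joint_basis (power_dims D n))"
      unfolding sum_joint_basis_join by simp
    finally have "card (joint_basis (power_dims D (Suc n))) = card (joint_basis D) ^ Suc n" using Suc by simp
    then show ?case .
  qed (simp add: joint_basis_trivial)
  have "real m \<le> log 2 (real (card (joint_basis D))) * real n + 1" if m: "m \<in> key_achievable D \<rho> n (1/2)" for m n
  proof -
    from m obtain a b \<Lambda> \<gamma> where \<Lambda>: "\<gamma> \<in> private_states m a b"
      "locc {Alice, Bob} (power_dims D n) (key_shield (2 ^ m) a b) \<Lambda>"
      "close_ops (key_shield (2 ^ m) a b) (1/2) (\<Lambda> (tensor_power D \<rho> n)) \<gamma>"
      unfolding key_achievable_iff[OF p(1)] by blast
    have pn: "joint_psd (power_dims D n) (tensor_power D \<rho> n)" by (rule tensor_power_psd[OF p(1)])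
    have tn: "joint_trace (power_dims D n) (tensor_power D \<rho> n) = 1" by (simp add: tensor_power_trace p)
    have "concat (replicate n []) = []" for n :: nat by (induction n) auto
    then have Cn: "power_dims D n Charlie = []" using C by (simp add: power_dims_def)
    have "sep_bound (power_dims D n) (\<Sum>x\<in>joint_basis (power_dims D n). 1) (tensor_power D \<rho> n)"
    proof (rule sep_bound_diag)
      show "joint_psd (power_dims D n) (\<lambda>x y. diag_op (joint_basis (power_dims D n)) (\<lambda>x. of_real 1) x y - transpose_Charlie (tensor_power D \<rho> n) x y)"
        unfolding op_id_eq_diag_op[symmetric] transpose_Charlie_trivial[where D = "power_dims D n", OF Cn positive_opD(1)[OF pn]]
        by (rule psd_le_identity[OF finite_joint_basis pn tn])
    qed simp
    then have "sep_bound (power_dims D n) (real (card (joint_basis D)) ^ n) (tensor_power D \<rho> n)"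
      by (simp add: cardn)
    from locc_sep_bound[OF \<Lambda>(2) this]
    have "1 - 1/2 \<le> real (card (joint_basis D)) ^ n / 2 ^ m"
      by (rule sep_bound_private[OF _ positive_opD(1)[OF locc_psd[OF \<Lambda>(2) pn]] \<Lambda>(1,3)])
    then show ?thesis using pos by (intro power_two_bound) auto
  qed
  then show ?thesis unfolding distillable_key_eq
    by (intro rate_le[of "1/2" _ _ 1]) auto
qed

lemma transpose_Charlie_tensor:
  "transpose_Charlie (tensor D \<rho> \<tau>) = tensor D (transpose_Charlie \<rho>) (transpose_Charlie \<tau>)"
proof -
  have "(\<lambda>p. take (length (D p)) ((x(Charlie := c)) p)) = (\<lambda>p. take (length (D p)) (x p))(Charlie := take (length (D Charlie)) c)"
    "(\<lambda>p. drop (length (D p)) ((x(Charlie := c)) p)) = (\<lambda>p. drop (length (D p)) (x p))(Charlie := drop (length (D Charlie)) c)"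
    for x :: index and c by (auto simp: fun_eq_iff)
  then show ?thesis unfolding tensor_def transpose_Charlie_def by simp
qed

lemma tensor_diag:
  "tensor D (diag_op (joint_basis D) w) (diag_op (joint_basis E) w')
    = diag_op (joint_basis (join D E)) (\<lambda>x. w (\<lambda>p. take (length (D p)) (x p)) * w' (\<lambda>p. drop (length (D p)) (x p)))"
proof (intro ext)
  fix x y :: index
  let ?t = "\<lambda>x p. take (length (D p)) (x p)" and ?d = "\<lambda>x p. drop (length (D p)) (x p)"
  have eq: "x = y" if e: "?t x = ?t y" "?d x = ?d y"
  proof
    fix p
    show "x p = y p" using fun_cong[OF e(1), of p] fun_cong[OF e(2), of p] by (metis append_take_drop_id)
  qed
  show "tensor D (diag_op (joint_basis D) w) (diag_op (joint_basis E) w') x y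
    = diag_op (joint_basis (join D E)) (\<lambda>x. w (?t x) * w' (?d x)) x y"
  proof (cases "x = y")
    case True
    then show ?thesis by (simp add: tensor_def diag_op_def joint_basis_join_iff)
  next
    case False
    then have "?t x \<noteq> ?t y \<or> ?d x \<noteq> ?d y" using eq by blast
    then show ?thesis using False by (auto simp: tensor_def diag_op_def)
  qed
qed

lemma tensor_power_diag:
  assumes "\<forall>x\<in>joint_basis D. w x \<ge> 0"
  shows "\<exists>w'. (\<forall>x\<in>joint_basis (power_dims D n). w' x \<ge> 0)
    \<and> tensor_power D (diag_op (joint_basis D) (\<lambda>x. complex_of_real (w x))) n = diag_op (joint_basis (power_dims D n)) (\<lambda>x. complex_of_real (w' x))
    \<and> (\<Sum>x\<in>joint_basis (power_dims D n). w' x) = (\<Sum>x\<in>joint_basis D. w x) ^ n"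
proof (induction n)
  case 0
  show ?case
    by (rule exI[of _ "\<lambda>x. 1"]) (auto simp: joint_basis_trivial op_id_eq_diag_op)
next
  case (Suc n)
  obtain w' where w': "\<forall>x\<in>joint_basis (power_dims D n). w' x \<ge> 0"
    "tensor_power D (diag_op (joint_basis D) (\<lambda>x. complex_of_real (w x))) n = diag_op (joint_basis (power_dims D n)) (\<lambda>x. complex_of_real (w' x))"
    "(\<Sum>x\<in>joint_basis (power_dims D n). w' x) = (\<Sum>x\<in>joint_basis D. w x) ^ n"
    using Suc by (elim exE conjE) (rule that)
  define w2 where "w2 = (\<lambda>x. w (\<lambda>p. take (length (D p)) (x p)) * w' (\<lambda>p. drop (length (D p)) (x p)))"
  have "\<forall>x\<in>joint_basis (join D (power_dims D n)). w2 x \<ge> 0"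
    using assms w'(1) by (auto simp: joint_basis_join_iff w2_def)
  moreover have "tensor_power D (diag_op (joint_basis D) (\<lambda>x. complex_of_real (w x))) (Suc n)
     = diag_op (joint_basis (join D (power_dims D n))) (\<lambda>x. complex_of_real (w2 x))"
    by (simp add: w'(2) tensor_diag w2_def)
  moreover have "(\<Sum>x\<in>joint_basis (join D (power_dims D n)). w2 x) = (\<Sum>x\<in>joint_basis D. w x) ^ Suc n"
    unfolding sum_joint_basis_join power_Suc w'(3)[symmetric] sum_product
    by (intro sum.cong refl) (simp add: w2_def joint_basis_length)
  ultimately have "\<exists>w'. (\<forall>x\<in>joint_basis (power_dims D (Suc n)). w' x \<ge> 0)
    \<and> tensor_power D (diag_op (joint_basis D) (\<lambda>x. complex_of_real (w x))) (Suc n) = diag_op (joint_basis (power_dims D (Suc n))) (\<lambda>x. complex_of_real (w' x))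
    \<and> (\<Sum>x\<in>joint_basis (power_dims D (Suc n)). w' x) = (\<Sum>x\<in>joint_basis D. w x) ^ Suc n"
    unfolding power_dims_Suc by (intro exI[of _ w2] conjI)
  then show ?case .
qed

text \<open>Telescoping: Y (x) Y' - X (x) X' = (Y - X) (x) Y' + X (x) (Y' - X'), with X and Y'
  positive.\<close>

lemma tensor_power_mono:
  assumes "joint_psd D X" "joint_psd D (\<lambda>x y. Y x y - X x y)"
  shows "joint_psd (power_dims D n) (\<lambda>x y. tensor_power D Y n x y - tensor_power D X n x y)"
proof (induction n)
  case 0
  show ?case by (simp add: positive_op_zero)
next
  case (Suc n)
  have Y: "joint_psd D Y" using positive_op_add[OF assms] by simp
  let ?X = "tensor_power D X n" and ?Y = "tensor_power D Y n"
  have "joint_psd (join D (power_dims D n)) (\<lambda>x y. tensor D (\<lambda>x y. Y x y - X x y) ?Y x y + tensor D X (\<lambda>x y. ?Y x y - ?X x y) x y)"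
    by (intro positive_op_add tensor_psd assms tensor_power_psd Y Suc)
  also have "(\<lambda>x y. tensor D (\<lambda>x y. Y x y - X x y) ?Y x y + tensor D X (\<lambda>x y. ?Y x y - ?X x y) x y)
    = (\<lambda>x y. tensor_power D Y (Suc n) x y - tensor_power D X (Suc n) x y)"
    by (auto simp: fun_eq_iff tensor_def algebra_simps)
  finally have "joint_psd (power_dims D (Suc n)) (\<lambda>x y. tensor_power D Y (Suc n) x y - tensor_power D X (Suc n) x y)"
    unfolding power_dims_Suc .
  then show ?case .
qed

lemma transpose_Charlie_tensor_power:
  "transpose_Charlie (tensor_power D \<omega> n) = tensor_power D (transpose_Charlie \<omega>) n"
proof (induction n)
  case 0
  show ?case
    using transpose_Charlie_trivial[of "\<lambda>p. []" "op_id {\<lambda>p. []}"] by (simp add: joint_basis_trivial)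
next
  case (Suc n)
  then show ?case by (simp add: transpose_Charlie_tensor)
qed

text \<open>Positivity of the partial transpose enters here, through
  \<open>tensor_power_mono\<close>: it lifts the domination of one copy to n copies. The rest is the
  separable bound, carried through the protocol and through the trace over Charlie.\<close>

lemma repeater_rate_le:
  assumes \<omega>: "joint_psd D \<omega>" and t: "joint_psd D (transpose_Charlie \<omega>)"
    and w: "\<And>x. x \<in> joint_basis D \<Longrightarrow> w x \<ge> 0"
    and le: "joint_psd D (\<lambda>x y. diag_op (joint_basis D) (\<lambda>x. of_real (w x)) x y - transpose_Charlie \<omega> x y)"
    and K: "(\<Sum>x\<in>joint_basis D. w x) = K" "K > 0"
  shows "rate (repeater_achievable D \<omega>) \<le> ereal (log 2 K)"
proof -
  have wb: "\<forall>x\<in>joint_basis D. w x \<ge> 0" using w by blast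
  have "real m \<le> log 2 K * real n + 1" if m: "m \<in> repeater_achievable D \<omega> n (1/2)" for m n
  proof -
    from m obtain a b cs \<Lambda> \<gamma> where \<Lambda>: "\<gamma> \<in> private_states m a b"
      "locc {Alice, Bob, Charlie} (power_dims D n) ((key_shield (2 ^ m) a b)(Charlie := cs)) \<Lambda>"
      "close_ops (key_shield (2 ^ m) a b) (1/2) (trace_out_Charlie ((key_shield (2 ^ m) a b)(Charlie := cs)) (\<Lambda> (tensor_power D \<omega> n))) \<gamma>"
      unfolding repeater_achievable_iff[OF \<omega>] by blast
    have e: "((key_shield (2 ^ m) a b)(Charlie := cs))(Charlie := []) = key_shield (2 ^ m) a b"
      by (auto simp: fun_eq_iff)
    have tl: "locc {Alice, Bob, Charlie} ((key_shield (2 ^ m) a b)(Charlie := cs)) (key_shield (2 ^ m) a b)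
       (trace_out_Charlie ((key_shield (2 ^ m) a b)(Charlie := cs)))"
      using locc_trace_out_Charlie[of "{Alice, Bob, Charlie}" "(key_shield (2 ^ m) a b)(Charlie := cs)"] unfolding e by simp
    note l = locc_compose[OF \<Lambda>(2) tl]
    obtain w' where w': "\<forall>x\<in>joint_basis (power_dims D n). w' x \<ge> 0"
      "tensor_power D (diag_op (joint_basis D) (\<lambda>x. complex_of_real (w x))) n = diag_op (joint_basis (power_dims D n)) (\<lambda>x. complex_of_real (w' x))"
      "(\<Sum>x\<in>joint_basis (power_dims D n). w' x) = (\<Sum>x\<in>joint_basis D. w x) ^ n"
      using tensor_power_diag[where D = D and w = w and n = n, OF wb] by (elim exE conjE) (rule that)
    have "sep_bound (power_dims D n) (\<Sum>x\<in>joint_basis (power_dims D n). w' x) (tensor_power D \<omega> n)"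
      using w' tensor_power_mono[OF t le, of n]
      by (intro sep_bound_diag) (auto simp: transpose_Charlie_tensor_power)
    then have sb: "sep_bound (power_dims D n) (K ^ n) (tensor_power D \<omega> n)" by (simp add: w'(3) K)
    have "1 - 1/2 \<le> K ^ n / 2 ^ m"
      by (rule sep_bound_private[OF locc_sep_bound[OF l sb] positive_opD(1)[OF locc_psd[OF l tensor_power_psd[OF \<omega>]]] \<Lambda>(1,3)])
    then show ?thesis using K(2) by (intro power_two_bound) auto
  qed
  then show ?thesis by (intro rate_le[of "1/2" _ _ 1]) auto
qed


subsection \<open>Non-negativity of the repeater rate\<close>

lemma locc_discard_party:
  assumes "p \<in> P" "party_basis es \<noteq> {}"
  shows "\<exists>\<Lambda>. locc P D (D(p := es)) \<Lambda>"
proof -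
  obtain z where z: "z \<in> party_basis es" using assms by blast
  have "locc P D (D(p := es)) (\<lambda>\<rho> x y. \<Sum>k\<in>{()}. (\<lambda>\<rho>. \<rho>)
      (\<lambda>x y. of_real 1 * (\<Sum>l\<in>party_basis (D p). pull p {z} (\<lambda>w. l) \<rho> x y)) x y)"
  proof (rule locc_pull[OF assms(1), where es = "\<lambda>k. es"])
    show "locc P (D(p := es)) (D(p := es)) (\<lambda>\<rho>. \<rho>)" by (rule locc.stop)
  qed (use z in auto)
  then show ?thesis by blast
qed

lemma op_id_private_state: "op_id (joint_basis (key_shield 1 1 1)) \<in> private_states 0 1 1"
proof -
  let ?S = "{..<1 :: nat} \<times> {..<1 :: nat}"
  have d: "density_op ?S (op_id ?S)"
    using positive_op_id[of ?S] by (simp add: density_op_def op_trace_def) (simp add: op_id_def)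
  have u: "unitary_op ?S (op_id ?S)"
    by (simp add: unitary_op_def op_mult_id_left[of _ _ ?S])
  have om: "op_mult ?S (op_mult ?S (op_id ?S) (op_id ?S)) (op_adj (op_id ?S)) = op_id ?S"
    by (simp add: op_mult_id_left[of _ _ ?S])
  have "op_id (joint_basis (key_shield 1 1 1)) = (\<lambda>x y. if x \<in> joint_basis (key_shield (2 ^ 0) 1 1) \<and> y \<in> joint_basis (key_shield (2 ^ 0) 1 1)
          then 1 / 2 ^ 0 * (\<Sum>i<2 ^ 0. \<Sum>j<2 ^ 0.
            of_bool (x Alice ! 0 = i \<and> x Bob ! 0 = i \<and> y Alice ! 0 = j \<and> y Bob ! 0 = j)
            * op_mult ?S (op_mult ?S (op_id ?S) (op_id ?S)) (op_adj (op_id ?S)) (shield_index x) (shield_index y))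
          else 0)"
    unfolding om
  proof (intro ext)
    fix x y :: index
    have J: "z \<in> joint_basis (key_shield (2 ^ 0) 1 1) \<longleftrightarrow> z = ks_index 0 0 (0, 0)" for z
      by (auto simp: joint_basis_key_shield_iff)
    show "op_id (joint_basis (key_shield 1 1 1)) x y = (if x \<in> joint_basis (key_shield (2 ^ 0) 1 1) \<and> y \<in> joint_basis (key_shield (2 ^ 0) 1 1)
          then 1 / 2 ^ 0 * (\<Sum>i<2 ^ 0. \<Sum>j<2 ^ 0.
            of_bool (x Alice ! 0 = i \<and> x Bob ! 0 = i \<and> y Alice ! 0 = j \<and> y Bob ! 0 = j)
            * op_id ?S (shield_index x) (shield_index y)) else 0)"
    proof (cases "x = ks_index 0 0 (0, 0) \<and> y = ks_index 0 0 (0, 0)")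
      case True
      then have "x = ks_index 0 0 (0, 0)" "y = ks_index 0 0 (0, 0)" by auto
      then show ?thesis using J[of x] by (simp add: op_id_def)
    next
      case False
      then have "\<not> (x = y \<and> x \<in> joint_basis (key_shield (2 ^ 0) 1 1))"
        "\<not> (x \<in> joint_basis (key_shield (2 ^ 0) 1 1) \<and> y \<in> joint_basis (key_shield (2 ^ 0) 1 1))"
        unfolding J by auto
      then show ?thesis by (auto simp: op_id_def)
    qed
  qed
  then show ?thesis
    unfolding private_states_def mem_Collect_eq using d u
    by (intro exI[of _ "op_id ?S"] exI[of _ "\<lambda>i. op_id ?S"]) simp
qed

text \<open>A supremum over no key lengths would be minus infinity, so some length must always be
  achievable. Zero bits are: if the outputs of Alice and Bob are one-dimensional, the only state
  they can share is a private state of zero bits.\<close>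

lemma repeater_rate_nonneg:
  assumes \<omega>: "density_op (joint_basis D) \<omega>"
  shows "0 \<le> rate (repeater_achievable D \<omega>)"
proof -
  have p: "joint_psd D \<omega>" "joint_trace D \<omega> = 1" using \<omega> by (auto simp: density_op_def)
  have "0 \<in> repeater_achievable D \<omega> n \<epsilon>" if "\<epsilon> > 0" for n \<epsilon>
  proof -
    let ?P = "{Alice, Bob, Charlie}" and ?D = "power_dims D n"
    have ne: "party_basis [1, 1] \<noteq> {}" by (auto simp: party_basis_def set_Cons_def)
    obtain \<Lambda>1 where 1: "locc ?P ?D (?D(Alice := [1,1])) \<Lambda>1" using locc_discard_party[of Alice ?P "[1,1]"] ne by blast
    obtain \<Lambda>2 where 2: "locc ?P (?D(Alice := [1,1])) (?D(Alice := [1,1], Bob := [1,1])) \<Lambda>2"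
      using locc_discard_party[of Bob ?P "[1,1]"] ne by blast
    let ?E = "(key_shield (2 ^ 0) 1 1)(Charlie := ?D Charlie)"
    have E: "?D(Alice := [1,1], Bob := [1,1]) = ?E"
      by (auto simp: index_eq_iff)
    have l: "locc ?P ?D ?E (\<lambda>\<rho>. \<Lambda>2 (\<Lambda>1 \<rho>))" using locc_compose[OF 1 2] unfolding E .
    have e: "?E(Charlie := []) = key_shield 1 1 1" by (auto simp: index_eq_iff)
    have tl: "locc ?P ?E (key_shield 1 1 1) (trace_out_Charlie ?E)"
      using locc_trace_out_Charlie[of ?P ?E] unfolding e by simp
    note l2 = locc_compose[OF l tl]
    let ?\<alpha> = "trace_out_Charlie ?E (\<Lambda>2 (\<Lambda>1 (tensor_power D \<omega> n)))"
    have ops: "?\<alpha> \<in> joint_ops (key_shield 1 1 1)"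
      using positive_opD(1)[OF locc_psd[OF l2 tensor_power_psd[OF p(1)]]] .
    have tr: "joint_trace (key_shield 1 1 1) ?\<alpha> = 1"
      using locc_trace[OF l2] tensor_power_trace[of D n \<omega>] p(2) by simp
    have "?\<alpha> x y = op_id (joint_basis (key_shield 1 1 1)) x y" for x y
    proof -
      have "?\<alpha> (ks_index 0 0 (0,0)) (ks_index 0 0 (0,0)) = 1"
      proof -
        have "{..<Suc 0} \<times> {..<Suc 0} = {(0, 0)}" by auto
        then show ?thesis using tr by (simp add: op_trace_def sum_joint_basis_key_shield)
      qed
      then show ?thesis using operatorsD[OF ops, of x y]
        by (auto simp: op_id_def joint_basis_key_shield_iff)
    qed
    then have "?\<alpha> = op_id (joint_basis (key_shield 1 1 1))" by (intro ext)
    then have "close_ops (key_shield (2 ^ 0) 1 1) \<epsilon> ?\<alpha> (op_id (joint_basis (key_shield 1 1 1)))"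
      using that by (simp add: close_ops_refl)
    then show ?thesis
      unfolding repeater_achievable_iff[OF p(1)] using op_id_private_state l by blast
  qed
  then have "ereal 0 \<le> rate (repeater_achievable D \<omega>)"
    by (intro rate_ge always_eventually allI bexI[of _ 0]) auto
  then show ?thesis by (simp add: zero_ereal_def)
qed


subsection \<open>Chains of two states\<close>

definition chain_index :: "index \<Rightarrow> index \<Rightarrow> index" where
  "chain_index y z = (\<lambda>p. case p of Alice \<Rightarrow> y Alice | Bob \<Rightarrow> z Bob | Charlie \<Rightarrow> y Bob @ z Alice)"

definition chain_left :: "dims \<Rightarrow> index \<Rightarrow> index" where
  "chain_left D x = (\<lambda>p. case p of Alice \<Rightarrow> x Alice | Bob \<Rightarrow> take (length (D Bob)) (x Charlie) | Charlie \<Rightarrow> [])"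

definition chain_right :: "dims \<Rightarrow> index \<Rightarrow> index" where
  "chain_right D x = (\<lambda>p. case p of Alice \<Rightarrow> drop (length (D Bob)) (x Charlie) | Bob \<Rightarrow> x Bob | Charlie \<Rightarrow> [])"

lemma chain_apply: "chain D E \<rho> \<tau> x y = \<rho> (chain_left D x) (chain_left D y) * \<tau> (chain_right D x) (chain_right D y)"
  by (simp add: chain_def chain_left_def chain_right_def Let_def)

lemma joint_basis_chain_iff:
  assumes "D Charlie = []" "E Charlie = []"
  shows "x \<in> joint_basis (chain_dims D E) \<longleftrightarrow> chain_left D x \<in> joint_basis D \<and> chain_right D x \<in> joint_basis E"
  using assms
  by (auto simp: joint_basis_def party_all chain_dims_def chain_left_def chain_right_def party_basis_append_iff)

lemma sum_joint_basis_chain: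
  assumes "D Charlie = []" "E Charlie = []"
  shows "(\<Sum>x\<in>joint_basis (chain_dims D E). f x) = (\<Sum>y\<in>joint_basis D. \<Sum>z\<in>joint_basis E. f (chain_index y z))"
proof -
  have lr: "chain_left D (chain_index y z) = y" "chain_right D (chain_index y z) = z"
    if "y \<in> joint_basis D" "z \<in> joint_basis E" for y z
  proof -
    have "length (y Bob) = length (D Bob)" "y Charlie = []" "z Charlie = []"
      using that assms joint_basis_length[OF that(1), of Bob] joint_basis_length[OF that(1), of Charlie]
       joint_basis_length[OF that(2), of Charlie] by auto
    then show "chain_left D (chain_index y z) = y" "chain_right D (chain_index y z) = z"
      by (simp_all add: index_eq_iff chain_left_def chain_right_def chain_index_def)
  qed
  have "chain_index (chain_left D x) (chain_right D x) = x" for x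
    by (simp add: index_eq_iff chain_left_def chain_right_def chain_index_def)
  then have "(\<Sum>(y,z)\<in>joint_basis D \<times> joint_basis E. f (chain_index y z)) = (\<Sum>x\<in>joint_basis (chain_dims D E). f x)"
    by (intro sum.reindex_bij_witness[where j = "\<lambda>(y,z). chain_index y z" and i = "\<lambda>x. (chain_left D x, chain_right D x)"])
      (auto simp: joint_basis_chain_iff[where D = D and E = E, OF assms] lr)
  then show ?thesis by (simp add: sum.cartesian_product)
qed

lemma chain_index_left_right:
  assumes "D Charlie = []" "y \<in> joint_basis D" "E Charlie = []" "z \<in> joint_basis E"
  shows "chain_left D (chain_index y z) = y" "chain_right D (chain_index y z) = z"
proof -
  have "length (y Bob) = length (D Bob)" "y Charlie = []" "z Charlie = []"
    using assms joint_basis_length[OF assms(2), of Bob] joint_basis_length[OF assms(2), of Charlie]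
     joint_basis_length[OF assms(4), of Charlie] by auto
  then show "chain_left D (chain_index y z) = y" "chain_right D (chain_index y z) = z"
    by (simp_all add: index_eq_iff chain_left_def chain_right_def chain_index_def)
qed

lemma chain_psd:
  assumes C: "D Charlie = []" "E Charlie = []" and "joint_psd D \<rho>" "joint_psd E \<tau>"
  shows "joint_psd (chain_dims D E) (chain D E \<rho> \<tau>)"
proof -
  obtain v where v: "\<forall>k i. i \<notin> joint_basis D \<longrightarrow> v k i = 0"
    "\<rho> = (\<lambda>i j. \<Sum>k\<in>joint_basis D. v k i * cnj (v k j))"
    using positive_op_decomp[OF finite_joint_basis assms(3)] by (elim exE conjE) (rule that)
  obtain w where w: "\<forall>k i. i \<notin> joint_basis E \<longrightarrow> w k i = 0"
    "\<tau> = (\<lambda>i j. \<Sum>k\<in>joint_basis E. w k i * cnj (w k j))"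
    using positive_op_decomp[OF finite_joint_basis assms(4)] by (elim exE conjE) (rule that)
  let ?V = "\<lambda>(k,l) x. v k (chain_left D x) * w l (chain_right D x)"
  have "chain D E \<rho> \<tau> = (\<lambda>i j. \<Sum>k\<in>joint_basis D \<times> joint_basis E. ?V k i * cnj (?V k j))"
    unfolding fun_eq_iff chain_apply v(2) w(2) sum_product sum.cartesian_product
    by (intro allI sum.cong refl) (auto simp: mult_ac)
  moreover have "joint_psd (chain_dims D E) (\<lambda>i j. \<Sum>k\<in>joint_basis D \<times> joint_basis E. ?V k i * cnj (?V k j))"
    using v(1) w(1) by (intro positive_opI) (auto simp: joint_basis_chain_iff[where D = D and E = E, OF C])
  ultimately show ?thesis by simp
qed

lemma chain_trace:
  assumes C: "D Charlie = []" "E Charlie = []"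
  shows "joint_trace (chain_dims D E) (chain D E \<rho> \<tau>) = joint_trace D \<rho> * joint_trace E \<tau>"
  unfolding op_trace_def sum_joint_basis_chain[where D = D and E = E, OF C] sum_product
  by (intro sum.cong refl) (simp add: chain_apply chain_index_left_right[where D = D and E = E, OF C(1) _ C(2)])

definition transpose_Alice :: "joint_op \<Rightarrow> joint_op" where
  "transpose_Alice \<rho> = (\<lambda>x y. \<rho> (x(Alice := y Alice)) (y(Alice := x Alice)))"

lemma transpose_Charlie_chain:
  "transpose_Charlie (chain D E \<rho> \<tau>) = chain D E (transpose_Bob \<rho>) (transpose_Alice \<tau>)"
proof -
  have "chain_left D (x(Charlie := y Charlie)) = (chain_left D x)(Bob := chain_left D y Bob)"
    "chain_right D (x(Charlie := y Charlie)) = (chain_right D x)(Alice := chain_right D y Alice)" for x y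
    by (simp_all add: index_eq_iff chain_left_def chain_right_def)
  then show ?thesis
    by (intro ext) (simp only: transpose_Charlie_def chain_apply transpose_Bob_def transpose_Alice_def)
qed

text \<open>The two one-sided transposes differ by a full transposition, which preserves positivity.
  Hypotheses on Bob's side therefore cover the copy in which Charlie plays Alice.\<close>

lemma transpose_Alice_eq:
  assumes "D Charlie = []" "\<rho> \<in> joint_ops D"
  shows "transpose_Alice \<rho> x y = transpose_Bob \<rho> y x"
proof (cases "x Charlie = [] \<and> y Charlie = []")
  case True
  then have "x(Alice := y Alice) = y(Bob := x Bob)" "y(Alice := x Alice) = x(Bob := y Bob)"
    by (simp_all add: index_eq_iff)
  then show ?thesis by (simp add: transpose_Alice_def transpose_Bob_def)
next
  case False
  then have n: "x \<notin> joint_basis D \<or> y \<notin> joint_basis D"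
    and "x(Alice := a) \<notin> joint_basis D \<or> y(Alice := b) \<notin> joint_basis D"
    and "y(Bob := a) \<notin> joint_basis D \<or> x(Bob := b) \<notin> joint_basis D" for a b
    using joint_basis_Charlie[where D = D, OF _ assms(1)] by fastforce+
  then show ?thesis using operatorsD[OF assms(2)] by (simp add: transpose_Alice_def transpose_Bob_def)
qed

lemma positive_op_transpose:
  assumes "finite S" "positive_op S A" shows "positive_op S (\<lambda>i j. A j i)"
proof -
  obtain v where v: "\<forall>k i. i \<notin> S \<longrightarrow> v k i = 0" "A = (\<lambda>i j. \<Sum>k\<in>S. v k i * cnj (v k j))"
    using positive_op_decomp[OF assms] by (elim exE conjE) (rule that)
  have "(\<lambda>i j. A j i) = (\<lambda>i j. \<Sum>k\<in>S. cnj (v k i) * cnj (cnj (v k j)))"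
    unfolding v(2) by (simp add: mult.commute)
  moreover have "positive_op S (\<lambda>i j. \<Sum>k\<in>S. cnj (v k i) * cnj (cnj (v k j)))"
    using v(1) assms(1) by (intro positive_opI) auto
  ultimately show ?thesis by simp
qed

text \<open>With W the diagonal bound and X, Y the transposes of the two copies, W (x) W - X (x) Y =
  (W - X) (x) W + X (x) (W - Y). Both summands are positive, the second because of PPT. The traces
  multiply to K^2, whence the factor 2.\<close>

theorem repeater_rate_bounds:
  assumes C: "D Charlie = []" and \<rho>: "density_op (joint_basis D) \<rho>" and ppt: "PPT D \<rho>"
    and w: "\<And>x. x \<in> joint_basis D \<Longrightarrow> w x \<ge> 0"
    and le: "joint_psd D (\<lambda>x y. diag_op (joint_basis D) (\<lambda>x. complex_of_real (w x)) x y - transpose_Bob \<rho> x y)"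
    and K: "(\<Sum>x\<in>joint_basis D. w x) = K" "K > 0"
  shows "0 \<le> repeater_rate D D \<rho> \<rho>" "repeater_rate D D \<rho> \<rho> \<le> ereal (2 * log 2 K)"
proof -
  have p: "joint_psd D \<rho>" "joint_trace D \<rho> = 1" using \<rho> by (auto simp: density_op_def)
  let ?W = "diag_op (joint_basis D) (\<lambda>x. complex_of_real (w x))"
  have TA: "transpose_Alice \<rho> = (\<lambda>x y. transpose_Bob \<rho> y x)"
    using transpose_Alice_eq[where D = D, OF C positive_opD(1)[OF p(1)]] by (intro ext)
  have tB: "joint_psd D (transpose_Bob \<rho>)" using ppt by (simp add: PPT_def)
  have tA: "joint_psd D (transpose_Alice \<rho>)" unfolding TA by (rule positive_op_transpose[OF finite_joint_basis tB])
  have leA: "joint_psd D (\<lambda>x y. ?W x y - transpose_Alice \<rho> x y)"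
  proof -
    have "(\<lambda>x y. ?W x y - transpose_Alice \<rho> x y) = (\<lambda>x y. ?W y x - transpose_Bob \<rho> y x)"
      unfolding TA by (intro ext) (auto simp: diag_op_def)
    then show ?thesis using positive_op_transpose[OF finite_joint_basis le] by simp
  qed
  let ?w = "\<lambda>x. w (chain_left D x) * w (chain_right D x)"
  have cW: "diag_op (joint_basis (chain_dims D D)) (\<lambda>x. complex_of_real (?w x)) = chain D D ?W ?W"
  proof (intro ext)
    fix x y
    have inj: "x = y" if "chain_left D x = chain_left D y" "chain_right D x = chain_right D y"
    proof -
      have "take n (x Charlie) = take n (y Charlie)" "drop n (x Charlie) = drop n (y Charlie)" if "n = length (D Bob)" for n
        using fun_cong[OF \<open>chain_left D x = chain_left D y\<close>, of Bob] fun_cong[OF \<open>chain_right D x = chain_right D y\<close>, of Alice] that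
        by (simp_all add: chain_left_def chain_right_def)
      then have "x Charlie = y Charlie" by (metis append_take_drop_id)
      then show ?thesis
        using fun_cong[OF that(1), of Alice] fun_cong[OF that(2), of Bob]
        by (simp add: index_eq_iff chain_left_def chain_right_def)
    qed
    show "diag_op (joint_basis (chain_dims D D)) (\<lambda>x. complex_of_real (?w x)) x y = chain D D ?W ?W x y"
    proof (cases "x = y")
      case True
      then show ?thesis by (simp add: chain_apply diag_op_def joint_basis_chain_iff[where D = D and E = D, OF C C])
    next
      case False
      then have "chain_left D x \<noteq> chain_left D y \<or> chain_right D x \<noteq> chain_right D y" using inj by blast
      then show ?thesis using False by (auto simp: chain_apply diag_op_def)
    qed
  qed
  have W: "joint_psd D ?W" by (rule positive_diag_op[OF finite_joint_basis w])
  have "joint_psd (chain_dims D D) (\<lambda>x y. chain D D (\<lambda>x y. ?W x y - transpose_Bob \<rho> x y) ?W x y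
      + chain D D (transpose_Bob \<rho>) (\<lambda>x y. ?W x y - transpose_Alice \<rho> x y) x y)"
    by (intro positive_op_add chain_psd C W le leA tB)
  also have "(\<lambda>x y. chain D D (\<lambda>x y. ?W x y - transpose_Bob \<rho> x y) ?W x y
      + chain D D (transpose_Bob \<rho>) (\<lambda>x y. ?W x y - transpose_Alice \<rho> x y) x y)
    = (\<lambda>x y. diag_op (joint_basis (chain_dims D D)) (\<lambda>x. complex_of_real (?w x)) x y - transpose_Charlie (chain D D \<rho> \<rho>) x y)"
    unfolding cW transpose_Charlie_chain by (simp add: fun_eq_iff chain_apply algebra_simps)
  finally have le2: "joint_psd (chain_dims D D) (\<lambda>x y. diag_op (joint_basis (chain_dims D D)) (\<lambda>x. complex_of_real (?w x)) x y - transpose_Charlie (chain D D \<rho> \<rho>) x y)" .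
  have "(\<Sum>x\<in>joint_basis (chain_dims D D). ?w x) = (\<Sum>x\<in>joint_basis D. \<Sum>y\<in>joint_basis D. w x * w y)"
    unfolding sum_joint_basis_chain[where D = D and E = D, OF C C] by (intro sum.cong refl) (simp add: chain_index_left_right[where D = D and E = D, OF C _ C])
  also have "\<dots> = K * K" unfolding sum_product[symmetric] K ..
  finally have K2: "(\<Sum>x\<in>joint_basis (chain_dims D D). ?w x) = K * K" .
  have "rate (repeater_achievable (chain_dims D D) (chain D D \<rho> \<rho>)) \<le> ereal (log 2 (K * K))"
    by (rule repeater_rate_le[OF chain_psd[OF C C p(1) p(1)] _ _ le2 K2])
      (use w K(2) in \<open>auto simp: transpose_Charlie_chain joint_basis_chain_iff[where D = D and E = D, OF C C] intro!: chain_psd C tA tB\<close>)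
  then show "repeater_rate D D \<rho> \<rho> \<le> ereal (2 * log 2 K)"
    unfolding repeater_rate_eq using K(2) by (simp add: log_mult)
  show "0 \<le> repeater_rate D D \<rho> \<rho>"
    unfolding repeater_rate_eq by (rule repeater_rate_nonneg) (simp add: density_op_def chain_psd C p chain_trace)
qed

subsection \<open>Elementary protocols\<close>

lemma locc_exists:
  assumes P: "{Alice, Bob} \<subseteq> P" and C: "D Charlie = E Charlie" and ne: "joint_basis E \<noteq> {}"
  shows "\<exists>\<Lambda>. locc P D E \<Lambda>"
proof -
  have ne': "party_basis (E p) \<noteq> {}" for p using ne by (auto simp: joint_basis_def)
  obtain \<Lambda>1 where 1: "locc P D (D(Alice := E Alice)) \<Lambda>1"
    using locc_discard_party[of Alice P "E Alice" D] P ne' by blast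
  obtain \<Lambda>2 where 2: "locc P (D(Alice := E Alice)) (D(Alice := E Alice, Bob := E Bob)) \<Lambda>2"
    using locc_discard_party[of Bob P "E Bob"] P ne' by blast
  have "D(Alice := E Alice, Bob := E Bob) = E" using C by (auto simp: index_eq_iff)
  then show ?thesis using locc_compose[OF 1 2] by auto
qed

lemma pull_full:
  assumes "\<rho> \<in> joint_ops D"
  shows "pull p (party_basis (D p)) (\<lambda>w. w) \<rho> = \<rho>"
proof (intro ext)
  fix x y
  show "pull p (party_basis (D p)) (\<lambda>w. w) \<rho> x y = \<rho> x y"
  proof (cases "x p \<in> party_basis (D p) \<and> y p \<in> party_basis (D p)")
    case False
    then have "x \<notin> joint_basis D \<or> y \<notin> joint_basis D" by (auto simp: joint_basis_def)
    then show ?thesis using False operatorsD[OF assms] by (simp add: pull_def)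
  qed (simp add: pull_def)
qed

text \<open>Party \<open>p\<close> tosses a coin, by an instrument whose Kraus operators are
  multiples of the identity, and announces the result.\<close>

lemma locc_mix:
  assumes p: "p \<in> P" and t: "0 \<le> t" "t \<le> 1" and 1: "locc P D E \<Lambda>1" and 2: "locc P D E \<Lambda>2"
  shows "\<exists>\<Lambda>. locc P D E \<Lambda> \<and> (\<forall>\<rho>\<in>joint_ops D. \<Lambda> \<rho> = (\<lambda>x y. of_real t * \<Lambda>1 \<rho> x y + of_real (1 - t) * \<Lambda>2 \<rho> x y))"
proof -
  define \<Lambda> where "\<Lambda> = (\<lambda>b. if b then \<Lambda>1 else \<Lambda>2)"
  define q where "q = (\<lambda>b. if b then t else 1 - t)"
  define \<Theta> where "\<Theta> = (\<lambda>\<rho> x y. \<Sum>k\<in>UNIV. \<Lambda> k (\<lambda>x y. of_real (q k) * (\<Sum>l\<in>{()}. pull p (party_basis (D p)) (\<lambda>w. w) \<rho> x y)) x y)"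
  have "locc P D E \<Theta>"
    unfolding \<Theta>_def
  proof (rule locc_pull[OF p, where es = "\<lambda>k. D p"])
    fix k show "locc P (D(p := D p)) E (\<Lambda> k)" using 1 2 by (simp add: \<Lambda>_def)
  qed (use t in \<open>auto simp: q_def UNIV_bool\<close>)
  moreover have "\<Theta> \<rho> = (\<lambda>x y. of_real t * \<Lambda>1 \<rho> x y + of_real (1 - t) * \<Lambda>2 \<rho> x y)" if \<rho>: "\<rho> \<in> joint_ops D" for \<rho>
  proof -
    have s: "\<Lambda>' (\<lambda>x y. of_real c * \<rho> x y) x y = of_real c * \<Lambda>' \<rho> x y" if "locc P D E \<Lambda>'" for \<Lambda>' c x y
      using linear_mapD[OF locc_linear[OF that], of "of_real c" \<rho> 0] by simp
    show ?thesis unfolding \<Theta>_def pull_full[OF \<rho>] using 1 2 by (simp add: UNIV_bool \<Lambda>_def q_def s add.commute)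
  qed
  ultimately show ?thesis by blast
qed

definition basis_op :: "index \<Rightarrow> joint_op" where
  "basis_op f = (\<lambda>x y. of_bool (x = f \<and> y = f))"

lemma basis_op_density:
  assumes "f \<in> joint_basis D"
  shows "joint_psd D (basis_op f)" "joint_trace D (basis_op f) = 1"
proof -
  have "basis_op f = diag_op (joint_basis D) (\<lambda>x. complex_of_real (of_bool (x = f)))"
    using assms by (intro ext) (auto simp: basis_op_def diag_op_def)
  then show "joint_psd D (basis_op f)" using positive_diag_op[of "joint_basis D" "\<lambda>x. of_bool (x = f)"] by simp
  have "joint_trace D (basis_op f) = (\<Sum>x\<in>joint_basis D. if x = f then 1 else 0)"
    unfolding op_trace_def basis_op_def by (intro sum.cong) auto
  then show "joint_trace D (basis_op f) = 1" using assms by simp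
qed

lemma locc_prepend:
  assumes P: "{Alice, Bob} \<subseteq> P" and f: "f \<in> joint_basis R" and C: "R Charlie = []"
  shows "\<exists>\<Lambda>. locc P E (join R E) \<Lambda> \<and> (\<forall>\<tau>\<in>joint_ops E. \<Lambda> \<tau> = tensor R (basis_op f) \<tau>)"
proof -
  have fp: "f p \<in> party_basis (R p)" for p using f by (simp add: joint_basis_def)
  have fl: "length (f p) = length (R p)" for p using joint_basis_length[OF f] .
  define V where "V = (\<lambda>p. (\<lambda>v. f p @ v) ` party_basis (E p))"
  define g where "g = (\<lambda>p w. drop (length (R p)) w :: nat list)"
  have single: "locc P F (F(p := R p @ E p)) (pull p (V p) (g p))" if p: "p \<in> P" and F: "F p = E p" for p F
  proof -
    have "locc P F (F(p := R p @ E p)) (\<lambda>\<rho> x y. \<Sum>k\<in>{()}. (\<lambda>\<rho>. \<rho>) (\<lambda>x y. of_real 1 * (\<Sum>l\<in>{()}. pull p (V p) (g p) \<rho> x y)) x y)"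
    proof (rule locc_pull[OF p, where es = "\<lambda>k. R p @ E p"])
      show "locc P (F(p := R p @ E p)) (F(p := R p @ E p)) (\<lambda>\<rho>. \<rho>)" by (rule locc.stop)
      show "V p \<subseteq> party_basis (R p @ E p)" unfolding V_def using append_in_party_basis[OF fp] by blast
      have im: "g p ` V p = party_basis (E p)" by (auto simp: V_def g_def image_image fl)
      have inj: "inj_on (g p) (V p)" by (auto simp: inj_on_def V_def g_def fl)
      show "inj_on (g p) (V p) \<and> g p ` V p \<subseteq> party_basis (F p)" using im inj F by simp
      fix u assume "u \<in> party_basis (F p)"
      then show "(\<Sum>k\<in>{()}. \<Sum>l\<in>{()}. if u \<in> g p ` V p then 1 else 0) = (1 :: real)" using im F by simp
    qed auto
    then show ?thesis by (simp add: pull_def[abs_def])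
  qed
  have A: "locc P E (E(Alice := R Alice @ E Alice)) (pull Alice (V Alice) (g Alice))"
    using P by (intro single) auto
  have B: "locc P (E(Alice := R Alice @ E Alice)) (E(Alice := R Alice @ E Alice, Bob := R Bob @ E Bob)) (pull Bob (V Bob) (g Bob))"
    using P by (intro single) auto
  have e: "E(Alice := R Alice @ E Alice, Bob := R Bob @ E Bob) = join R E" using C by (auto simp: index_eq_iff)
  have "pull Bob (V Bob) (g Bob) (pull Alice (V Alice) (g Alice) \<tau>) = tensor R (basis_op f) \<tau>" if \<tau>: "\<tau> \<in> joint_ops E" for \<tau>
  proof (intro ext)
    fix x y :: index
    let ?t = "\<lambda>x p. take (length (R p)) (x p)" and ?d = "\<lambda>x p. drop (length (R p)) (x p)"
    have V: "w \<in> V p \<longleftrightarrow> take (length (R p)) w = f p \<and> drop (length (R p)) w \<in> party_basis (E p)" for w p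
      by (auto simp: V_def fl image_iff) (metis append_take_drop_id)
    have upd: "(x(Bob := g Bob (x Bob)))(Alice := g Alice ((x(Bob := g Bob (x Bob))) Alice)) = ?d x" for x
      using C by (simp add: index_eq_iff g_def)
    have tf: "?t x = f \<longleftrightarrow> take (length (R Alice)) (x Alice) = f Alice \<and> take (length (R Bob)) (x Bob) = f Bob" for x
      using fl[of Charlie] C by (simp add: index_eq_iff)
    have lhs: "pull Bob (V Bob) (g Bob) (pull Alice (V Alice) (g Alice) \<tau>) x y
      = (if x Alice \<in> V Alice \<and> x Bob \<in> V Bob \<and> y Alice \<in> V Alice \<and> y Bob \<in> V Bob then \<tau> (?d x) (?d y) else 0)"
      unfolding pull_def upd by simp
    show "pull Bob (V Bob) (g Bob) (pull Alice (V Alice) (g Alice) \<tau>) x y = tensor R (basis_op f) \<tau> x y"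
    proof (cases "?d x \<in> joint_basis E \<and> ?d y \<in> joint_basis E")
      case True
      then have "drop (length (R p)) (x p) \<in> party_basis (E p)" "drop (length (R p)) (y p) \<in> party_basis (E p)" for p
        by (auto simp: joint_basis_def)
      then show ?thesis unfolding lhs V tensor_def basis_op_def tf by auto
    next
      case False
      then have "\<tau> (?d x) (?d y) = 0" using operatorsD[OF \<tau>] by blast
      then show ?thesis unfolding lhs tensor_def by simp
    qed
  qed
  then show ?thesis using locc_compose[OF A B] unfolding e by blast
qed

lemma sum_joint_basis_AB:
  assumes "R Charlie = []"
  shows "(\<Sum>z\<in>joint_basis R. F z) = (\<Sum>a\<in>party_basis (R Alice). \<Sum>b\<in>party_basis (R Bob).
    F ((\<lambda>p. [])(Alice := a, Bob := b)))"
proof -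
  have e: "R(Alice := [], Bob := []) = (\<lambda>p. [])" using assms by (auto simp: index_eq_iff)
  have "(\<Sum>z\<in>joint_basis R. F z) = (\<Sum>z\<in>joint_basis (R(Alice := [])). \<Sum>a\<in>party_basis (R Alice). F (z(Alice := a)))"
    by (rule sum_joint_basis_upd)
  also have "\<dots> = (\<Sum>b\<in>party_basis (R Bob). \<Sum>a\<in>party_basis (R Alice). F ((\<lambda>p. [])(Bob := b, Alice := a)))"
    unfolding sum_joint_basis_upd[of _ "R(Alice := [])" Bob] e joint_basis_trivial by (simp add: fun_upd_def)
  also have "\<dots> = (\<Sum>a\<in>party_basis (R Alice). \<Sum>b\<in>party_basis (R Bob). F ((\<lambda>p. [])(Bob := b, Alice := a)))"
    by (rule sum.swap)
  finally show ?thesis by (simp add: fun_upd_twist[of Alice Bob])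
qed

lemma locc_discard_prefix:
  assumes P: "{Alice, Bob} \<subseteq> P" and C: "R Charlie = []"
  shows "\<exists>\<Lambda>. locc P (join R E) E \<Lambda>
    \<and> (\<forall>\<rho>. \<forall>\<tau>\<in>joint_ops E. \<Lambda> (tensor R \<rho> \<tau>) = (\<lambda>x y. joint_trace R \<rho> * \<tau> x y))"
proof -
  define Q where "Q = (\<lambda>p \<rho> x y. \<Sum>l\<in>party_basis (R p). pull p (party_basis (E p)) (\<lambda>w. l @ w) \<rho> x y)"
  have Qd: "Q p \<rho> x y = (\<Sum>l\<in>party_basis (R p). pull p (party_basis (E p)) (\<lambda>w. l @ w) \<rho> x y)" for p \<rho> x y
    by (simp add: Q_def)
  have single: "locc P F (F(p := E p)) (Q p)" if p: "p \<in> P" and F: "F p = R p @ E p" for p F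
  proof -
    have "locc P F (F(p := E p)) (\<lambda>\<rho> x y. \<Sum>k\<in>{()}. (\<lambda>\<rho>. \<rho>)
      (\<lambda>x y. of_real 1 * (\<Sum>l\<in>party_basis (R p). pull p (party_basis (E p)) (\<lambda>w. l @ w) \<rho> x y)) x y)"
    proof (rule locc_pull[OF p, where es = "\<lambda>k. E p"])
      show "locc P (F(p := E p)) (F(p := E p)) (\<lambda>\<rho>. \<rho>)" by (rule locc.stop)
      fix l assume "l \<in> party_basis (R p)"
      then show "inj_on (\<lambda>w. l @ w) (party_basis (E p)) \<and> (\<lambda>w. l @ w) ` party_basis (E p) \<subseteq> party_basis (F p)"
        using F by (auto simp: inj_on_def append_in_party_basis)
    next
      fix u assume u: "u \<in> party_basis (F p)"
      have "u \<in> (\<lambda>w. l @ w) ` party_basis (E p) \<longleftrightarrow> l = take (length (R p)) u" if l: "l \<in> party_basis (R p)" for l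
      proof
        assume "u \<in> (\<lambda>w. l @ w) ` party_basis (E p)"
        then show "l = take (length (R p)) u" using party_basis_length[OF l] by auto
      next
        assume "l = take (length (R p)) u"
        then have "u = l @ drop (length (R p)) u" by simp
        moreover have "drop (length (R p)) u \<in> party_basis (E p)" using u F by (simp add: party_basis_append_iff)
        ultimately show "u \<in> (\<lambda>w. l @ w) ` party_basis (E p)" by blast
      qed
      then have "(\<Sum>l\<in>party_basis (R p). if u \<in> (\<lambda>w. l @ w) ` party_basis (E p) then 1 else 0)
        = (\<Sum>l\<in>party_basis (R p). if l = take (length (R p)) u then 1 else (0 :: real))"
        by (intro sum.cong refl) simp
      then show "(\<Sum>k\<in>{()}. \<Sum>l\<in>party_basis (R p). if u \<in> (\<lambda>w. l @ w) ` party_basis (E p) then 1 else 0) = (1 :: real)"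
        using u F by (simp add: party_basis_append_iff)
    qed auto
    then show ?thesis by (simp add: Q_def[abs_def])
  qed
  let ?F = "(join R E)(Alice := E Alice)"
  have A: "locc P (join R E) ?F (Q Alice)" using P by (intro single) auto
  have B: "locc P ?F (?F(Bob := E Bob)) (Q Bob)" using P by (intro single) auto
  have e: "?F(Bob := E Bob) = E" using C by (auto simp: index_eq_iff)
  have "Q Bob (Q Alice (tensor R \<rho> \<tau>)) = (\<lambda>x y. joint_trace R \<rho> * \<tau> x y)" if \<tau>: "\<tau> \<in> joint_ops E" for \<rho> \<tau>
  proof (intro ext)
    fix x y :: index
    show "Q Bob (Q Alice (tensor R \<rho> \<tau>)) x y = joint_trace R \<rho> * \<tau> x y"
    proof (cases "x \<in> joint_basis E \<and> y \<in> joint_basis E")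
      case True
      then have E: "x p \<in> party_basis (E p)" "y p \<in> party_basis (E p)" for p by (auto simp: joint_basis_def)
      have "Q Bob (Q Alice (tensor R \<rho> \<tau>)) x y = (\<Sum>b\<in>party_basis (R Bob). \<Sum>a\<in>party_basis (R Alice).
         tensor R \<rho> \<tau> (x(Bob := b @ x Bob, Alice := a @ x Alice)) (y(Bob := b @ y Bob, Alice := a @ y Alice)))"
        unfolding Q_def pull_def by (simp add: E)
      also have "\<dots> = (\<Sum>b\<in>party_basis (R Bob). \<Sum>a\<in>party_basis (R Alice).
          \<rho> ((\<lambda>p. [])(Alice := a, Bob := b)) ((\<lambda>p. [])(Alice := a, Bob := b)) * \<tau> x y)"
      proof (intro sum.cong refl)
        fix a b assume ab: "b \<in> party_basis (R Bob)" "a \<in> party_basis (R Alice)"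
        have "(\<lambda>p. take (length (R p)) ((x(Bob := b @ x Bob, Alice := a @ x Alice)) p)) = (\<lambda>p. [])(Alice := a, Bob := b)"
          "(\<lambda>p. drop (length (R p)) ((x(Bob := b @ x Bob, Alice := a @ x Alice)) p)) = x" for x :: index
          using party_basis_length[OF ab(1)] party_basis_length[OF ab(2)] C by (simp_all add: index_eq_iff)
        then show "tensor R \<rho> \<tau> (x(Bob := b @ x Bob, Alice := a @ x Alice)) (y(Bob := b @ y Bob, Alice := a @ y Alice))
          = \<rho> ((\<lambda>p. [])(Alice := a, Bob := b)) ((\<lambda>p. [])(Alice := a, Bob := b)) * \<tau> x y"
          unfolding tensor_def by simp
      qed
      also have "\<dots> = (\<Sum>a\<in>party_basis (R Alice). \<Sum>b\<in>party_basis (R Bob).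
          \<rho> ((\<lambda>p. [])(Alice := a, Bob := b)) ((\<lambda>p. [])(Alice := a, Bob := b)) * \<tau> x y)"
        by (rule sum.swap)
      also have "\<dots> = joint_trace R \<rho> * \<tau> x y"
        unfolding op_trace_def sum_joint_basis_AB[where R = R, OF C] sum_distrib_right ..
      finally show ?thesis .
    next
      case False
      then have z: "\<tau> x y = 0" using operatorsD[OF \<tau>] by blast
      have "pull Bob (party_basis (E Bob)) (\<lambda>w. b @ w) (Q Alice (tensor R \<rho> \<tau>)) x y = 0" if b: "b \<in> party_basis (R Bob)" for b
      proof -
        have "pull Alice (party_basis (E Alice)) (\<lambda>w. a @ w) (tensor R \<rho> \<tau>) (x(Bob := b @ x Bob)) (y(Bob := b @ y Bob)) = 0"
          if a: "a \<in> party_basis (R Alice)" for a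
        proof -
          have "(\<lambda>p. drop (length (R p)) ((x(Bob := b @ x Bob, Alice := a @ x Alice)) p)) = x" for x :: index
            using party_basis_length[OF a] party_basis_length[OF b] C by (simp_all add: index_eq_iff)
          then show ?thesis unfolding pull_def tensor_def using z by simp
        qed
        then show ?thesis by (simp add: pull_def Q_def)
      qed
      then show ?thesis unfolding Qd[of Bob] using z by simp
    qed
  qed
  then show ?thesis using locc_compose[OF A B] unfolding e by blast
qed


subsection \<open>Mixing with a flagged product state\<close>

lemma close_ops_density:
  assumes "joint_psd D A" "joint_trace D A = 1" "joint_psd D B" "joint_trace D B = 1"
  shows "close_ops D 2 A B"
  unfolding close_ops_def using assms by (intro exI[of _ A] exI[of _ B]) auto

lemma trivial_density:
  assumes "joint_psd (\<lambda>p. []) A" "joint_trace (\<lambda>p. []) A = 1"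
  shows "A = op_id {\<lambda>p. []}"
proof (intro ext)
  fix x y
  show "A x y = op_id {\<lambda>p. []} x y"
  proof (cases "x = (\<lambda>p. []) \<and> y = (\<lambda>p. [])")
    case True
    then show ?thesis using assms(2) by (simp add: joint_basis_trivial op_trace_def op_id_def)
  next
    case False
    then have "A x y = 0"
      using operatorsD[OF positive_opD(1)[OF assms(1)], of x y] by (auto simp: joint_basis_trivial)
    then show ?thesis using False by (auto simp: op_id_def)
  qed
qed

text \<open>A conversion of k copies of \<tau> into nearly n copies of \<rho> is run before a
  protocol for \<rho>. The errors add because protocols contract the distance.\<close>

lemma key_achievable_transfer:
  assumes \<rho>: "joint_psd D \<rho>" and \<tau>: "joint_psd D \<tau>"
    and \<Theta>: "locc {Alice, Bob} (power_dims D k) (power_dims D n) \<Theta>"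
    and c: "close_ops (power_dims D n) \<delta> (\<Theta> (tensor_power D \<tau> k)) (tensor_power D \<rho> n)"
  shows "key_achievable D \<rho> n \<epsilon> \<subseteq> key_achievable D \<tau> k (\<delta> + \<epsilon>)"
proof
  fix m assume "m \<in> key_achievable D \<rho> n \<epsilon>"
  then obtain a b \<Lambda> \<gamma> where \<Lambda>: "\<gamma> \<in> private_states m a b"
      "locc {Alice, Bob} (power_dims D n) (key_shield (2 ^ m) a b) \<Lambda>"
      "close_ops (key_shield (2 ^ m) a b) \<epsilon> (\<Lambda> (tensor_power D \<rho> n)) \<gamma>"
    unfolding key_achievable_iff[OF \<rho>] by blast
  have "close_ops (key_shield (2 ^ m) a b) (\<delta> + \<epsilon>) (\<Lambda> (\<Theta> (tensor_power D \<tau> k))) \<gamma>"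
    using close_ops_trans[OF close_ops_locc[OF \<Lambda>(2) c] \<Lambda>(3)] .
  then show "m \<in> key_achievable D \<tau> k (\<delta> + \<epsilon>)"
    unfolding key_achievable_iff[OF \<tau>] using \<Lambda>(1) locc_compose[OF \<Theta> \<Lambda>(2)] by blast
qed

lemma distillable_key_nonneg:
  assumes C: "D Charlie = []" and \<rho>: "density_op (joint_basis D) \<rho>"
  shows "0 \<le> distillable_key D \<rho>"
proof -
  have p: "joint_psd D \<rho>" "joint_trace D \<rho> = 1" using \<rho> by (auto simp: density_op_def)
  have "0 \<in> key_achievable D \<rho> n \<epsilon>" if "\<epsilon> > 0" for n \<epsilon>
  proof -
    have "concat (replicate n []) = []" for n :: nat by (induction n) auto
    then have Cn: "power_dims D n Charlie = key_shield (2 ^ 0) 1 1 Charlie" using C by (simp add: power_dims_def)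
    have "ks_index 0 0 (0,0) \<in> joint_basis (key_shield (2 ^ 0) 1 1)" by (simp add: joint_basis_key_shield_iff)
    then obtain \<Lambda> where l: "locc {Alice, Bob} (power_dims D n) (key_shield (2 ^ 0) 1 1) \<Lambda>"
      using locc_exists[of "{Alice, Bob}" "power_dims D n" "key_shield (2 ^ 0) 1 1", OF _ Cn] by blast
    let ?\<alpha> = "\<Lambda> (tensor_power D \<rho> n)"
    have ops: "?\<alpha> \<in> joint_ops (key_shield (2 ^ 0) 1 1)"
      using positive_opD(1)[OF locc_psd[OF l tensor_power_psd[OF p(1)]]] .
    have tr: "joint_trace (key_shield (2 ^ 0) 1 1) ?\<alpha> = 1"
      using locc_trace[OF l] tensor_power_trace[of D n \<rho>] p(2) by simp
    have "?\<alpha> x y = op_id (joint_basis (key_shield 1 1 1)) x y" for x y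
    proof -
      have "?\<alpha> (ks_index 0 0 (0,0)) (ks_index 0 0 (0,0)) = 1"
      proof -
        have "{..<Suc 0} \<times> {..<Suc 0} = {(0, 0)}" by auto
        then show ?thesis using tr by (simp add: op_trace_def sum_joint_basis_key_shield)
      qed
      then show ?thesis using operatorsD[OF ops, of x y]
        by (auto simp: op_id_def joint_basis_key_shield_iff)
    qed
    then have "?\<alpha> = op_id (joint_basis (key_shield 1 1 1))" by (intro ext)
    then have "close_ops (key_shield (2 ^ 0) 1 1) \<epsilon> ?\<alpha> (op_id (joint_basis (key_shield 1 1 1)))"
      using that by (simp add: close_ops_refl)
    then show ?thesis
      unfolding key_achievable_iff[OF p(1)] using op_id_private_state l by blast
  qed
  then have "ereal 0 \<le> rate (key_achievable D \<rho>)"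
    by (intro rate_ge always_eventually allI bexI[of _ 0]) auto
  then show ?thesis by (simp add: zero_ereal_def distillable_key_eq)
qed

section \<open>Conversions between a state and its flagged mixture\<close>

definition flag_mix :: "real \<Rightarrow> joint_op \<Rightarrow> index \<Rightarrow> joint_op" where
  "flag_mix t \<rho> f = (\<lambda>x y. of_real t * \<rho> x y + of_real (1 - t) * basis_op f x y)"

lemma flag_mix_density:
  assumes "joint_psd D \<rho>" "joint_trace D \<rho> = 1" "f \<in> joint_basis D" "0 \<le> t" "t \<le> 1"
  shows "joint_psd D (flag_mix t \<rho> f)" "joint_trace D (flag_mix t \<rho> f) = 1"
proof -
  show "joint_psd D (flag_mix t \<rho> f)"
    unfolding flag_mix_def using assms by (intro positive_op_add positive_op_scale basis_op_density) auto
  have "joint_trace D (flag_mix t \<rho> f) = of_real t * joint_trace D \<rho> + of_real (1 - t) * joint_trace D (basis_op f)"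
    by (simp add: op_trace_def flag_mix_def sum.distrib sum_distrib_left)
  then show "joint_trace D (flag_mix t \<rho> f) = 1" using assms(2) basis_op_density(2)[OF assms(3)] by simp
qed

lemma tensor_flag_mix:
  "tensor D (flag_mix t \<rho> f) \<tau> = (\<lambda>x y. of_real t * tensor D \<rho> \<tau> x y + of_real (1 - t) * tensor D (basis_op f) \<tau> x y)"
  by (simp add: tensor_def flag_mix_def algebra_simps fun_eq_iff)

lemma dims_Charlie_power: "D Charlie = [] \<Longrightarrow> power_dims D n Charlie = []"
  by (induction n) (simp_all add: power_dims_def)

context
  fixes D :: dims and \<rho> :: joint_op and f :: index and t :: real
  assumes C: "D Charlie = []" and \<rho>: "joint_psd D \<rho>" "joint_trace D \<rho> = 1"
    and f: "f \<in> joint_basis D" and t: "0 \<le> t" "t \<le> 1"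
begin

text \<open>The trivial system carries a single state, so a target of zero copies is hit
  exactly.\<close>

lemma discard_all:
  assumes "joint_psd (power_dims D k) \<tau>" "joint_trace (power_dims D k) \<tau> = 1" "\<delta> \<ge> 0"
  shows "\<exists>\<Theta>. locc {Alice, Bob} (power_dims D k) (power_dims D 0) \<Theta>
    \<and> close_ops (power_dims D 0) \<delta> (\<Theta> \<tau>) (tensor_power D \<sigma> 0)"
proof -
  obtain \<Theta> where l: "locc {Alice, Bob} (power_dims D k) (\<lambda>p. []) \<Theta>"
    using locc_exists[of "{Alice, Bob}" "power_dims D k" "\<lambda>p. []"] dims_Charlie_power[where D = D, OF C]
    by (auto simp: joint_basis_trivial)
  have "\<Theta> \<tau> = op_id {\<lambda>p. []}"
    using trivial_density locc_psd[OF l assms(1)] locc_trace[OF l] assms(2) by simp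
  then have "close_ops (power_dims D 0) \<delta> (\<Theta> \<tau>) (tensor_power D \<sigma> 0)"
    using assms(3) by (simp add: close_ops_refl)
  then show ?thesis using l by auto
qed

text \<open>Toss a coin for each of the n positions and use up a copy of \<rho> with probability t.
  The simulation fails only if more than k copies are called for; by Markov this has probability at
  most E[z^X] / z^(k+1) = (1 - t + t z)^n / z^(k+1) for binomial X. The induction carries this bound
  B directly, since it obeys the recursion of the protocol, B(n+1, k+1) = t B(n, k) + (1 - t) B(n,
  k+1).\<close>

lemma simulate_flag_mix:
  assumes z: "z \<ge> 1"
  shows "\<exists>\<Theta>. locc {Alice, Bob} (power_dims D k) (power_dims D n) \<Theta>
    \<and> close_ops (power_dims D n) (2 * (1 - t + t * z) ^ n / z ^ Suc k)
        (\<Theta> (tensor_power D \<rho> k)) (tensor_power D (flag_mix t \<rho> f) n)"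
proof (induction n arbitrary: k)
  case 0
  show ?case using tensor_power_psd[OF \<rho>(1), of k] tensor_power_trace[of D k \<rho>] \<rho>(2) z
    by (intro discard_all) auto
next
  case (Suc n)
  let ?\<omega> = "flag_mix t \<rho> f" and ?y = "1 - t + t * z"
  let ?W = "tensor_power D ?\<omega> n"
  have y: "?y \<ge> 1" using z t by (simp add: mult_left_mono[of 1 z t, simplified])
  note fd = flag_mix_density[OF \<rho> f t] and bd = basis_op_density[OF f]
  obtain A where A: "locc {Alice, Bob} (power_dims D n) (join D (power_dims D n)) A"
    "\<forall>\<tau>\<in>joint_ops (power_dims D n). A \<tau> = tensor D (basis_op f) \<tau>"
    using locc_prepend[of "{Alice, Bob}" f D "power_dims D n", OF _ f C] by auto
  have "\<exists>\<Theta>. locc {Alice, Bob} (power_dims D k) (join D (power_dims D n)) \<Theta>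
    \<and> close_ops (join D (power_dims D n)) (2 * ?y ^ Suc n / z ^ Suc k) (\<Theta> (tensor_power D \<rho> k)) (tensor D ?\<omega> ?W)"
  proof (cases k)
    \<comment> \<open>No copies are left. The flag is output in any case, which is wrong with
      probability t and then at distance at most 2.\<close>
    case 0
    obtain \<Theta> where \<Theta>: "locc {Alice, Bob} (power_dims D 0) (power_dims D n) \<Theta>"
      "close_ops (power_dims D n) (2 * ?y ^ n / z ^ Suc 0) (\<Theta> (tensor_power D \<rho> 0)) ?W"
      using Suc[of 0] by (elim exE conjE) (rule that)
    let ?B = "\<Theta> (tensor_power D \<rho> 0)"
    have Bp: "joint_psd (power_dims D n) ?B" by (rule locc_psd[OF \<Theta>(1) tensor_power_psd[OF \<rho>(1)]])
    have Bt: "joint_trace (power_dims D n) ?B = 1"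
      unfolding locc_trace[OF \<Theta>(1)] tensor_power_trace \<rho>(2) by simp
    have c1: "close_ops (join D (power_dims D n)) 2 (tensor D (basis_op f) ?B) (tensor D \<rho> ?W)"
      using Bp Bt bd \<rho> fd by (intro close_ops_density) (simp_all add: tensor_psd tensor_trace tensor_power_psd tensor_power_trace)
    have c2: "close_ops (join D (power_dims D n)) (2 * ?y ^ n / z ^ Suc 0) (tensor D (basis_op f) ?B) (tensor D (basis_op f) ?W)"
      by (rule close_ops_tensor[OF bd \<Theta>(2)])
    have "close_ops (join D (power_dims D n)) (t * 2 + (1 - t) * (2 * ?y ^ n / z ^ Suc 0))
       (\<lambda>x y. of_real t * tensor D (basis_op f) ?B x y + of_real (1 - t) * tensor D (basis_op f) ?B x y) (tensor D ?\<omega> ?W)"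
      unfolding tensor_flag_mix using t by (intro close_ops_convex[OF c1 c2]) auto
    also have "(\<lambda>x y. of_real t * tensor D (basis_op f) ?B x y + of_real (1 - t) * tensor D (basis_op f) ?B x y) = A ?B"
      using A(2) positive_opD(1)[OF Bp] by (simp add: fun_eq_iff algebra_simps)
    finally have "close_ops (join D (power_dims D n)) (t * 2 + (1 - t) * (2 * ?y ^ n / z ^ Suc 0)) (A ?B) (tensor D ?\<omega> ?W)" .
    moreover have "t * 2 + (1 - t) * (2 * ?y ^ n / z ^ Suc 0) \<le> 2 * ?y ^ Suc n / z ^ Suc k"
    proof -
      have "1 \<le> ?y ^ n" using y by (rule one_le_power)
      then have "t * 2 * 1 \<le> t * 2 * ?y ^ n" using t by (intro mult_left_mono) auto
      moreover have "2 * ?y ^ Suc n / z ^ Suc k = t * 2 * ?y ^ n + (1 - t) * (2 * ?y ^ n / z ^ Suc 0)"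
        using z 0 by (simp add: field_simps)
      ultimately show ?thesis by simp
    qed
    ultimately show ?thesis
      using locc_compose[OF \<Theta>(1) A(1)] 0 by (intro exI[of _ "\<lambda>\<rho>. A (\<Theta> \<rho>)"]) (auto intro: close_ops_mono)
  next
    case (Suc k')
    obtain \<Theta>1 where \<Theta>1: "locc {Alice, Bob} (power_dims D k') (power_dims D n) \<Theta>1"
      "close_ops (power_dims D n) (2 * ?y ^ n / z ^ Suc k') (\<Theta>1 (tensor_power D \<rho> k')) ?W"
      using Suc.IH[of k'] by (elim exE conjE) (rule that)
    obtain \<Theta>2 where \<Theta>2: "locc {Alice, Bob} (power_dims D k) (power_dims D n) \<Theta>2"
      "close_ops (power_dims D n) (2 * ?y ^ n / z ^ Suc k) (\<Theta>2 (tensor_power D \<rho> k)) ?W"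
      using Suc.IH[of k] by (elim exE conjE) (rule that)
    obtain \<Lambda>1 where \<Lambda>1: "locc {Alice, Bob} (join D (power_dims D k')) (join D (power_dims D n)) \<Lambda>1"
      "\<forall>\<rho>\<in>joint_ops D. \<forall>\<tau>. \<Lambda>1 (tensor D \<rho> \<tau>) = tensor D \<rho> (\<Theta>1 \<tau>)"
      using locc_context[where R = D, OF \<Theta>1(1)] by (elim exE conjE) (rule that)
    note \<Lambda>2 = locc_compose[OF \<Theta>2(1) A(1)]
    have \<Lambda>1': "locc {Alice, Bob} (power_dims D k) (join D (power_dims D n)) \<Lambda>1" using \<Lambda>1(1) Suc by simp
    obtain \<Theta> where \<Theta>: "locc {Alice, Bob} (power_dims D k) (join D (power_dims D n)) \<Theta>"
      "\<forall>\<rho>\<in>joint_ops (power_dims D k). \<Theta> \<rho> = (\<lambda>x y. of_real t * \<Lambda>1 \<rho> x y + of_real (1 - t) * A (\<Theta>2 \<rho>) x y)"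
      using locc_mix[OF _ t \<Lambda>1' \<Lambda>2, of Alice] by auto
    let ?R = "tensor_power D \<rho> k"
    have Rp: "joint_psd (power_dims D k) ?R" by (rule tensor_power_psd[OF \<rho>(1)])
    have e1: "\<Lambda>1 ?R = tensor D \<rho> (\<Theta>1 (tensor_power D \<rho> k'))"
      using \<Lambda>1(2) positive_opD(1)[OF \<rho>(1)] Suc by simp
    have e2: "A (\<Theta>2 ?R) = tensor D (basis_op f) (\<Theta>2 ?R)"
      using A(2) positive_opD(1)[OF locc_psd[OF \<Theta>2(1) Rp]] by simp
    have "close_ops (join D (power_dims D n)) (t * (2 * ?y ^ n / z ^ Suc k') + (1 - t) * (2 * ?y ^ n / z ^ Suc k))
      (\<lambda>x y. of_real t * \<Lambda>1 ?R x y + of_real (1 - t) * A (\<Theta>2 ?R) x y) (tensor D ?\<omega> ?W)"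
      unfolding tensor_flag_mix e1 e2 using t
      by (intro close_ops_convex close_ops_tensor \<rho> bd \<Theta>1(2) \<Theta>2(2)) auto
    moreover have "t * (2 * ?y ^ n / z ^ Suc k') + (1 - t) * (2 * ?y ^ n / z ^ Suc k) = 2 * ?y ^ Suc n / z ^ Suc k"
      using z Suc by (simp add: field_simps)
    ultimately show ?thesis using \<Theta> positive_opD(1)[OF Rp] by (intro exI[of _ \<Theta>]) simp
  qed
  then have "\<exists>\<Theta>. locc {Alice, Bob} (power_dims D k) (power_dims D (Suc n)) \<Theta>
    \<and> close_ops (power_dims D (Suc n)) (2 * ?y ^ Suc n / z ^ Suc k) (\<Theta> (tensor_power D \<rho> k)) (tensor_power D ?\<omega> (Suc n))"
    by simp
  then show ?case .
qed

context
  fixes G :: "nat list set"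
  assumes G: "\<And>x y. \<rho> x y \<noteq> 0 \<Longrightarrow> x Alice \<in> G \<and> y Alice \<in> G" and fG: "f Alice \<notin> G"
begin

text \<open>On Alice's side \<rho> lives on indices in \<open>G\<close> and the flag outside, so her
  projective measurement tells the two apart without disturbing either.\<close>

lemma measure_flag:
  assumes 1: "locc {Alice, Bob} (join D E) F \<Lambda>1" and 2: "locc {Alice, Bob} (join D E) F \<Lambda>2"
  shows "\<exists>\<Theta>. locc {Alice, Bob} (join D E) F \<Theta> \<and> (\<forall>\<tau>\<in>joint_ops E. \<Theta> (tensor D (flag_mix t \<rho> f) \<tau>)
     = (\<lambda>x y. of_real t * \<Lambda>1 (tensor D \<rho> \<tau>) x y + of_real (1 - t) * \<Lambda>2 (tensor D (basis_op f) \<tau>) x y))"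
proof -
  define V where "V = (\<lambda>b. {u \<in> party_basis (join D E Alice). (take (length (D Alice)) u \<in> G) = b})"
  define \<Lambda> where "\<Lambda> = (\<lambda>b. if b then \<Lambda>1 else \<Lambda>2)"
  define \<Theta> where "\<Theta> = (\<lambda>\<rho> x y. \<Sum>k\<in>UNIV. \<Lambda> k (\<lambda>x y. of_real 1 * (\<Sum>l\<in>{()}. pull Alice (V k) (\<lambda>w. w) \<rho> x y)) x y)"
  have l: "locc {Alice, Bob} (join D E) F \<Theta>"
    unfolding \<Theta>_def
  proof (rule locc_pull[where es = "\<lambda>k. join D E Alice"])
    fix k show "locc {Alice, Bob} ((join D E)(Alice := join D E Alice)) F (\<Lambda> k)"
      using 1 2 by (simp add: \<Lambda>_def del: join_apply)
    fix u assume "u \<in> party_basis (join D E Alice)"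
    then show "(\<Sum>k\<in>UNIV. \<Sum>l\<in>{()}. if u \<in> (\<lambda>w. w) ` V k then 1 else 0) = (1 :: real)"
      by (auto simp: V_def UNIV_bool)
  qed (auto simp: V_def)
  have "\<Theta> (tensor D (flag_mix t \<rho> f) \<tau>)
     = (\<lambda>x y. of_real t * \<Lambda>1 (tensor D \<rho> \<tau>) x y + of_real (1 - t) * \<Lambda>2 (tensor D (basis_op f) \<tau>) x y)"
    if \<tau>: "\<tau> \<in> joint_ops E" for \<tau>
  proof -
    let ?T = "tensor D (flag_mix t \<rho> f) \<tau>"
    have ops: "tensor D \<rho> \<tau> \<in> joint_ops (join D E)" "tensor D (basis_op f) \<tau> \<in> joint_ops (join D E)"
      using tensor_operators[OF positive_opD(1)[OF \<rho>(1)] \<tau>]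
        tensor_operators[OF positive_opD(1)[OF basis_op_density(1)[OF f]] \<tau>] by auto
    have jb: "x Alice \<in> party_basis (join D E Alice)" if "x \<in> joint_basis (join D E)" for x
      using that by (simp add: joint_basis_def)
    have z1: "tensor D \<rho> \<tau> x y = 0" if "x Alice \<notin> V True \<or> y Alice \<notin> V True" for x y
    proof (rule ccontr)
      assume n: "tensor D \<rho> \<tau> x y \<noteq> 0"
      then have "x Alice \<in> party_basis (join D E Alice)" "y Alice \<in> party_basis (join D E Alice)"
        using operatorsD[OF ops(1)] jb by blast+
      moreover have "take (length (D Alice)) (x Alice) \<in> G" "take (length (D Alice)) (y Alice) \<in> G"
        using n G by (auto simp: tensor_def)
      ultimately show False using that by (simp add: V_def)
    qed
    have z2: "tensor D (basis_op f) \<tau> x y = 0" if "x Alice \<notin> V False \<or> y Alice \<notin> V False" for x y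
    proof (rule ccontr)
      assume n: "tensor D (basis_op f) \<tau> x y \<noteq> 0"
      then have "x Alice \<in> party_basis (join D E Alice)" "y Alice \<in> party_basis (join D E Alice)"
        using operatorsD[OF ops(2)] jb by blast+
      moreover have "(\<lambda>p. take (length (D p)) (x p)) = f" "(\<lambda>p. take (length (D p)) (y p)) = f"
        using n by (auto simp: tensor_def basis_op_def)
      then have "take (length (D Alice)) (x Alice) = f Alice" "take (length (D Alice)) (y Alice) = f Alice"
        by (auto dest: fun_cong[of _ _ Alice])
      ultimately show False using that fG by (simp add: V_def)
    qed
    have dis: "u \<notin> V True \<or> u \<notin> V False" for u by (auto simp: V_def)
    have p1: "pull Alice (V True) (\<lambda>w. w) ?T = (\<lambda>x y. of_real t * tensor D \<rho> \<tau> x y)"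
    proof (intro ext)
      fix x y
      show "pull Alice (V True) (\<lambda>w. w) ?T x y = of_real t * tensor D \<rho> \<tau> x y"
      proof (cases "x Alice \<in> V True \<and> y Alice \<in> V True")
        case True
        then have "tensor D (basis_op f) \<tau> x y = 0" using z2[of x y] dis by blast
        then show ?thesis using True by (simp add: pull_def tensor_flag_mix)
      next
        case False
        then have "tensor D \<rho> \<tau> x y = 0" using z1[of x y] by blast
        then show ?thesis using False by (auto simp: pull_def)
      qed
    qed
    have p2: "pull Alice (V False) (\<lambda>w. w) ?T = (\<lambda>x y. of_real (1 - t) * tensor D (basis_op f) \<tau> x y)"
    proof (intro ext)
      fix x y
      show "pull Alice (V False) (\<lambda>w. w) ?T x y = of_real (1 - t) * tensor D (basis_op f) \<tau> x y"
      proof (cases "x Alice \<in> V False \<and> y Alice \<in> V False")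
        case True
        then have "tensor D \<rho> \<tau> x y = 0" using z1[of x y] dis by blast
        then show ?thesis using True by (simp add: pull_def tensor_flag_mix)
      next
        case False
        then have "tensor D (basis_op f) \<tau> x y = 0" using z2[of x y] by blast
        then show ?thesis using False by (auto simp: pull_def)
      qed
    qed
    have s: "\<Lambda>' (\<lambda>x y. of_real c * \<sigma> x y) x y = of_real c * \<Lambda>' \<sigma> x y" if "locc {Alice, Bob} (join D E) F \<Lambda>'" for \<Lambda>' c x y \<sigma>
      using linear_mapD[OF locc_linear[OF that], of "of_real c" \<sigma> 0] by simp
    show ?thesis
      unfolding \<Theta>_def using 1 2 by (simp add: UNIV_bool \<Lambda>_def p1 p2 s add.commute del: of_real_diff)
  qed
  then show ?thesis using l by blast
qed

text \<open>The mirror image: measure the flags one by one and keep the unflagged copies. Failure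
  means fewer than k of them among n, of probability at most E[z^(k - X)] = (1 - t + t / z)^n z^k
  for z \<ge> 1, and this expression again obeys the recursion of the protocol.\<close>

lemma extract_flag_mix:
  assumes z: "z \<ge> 1"
  shows "\<exists>\<Theta>. locc {Alice, Bob} (power_dims D n) (power_dims D k) \<Theta>
    \<and> close_ops (power_dims D k) (2 * (1 - t + t / z) ^ n * z ^ k)
        (\<Theta> (tensor_power D (flag_mix t \<rho> f) n)) (tensor_power D \<rho> k)"
proof (induction n arbitrary: k)
  case 0
  have "joint_trace (power_dims D k) (tensor_power D \<rho> k) = 1" by (simp add: tensor_power_trace \<rho>)
  then have ne: "joint_basis (power_dims D k) \<noteq> {}" by (auto simp: op_trace_def)
  obtain \<Theta> where l: "locc {Alice, Bob} (power_dims D 0) (power_dims D k) \<Theta>"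
    using locc_exists[of "{Alice, Bob}" "power_dims D 0" "power_dims D k", OF _ _ ne] dims_Charlie_power[where D = D, OF C] by auto
  let ?O = "tensor_power D (flag_mix t \<rho> f) 0"
  note fd = flag_mix_density[OF \<rho> f t]
  \<comment> \<open>Nothing is left to measure; the trivial distance 2 is within the bound because z
    \<ge> 1.\<close>
  have "close_ops (power_dims D k) 2 (\<Theta> ?O) (tensor_power D \<rho> k)"
    using locc_psd[OF l tensor_power_psd[OF fd(1)]] locc_trace[OF l, of ?O] tensor_power_trace[of D 0 "flag_mix t \<rho> f"]
      tensor_power_psd[OF \<rho>(1)]
    by (intro close_ops_density) (simp_all add: tensor_power_trace \<rho>)
  moreover have "2 \<le> 2 * (1 - t + t / z) ^ 0 * z ^ k" using z by simp
  ultimately show ?case using l close_ops_mono by blast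
next
  case (Suc n)
  let ?\<omega> = "flag_mix t \<rho> f" and ?y = "1 - t + t / z"
  let ?W = "tensor_power D ?\<omega> n"
  have y: "?y \<ge> 0" using z t by simp
  note fd = flag_mix_density[OF \<rho> f t] and bd = basis_op_density[OF f]
  have "\<exists>\<Theta>. locc {Alice, Bob} (join D (power_dims D n)) (power_dims D k) \<Theta>
    \<and> close_ops (power_dims D k) (2 * ?y ^ Suc n * z ^ k) (\<Theta> (tensor D ?\<omega> ?W)) (tensor_power D \<rho> k)"
  proof (cases k)
    case 0
    have "joint_psd (power_dims D (Suc n)) (tensor_power D ?\<omega> (Suc n))" "joint_trace (power_dims D (Suc n)) (tensor_power D ?\<omega> (Suc n)) = 1"
      by (simp_all only: tensor_power_psd[OF fd(1)] tensor_power_trace fd(2) power_one)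
    from discard_all[OF this, of "2 * ?y ^ Suc n * z ^ k" \<rho>] show ?thesis using y z 0 by simp
  next
    case (Suc k')
    obtain \<Theta>1 where \<Theta>1: "locc {Alice, Bob} (power_dims D n) (power_dims D k') \<Theta>1"
      "close_ops (power_dims D k') (2 * ?y ^ n * z ^ k') (\<Theta>1 ?W) (tensor_power D \<rho> k')"
      using Suc.IH[of k'] by (elim exE conjE) (rule that)
    obtain \<Theta>2 where \<Theta>2: "locc {Alice, Bob} (power_dims D n) (power_dims D k) \<Theta>2"
      "close_ops (power_dims D k) (2 * ?y ^ n * z ^ k) (\<Theta>2 ?W) (tensor_power D \<rho> k)"
      using Suc.IH[of k] by (elim exE conjE) (rule that)
    obtain \<Lambda>1 where \<Lambda>1: "locc {Alice, Bob} (join D (power_dims D n)) (join D (power_dims D k')) \<Lambda>1"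
      "\<forall>\<rho>\<in>joint_ops D. \<forall>\<tau>. \<Lambda>1 (tensor D \<rho> \<tau>) = tensor D \<rho> (\<Theta>1 \<tau>)"
      using locc_context[where R = D, OF \<Theta>1(1)] by (elim exE conjE) (rule that)
    have \<Lambda>1': "locc {Alice, Bob} (join D (power_dims D n)) (power_dims D k) \<Lambda>1" using \<Lambda>1(1) Suc by simp
    obtain A where A: "locc {Alice, Bob} (join D (power_dims D n)) (power_dims D n) A"
      "\<forall>\<rho>. \<forall>\<tau>\<in>joint_ops (power_dims D n). A (tensor D \<rho> \<tau>) = (\<lambda>x y. joint_trace D \<rho> * \<tau> x y)"
      using locc_discard_prefix[of "{Alice, Bob}" D "power_dims D n", OF _ C] by auto
    obtain \<Theta> where \<Theta>: "locc {Alice, Bob} (join D (power_dims D n)) (power_dims D k) \<Theta>"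
      "\<forall>\<tau>\<in>joint_ops (power_dims D n). \<Theta> (tensor D (flag_mix t \<rho> f) \<tau>)
     = (\<lambda>x y. of_real t * \<Lambda>1 (tensor D \<rho> \<tau>) x y + of_real (1 - t) * \<Theta>2 (A (tensor D (basis_op f) \<tau>)) x y)"
      using measure_flag[OF \<Lambda>1' locc_compose[OF A(1) \<Theta>2(1)]] by (elim exE conjE) (rule that)
    have Wp: "?W \<in> joint_ops (power_dims D n)" by (rule positive_opD(1)[OF tensor_power_psd[OF fd(1)]])
    have "A (tensor D (basis_op f) ?W) = ?W" using A(2) Wp bd(2) by simp
    moreover have "\<Lambda>1 (tensor D \<rho> ?W) = tensor D \<rho> (\<Theta>1 ?W)" using \<Lambda>1(2) positive_opD(1)[OF \<rho>(1)] by simp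
    ultimately have e: "\<Theta> (tensor D ?\<omega> ?W) = (\<lambda>x y. of_real t * tensor D \<rho> (\<Theta>1 ?W) x y + of_real (1 - t) * \<Theta>2 ?W x y)"
      using \<Theta>(2) Wp by simp
    have c1: "close_ops (power_dims D k) (2 * ?y ^ n * z ^ k') (tensor D \<rho> (\<Theta>1 ?W)) (tensor_power D \<rho> k)"
      using close_ops_tensor[OF \<rho> \<Theta>1(2)] Suc by simp
    have "close_ops (power_dims D k) (t * (2 * ?y ^ n * z ^ k') + (1 - t) * (2 * ?y ^ n * z ^ k)) (\<Theta> (tensor D ?\<omega> ?W))
      (\<lambda>x y. of_real t * tensor_power D \<rho> k x y + of_real (1 - t) * tensor_power D \<rho> k x y)"
      unfolding e using t by (intro close_ops_convex c1 \<Theta>2(2)) auto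
    also have "(\<lambda>x y. of_real t * tensor_power D \<rho> k x y + of_real (1 - t) * tensor_power D \<rho> k x y) = tensor_power D \<rho> k"
      by (simp add: fun_eq_iff algebra_simps)
    also have "t * (2 * ?y ^ n * z ^ k') + (1 - t) * (2 * ?y ^ n * z ^ k) = 2 * ?y ^ Suc n * z ^ k"
      using z Suc by (simp add: field_simps)
    finally show ?thesis using \<Theta>(1) by blast
  qed
  then have "\<exists>\<Theta>. locc {Alice, Bob} (power_dims D (Suc n)) (power_dims D k) \<Theta>
    \<and> close_ops (power_dims D k) (2 * ?y ^ Suc n * z ^ k) (\<Theta> (tensor_power D ?\<omega> (Suc n))) (tensor_power D \<rho> k)"
    by simp
  then show ?case .
qed

end

end

subsection \<open>Concentration bounds\<close>

text \<open>Exponential decay, uniform in k, follows from ln y < (t + \<eta>) ln z for y = 1 - t + t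
  z. With z = 1 + \<eta> / 2 the left side is at most t \<eta> / 2 and ln z \<ge> 1 - 1 / z, so it
  is enough that t z < t + \<eta>, which holds because t \<le> 1.\<close>

lemma chernoff_upper:
  fixes t \<eta> :: real
  assumes t: "0 \<le> t" "t \<le> 1" and \<eta>: "\<eta> > 0"
  shows "\<exists>z\<ge>1. \<forall>\<epsilon>>0. \<forall>\<^sub>F n in sequentially. \<forall>k. (t + \<eta>) * real n \<le> real k \<longrightarrow> (1 - t + t * z) ^ n / z ^ k \<le> \<epsilon>"
proof -
  define z where "z = 1 + \<eta> / 2"
  have z: "z > 1" using \<eta> by (simp add: z_def)
  define y where "y = 1 - t + t * z"
  have y1: "y = 1 + t * (\<eta> / 2)" by (simp add: y_def z_def algebra_simps)
  then have y: "y > 0" using t \<eta> by (simp add: add_pos_nonneg)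
  have lny: "ln y \<le> t * (\<eta> / 2)" using ln_le_minus_one[OF y] y1 by simp
  have "ln (1 / z) \<le> 1 / z - 1" using z by (intro ln_le_minus_one) auto
  then have lnz: "1 - 1 / z \<le> ln z" using z by (simp add: ln_div)
  have "t * (\<eta> / 2) < (t + \<eta>) * (1 - 1 / z)"
  proof -
    have "t * (\<eta> / 2) * z < (t + \<eta>) * (\<eta> / 2)"
    proof -
      have "t * (\<eta> / 2) * z = (t + t * (\<eta> / 2)) * (\<eta> / 2)" by (simp add: z_def algebra_simps)
      also have "\<dots> < (t + \<eta>) * (\<eta> / 2)"
        using \<eta> t mult_right_mono[of t 1 "\<eta> / 2"] by (intro mult_strict_right_mono add_strict_left_mono) auto
      finally show ?thesis .
    qed
    moreover have "(t + \<eta>) * (1 - 1 / z) * z = (t + \<eta>) * (\<eta> / 2)"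
    proof -
      have "(1 - 1 / z) * z = z - 1" using z by (simp add: left_diff_distrib)
      then show ?thesis by (simp only: mult.assoc) (simp add: z_def)
    qed
    ultimately have "t * (\<eta> / 2) * z < (t + \<eta>) * (1 - 1 / z) * z" by (simp only:)
    then show ?thesis using z by (simp only: mult_less_cancel_right_disj) linarith
  qed
  also have "\<dots> \<le> (t + \<eta>) * ln z" using lnz t \<eta> by (intro mult_left_mono) auto
  finally have "ln y < (t + \<eta>) * ln z" using lny by simp
  then have lt: "y < z powr (t + \<eta>)"
  proof -
    have "exp (ln y) < exp ((t + \<eta>) * ln z)" using \<open>ln y < (t + \<eta>) * ln z\<close> by simp
    then show ?thesis using y z by (simp add: powr_def)
  qed
  define q where "q = y / z powr (t + \<eta>)"
  have q: "0 \<le> q" "q < 1" using lt y z by (auto simp: q_def)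
  have b: "y ^ n / z ^ k \<le> q ^ n" if "(t + \<eta>) * real n \<le> real k" for n k
  proof -
    have "(z powr (t + \<eta>)) ^ n = z powr ((t + \<eta>) * n)"
      using z by (simp add: powr_powr flip: powr_realpow)
    also have "\<dots> \<le> z powr k" using that z by (intro powr_mono) auto
    also have "\<dots> = z ^ k" using z by (simp add: powr_realpow)
    finally have "(z powr (t + \<eta>)) ^ n \<le> z ^ k" .
    then have "y ^ n / z ^ k \<le> y ^ n / (z powr (t + \<eta>)) ^ n"
      using y z by (intro divide_left_mono) auto
    then show ?thesis by (simp add: q_def power_divide)
  qed
  have lim: "(\<lambda>n. q ^ n) \<longlonglongrightarrow> 0" using q by (intro LIMSEQ_realpow_zero) auto
  have qe: "\<forall>\<^sub>F n in sequentially. q ^ n \<le> \<epsilon>" if "\<epsilon> > 0" for \<epsilon>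
    using order_tendstoD(2)[OF lim that] by (rule eventually_mono) simp
  have "\<forall>\<^sub>F n in sequentially. \<forall>k. (t + \<eta>) * real n \<le> real k \<longrightarrow> y ^ n / z ^ k \<le> \<epsilon>" if e: "\<epsilon> > 0" for \<epsilon>
    using qe[OF e]
  proof (rule eventually_mono, intro allI impI)
    fix n k assume "q ^ n \<le> \<epsilon>" "(t + \<eta>) * real n \<le> real k"
    then show "y ^ n / z ^ k \<le> \<epsilon>" using b[of n k] by linarith
  qed
  then show ?thesis
    using z unfolding y_def by (intro exI[of _ z] conjI allI impI) auto
qed

text \<open>Here k is the growing parameter and n is at least k / s with s = t - \<eta>, so decay
  means y^(1/s) z < 1. With z = 1 + \<eta>, the estimates ln y \<le> - t \<eta> / z and ln z \<le>
  \<eta> reduce this to s z < t.\<close>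

lemma chernoff_lower:
  fixes t \<eta> :: real
  assumes t: "t \<le> 1" and \<eta>: "\<eta> > 0" "\<eta> < t"
  shows "\<exists>z\<ge>1. \<forall>\<epsilon>>0. \<forall>\<^sub>F k in sequentially. \<forall>n. real k \<le> (t - \<eta>) * real n \<longrightarrow> (1 - t + t / z) ^ n * z ^ k \<le> \<epsilon>"
proof -
  define z where "z = 1 + \<eta>"
  have z: "z > 1" using \<eta> by (simp add: z_def)
  define y where "y = 1 - t + t / z"
  have y: "y > 0" "y \<le> 1"
  proof -
    have "t / z > 0" using z \<eta> by (intro divide_pos_pos) auto
    then show "y > 0" using t by (simp add: y_def)
    have "t / z \<le> t" using z \<eta> by (simp add: divide_le_eq)
    then show "y \<le> 1" by (simp add: y_def)
  qed
  define s where "s = t - \<eta>"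
  have s: "s > 0" using \<eta> by (simp add: s_def)
  have lny: "ln y \<le> - (t * \<eta> / z)"
  proof -
    have "ln y \<le> y - 1" using ln_le_minus_one[OF y(1)] .
    also have "\<dots> = - (t * \<eta> / z)" using z by (simp add: y_def z_def field_simps)
    finally show ?thesis .
  qed
  have lnz: "ln z \<le> \<eta>" using ln_le_minus_one[of z] z by (simp add: z_def)
  have "s * z < t"
  proof -
    have "s * z = t - \<eta> * (1 - t) - \<eta> * \<eta>" by (simp add: s_def z_def algebra_simps)
    moreover have "\<eta> * (1 - t) \<ge> 0" "\<eta> * \<eta> > 0" using t \<eta> by auto
    ultimately show ?thesis by linarith
  qed
  then have "s * \<eta> < t * \<eta> / z" using z \<eta> by (simp add: field_simps)
  moreover have "s * ln z \<le> s * \<eta>" using s lnz by (intro mult_left_mono) auto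
  ultimately have "ln y + s * ln z < 0" using lny by linarith
  then have neg: "ln y / s + ln z < 0" using s by (simp add: field_simps)
  define q where "q = y powr (1 / s) * z"
  have q: "q > 0" using y z by (simp add: q_def)
  have "ln q = ln y / s + ln z" using y z by (simp add: q_def ln_mult ln_powr)
  then have "ln q < 0" using neg by linarith
  then have q1: "q < 1" using q by simp
  have b: "y ^ n * z ^ k \<le> q ^ k" if "real k \<le> s * real n" for n k
  proof -
    have "y ^ n = y powr n" using y by (simp add: powr_realpow)
    also have "\<dots> \<le> y powr (k / s)" using that y s by (intro powr_mono') (auto simp: field_simps)
    also have "\<dots> = (y powr (1 / s)) ^ k" using y by (simp add: powr_powr flip: powr_realpow)
    finally have "y ^ n * z ^ k \<le> (y powr (1 / s)) ^ k * z ^ k" using z by (intro mult_right_mono) auto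
    then show ?thesis by (simp add: q_def power_mult_distrib)
  qed
  have lim: "(\<lambda>n. q ^ n) \<longlonglongrightarrow> 0" using q q1 by (intro LIMSEQ_realpow_zero) auto
  have qe: "\<forall>\<^sub>F n in sequentially. q ^ n \<le> \<epsilon>" if "\<epsilon> > 0" for \<epsilon>
    using order_tendstoD(2)[OF lim that] by (rule eventually_mono) simp
  have "\<forall>\<^sub>F k in sequentially. \<forall>n. real k \<le> s * real n \<longrightarrow> y ^ n * z ^ k \<le> \<epsilon>" if e: "\<epsilon> > 0" for \<epsilon>
    using qe[OF e]
  proof (rule eventually_mono, intro allI impI)
    fix k n assume "q ^ k \<le> \<epsilon>" "real k \<le> s * real n"
    then show "y ^ n * z ^ k \<le> \<epsilon>" using b[of k n] by linarith
  qed
  then show ?thesis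
    using z unfolding y_def s_def by (intro exI[of _ z] conjI allI impI) auto
qed


subsection \<open>The key of a flagged mixture\<close>

lemma key_achievable_mono: "\<epsilon> \<le> \<epsilon>' \<Longrightarrow> key_achievable D \<rho> n \<epsilon> \<subseteq> key_achievable D \<rho> n \<epsilon>'"
  unfolding key_achievable_def by (force intro: order_trans)

lemma filterlim_nat_ceiling:
  fixes c :: real
  assumes "c > 0"
  shows "filterlim (\<lambda>n. nat \<lceil>c * real n\<rceil>) at_top sequentially"
proof -
  have "filterlim (\<lambda>n. c * real n) at_top sequentially"
    using assms by (intro filterlim_tendsto_pos_mult_at_top[OF tendsto_const assms] filterlim_real_sequentially)
  then have "filterlim (\<lambda>n. real (nat \<lceil>c * real n\<rceil>)) at_top sequentially"
    by (rule filterlim_at_top_mono) (rule always_eventually, rule allI, linarith)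
  then show ?thesis by (simp add: filterlim_sequentially_iff_filterlim_real)
qed

context
  fixes D :: dims and \<rho> :: joint_op and f :: index and t :: real and G :: "nat list set"
  assumes C: "D Charlie = []" and \<rho>: "joint_psd D \<rho>" "joint_trace D \<rho> = 1"
    and f: "f \<in> joint_basis D" and t: "0 \<le> t" "t \<le> 1"
    and G: "\<And>x y. \<rho> x y \<noteq> 0 \<Longrightarrow> x Alice \<in> G \<and> y Alice \<in> G" and fG: "f Alice \<notin> G"
begin

text \<open>About (t + \<eta>) n copies of \<rho> suffice to produce n copies of the
  mixture.\<close>

lemma flag_mix_key_le:
  assumes r: "distillable_key D \<rho> \<le> ereal r" "r \<ge> 0" and \<eta>: "\<eta> > 0"
  shows "distillable_key D (flag_mix t \<rho> f) \<le> ereal (r * (t + \<eta>))"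
proof -
  note fd = flag_mix_density[OF \<rho> f t]
  let ?g = "\<lambda>n. nat \<lceil>(t + \<eta>) * real n\<rceil>"
  have pos: "t + \<eta> > 0" using t \<eta> by simp
  obtain z where z: "z \<ge> 1" "\<forall>\<epsilon>>0. \<forall>\<^sub>F n in sequentially. \<forall>k. (t + \<eta>) * real n \<le> real k \<longrightarrow> (1 - t + t * z) ^ n / z ^ k \<le> \<epsilon>"
    using chernoff_upper[OF t \<eta>] by blast
  show ?thesis
    unfolding distillable_key_eq
  proof (rule rate_compare[where g = ?g and B = "key_achievable D \<rho>" and C = 1])
    fix \<epsilon> :: real assume e: "\<epsilon> > 0"
    then have "\<forall>\<^sub>F n in sequentially. \<forall>k. (t + \<eta>) * real n \<le> real k \<longrightarrow> (1 - t + t * z) ^ n / z ^ k \<le> \<epsilon> / 4"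
      by (intro z(2)[rule_format]) simp
    then have "\<forall>\<^sub>F n in sequentially. key_achievable D (flag_mix t \<rho> f) n (\<epsilon> / 2) \<subseteq> key_achievable D \<rho> (?g n) \<epsilon>"
    proof eventually_elim
      case (elim n)
      let ?\<delta> = "2 * (1 - t + t * z) ^ n / z ^ Suc (?g n)"
      have "(t + \<eta>) * real n \<le> real (Suc (?g n))" by linarith
      then have "(1 - t + t * z) ^ n / z ^ Suc (?g n) \<le> \<epsilon> / 4" using elim by blast
      moreover have "?\<delta> = 2 * ((1 - t + t * z) ^ n / z ^ Suc (?g n))" by simp
      ultimately have d: "?\<delta> + \<epsilon> / 2 \<le> \<epsilon>" by linarith
      obtain \<Theta> where \<Theta>: "locc {Alice, Bob} (power_dims D (?g n)) (power_dims D n) \<Theta>"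
        "close_ops (power_dims D n) ?\<delta> (\<Theta> (tensor_power D \<rho> (?g n))) (tensor_power D (flag_mix t \<rho> f) n)"
        using simulate_flag_mix[where D = D and k = "?g n" and n = n, OF C \<rho> f t z(1)] by blast
      show ?case
        using key_achievable_transfer[OF fd(1) \<rho>(1) \<Theta>] key_achievable_mono[OF d] by blast
    qed
    then show "\<exists>\<delta>>0. \<forall>\<^sub>F n in sequentially. key_achievable D (flag_mix t \<rho> f) n \<delta> \<subseteq> key_achievable D \<rho> (?g n) \<epsilon>"
      using e by (intro exI[of _ "\<epsilon> / 2"]) auto
  next
    show "filterlim ?g at_top sequentially" by (rule filterlim_nat_ceiling[OF pos])
    show "\<forall>\<^sub>F n in sequentially. real (?g n) \<le> (t + \<eta>) * real n + 1"
    proof (rule always_eventually, rule allI)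
      fix n
      have "(t + \<eta>) * real n \<ge> 0" using pos by simp
      then show "real (?g n) \<le> (t + \<eta>) * real n + 1" by linarith
    qed
  qed (use r pos distillable_key_eq in auto)
qed

text \<open>About k / (t - \<eta>) copies of the mixture suffice to collect k copies of
  \<rho>.\<close>

lemma flag_mix_key_ge:
  assumes r: "distillable_key D (flag_mix t \<rho> f) \<le> ereal r" "r \<ge> 0" and \<eta>: "0 < \<eta>" "\<eta> < t"
  shows "distillable_key D \<rho> \<le> ereal (r * (1 / (t - \<eta>)))"
proof -
  note fd = flag_mix_density[OF \<rho> f t]
  let ?c = "1 / (t - \<eta>)"
  let ?g = "\<lambda>k. nat \<lceil>?c * real k\<rceil>"
  have pos: "?c > 0" using \<eta> by simp
  obtain z where z: "z \<ge> 1" "\<forall>\<epsilon>>0. \<forall>\<^sub>F k in sequentially. \<forall>n. real k \<le> (t - \<eta>) * real n \<longrightarrow> (1 - t + t / z) ^ n * z ^ k \<le> \<epsilon>"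
    using chernoff_lower[OF t(2) \<eta>] by blast
  show ?thesis
    unfolding distillable_key_eq
  proof (rule rate_compare[where g = ?g and B = "key_achievable D (flag_mix t \<rho> f)" and C = 1])
    fix \<epsilon> :: real assume e: "\<epsilon> > 0"
    then have "\<forall>\<^sub>F k in sequentially. \<forall>n. real k \<le> (t - \<eta>) * real n \<longrightarrow> (1 - t + t / z) ^ n * z ^ k \<le> \<epsilon> / 4"
      by (intro z(2)[rule_format]) simp
    then have "\<forall>\<^sub>F k in sequentially. key_achievable D \<rho> k (\<epsilon> / 2) \<subseteq> key_achievable D (flag_mix t \<rho> f) (?g k) \<epsilon>"
    proof eventually_elim
      case (elim k)
      let ?\<delta> = "2 * (1 - t + t / z) ^ (?g k) * z ^ k"
      have "?c * real k \<le> real (?g k)" by linarith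
      then have "(t - \<eta>) * (?c * real k) \<le> (t - \<eta>) * real (?g k)" using \<eta> by (intro mult_left_mono) auto
      then have "real k \<le> (t - \<eta>) * real (?g k)" using \<eta> by simp
      then have "(1 - t + t / z) ^ (?g k) * z ^ k \<le> \<epsilon> / 4" using elim by blast
      then have d: "?\<delta> + \<epsilon> / 2 \<le> \<epsilon>" by simp
      have "\<exists>\<Theta>. locc {Alice, Bob} (power_dims D (?g k)) (power_dims D k) \<Theta>
        \<and> close_ops (power_dims D k) ?\<delta> (\<Theta> (tensor_power D (flag_mix t \<rho> f) (?g k))) (tensor_power D \<rho> k)"
        by (rule extract_flag_mix[where G = G]; fact)
      then obtain \<Theta> where \<Theta>: "locc {Alice, Bob} (power_dims D (?g k)) (power_dims D k) \<Theta>"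
        "close_ops (power_dims D k) ?\<delta> (\<Theta> (tensor_power D (flag_mix t \<rho> f) (?g k))) (tensor_power D \<rho> k)"
        by (elim exE conjE) (rule that)
      show ?case
        using key_achievable_transfer[OF \<rho>(1) fd(1) \<Theta>] key_achievable_mono[OF d] by blast
    qed
    then show "\<exists>\<delta>>0. \<forall>\<^sub>F k in sequentially. key_achievable D \<rho> k \<delta> \<subseteq> key_achievable D (flag_mix t \<rho> f) (?g k) \<epsilon>"
      using e by (intro exI[of _ "\<epsilon> / 2"]) auto
  next
    show "filterlim ?g at_top sequentially" by (rule filterlim_nat_ceiling[OF pos])
    show "\<forall>\<^sub>F n in sequentially. real (?g n) \<le> ?c * real n + 1"
    proof (rule always_eventually, rule allI)
      fix n
      have "?c * real n \<ge> 0" using pos by simp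
      then show "real (?g n) \<le> ?c * real n + 1" by linarith
    qed
  qed (use r pos distillable_key_eq in auto)
qed

text \<open>Each conversion loses only \<eta>, which is arbitrary, so the factor t is exact whatever
  the key rate of \<rho> may be.\<close>

theorem distillable_key_flag_mix:
  assumes k: "distillable_key D \<rho> = ereal k"
  shows "distillable_key D (flag_mix t \<rho> f) = ereal (t * k)"
proof (rule antisym)
  have d: "density_op (joint_basis D) \<rho>" "density_op (joint_basis D) (flag_mix t \<rho> f)"
    using \<rho> flag_mix_density[OF \<rho> f t] by (auto simp: density_op_def)
  have k0: "k \<ge> 0" using distillable_key_nonneg[where D = D, OF C d(1)] k by simp
  show "distillable_key D (flag_mix t \<rho> f) \<le> ereal (t * k)"
  proof (rule ereal_le_epsilon2)
    fix e :: real assume e: "e > 0"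
    have "distillable_key D (flag_mix t \<rho> f) \<le> ereal (k * (t + e / (k + 1)))"
      using k k0 e by (intro flag_mix_key_le) auto
    also have "k * (t + e / (k + 1)) \<le> t * k + e"
      using k0 e by (simp add: field_simps)
    finally show "distillable_key D (flag_mix t \<rho> f) \<le> ereal (t * k) + ereal e" by simp
  qed
  show "ereal (t * k) \<le> distillable_key D (flag_mix t \<rho> f)"
  proof (rule ccontr)
    assume "\<not> ?thesis"
    then have lt: "distillable_key D (flag_mix t \<rho> f) < ereal (t * k)" by simp
    then obtain r0 where r0: "distillable_key D (flag_mix t \<rho> f) < ereal r0" "r0 < t * k"
      using ereal_dense2[OF lt] by auto
    have "ereal 0 < ereal r0"
      using order_le_less_trans[OF distillable_key_nonneg[where D = D, OF C d(2)] r0(1)] by (simp add: zero_ereal_def)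
    then have r00: "r0 \<ge> 0" by simp
    then have tk: "t * k > 0" using r0(2) by simp
    then have tp: "t > 0" "k > 0" using t k0 by (auto simp: zero_less_mult_iff)
    \<comment> \<open>Half the available gap: then k (t - \<eta>) is the midpoint of t k and r0,
      still above r0.\<close>
    define \<eta> where "\<eta> = (t - r0 / k) / 2"
    have \<eta>: "0 < \<eta>" "\<eta> < t" using r0(2) tp r00 by (auto simp: \<eta>_def field_simps)
    have "ereal k \<le> ereal (r0 * (1 / (t - \<eta>)))"
      using flag_mix_key_ge[of r0 \<eta>] r0(1) r00 \<eta> k by simp
    then have "k * (t - \<eta>) \<le> r0" using \<eta> by (simp add: field_simps)
    moreover have "k * (t - \<eta>) = (k * t + r0) / 2" using tp by (simp add: \<eta>_def field_simps)
    ultimately show False using r0(2) by (simp add: algebra_simps)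
  qed
qed

end

subsection \<open>Binary linear codes\<close>

text \<open>Words of length \<open>n\<close> over the field with two elements are subsets of \<open>{..<n}\<close>; addition is symmetric difference.\<close>

definition sd :: "'a set \<Rightarrow> 'a set \<Rightarrow> 'a set" where
  "sd A B = {x. (x \<in> A) \<noteq> (x \<in> B)}"

lemma sd_iff [simp]: "x \<in> sd A B \<longleftrightarrow> (x \<in> A) \<noteq> (x \<in> B)"
  by (simp add: sd_def)

lemma sd_simps [simp]: "sd A A = {}" "sd A {} = A" "sd {} A = A" "sd A (sd A B) = B" "sd (sd B A) A = B"
  by (auto simp: sd_def)

lemma sd_assoc: "sd (sd A B) C = sd A (sd B C)"
  by (auto simp: sd_def)

lemma sd_commute: "sd A B = sd B A"
  by (auto simp: sd_def)

lemma sd_left_cancel [simp]: "sd A B = sd A C \<longleftrightarrow> B = C"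
  by (auto simp: sd_def)

lemma sd_right_cancel [simp]: "sd B A = sd C A \<longleftrightarrow> B = C"
  by (auto simp: sd_def)

lemma sd_empty_iff [simp]: "sd A B = {} \<longleftrightarrow> A = B"
  by (auto simp: sd_def)

lemma sd_Pow: "A \<subseteq> U \<Longrightarrow> B \<subseteq> U \<Longrightarrow> sd A B \<subseteq> U"
  by (auto simp: sd_def)

lemma card_sd_le: "finite A \<Longrightarrow> finite B \<Longrightarrow> card (sd A B) \<le> card A + card B"
  by (rule order_trans[OF card_mono card_Un_le]) (auto simp: sd_def)

definition linear_code :: "nat \<Rightarrow> nat set set \<Rightarrow> bool" where
  "linear_code n C \<longleftrightarrow> C \<subseteq> Pow {..<n} \<and> {} \<in> C \<and> (\<forall>a\<in>C. \<forall>b\<in>C. sd a b \<in> C)"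

lemma linear_codeD:
  assumes "linear_code n C"
  shows "c \<in> C \<Longrightarrow> c \<subseteq> {..<n}" "{} \<in> C" "a \<in> C \<Longrightarrow> b \<in> C \<Longrightarrow> sd a b \<in> C" "finite C"
  using assms finite_subset[of C "Pow {..<n}"] by (auto simp: linear_code_def)

definition ball_size :: "nat \<Rightarrow> nat \<Rightarrow> nat" where
  "ball_size n s = card {w \<in> Pow {..<n}. card w \<le> s}"

text \<open>Greedy doubling: as long as the balls of radius s around the codewords cannot fill the
  space, some word v is farther than s from the whole code, and adjoining v doubles the code while
  all nonzero weights stay above s.\<close>

lemma code_of_size:
  assumes "\<And>l. l < k \<Longrightarrow> 2 ^ l * ball_size n s < 2 ^ n"
  shows "\<exists>C. linear_code n C \<and> card C = 2 ^ k \<and> (\<forall>c\<in>C. c \<noteq> {} \<longrightarrow> s < card c)"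
  using assms
proof (induction k)
  case 0
  show ?case by (rule exI[of _ "{{}}"]) (auto simp: linear_code_def)
next
  case (Suc k)
  then obtain C where C: "linear_code n C" "card C = 2 ^ k" "\<forall>c\<in>C. c \<noteq> {} \<longrightarrow> s < card c"
    by (metis less_SucI)
  note c = linear_codeD[OF C(1)]
  let ?B = "{w \<in> Pow {..<n}. card w \<le> s}"
  let ?N = "(\<lambda>(c, w). sd c w) ` (C \<times> ?B)"
  have "card ?N \<le> card (C \<times> ?B)" by (intro card_image_le finite_cartesian_product c(4)) auto
  also have "\<dots> = 2 ^ k * ball_size n s" by (simp add: card_cartesian_product C(2) ball_size_def)
  also have "\<dots> < card (Pow {..<n})" using Suc.prems[of k] by (simp add: card_Pow)
  finally have "\<not> Pow {..<n} \<subseteq> ?N"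
    using card_mono[of ?N "Pow {..<n}"] c(4) by auto
  then obtain v where v: "v \<subseteq> {..<n}" "v \<notin> ?N" by auto
  have far: "s < card (sd v c)" if "c \<in> C" for c
  proof (rule ccontr)
    assume "\<not> ?thesis"
    then have "sd c v \<in> ?B" using v(1) c(1)[OF that] sd_Pow[of c "{..<n}" v] by (auto simp: sd_commute)
    then have "sd c (sd c v) \<in> ?N" using that by blast
    then show False using v(2) by simp
  qed
  have vC: "sd v c \<notin> C" if cc: "c \<in> C" for c
  proof
    assume "sd v c \<in> C"
    then have "sd (sd v c) c \<in> C" by (rule c(3)[OF _ cc])
    then have "v \<in> C" by simp
    from far[OF this] show False by simp
  qed
  let ?C = "C \<union> sd v ` C"
  have "linear_code n ?C"
    unfolding linear_code_def
  proof (intro conjI ballI)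
    show "?C \<subseteq> Pow {..<n}" using c(1) v(1) sd_Pow by blast
    show "{} \<in> ?C" using c(2) by simp
    fix a b assume "a \<in> ?C" "b \<in> ?C"
    then consider "a \<in> C" "b \<in> C" | a' where "a' \<in> C" "a = sd v a'" "b \<in> C" | b' where "a \<in> C" "b' \<in> C" "b = sd v b'"
      | a' b' where "a' \<in> C" "a = sd v a'" "b' \<in> C" "b = sd v b'" by blast
    then show "sd a b \<in> ?C"
    proof cases
      case 1 then show ?thesis using c(3) by blast
    next
      case 2 then show ?thesis using c(3) by (auto simp: sd_assoc)
    next
      case 3
      then have "sd a b = sd v (sd a b')" by (auto simp: sd_def)
      then show ?thesis using c(3) 3 by blast
    next
      case 4
      then have "sd a b = sd a' b'" by (auto simp: sd_def)
      then show ?thesis using c(3) 4 by simp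
    qed
  qed
  moreover have "card ?C = 2 ^ Suc k"
  proof -
    have "card ?C = card C + card (sd v ` C)" using c(4) vC by (intro card_Un_disjoint) auto
    also have "card (sd v ` C) = card C" by (rule card_image) (auto simp: inj_on_def)
    finally show ?thesis using C(2) by simp
  qed
  moreover have "\<forall>c\<in>?C. c \<noteq> {} \<longrightarrow> s < card c" using C(3) far by auto
  ultimately show ?case by blast
qed

text \<open>Take the least k for which 2^k balls could fill the space; below it the greedy step
  always succeeds.\<close>

lemma gilbert_varshamov:
  "\<exists>C k. linear_code n C \<and> card C = 2 ^ k \<and> (\<forall>c\<in>C. c \<noteq> {} \<longrightarrow> s < card c) \<and> 2 ^ n \<le> 2 ^ k * ball_size n s"
proof -
  have "{{}} \<subseteq> {w \<in> Pow {..<n}. card w \<le> s}" by auto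
  then have "ball_size n s \<ge> 1" unfolding ball_size_def using card_mono[of "{w \<in> Pow {..<n}. card w \<le> s}" "{{}}"] by simp
  then have ex: "2 ^ n \<le> 2 ^ n * ball_size n s" by simp
  define k where "k = (LEAST k. 2 ^ n \<le> 2 ^ k * ball_size n s)"
  have k: "2 ^ n \<le> 2 ^ k * ball_size n s" unfolding k_def by (rule LeastI[of "\<lambda>k. 2 ^ n \<le> 2 ^ k * ball_size n s", OF ex])
  have "2 ^ l * ball_size n s < 2 ^ n" if "l < k" for l
    using not_less_Least[of l "\<lambda>k. 2 ^ n \<le> 2 ^ k * ball_size n s"] that by (simp add: k_def not_le)
  from code_of_size[of k n s, OF this] show ?thesis using k by blast
qed

text \<open>If position i occurs in some word, the words avoiding i form a subgroup of index 2.
  Otherwise all words avoid it, and the code is halved at another position only to make the size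
  exactly \<open>2 ^ k\<close>.\<close>

lemma subcode_avoiding_position:
  assumes C: "linear_code n C" "card C = 2 ^ Suc k"
  shows "\<exists>C'. linear_code n C' \<and> C' \<subseteq> C \<and> card C' = 2 ^ k \<and> (\<forall>c\<in>C'. i \<notin> c)"
proof -
  note c = linear_codeD[OF C(1)]
  define S where "S = (\<lambda>j. {c \<in> C. j \<notin> c})"
  have lin: "linear_code n (S j)" for j
    using c by (auto simp: linear_code_def S_def)
  have half: "card (S j) = 2 ^ k" if j: "c0 \<in> C" "j \<in> c0" for j c0
  proof -
    have "C = S j \<union> sd c0 ` S j"
    proof (intro equalityI subsetI)
      fix a assume a: "a \<in> C"
      show "a \<in> S j \<union> sd c0 ` S j"
      proof (cases "j \<in> a")
        case True
        then have "sd c0 a \<in> S j" using a j c(3) by (simp add: S_def)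
        then have "sd c0 (sd c0 a) \<in> sd c0 ` S j" by (rule imageI)
        then show ?thesis by simp
      qed (use a in \<open>simp add: S_def\<close>)
    qed (use j c(3) in \<open>auto simp: S_def\<close>)
    moreover have "S j \<inter> sd c0 ` S j = {}" using j by (auto simp: S_def)
    moreover have "finite (S j)" using c(4) by (simp add: S_def)
    ultimately have "card C = card (S j) + card (sd c0 ` S j)" by (metis card_Un_disjoint finite_imageI)
    also have "card (sd c0 ` S j) = card (S j)" by (rule card_image) (auto simp: inj_on_def)
    finally show ?thesis using C(2) by simp
  qed
  show ?thesis
  proof (cases "\<exists>c0\<in>C. i \<in> c0")
    case True
    then obtain c0 where "c0 \<in> C" "i \<in> c0" by blast
    from half[OF this] show ?thesis using lin by (intro exI[of _ "S i"]) (auto simp: S_def)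
  next
    case False
    have "C \<noteq> {{}}" using C(2) by auto
    then obtain c0 j where "c0 \<in> C" "j \<in> c0" using c(2) by blast
    from half[OF this] show ?thesis using lin False by (intro exI[of _ "S j"]) (auto simp: S_def)
  qed
qed

lemma subcode_avoiding:
  assumes C: "linear_code n C" "card C = 2 ^ k" and r: "r \<le> k" and e: "finite e" "card e \<le> r"
  shows "\<exists>C'. linear_code n C' \<and> C' \<subseteq> C \<and> card C' = 2 ^ (k - r) \<and> (\<forall>c\<in>C'. c \<inter> e = {})"
  using r e
proof (induction r arbitrary: e)
  case 0
  then show ?case using C by (intro exI[of _ C]) auto
next
  case (Suc r)
  \<comment> \<open>For empty \<open>e\<close> this is an arbitrary position and the step merely
    halves the code, which keeps the final size independent of \<open>card e\<close>.\<close>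
  define i where "i = (SOME i. i \<in> e)"
  have "card (e - {i}) \<le> r"
  proof (cases "e = {}")
    case False
    then have "i \<in> e" by (simp add: i_def some_in_eq)
    then show ?thesis using card_Diff_singleton[of i e] Suc.prems(3) by simp
  qed simp
  then have "\<exists>C1. linear_code n C1 \<and> C1 \<subseteq> C \<and> card C1 = 2 ^ (k - r) \<and> (\<forall>c\<in>C1. c \<inter> (e - {i}) = {})"
    using Suc.prems by (intro Suc.IH) auto
  then obtain C1 where C1: "linear_code n C1" "C1 \<subseteq> C" "card C1 = 2 ^ (k - r)" "\<forall>c\<in>C1. c \<inter> (e - {i}) = {}"
    by (elim exE conjE) (rule that)
  have "k - r = Suc (k - Suc r)" using Suc.prems by simp
  then have "card C1 = 2 ^ Suc (k - Suc r)" using C1(3) by simp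
  from subcode_avoiding_position[OF C1(1) this, of i]
  obtain C2 where C2: "linear_code n C2" "C2 \<subseteq> C1" "card C2 = 2 ^ (k - Suc r)" "\<forall>c\<in>C2. i \<notin> c"
    by (elim exE conjE) (rule that)
  have "\<forall>c\<in>C2. c \<inter> e = {}" using C1(4) C2(2,4) by blast
  then show ?case using C1(2) C2 by (intro exI[of _ C2]) blast
qed

text \<open>\<open>rep\<close> is chosen from the coset as a set, hence is constant on cosets; every
  word is its representative plus a unique codeword.\<close>

lemma coset_representatives:
  assumes C: "linear_code n C"
  shows "\<exists>R \<subseteq> Pow {..<n}. bij_betw (\<lambda>(x, c). sd x c) (R \<times> C) (Pow {..<n})"
proof -
  note c = linear_codeD[OF C]
  define rep where "rep = (\<lambda>x. SOME y. y \<in> sd x ` C)"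
  have rep: "rep x \<in> sd x ` C" for x
    unfolding rep_def by (rule someI_ex) (use c(2) in blast)
  have im: "sd (sd x a) ` C = sd x ` C" if "a \<in> C" for x a
  proof (intro equalityI subsetI)
    fix y assume "y \<in> sd (sd x a) ` C"
    then obtain b where "b \<in> C" "y = sd (sd x a) b" by blast
    then show "y \<in> sd x ` C" using c(3)[OF that] by (auto simp: sd_assoc)
  next
    fix y assume "y \<in> sd x ` C"
    then obtain b where b: "b \<in> C" "y = sd x b" by blast
    have "y = sd (sd x a) (sd a b)" using b by (auto simp: sd_def)
    then show "y \<in> sd (sd x a) ` C" using c(3)[OF that b(1)] by blast
  qed
  have rep_eq: "rep (sd x a) = rep x" if "a \<in> C" for x a using im[OF that, of x] by (simp add: rep_def)
  define R where "R = rep ` Pow {..<n}"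
  have RP: "R \<subseteq> Pow {..<n}"
  proof
    fix y assume "y \<in> R"
    then obtain x where x: "x \<subseteq> {..<n}" "y = rep x" by (auto simp: R_def)
    then obtain a where "a \<in> C" "y = sd x a" using rep[of x] by blast
    then show "y \<in> Pow {..<n}" using x(1) c(1) sd_Pow by blast
  qed
  have rr: "rep y = y" if "y \<in> R" for y
  proof -
    obtain x where x: "y = rep x" using \<open>y \<in> R\<close> by (auto simp: R_def)
    then obtain a where "a \<in> C" "y = sd x a" using rep[of x] by blast
    then show ?thesis using rep_eq[of a x] x by simp
  qed
  have "bij_betw (\<lambda>(x, c). sd x c) (R \<times> C) (Pow {..<n})"
  proof (rule bij_betw_byWitness[where f' = "\<lambda>y. (rep y, sd (rep y) y)"])
    show "\<forall>a\<in>R \<times> C. (\<lambda>y. (rep y, sd (rep y) y)) (case a of (x, c) \<Rightarrow> sd x c) = a"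
      using rr rep_eq by auto
    show "\<forall>a'\<in>Pow {..<n}. (case (rep a', sd (rep a') a') of (x, c) \<Rightarrow> sd x c) = a'" by simp
    show "(\<lambda>(x, c). sd x c) ` (R \<times> C) \<subseteq> Pow {..<n}"
    proof
      fix z assume "z \<in> (\<lambda>(x, c). sd x c) ` (R \<times> C)"
      then obtain x a where "x \<in> R" "a \<in> C" "z = sd x a" by auto
      then show "z \<in> Pow {..<n}" using sd_Pow[of x "{..<n}" a] RP c(1)[of a] by auto
    qed
    show "(\<lambda>y. (rep y, sd (rep y) y)) ` Pow {..<n} \<subseteq> R \<times> C"
    proof
      fix z assume "z \<in> (\<lambda>y. (rep y, sd (rep y) y)) ` Pow {..<n}"
      then obtain y where y: "y \<in> Pow {..<n}" "z = (rep y, sd (rep y) y)" by blast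
      obtain a where a: "a \<in> C" "rep y = sd y a" using rep[of y] by blast
      have "sd (rep y) y = a" using a(2) by (auto simp: sd_def)
      moreover have "rep y \<in> R" using y(1) unfolding R_def by (rule imageI)
      ultimately show "z \<in> R \<times> C" using y(2) a(1) by (simp only: mem_Times_iff fst_conv snd_conv simp_thms)
    qed
  qed
  then show ?thesis using RP by blast
qed

text \<open>The binomial theorem, summed over subsets instead of sizes; for a + b = 1 it is the
  total probability of all words.\<close>

lemma sum_Pow_power:
  fixes a b :: real
  shows "(\<Sum>w\<in>Pow {..<n}. a ^ card w * b ^ (n - card w)) = (a + b) ^ n"
proof (induction n)
  case (Suc n)
  have e: "Pow {..<Suc n} = Pow {..<n} \<union> insert n ` Pow {..<n}"
    by (simp add: lessThan_Suc Pow_insert)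
  have d: "Pow {..<n} \<inter> insert n ` Pow {..<n} = {}" by auto
  have inj: "inj_on (insert n) (Pow {..<n})" by (auto simp: inj_on_def)
  have cw: "card w \<le> n" "card (insert n w) = Suc (card w)" if "w \<in> Pow {..<n}" for w
  proof -
    have "finite w" "n \<notin> w" using that finite_subset[of w "{..<n}"] by auto
    then show "card w \<le> n" "card (insert n w) = Suc (card w)" using that card_mono[of "{..<n}" w] by auto
  qed
  have "(\<Sum>w\<in>Pow {..<Suc n}. a ^ card w * b ^ (Suc n - card w))
    = (\<Sum>w\<in>Pow {..<n}. a ^ card w * b ^ (Suc n - card w)) + (\<Sum>w\<in>Pow {..<n}. a ^ card (insert n w) * b ^ (Suc n - card (insert n w)))"
    unfolding e using d inj by (subst sum.union_disjoint) (auto simp: sum.reindex)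
  also have "(\<Sum>w\<in>Pow {..<n}. a ^ card w * b ^ (Suc n - card w)) = b * (\<Sum>w\<in>Pow {..<n}. a ^ card w * b ^ (n - card w))"
    unfolding sum_distrib_left by (intro sum.cong refl) (simp add: cw Suc_diff_le)
  also have "(\<Sum>w\<in>Pow {..<n}. a ^ card (insert n w) * b ^ (Suc n - card (insert n w))) = a * (\<Sum>w\<in>Pow {..<n}. a ^ card w * b ^ (n - card w))"
    unfolding sum_distrib_left by (intro sum.cong refl) (simp add: cw)
  finally show ?case by (simp add: Suc algebra_simps)
qed simp

text \<open>Under independent bits of bias \<alpha> every word of the ball has probability at least
  2^(-n h(\<alpha>)), because for \<alpha> \<le> 1 / 2 the probability does not grow with the weight
  and s \<le> \<alpha> n. All probabilities add up to 1.\<close>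

lemma ball_size_le:
  assumes \<alpha>: "0 < \<alpha>" "\<alpha> \<le> 1 / 2" and s: "real s \<le> \<alpha> * real n"
  shows "log 2 (ball_size n s) \<le> real n * binary_entropy \<alpha>"
proof -
  have "(\<Sum>w\<in>{w \<in> Pow {..<n}. card w \<le> s}. 2 powr (- (real n * binary_entropy \<alpha>)))
    \<le> (\<Sum>w\<in>{w \<in> Pow {..<n}. card w \<le> s}. \<alpha> ^ card w * (1 - \<alpha>) ^ (n - card w))"
  proof (rule sum_mono)
    fix w assume w: "w \<in> {w \<in> Pow {..<n}. card w \<le> s}"
    then have cw: "card w \<le> n" using card_mono[of "{..<n}" w] by simp
    have "log 2 \<alpha> \<le> log 2 (1 - \<alpha>)" using \<alpha> by simp
    moreover have "real (card w) \<le> \<alpha> * real n" using w s by simp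
    ultimately have "(\<alpha> * real n - real (card w)) * (log 2 \<alpha> - log 2 (1 - \<alpha>)) \<le> 0"
      by (intro mult_nonneg_nonpos) auto
    then have "- (real n * binary_entropy \<alpha>) \<le> real (card w) * log 2 \<alpha> + (real n - real (card w)) * log 2 (1 - \<alpha>)"
      by (simp add: binary_entropy_def algebra_simps)
    then have "2 powr (- (real n * binary_entropy \<alpha>)) \<le> 2 powr (real (card w) * log 2 \<alpha> + (real n - real (card w)) * log 2 (1 - \<alpha>))"
      by simp
    also have "\<dots> = (2 powr log 2 \<alpha>) powr (card w) * (2 powr log 2 (1 - \<alpha>)) powr (n - card w)"
      using cw by (simp add: powr_add powr_powr of_nat_diff mult.commute)
    also have "\<dots> = \<alpha> ^ card w * (1 - \<alpha>) ^ (n - card w)"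
      using \<alpha> by (simp add: powr_realpow)
    finally show "2 powr (- (real n * binary_entropy \<alpha>)) \<le> \<alpha> ^ card w * (1 - \<alpha>) ^ (n - card w)" .
  qed
  also have "\<dots> \<le> (\<Sum>w\<in>Pow {..<n}. \<alpha> ^ card w * (1 - \<alpha>) ^ (n - card w))"
    using \<alpha> by (intro sum_mono2) auto
  also have "\<dots> = 1" by (simp add: sum_Pow_power)
  finally have "ball_size n s * 2 powr (- (real n * binary_entropy \<alpha>)) \<le> 1" by (simp add: ball_size_def)
  then have le: "ball_size n s \<le> 2 powr (real n * binary_entropy \<alpha>)"
    by (simp add: powr_minus field_simps)
  have "{{}} \<subseteq> {w \<in> Pow {..<n}. card w \<le> s}" by auto
  then have "ball_size n s \<ge> 1" unfolding ball_size_def using card_mono[of "{w \<in> Pow {..<n}. card w \<le> s}" "{{}}"] by simp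
  then show ?thesis using le by (simp add: log_le_iff)
qed


subsection \<open>Private states from monomial unitaries\<close>

text \<open>The unitary for key i sends the basis vector \<open>\<pi> i s\<close> to
  \<open>\<phi> i s\<close> times \<open>s\<close>, and \<sigma> is diagonal. Each
  \<open>\<pi> i\<close> is its own inverse, as shield swaps are.\<close>

lemma private_state_monomial:
  fixes \<phi> :: "nat \<Rightarrow> nat \<times> nat \<Rightarrow> complex" and \<pi> :: "nat \<Rightarrow> nat \<times> nat \<Rightarrow> nat \<times> nat" and w :: "nat \<times> nat \<Rightarrow> real"
  assumes S: "S = {..<a} \<times> {..<b}"
    and \<pi>: "\<And>i s. i < 2 ^ m \<Longrightarrow> s \<in> S \<Longrightarrow> \<pi> i s \<in> S \<and> \<pi> i (\<pi> i s) = s"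
    and \<phi>: "\<And>i s. i < 2 ^ m \<Longrightarrow> s \<in> S \<Longrightarrow> \<phi> i s * cnj (\<phi> i s) = 1"
    and w: "\<And>s. s \<in> S \<Longrightarrow> w s \<ge> 0" "(\<Sum>s\<in>S. w s) = 1"
    and ops: "\<gamma> \<in> joint_ops (key_shield (2 ^ m) a b)"
    and \<gamma>: "\<And>i j i' j' s s'. i < 2 ^ m \<Longrightarrow> j < 2 ^ m \<Longrightarrow> i' < 2 ^ m \<Longrightarrow> j' < 2 ^ m \<Longrightarrow> s \<in> S \<Longrightarrow> s' \<in> S \<Longrightarrow>
      \<gamma> (ks_index i j s) (ks_index i' j' s') =
        (if i = j \<and> i' = j' \<and> \<pi> i s = \<pi> i' s' then \<phi> i s * cnj (\<phi> i' s') * w (\<pi> i s) / 2 ^ m else 0)"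
  shows "\<gamma> \<in> private_states m a b"
proof -
  have fin: "finite S" using S by simp
  define U where "U = (\<lambda>i s r. if s \<in> S \<and> r \<in> S \<and> r = \<pi> i s then \<phi> i s else 0)"
  define \<sigma> where "\<sigma> = diag_op S (\<lambda>s. complex_of_real (w s))"
  have dens: "density_op S \<sigma>"
  proof -
    have "op_trace S \<sigma> = complex_of_real (\<Sum>s\<in>S. w s)" by (simp add: op_trace_def \<sigma>_def diag_op_def)
    then show ?thesis using positive_diag_op[OF fin, of w] w by (simp add: density_op_def \<sigma>_def)
  qed
  have \<phi>': "cnj (\<phi> i s) * \<phi> i s = 1" if "i < 2 ^ m" "s \<in> S" for i s using \<phi>[OF that] by (simp add: mult.commute)
  have uni: "unitary_op S (U i)" if i: "i < 2 ^ m" for i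
    unfolding unitary_op_def
  proof (intro conjI ext)
    show "U i \<in> operators S S" by (auto simp: operators_def U_def)
    fix r r'
    have "op_mult S (op_adj (U i)) (U i) r r' = (\<Sum>s\<in>S. if s = \<pi> i r then (if r = r' \<and> r \<in> S then 1 else 0) else 0)"
      unfolding op_mult_def op_adj_def
    proof (intro sum.cong refl)
      fix s assume s: "s \<in> S"
      show "cnj (U i s r) * U i s r' = (if s = \<pi> i r then (if r = r' \<and> r \<in> S then 1 else 0) else 0)"
      proof (cases "r \<in> S \<and> r = \<pi> i s")
        case True
        then have "s = \<pi> i r" using \<pi>[OF i s] by simp
        then show ?thesis using True \<phi>'[OF i s] s by (auto simp: U_def)
      next
        case False
        then have "\<not> (s = \<pi> i r \<and> r \<in> S)" using \<pi>[OF i, of r] by auto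
        then show ?thesis using False by (auto simp: U_def)
      qed
    qed
    then show "op_mult S (op_adj (U i)) (U i) r r' = op_id S r r'"
      using fin \<pi>[OF i, of r] by (auto simp: op_id_def)
  next
    fix s s'
    have "op_mult S (U i) (op_adj (U i)) s s' = (\<Sum>r\<in>S. if r = \<pi> i s then (if s = s' \<and> s \<in> S then 1 else 0) else 0)"
      unfolding op_mult_def op_adj_def
    proof (intro sum.cong refl)
      fix r assume r: "r \<in> S"
      show "U i s r * cnj (U i s' r) = (if r = \<pi> i s then (if s = s' \<and> s \<in> S then 1 else 0) else 0)"
      proof (cases "s \<in> S \<and> s' \<in> S \<and> r = \<pi> i s")
        case True
        then have "\<pi> i s = \<pi> i s' \<longleftrightarrow> s = s'" using \<pi>[OF i, of s] \<pi>[OF i, of s'] by metis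
        then show ?thesis using True \<phi>[OF i, of s] r by (auto simp: U_def)
      next
        case False
        then show ?thesis by (auto simp: U_def)
      qed
    qed
    then show "op_mult S (U i) (op_adj (U i)) s s' = op_id S s s'"
      using fin \<pi>[OF i, of s] by (auto simp: op_id_def)
  qed
  have om: "op_mult S (op_mult S (U i) \<sigma>) (op_adj (U j)) s s'
      = (if \<pi> i s = \<pi> j s' then \<phi> i s * cnj (\<phi> j s') * w (\<pi> i s) else 0)"
    if ij: "i < 2 ^ m" "j < 2 ^ m" and s: "s \<in> S" "s' \<in> S" for i j s s'
  proof -
    have "op_mult S (op_mult S (U i) \<sigma>) (op_adj (U j)) s s' = (\<Sum>r\<in>S. U i s r * of_real (w r) * cnj (U j s' r))"
      unfolding \<sigma>_def by (rule diag_op_conj_apply[OF fin])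
    also have "\<dots> = (\<Sum>r\<in>S. if r = \<pi> i s then (if \<pi> i s = \<pi> j s' then \<phi> i s * cnj (\<phi> j s') * w (\<pi> i s) else 0) else 0)"
    proof (intro sum.cong refl)
      fix r assume r: "r \<in> S"
      show "U i s r * of_real (w r) * cnj (U j s' r) = (if r = \<pi> i s then (if \<pi> i s = \<pi> j s' then \<phi> i s * cnj (\<phi> j s') * w (\<pi> i s) else 0) else 0)"
        using r s by (auto simp: U_def)
    qed
    finally show ?thesis using fin \<pi>[OF ij(1) s(1)] by simp
  qed
  let ?E = "key_shield (2 ^ m) a b"
  have "\<gamma> = (\<lambda>x y. if x \<in> joint_basis ?E \<and> y \<in> joint_basis ?E
          then 1 / 2 ^ m * (\<Sum>i<2 ^ m. \<Sum>j<2 ^ m.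
            of_bool (x Alice ! 0 = i \<and> x Bob ! 0 = i \<and> y Alice ! 0 = j \<and> y Bob ! 0 = j)
            * op_mult S (op_mult S (U i) \<sigma>) (op_adj (U j)) (shield_index x) (shield_index y)) else 0)"
  proof (intro ext)
    fix x y
    show "\<gamma> x y = (if x \<in> joint_basis ?E \<and> y \<in> joint_basis ?E
          then 1 / 2 ^ m * (\<Sum>i<2 ^ m. \<Sum>j<2 ^ m.
            of_bool (x Alice ! 0 = i \<and> x Bob ! 0 = i \<and> y Alice ! 0 = j \<and> y Bob ! 0 = j)
            * op_mult S (op_mult S (U i) \<sigma>) (op_adj (U j)) (shield_index x) (shield_index y)) else 0)"
    proof (cases "x \<in> joint_basis ?E \<and> y \<in> joint_basis ?E")
      case True
      then obtain i1 j1 s i2 j2 s' where x: "x = ks_index i1 j1 s" "i1 < 2 ^ m" "j1 < 2 ^ m" "s \<in> S"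
        and y: "y = ks_index i2 j2 s'" "i2 < 2 ^ m" "j2 < 2 ^ m" "s' \<in> S"
        unfolding joint_basis_key_shield_iff S by blast
      have "(\<Sum>i<2 ^ m. \<Sum>j<2 ^ m.
            of_bool (x Alice ! 0 = i \<and> x Bob ! 0 = i \<and> y Alice ! 0 = j \<and> y Bob ! 0 = j)
            * op_mult S (op_mult S (U i) \<sigma>) (op_adj (U j)) (shield_index x) (shield_index y))
        = (\<Sum>i<2 ^ m. if i = i1 then (\<Sum>j<2 ^ m. if j = i2 then
            of_bool (j1 = i1 \<and> j2 = i2) * op_mult S (op_mult S (U i1) \<sigma>) (op_adj (U i2)) s s' else 0) else 0)"
      proof (cases "j1 = i1 \<and> j2 = i2")
        case True
        then show ?thesis unfolding x(1) y(1) by (intro sum.cong refl) (auto intro!: sum.cong)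
      next
        case False
        then have z0: "of_bool (x Alice ! 0 = i \<and> x Bob ! 0 = i \<and> y Alice ! 0 = j \<and> y Bob ! 0 = j) = (0 :: complex)" for i j
          by (auto simp: x(1) y(1))
        have f0: "of_bool (j1 = i1 \<and> j2 = i2) = (0 :: complex)" using False by auto
        show ?thesis unfolding z0 f0 by simp
      qed
      also have "\<dots> = of_bool (j1 = i1 \<and> j2 = i2) * op_mult S (op_mult S (U i1) \<sigma>) (op_adj (U i2)) s s'"
        using x y by simp
      finally have sm: "(\<Sum>i<2 ^ m. \<Sum>j<2 ^ m.
            of_bool (x Alice ! 0 = i \<and> x Bob ! 0 = i \<and> y Alice ! 0 = j \<and> y Bob ! 0 = j)
            * op_mult S (op_mult S (U i) \<sigma>) (op_adj (U j)) (shield_index x) (shield_index y))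
        = of_bool (j1 = i1 \<and> j2 = i2) * op_mult S (op_mult S (U i1) \<sigma>) (op_adj (U i2)) s s'" .
      have "\<gamma> x y = 1 / 2 ^ m * (of_bool (j1 = i1 \<and> j2 = i2) * op_mult S (op_mult S (U i1) \<sigma>) (op_adj (U i2)) s s')"
        unfolding x(1) y(1) \<gamma>[OF x(2,3) y(2,3) x(4) y(4)] om[OF x(2) y(2) x(4) y(4)] by auto
      then show ?thesis by (simp only: sm True simp_thms if_True)
    next
      case False
      then show ?thesis using operatorsD[OF ops, of x y] by auto
    qed
  qed
  then show ?thesis unfolding private_states_def mem_Collect_eq S[symmetric] using dens uni by blast
qed

subsection \<open>Words and blocks\<close>

text \<open>The layout of n pairs [key bit, shield index] in the list of one party.\<close>

definition blocks :: "nat \<Rightarrow> (nat \<Rightarrow> nat) \<Rightarrow> (nat \<Rightarrow> nat) \<Rightarrow> nat list" where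
  "blocks n b g = concat (map (\<lambda>i. [b i, g i]) [0..<n])"

lemma blocks_0 [simp]: "blocks 0 b g = []"
  by (simp add: blocks_def)

lemma blocks_Suc: "blocks (Suc n) b g = blocks n b g @ [b n, g n]"
  by (simp add: blocks_def)

lemma blocks_Suc_shift: "blocks (Suc n) b g = [b 0, g 0] @ blocks n (\<lambda>i. b (Suc i)) (\<lambda>i. g (Suc i))"
  by (induction n) (simp_all add: blocks_Suc)

lemma length_blocks [simp]: "length (blocks n b g) = 2 * n"
  by (induction n) (simp_all add: blocks_Suc)

lemma nth_blocks: "i < n \<Longrightarrow> blocks n b g ! (2 * i) = b i" "i < n \<Longrightarrow> blocks n b g ! Suc (2 * i) = g i"
proof (induction n)
  case (Suc n)
  { case 1 then show ?case using Suc by (cases "i = n") (auto simp: blocks_Suc nth_append) }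
  { case 2 then show ?case using Suc by (cases "i = n") (auto simp: blocks_Suc nth_append) }
qed simp_all

lemma concat_replicate_pair: "concat (replicate n [k, l]) = blocks n (\<lambda>i. k) (\<lambda>i. l)"
  by (simp add: blocks_def map_replicate_const)

text \<open>Key bits are kept as the set of positions with bit 1, so that they are directly elements
  of the binary codes.\<close>

definition word :: "nat \<Rightarrow> nat set \<Rightarrow> nat list \<Rightarrow> nat list" where
  "word n X As = blocks n (\<lambda>i. of_bool (i \<in> X)) (\<lambda>i. As ! i)"

definition bits :: "nat \<Rightarrow> nat list \<Rightarrow> nat set" where
  "bits n u = {i. i < n \<and> u ! (2 * i) = 1}"

lemma bits_Pow [simp]: "bits n u \<subseteq> {..<n}"
  by (auto simp: bits_def)

lemma bits_word [simp]: "X \<subseteq> {..<n} \<Longrightarrow> bits n (word n X As) = X"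
  by (auto simp: bits_def word_def nth_blocks of_bool_def split: if_splits)

lemma word_inject:
  assumes "X \<subseteq> {..<n}" "X' \<subseteq> {..<n}" "length As = n" "length As' = n"
  shows "word n X As = word n X' As' \<longleftrightarrow> X = X' \<and> As = As'"
proof
  assume w: "word n X As = word n X' As'"
  then have "X = X'" using bits_word[OF assms(1)] bits_word[OF assms(2)] by metis
  moreover have "As = As'"
  proof (rule nth_equalityI)
    fix i assume "i < length As"
    then show "As ! i = As' ! i"
      using nth_blocks(2)[of i n "\<lambda>i. of_bool (i \<in> X)" "\<lambda>i. As ! i"] nth_blocks(2)[of i n "\<lambda>i. of_bool (i \<in> X')" "\<lambda>i. As' ! i"] w assms
      by (simp add: word_def)
  qed (use assms in simp)
  ultimately show "X = X' \<and> As = As'" by simp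
qed simp

lemma word_in_party_basis:
  assumes "As \<in> party_basis (replicate n d)"
  shows "word n X As \<in> party_basis (concat (replicate n [2, d]))"
proof -
  have A: "length As = n" "\<And>i. i < n \<Longrightarrow> As ! i < d" using assms by (auto simp: party_basis_iff)
  have "word n X As ! i < concat (replicate n [2, d]) ! i" if "i < 2 * n" for i
  proof -
    have "i div 2 < n" using that by simp
    then show ?thesis
      using nth_blocks[of "i div 2" n] A(2)[of "i div 2"]
      by (cases "even i") (auto simp: word_def concat_replicate_pair elim!: evenE oddE)
  qed
  then show ?thesis by (simp add: party_basis_iff word_def concat_replicate_pair)
qed

lemma party_basis_word:
  assumes u: "u \<in> party_basis (concat (replicate n [2, d]))"
  shows "\<exists>As\<in>party_basis (replicate n d). u = word n (bits n u) As"
proof -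
  define As where "As = map (\<lambda>i. u ! Suc (2 * i)) [0..<n]"
  have l: "length u = 2 * n" and lt: "\<And>i. i < 2 * n \<Longrightarrow> u ! i < concat (replicate n [2, d]) ! i"
    using u by (auto simp: party_basis_iff concat_replicate_pair)
  have lt2: "u ! (2 * i) < 2" "u ! Suc (2 * i) < d" if "i < n" for i
    using lt[of "2 * i"] lt[of "Suc (2 * i)"] that by (auto simp: concat_replicate_pair nth_blocks)
  have "As \<in> party_basis (replicate n d)" using lt2 by (simp add: party_basis_iff As_def)
  moreover have "u = word n (bits n u) As"
  proof (rule nth_equalityI)
    show "length u = length (word n (bits n u) As)" using l by (simp add: word_def)
    fix i assume "i < length u"
    then have i: "i div 2 < n" using l by simp
    have "u ! (2 * (i div 2)) = 0 \<or> u ! (2 * (i div 2)) = 1" using lt2(1)[OF i] by auto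
    then show "u ! i = word n (bits n u) As ! i"
      using nth_blocks[OF i] i
      by (cases "even i") (auto simp: word_def bits_def As_def elim!: evenE oddE)
  qed
  ultimately show ?thesis by blast
qed

definition word_index :: "nat \<Rightarrow> nat set \<Rightarrow> nat list \<Rightarrow> nat set \<Rightarrow> nat list \<Rightarrow> index" where
  "word_index n X As Y Bs = (\<lambda>p. case p of Alice \<Rightarrow> word n X As | Bob \<Rightarrow> word n Y Bs | Charlie \<Rightarrow> [])"

lemma word_index_simps [simp]:
  "word_index n X As Y Bs Alice = word n X As" "word_index n X As Y Bs Bob = word n Y Bs" "word_index n X As Y Bs Charlie = []"
  by (simp_all add: word_index_def)

lemma power_dims_key_shield [simp]:
  "power_dims (key_shield k a b) n Alice = concat (replicate n [k, a])"
  "power_dims (key_shield k a b) n Bob = concat (replicate n [k, b])"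
  "power_dims (key_shield k a b) n Charlie = []"
  by (simp_all add: power_dims_def)

text \<open>Arbitrary index functions, rather than sets and lists, let the induction shift all of
  them by one.\<close>

lemma tensor_power_blocks:
  fixes D :: dims
  assumes D: "D = key_shield 2 d d"
  shows "tensor_power D \<rho> n
      (\<lambda>p. case p of Alice \<Rightarrow> blocks n b g | Bob \<Rightarrow> blocks n h l | Charlie \<Rightarrow> [])
      (\<lambda>p. case p of Alice \<Rightarrow> blocks n b' g' | Bob \<Rightarrow> blocks n h' l' | Charlie \<Rightarrow> [])
    = (\<Prod>i<n. \<rho> (ks_index (b i) (h i) (g i, l i)) (ks_index (b' i) (h' i) (g' i, l' i)))"
proof (induction n arbitrary: b g h l b' g' h' l')
  case 0
  have "(\<lambda>p. case p of Alice \<Rightarrow> [] | Bob \<Rightarrow> [] | Charlie \<Rightarrow> []) = (\<lambda>p. [] :: nat list)"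
    by (auto simp: fun_eq_iff split: party.split)
  then show ?case by (simp add: op_id_def)
next
  case (Suc n)
  let ?I = "\<lambda>n b g h l p. case p of Alice \<Rightarrow> blocks n b g | Bob \<Rightarrow> blocks n h l | Charlie \<Rightarrow> []"
  have t: "(\<lambda>p. take (length (D p)) (?I (Suc n) b g h l p)) = ks_index (b 0) (h 0) (g 0, l 0)" for b g h l
    by (simp add: index_eq_iff blocks_Suc_shift D)
  have dr: "(\<lambda>p. drop (length (D p)) (?I (Suc n) b g h l p))
     = ?I n (\<lambda>i. b (Suc i)) (\<lambda>i. g (Suc i)) (\<lambda>i. h (Suc i)) (\<lambda>i. l (Suc i))" for b g h l
    by (simp add: index_eq_iff blocks_Suc_shift D)
  show ?case
    unfolding tensor_power.simps tensor_def t dr Suc.IH prod.lessThan_Suc_shift by simp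
qed

lemma tensor_power_word:
  "tensor_power (key_shield 2 d d) \<rho> n (word_index n X As Y Bs) (word_index n X' As' Y' Bs')
    = (\<Prod>i<n. \<rho> (ks_index (of_bool (i \<in> X)) (of_bool (i \<in> Y)) (As ! i, Bs ! i))
                (ks_index (of_bool (i \<in> X')) (of_bool (i \<in> Y')) (As' ! i, Bs' ! i)))"
  unfolding word_index_def word_def by (rule tensor_power_blocks[OF refl])

lemma joint_basis_word_index:
  assumes "x \<in> joint_basis (power_dims (key_shield 2 d d) n)"
  shows "\<exists>As\<in>party_basis (replicate n d). \<exists>Bs\<in>party_basis (replicate n d).
     x = word_index n (bits n (x Alice)) As (bits n (x Bob)) Bs"
proof -
  have "x Alice \<in> party_basis (concat (replicate n [2, d]))" "x Bob \<in> party_basis (concat (replicate n [2, d]))" "x Charlie = []"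
    using assms by (auto simp: joint_basis_def party_all)
  then show ?thesis using party_basis_word[of "x Alice" n d] party_basis_word[of "x Bob" n d]
    by (auto simp: index_eq_iff)
qed

text \<open>The case of \<open>locc_pull\<close> with one Kraus operator of weight 1 per outcome:
  completeness says that the images partition the basis.\<close>

lemma locc_partition:
  assumes p: "p \<in> P" and finI: "finite I"
    and V: "\<And>k. k \<in> I \<Longrightarrow> V k \<subseteq> party_basis (es k)"
    and g: "\<And>k. k \<in> I \<Longrightarrow> inj_on (g k) (V k)" "\<And>k. k \<in> I \<Longrightarrow> g k ` V k \<subseteq> party_basis (D p)"
    and part: "\<And>u. u \<in> party_basis (D p) \<Longrightarrow> \<exists>k\<in>I. u \<in> g k ` V k \<and> (\<forall>k'\<in>I. u \<in> g k' ` V k' \<longrightarrow> k' = k)"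
    and \<Lambda>: "\<And>k. k \<in> I \<Longrightarrow> locc P (D(p := es k)) E (\<Lambda> k)"
  shows "locc P D E (\<lambda>\<rho> x y. \<Sum>k\<in>I. \<Lambda> k (pull p (V k) (g k) \<rho>) x y)"
proof -
  have "locc P D E (\<lambda>\<rho> x y. \<Sum>k\<in>I. \<Lambda> k (\<lambda>x y. of_real 1 * (\<Sum>l\<in>{()}. pull p (V k) (g k) \<rho> x y)) x y)"
  proof (rule locc_pull[OF p finI, where es = es])
    fix u assume "u \<in> party_basis (D p)"
    then obtain k where k: "k \<in> I" "u \<in> g k ` V k" "\<forall>k'\<in>I. u \<in> g k' ` V k' \<longrightarrow> k' = k" using part by blast
    have iff: "u \<in> g k' ` V k' \<longleftrightarrow> k' = k" if "k' \<in> I" for k' using k that by blast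
    have "(\<Sum>k\<in>I. \<Sum>l\<in>{()}. if u \<in> g k ` V k then 1 else (0 :: real)) = (\<Sum>k'\<in>I. if k' = k then 1 else 0)"
      by (intro sum.cong refl) (simp add: iff)
    then show "(\<Sum>k\<in>I. \<Sum>l\<in>{()}. if u \<in> g k ` V k then 1 else 0) = (1 :: real)" using k(1) finI by simp
  next
    fix k assume k: "k \<in> I"
    show "V k \<subseteq> party_basis (es k)" by (rule V[OF k])
    show "inj_on (g k) (V k) \<and> g k ` V k \<subseteq> party_basis (D p)" using g[OF k] by blast
    show "locc P (D(p := es k)) E (\<Lambda> k)" by (rule \<Lambda>[OF k])
  qed simp_all
  then show ?thesis by simp
qed

subsection \<open>The distillation protocol\<close>

text \<open>
  Alice announces the coset \<open>q\<close> of her word in the code \<open>C\<close>, Bob decodes the error pattern \<open>e\<close> and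
  announces it. On the positions in \<open>e\<close> Alice's bits are known to the environment, so the key is read
  off a subcode vanishing on \<open>e\<close>: Alice's word is \<open>sd x0 (c e i)\<close> with representative \<open>x0\<close> and key \<open>i\<close>.
  All other data are kept in the shields, whose basis vectors \<open>decA\<close> and \<open>decB\<close> decode.
\<close>

locale protocol =
  fixes d n r m a b :: nat and C :: "nat set set" and R :: "nat set \<Rightarrow> nat set set" and c :: "nat set \<Rightarrow> nat \<Rightarrow> nat set"
    and Good :: "nat set set"
    and decA :: "nat \<Rightarrow> nat set \<times> nat set \<times> nat list" and decB :: "nat \<Rightarrow> nat set \<times> nat list"
  assumes C: "linear_code n C" and dist: "\<And>w. w \<in> C \<Longrightarrow> w \<noteq> {} \<Longrightarrow> 2 * r < card w"
    and Good: "Good = {e \<in> Pow {..<n}. card e \<le> r}"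
    and R: "\<And>e. e \<in> Good \<Longrightarrow> R e \<subseteq> Pow {..<n}"
    and Rc: "\<And>e. e \<in> Good \<Longrightarrow> bij_betw (\<lambda>(x, i). sd x (c e i)) (R e \<times> {..<2 ^ m}) (Pow {..<n})"
    and c: "\<And>e i. e \<in> Good \<Longrightarrow> i < 2 ^ m \<Longrightarrow> c e i \<in> C \<and> c e i \<inter> e = {}"
    and decA: "bij_betw decA {..<a} (SIGMA e:Good. R e \<times> party_basis (replicate n d))"
    and decB: "bij_betw decB {..<b} (Pow {..<n} \<times> party_basis (replicate n d))"
begin

abbreviation "SH \<equiv> party_basis (replicate n d)"
abbreviation "DD \<equiv> power_dims (key_shield 2 d d) n"
abbreviation "EE \<equiv> key_shield (2 ^ m) a b"

lemma finite_Good: "finite Good"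
  unfolding Good by simp

lemma empty_Good: "{} \<in> Good"
  by (simp add: Good)

lemma Good_sub: "e \<in> Good \<Longrightarrow> e \<subseteq> {..<n}"
  by (simp add: Good)

lemma c_sub: "e \<in> Good \<Longrightarrow> i < 2 ^ m \<Longrightarrow> c e i \<subseteq> {..<n}"
  using c linear_codeD(1)[OF C] by blast

lemma SH_length: "As \<in> SH \<Longrightarrow> length As = n"
  by (simp add: party_basis_iff)

lemma Rc_unique:
  assumes "e \<in> Good" "x \<in> R e" "x' \<in> R e" "i < 2 ^ m" "i' < 2 ^ m" "sd x (c e i) = sd x' (c e i')"
  shows "x = x' \<and> i = i'"
proof -
  have "(x, i) = (x', i')"
    using Rc[OF assms(1)] assms by (intro inj_onD[OF bij_betw_imp_inj_on[OF Rc[OF assms(1)]], of "(x, i)" "(x', i')"]) auto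
  then show ?thesis by simp
qed

lemma Rc_exists:
  assumes "e \<in> Good" "X \<subseteq> {..<n}"
  shows "\<exists>x\<in>R e. \<exists>i<2 ^ m. X = sd x (c e i)"
proof -
  have "X \<in> (\<lambda>(x, i). sd x (c e i)) ` (R e \<times> {..<2 ^ m})"
    using bij_betw_imp_surj_on[OF Rc[OF assms(1)]] assms(2) by simp
  then show ?thesis by auto
qed

section \<open>Cosets and decoding\<close>

definition Q :: "nat set set set" where
  "Q = (\<lambda>x. sd x ` C) ` Pow {..<n}"

lemma coset_mem_iff: "X \<in> sd x ` C \<longleftrightarrow> sd x X \<in> C"
proof
  assume "sd x X \<in> C"
  then have "sd x (sd x X) \<in> sd x ` C" by (rule imageI)
  then show "X \<in> sd x ` C" by simp
qed auto

lemma coset_eqI: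
  assumes "X \<in> q" "q \<in> Q" shows "q = sd X ` C"
proof -
  obtain x where x: "q = sd x ` C" using assms(2) by (auto simp: Q_def)
  then have xX: "sd x X \<in> C" using assms(1) coset_mem_iff by simp
  have "Y \<in> q \<longleftrightarrow> Y \<in> sd X ` C" for Y
  proof -
    have "sd x Y = sd (sd x X) (sd X Y)" "sd X Y = sd (sd x X) (sd x Y)" by (auto simp: sd_def)
    then show ?thesis unfolding x coset_mem_iff using linear_codeD(3)[OF C xX] by metis
  qed
  then show ?thesis by blast
qed

lemma self_in_coset: "X \<in> sd X ` C"
  unfolding coset_mem_iff using linear_codeD(2)[OF C] by simp

text \<open>The default \<open>{}\<close> lies in \<open>Good\<close>, so every word of Bob has an
  outcome and his measurement is complete.\<close>

definition dec :: "nat set set \<Rightarrow> nat set \<Rightarrow> nat set" where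
  "dec q Y = (if \<exists>e\<in>Good. sd Y e \<in> q then SOME e. e \<in> Good \<and> sd Y e \<in> q else {})"

lemma dec_Good: "dec q Y \<in> Good"
proof (cases "\<exists>e\<in>Good. sd Y e \<in> q")
  case True
  then have "(SOME e. e \<in> Good \<and> sd Y e \<in> q) \<in> Good \<and> sd Y (SOME e. e \<in> Good \<and> sd Y e \<in> q) \<in> q"
    by (rule_tac someI_ex[of "\<lambda>e. e \<in> Good \<and> sd Y e \<in> q"]) blast
  then show ?thesis using True by (simp add: dec_def)
qed (simp add: dec_def empty_Good)

text \<open>Two candidates for the error differ by a codeword of weight at most 2 r, and the
  distance of the code forces it to be empty.\<close>

lemma dec_correct:
  assumes q: "q \<in> Q" "X \<in> q" and e: "e \<in> Good"
  shows "dec q (sd X e) = e"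
proof -
  have ex: "\<exists>e'\<in>Good. sd (sd X e) e' \<in> q" using assms by (intro bexI[of _ e]) auto
  let ?e = "SOME e'. e' \<in> Good \<and> sd (sd X e) e' \<in> q"
  have s: "?e \<in> Good" "sd (sd X e) ?e \<in> q"
    using someI_ex[of "\<lambda>e'. e' \<in> Good \<and> sd (sd X e) e' \<in> q"] ex by blast+
  have "sd X (sd (sd X e) ?e) \<in> C"
    using s(2) coset_eqI[OF q(2,1)] coset_mem_iff by metis
  moreover have "sd X (sd (sd X e) ?e) = sd e ?e" by (auto simp: sd_def)
  ultimately have C': "sd e ?e \<in> C" by simp
  have "finite e" "finite ?e" using e s(1) finite_subset[of _ "{..<n}"] by (auto simp: Good)
  then have "card (sd e ?e) \<le> 2 * r" using card_sd_le[of e ?e] e s(1) by (auto simp: Good)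
  then have "sd e ?e = {}" using dist[OF C'] by force
  then show ?thesis using ex by (simp add: dec_def)
qed

section \<open>Kraus operators of the protocol\<close>

definition VA :: "nat set set \<Rightarrow> nat list set" where
  "VA q = {u \<in> party_basis (DD Alice). bits n u \<in> q}"

definition VB :: "nat set set \<Rightarrow> nat set \<Rightarrow> nat list set" where
  "VB q e = {u \<in> party_basis (DD Bob). dec q (bits n u) = e}"

text \<open>Alice's relabelling is split by the representative x, which she announces. This removes
  coherences between different representatives, for which the monomial form of the output leaves no
  room. Bob's \<open>WB e\<close> is not split: he performs a single relabelling.\<close>

definition WA :: "nat set \<Rightarrow> nat set \<Rightarrow> nat list set" where
  "WA e x = {w \<in> party_basis (EE Alice). fst (decA (w ! 1)) = e \<and> fst (snd (decA (w ! 1))) = x}"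

definition gA :: "nat list \<Rightarrow> nat list" where
  "gA w = (case decA (w ! 1) of (e, x, As) \<Rightarrow> word n (sd x (c e (w ! 0))) As)"

definition WB :: "nat set \<Rightarrow> nat list set" where
  "WB e = {w \<in> party_basis (EE Bob). fst (decB (w ! 1)) \<in> R e}"

definition gB :: "nat set \<Rightarrow> nat list \<Rightarrow> nat list" where
  "gB e w = (case decB (w ! 1) of (x, Bs) \<Rightarrow> word n (sd (sd x (c e (w ! 0))) e) Bs)"

lemma decA_in: "s < a \<Longrightarrow> decA s = (e, x, As) \<Longrightarrow> e \<in> Good \<and> x \<in> R e \<and> As \<in> SH"
  using bij_betwE[OF decA] by force

lemma decB_in: "s < b \<Longrightarrow> decB s = (x, Bs) \<Longrightarrow> x \<subseteq> {..<n} \<and> Bs \<in> SH"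
  using bij_betwE[OF decB] by force

lemma decA_ex: "e \<in> Good \<Longrightarrow> x \<in> R e \<Longrightarrow> As \<in> SH \<Longrightarrow> \<exists>s<a. decA s = (e, x, As)"
proof -
  assume "e \<in> Good" "x \<in> R e" "As \<in> SH"
  then have "(e, x, As) \<in> decA ` {..<a}" using bij_betw_imp_surj_on[OF decA] by simp
  then show ?thesis by auto
qed

lemma decB_ex: "x \<subseteq> {..<n} \<Longrightarrow> Bs \<in> SH \<Longrightarrow> \<exists>s<b. decB s = (x, Bs)"
proof -
  assume "x \<subseteq> {..<n}" "Bs \<in> SH"
  then have "(x, Bs) \<in> decB ` {..<b}" using bij_betw_imp_surj_on[OF decB] by simp
  then show ?thesis by auto
qed

lemma decA_inj: "s < a \<Longrightarrow> s' < a \<Longrightarrow> decA s = decA s' \<Longrightarrow> s = s'"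
  using inj_onD[OF bij_betw_imp_inj_on[OF decA]] by simp

lemma decB_inj: "s < b \<Longrightarrow> s' < b \<Longrightarrow> decB s = decB s' \<Longrightarrow> s = s'"
  using inj_onD[OF bij_betw_imp_inj_on[OF decB]] by simp

lemma sd_sub: "e \<in> Good \<Longrightarrow> x \<in> R e \<Longrightarrow> i < 2 ^ m \<Longrightarrow> sd x (c e i) \<subseteq> {..<n}"
  using R c_sub by (intro sd_Pow) auto

lemma WA_E:
  assumes "w \<in> WA e x"
  obtains i s As where "w = [i, s]" "i < 2 ^ m" "s < a" "decA s = (e, x, As)" "e \<in> Good" "x \<in> R e" "As \<in> SH"
proof -
  obtain i s where w: "w = [i, s]" "i < 2 ^ m" "s < a" using assms by (auto simp: WA_def party_basis_pair_iff)
  obtain As where As: "decA s = (e, x, As)" using assms w by (cases "decA s") (auto simp: WA_def)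
  show thesis using that[OF w As] decA_in[OF w(3) As] by blast
qed

lemma WB_E:
  assumes "w \<in> WB e"
  obtains i s x Bs where "w = [i, s]" "i < 2 ^ m" "s < b" "decB s = (x, Bs)" "x \<in> R e" "Bs \<in> SH"
proof -
  obtain i s where w: "w = [i, s]" "i < 2 ^ m" "s < b" using assms by (auto simp: WB_def party_basis_pair_iff)
  obtain x Bs where Bs: "decB s = (x, Bs)" by (cases "decB s")
  show thesis using that[OF w Bs] decB_in[OF w(3) Bs] assms Bs w by (simp add: WB_def)
qed

text \<open>A word corrected by e is uniquely a representative plus the codeword of a key, so
  \<open>gB e\<close> maps \<open>WB e\<close> bijectively onto Bob's whole basis and one Kraus
  operator is complete.\<close>

lemma locc_Bob_relabel:
  assumes P: "Bob \<in> P" and e: "e \<in> Good" and D: "D Bob = DD Bob" "D Alice = EE Alice" "D Charlie = []"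
  shows "locc P D EE (pull Bob (WB e) (gB e))"
proof -
  have "locc P D EE (\<lambda>\<rho> x y. \<Sum>k\<in>{()}. (\<lambda>\<rho>. \<rho>) (pull Bob (WB e) (gB e) \<rho>) x y)"
  proof (rule locc_partition[OF P, where es = "\<lambda>k. EE Bob"])
    show "WB e \<subseteq> party_basis (EE Bob)" by (auto simp: WB_def)
    show "inj_on (gB e) (WB e)"
    proof (rule inj_onI)
      fix w w' assume w: "w \<in> WB e" "w' \<in> WB e" "gB e w = gB e w'"
      obtain i s x Bs where 1: "w = [i, s]" "i < 2 ^ m" "s < b" "decB s = (x, Bs)" "x \<in> R e" "Bs \<in> SH" using WB_E[OF w(1)] .
      obtain i' s' x' Bs' where 2: "w' = [i', s']" "i' < 2 ^ m" "s' < b" "decB s' = (x', Bs')" "x' \<in> R e" "Bs' \<in> SH" using WB_E[OF w(2)] .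
      have "sd (sd x (c e i)) e = sd (sd x' (c e i')) e \<and> Bs = Bs'"
        using w(3) sd_sub[OF e 1(5,2)] sd_sub[OF e 2(5,2)] Good_sub[OF e] 1 2
        by (subst (asm) gB_def, subst (asm) gB_def)
          (simp add: word_inject sd_Pow SH_length)
      then have "x = x' \<and> i = i'" "Bs = Bs'" using Rc_unique[OF e 1(5) 2(5) 1(2) 2(2)] by auto
      then show "w = w'" using 1 2 decB_inj by simp
    qed
    show "gB e ` WB e \<subseteq> party_basis (D Bob)"
      by (auto simp: gB_def D word_in_party_basis elim!: WB_E)
    show "\<exists>k\<in>{()}. u \<in> gB e ` WB e \<and> (\<forall>k'\<in>{()}. u \<in> gB e ` WB e \<longrightarrow> k' = k)" if u: "u \<in> party_basis (D Bob)" for u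
    proof -
      obtain Bs where Bs: "Bs \<in> SH" "u = word n (bits n u) Bs"
        using party_basis_word[of u n d] u D by (auto)
      obtain x i where x: "x \<in> R e" "i < 2 ^ m" "sd (bits n u) e = sd x (c e i)"
        using Rc_exists[OF e sd_Pow[OF bits_Pow Good_sub[OF e]]] by blast
      obtain s where s: "s < b" "decB s = (x, Bs)" using decB_ex[OF _ Bs(1)] R[OF e] x(1) by blast
      have "[i, s] \<in> WB e" using x s by (auto simp: WB_def party_basis_pair_iff)
      moreover have "gB e [i, s] = u" using s x(3) Bs(2) by (simp add: gB_def flip: x(3))
      ultimately have "u \<in> gB e ` WB e" by blast
      then show ?thesis by simp
    qed
    have "D(Bob := EE Bob) = EE" using D by (simp add: index_eq_iff)
    then show "locc P (D(Bob := EE Bob)) EE (\<lambda>\<rho>. \<rho>)" by (simp add: locc.stop)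
  qed simp
  then show ?thesis by simp
qed

lemma locc_Alice_relabel:
  assumes P: "{Alice, Bob} \<subseteq> P" and e: "e \<in> Good"
  shows "locc P DD EE (\<lambda>\<rho> x y. \<Sum>z\<in>R e. pull Bob (WB e) (gB e) (pull Alice (WA e z) gA \<rho>) x y)"
proof (rule locc_partition[where es = "\<lambda>k. EE Alice"])
  show "Alice \<in> P" using P by simp
  show "finite (R e)" using R[OF e] by (rule finite_subset) simp
  fix z assume z: "z \<in> R e"
  show "WA e z \<subseteq> party_basis (EE Alice)" by (auto simp: WA_def)
  show "inj_on gA (WA e z)"
  proof (rule inj_onI)
    fix w w' assume w: "w \<in> WA e z" "w' \<in> WA e z" "gA w = gA w'"
    obtain i s As where 1: "w = [i, s]" "i < 2 ^ m" "s < a" "decA s = (e, z, As)" "As \<in> SH" using WA_E[OF w(1)] .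
    obtain i' s' As' where 2: "w' = [i', s']" "i' < 2 ^ m" "s' < a" "decA s' = (e, z, As')" "As' \<in> SH" using WA_E[OF w(2)] .
    have "sd z (c e i) = sd z (c e i') \<and> As = As'"
      using w(3) 1 2 sd_sub[OF e z 1(2)] sd_sub[OF e z 2(2)] by (simp add: gA_def word_inject SH_length del: sd_left_cancel)
    then have "i = i'" "As = As'" using Rc_unique[OF e z z 1(2) 2(2)] by auto
    then show "w = w'" using 1 2 decA_inj by simp
  qed
  show "gA ` WA e z \<subseteq> party_basis (DD Alice)"
    by (auto simp: gA_def word_in_party_basis elim!: WA_E)
  show "locc P (DD(Alice := EE Alice)) EE (pull Bob (WB e) (gB e))"
    using P e by (intro locc_Bob_relabel) auto
next
  fix u assume u: "u \<in> party_basis (DD Alice)"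
  obtain As where As: "As \<in> SH" "u = word n (bits n u) As"
    using party_basis_word[of u n d] u by (auto)
  obtain x i where x: "x \<in> R e" "i < 2 ^ m" "bits n u = sd x (c e i)" using Rc_exists[OF e bits_Pow] by blast
  obtain s where s: "s < a" "decA s = (e, x, As)" using decA_ex[OF e x(1) As(1)] by blast
  have "[i, s] \<in> WA e x" using x s by (auto simp: WA_def party_basis_pair_iff)
  moreover have "gA [i, s] = u" using s x(3) As(2) by (simp add: gA_def)
  ultimately have u1: "u \<in> gA ` WA e x" by blast
  have u2: "z = x" if z: "z \<in> R e" "u \<in> gA ` WA e z" for z
  proof -
    obtain w where w: "w \<in> WA e z" "u = gA w" using z(2) by blast
    obtain i' s' As' where 2: "w = [i', s']" "i' < 2 ^ m" "s' < a" "decA s' = (e, z, As')" "As' \<in> SH" using WA_E[OF w(1)] .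
    have "bits n u = sd z (c e i')" using w(2) 2 sd_sub[OF e z(1) 2(2)] by (simp add: gA_def)
    then have "sd z (c e i') = sd x (c e i)" using x(3) by (simp only:)
    then show ?thesis by (rule Rc_unique[OF e z(1) x(1) 2(2) x(2), THEN conjunct1])
  qed
  show "\<exists>k\<in>R e. u \<in> gA ` WA e k \<and> (\<forall>k'\<in>R e. u \<in> gA ` WA e k' \<longrightarrow> k' = k)"
  proof (rule bexI[OF _ x(1)], rule conjI[OF u1], rule ballI, rule impI)
    fix z assume "z \<in> R e" "u \<in> gA ` WA e z"
    then show "z = x" by (rule u2)
  qed
qed

definition distill :: "joint_op \<Rightarrow> joint_op" where
  "distill \<rho> = (\<lambda>x y. \<Sum>q\<in>Q. \<Sum>e\<in>Good. \<Sum>z\<in>R e. pull Bob (WB e) (gB e) (pull Alice (WA e z) gA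
      (pull Bob (VB q e) (\<lambda>w. w) (pull Alice (VA q) (\<lambda>w. w) \<rho>))) x y)"

text \<open>The nested sums of \<open>distill\<close> are the outcomes of successive rounds: Alice
  announces q, Bob e, Alice z, and Bob's last relabelling has a single outcome.\<close>

lemma locc_distill: "locc {Alice, Bob} DD EE distill"
proof -
  let ?P = "{Alice, Bob}"
  have 2: "locc ?P DD EE (\<lambda>\<rho> x y. \<Sum>e\<in>Good. (\<lambda>\<rho> x y. \<Sum>z\<in>R e. pull Bob (WB e) (gB e) (pull Alice (WA e z) gA \<rho>) x y)
      (pull Bob (VB q e) (\<lambda>w. w) \<rho>) x y)" for q
  proof (rule locc_partition[where es = "\<lambda>k. DD Bob"])
    fix e assume "e \<in> Good"
    then show "locc ?P (DD(Bob := DD Bob)) EE (\<lambda>\<rho> x y. \<Sum>z\<in>R e. pull Bob (WB e) (gB e) (pull Alice (WA e z) gA \<rho>) x y)"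
      unfolding fun_upd_triv by (intro locc_Alice_relabel) auto
  next
    fix u assume "u \<in> party_basis (DD Bob)"
    then show "\<exists>e\<in>Good. u \<in> (\<lambda>w. w) ` VB q e \<and> (\<forall>k'\<in>Good. u \<in> (\<lambda>w. w) ` VB q k' \<longrightarrow> k' = e)"
      using dec_Good by (intro bexI[of _ "dec q (bits n u)"]) (auto simp: VB_def)
  qed (auto simp: VB_def finite_Good simp del: power_dims_key_shield)
  have "locc ?P DD EE (\<lambda>\<rho> x y. \<Sum>q\<in>Q. (\<lambda>\<rho> x y. \<Sum>e\<in>Good. (\<lambda>\<rho> x y. \<Sum>z\<in>R e. pull Bob (WB e) (gB e) (pull Alice (WA e z) gA \<rho>) x y)
      (pull Bob (VB q e) (\<lambda>w. w) \<rho>) x y) (pull Alice (VA q) (\<lambda>w. w) \<rho>) x y)"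
  proof (rule locc_partition[where es = "\<lambda>k. DD Alice"])
    fix q
    show "locc ?P (DD(Alice := DD Alice)) EE (\<lambda>\<rho> x y. \<Sum>e\<in>Good. (\<lambda>\<rho> x y. \<Sum>z\<in>R e. pull Bob (WB e) (gB e) (pull Alice (WA e z) gA \<rho>) x y)
      (pull Bob (VB q e) (\<lambda>w. w) \<rho>) x y)"
      unfolding fun_upd_triv by (rule 2)
  next
    fix u assume "u \<in> party_basis (DD Alice)"
    moreover have "sd (bits n u) ` C \<in> Q" unfolding Q_def by (intro imageI) simp
    ultimately show "\<exists>q\<in>Q. u \<in> (\<lambda>w. w) ` VA q \<and> (\<forall>k'\<in>Q. u \<in> (\<lambda>w. w) ` VA k' \<longrightarrow> k' = q)"
      using self_in_coset coset_eqI by (intro bexI[of _ "sd (bits n u) ` C"]) (auto simp: VA_def)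
  qed (auto simp: VA_def Q_def simp del: power_dims_key_shield)
  then show ?thesis unfolding distill_def[abs_def] by simp
qed

end

subsection \<open>Twisted states\<close>

lemma prod_eq_zeroI:
  fixes f :: "nat \<Rightarrow> 'a::comm_semiring_1"
  assumes "k < n" "f k = 0" shows "(\<Prod>k<n. f k) = 0"
  by (rule prod_zero[OF finite_lessThan]) (rule bexI[of _ k]; use assms in simp)

definition sw :: "bool \<Rightarrow> nat \<times> nat \<Rightarrow> nat \<times> nat" where
  "sw b s = (if b then prod.swap s else s)"

definition phase :: "(nat \<times> nat \<Rightarrow> complex) \<Rightarrow> bool \<Rightarrow> nat \<times> nat \<Rightarrow> complex" where
  "phase ph b s = (if b then ph s else 1)"

text \<open>
  Single-copy states whose shield blocks are mixtures (with weights \<open>\<kappa>\<close>) of \<open>|00\<rangle>|s\<rangle> + ph s |11\<rangle>|swap s\<rangle>\<close>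
  without bit error, and of \<open>|01\<rangle>|s\<rangle>\<close> and \<open>|10\<rangle>|s\<rangle>\<close> (weights \<open>\<kappa>e\<close>) with bit error.
\<close>

definition twisted_state :: "nat \<Rightarrow> (nat \<times> nat \<Rightarrow> real) \<Rightarrow> (nat \<times> nat \<Rightarrow> real) \<Rightarrow> (nat \<times> nat \<Rightarrow> complex) \<Rightarrow> joint_op \<Rightarrow> bool" where
  "twisted_state d \<kappa> \<kappa>e ph \<rho> \<longleftrightarrow>
     (\<forall>s. 0 \<le> \<kappa> s \<and> \<kappa> (prod.swap s) = \<kappa> s \<and> 0 \<le> \<kappa>e s \<and> ph (prod.swap s) = ph s \<and> ph s * cnj (ph s) = 1)
   \<and> (\<forall>x y x' y'. \<forall>s\<in>{..<d} \<times> {..<d}. \<forall>s'\<in>{..<d} \<times> {..<d}.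
        \<rho> (ks_index (of_bool x) (of_bool y) s) (ks_index (of_bool x') (of_bool y') s')
         = (if x = y \<and> x' = y' \<and> sw x s = sw x' s' then \<kappa> s * phase ph x s * cnj (phase ph x' s')
            else if x \<noteq> y \<and> x' = x \<and> y' = y \<and> s = s' then complex_of_real (\<kappa>e s) else 0))"

locale private_source = protocol +
  fixes \<rho> :: joint_op and \<kappa> \<kappa>e :: "nat \<times> nat \<Rightarrow> real" and ph :: "nat \<times> nat \<Rightarrow> complex"
  assumes \<rho>: "joint_psd (key_shield 2 d d) \<rho>" "joint_trace (key_shield 2 d d) \<rho> = 1"
    and tw: "twisted_state d \<kappa> \<kappa>e ph \<rho>"
begin

lemma \<kappa>: "0 \<le> \<kappa> s" "\<kappa> (sw u s) = \<kappa> s" "0 \<le> \<kappa>e s"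
  and ph: "ph (sw u s) = ph s" "phase ph u' (sw u s) = phase ph u' s" "phase ph u s * cnj (phase ph u s) = 1"
proof -
  have t: "0 \<le> \<kappa> s \<and> \<kappa> (prod.swap s) = \<kappa> s \<and> 0 \<le> \<kappa>e s \<and> ph (prod.swap s) = ph s \<and> ph s * cnj (ph s) = 1"
    using tw unfolding twisted_state_def by blast
  then show "0 \<le> \<kappa> s" "\<kappa> (sw u s) = \<kappa> s" "0 \<le> \<kappa>e s" "ph (sw u s) = ph s"
    "phase ph u' (sw u s) = phase ph u' s" "phase ph u s * cnj (phase ph u s) = 1"
    unfolding sw_def phase_def by simp_all
qed

lemma entry:
  assumes "s \<in> {..<d} \<times> {..<d}" "s' \<in> {..<d} \<times> {..<d}"
  shows "\<rho> (ks_index (of_bool x) (of_bool y) s) (ks_index (of_bool x') (of_bool y') s')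
         = (if x = y \<and> x' = y' \<and> sw x s = sw x' s' then \<kappa> s * phase ph x s * cnj (phase ph x' s')
            else if x \<noteq> y \<and> x' = x \<and> y' = y \<and> s = s' then complex_of_real (\<kappa>e s) else 0)"
  using conjunct2[OF tw[unfolded twisted_state_def], THEN spec[of _ x], THEN spec[of _ y], THEN spec[of _ x'], THEN spec[of _ y'],
    THEN bspec, OF assms(1), THEN bspec, OF assms(2)] .

abbreviation "\<rho>n \<equiv> tensor_power (key_shield 2 d d) \<rho> n"

definition site :: "nat list \<Rightarrow> nat list \<Rightarrow> nat \<Rightarrow> nat \<times> nat" where
  "site As Bs k = (As ! k, Bs ! k)"

lemma site_in: "As \<in> SH \<Longrightarrow> Bs \<in> SH \<Longrightarrow> k < n \<Longrightarrow> site As Bs k \<in> {..<d} \<times> {..<d}"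
  by (simp add: site_def party_basis_iff)

definition wt :: "nat set \<Rightarrow> nat \<Rightarrow> nat \<times> nat \<Rightarrow> real" where
  "wt e k s = (if k \<in> e then \<kappa>e s else \<kappa> s)"

text \<open>A single copy has no coherence between bit error and no bit error, so some factor of the
  product is 0.\<close>

lemma power_entry_zero:
  assumes "X \<subseteq> {..<n}" "Y \<subseteq> {..<n}" "X' \<subseteq> {..<n}" "Y' \<subseteq> {..<n}"
    and "As \<in> SH" "Bs \<in> SH" "As' \<in> SH" "Bs' \<in> SH" and ne: "sd X Y \<noteq> sd X' Y'"
  shows "\<rho>n (word_index n X As Y Bs) (word_index n X' As' Y' Bs') = 0"
proof -
  obtain k where k: "(k \<in> sd X Y) \<noteq> (k \<in> sd X' Y')" using ne by blast
  then have "k < n" using assms(1-4) by auto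
  moreover have "\<rho> (ks_index (of_bool (k \<in> X)) (of_bool (k \<in> Y)) (site As Bs k)) (ks_index (of_bool (k \<in> X')) (of_bool (k \<in> Y')) (site As' Bs' k)) = 0"
    using k \<open>k < n\<close> assms by (subst entry) (auto simp: site_in simp del: mem_Times_iff)
  ultimately show ?thesis unfolding tensor_power_word site_def[symmetric] by (rule prod_eq_zeroI[where k = k])
qed

text \<open>At the positions of \<open>e\<close> a single copy is diagonal, which is where the
  agreement of X and X' on \<open>e\<close> enters; at the other positions it contributes its
  weight, the shield swap and the phases.\<close>

lemma power_entry:
  assumes SH: "As \<in> SH" "Bs \<in> SH" "As' \<in> SH" "Bs' \<in> SH" and e: "\<And>k. k \<in> e \<Longrightarrow> k \<in> X \<longleftrightarrow> k \<in> X'"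
  shows "\<rho>n (word_index n X As (sd X e) Bs) (word_index n X' As' (sd X' e) Bs')
    = (if \<forall>k<n. sw (k \<in> X - e) (site As Bs k) = sw (k \<in> X' - e) (site As' Bs' k)
       then of_real (\<Prod>k<n. wt e k (site As Bs k)) * (\<Prod>k<n. phase ph (k \<in> X - e) (site As Bs k))
         * cnj (\<Prod>k<n. phase ph (k \<in> X' - e) (site As' Bs' k)) else 0)"
proof -
  have f: "\<rho> (ks_index (of_bool (k \<in> X)) (of_bool (k \<in> sd X e)) (site As Bs k)) (ks_index (of_bool (k \<in> X')) (of_bool (k \<in> sd X' e)) (site As' Bs' k))
    = (if sw (k \<in> X - e) (site As Bs k) = sw (k \<in> X' - e) (site As' Bs' k)
       then of_real (wt e k (site As Bs k)) * phase ph (k \<in> X - e) (site As Bs k) * cnj (phase ph (k \<in> X' - e) (site As' Bs' k)) else 0)"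
    if k: "k < n" for k
  proof (cases "k \<in> e")
    case True
    then show ?thesis using e[OF True]
      by (subst entry[OF site_in[OF SH(1,2) k] site_in[OF SH(3,4) k]]) (auto simp: sw_def phase_def wt_def)
  next
    case False
    then show ?thesis
      by (subst entry[OF site_in[OF SH(1,2) k] site_in[OF SH(3,4) k]]) (auto simp: wt_def)
  qed
  show ?thesis
  proof (cases "\<forall>k<n. sw (k \<in> X - e) (site As Bs k) = sw (k \<in> X' - e) (site As' Bs' k)")
    case True
    have "\<rho>n (word_index n X As (sd X e) Bs) (word_index n X' As' (sd X' e) Bs')
      = (\<Prod>k<n. of_real (wt e k (site As Bs k)) * phase ph (k \<in> X - e) (site As Bs k) * cnj (phase ph (k \<in> X' - e) (site As' Bs' k)))"
      unfolding tensor_power_word site_def[symmetric] using f True by (intro prod.cong refl) simp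
    then show ?thesis using True by (simp add: prod.distrib)
  next
    case False
    then obtain k where "k < n" "sw (k \<in> X - e) (site As Bs k) \<noteq> sw (k \<in> X' - e) (site As' Bs' k)" by blast
    then have "\<rho>n (word_index n X As (sd X e) Bs) (word_index n X' As' (sd X' e) Bs') = 0"
      unfolding tensor_power_word site_def[symmetric] using f[of k] by (intro prod_eq_zeroI[where k = k]) simp_all
    then show ?thesis unfolding if_not_P[OF False] .
  qed
qed

section \<open>Correctable and uncorrectable error patterns\<close>

definition err :: "index \<Rightarrow> nat set" where
  "err x = sd (bits n (x Alice)) (bits n (x Bob))"

lemma err_sub: "err x \<subseteq> {..<n}"
  unfolding err_def by (intro sd_Pow bits_Pow)

definition \<rho>good :: joint_op where
  "\<rho>good = (\<lambda>x y. if err x \<in> Good \<and> err y \<in> Good then \<rho>n x y else 0)"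

definition \<rho>bad :: joint_op where
  "\<rho>bad = (\<lambda>x y. if err x \<notin> Good \<and> err y \<notin> Good then \<rho>n x y else 0)"

lemma psd_restrict:
  assumes "joint_psd D A" shows "joint_psd D (\<lambda>x y. if P x \<and> P y then A x y else 0)"
proof -
  obtain v where v: "\<forall>k i. i \<notin> joint_basis D \<longrightarrow> v k i = 0" "A = (\<lambda>i j. \<Sum>k\<in>joint_basis D. v k i * cnj (v k j))"
    using positive_op_decomp[OF finite_joint_basis assms] by (elim exE conjE) (rule that)
  let ?w = "\<lambda>k i. if P i then v k i else 0"
  have "(\<lambda>x y. if P x \<and> P y then A x y else 0) = (\<lambda>i j. \<Sum>k\<in>joint_basis D. ?w k i * cnj (?w k j))"
    unfolding v(2) by (intro ext) auto
  moreover have "joint_psd D (\<lambda>i j. \<Sum>k\<in>joint_basis D. ?w k i * cnj (?w k j))"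
    using v(1) by (intro positive_opI) auto
  ultimately show ?thesis by simp
qed

lemma \<rho>n_psd: "joint_psd DD \<rho>n"
  by (rule tensor_power_psd[OF \<rho>(1)])

lemma \<rho>good_psd: "joint_psd DD \<rho>good" and \<rho>bad_psd: "joint_psd DD \<rho>bad"
  unfolding \<rho>good_def \<rho>bad_def by (rule psd_restrict[OF \<rho>n_psd])+

text \<open>Entries between different error patterns vanish, so nothing is lost between the good and
  the bad part.\<close>

lemma \<rho>n_eq: "\<rho>n x y = \<rho>good x y + \<rho>bad x y"
proof (cases "x \<in> joint_basis DD \<and> y \<in> joint_basis DD")
  case True
  obtain As Bs where x: "x = word_index n (bits n (x Alice)) As (bits n (x Bob)) Bs" "As \<in> SH" "Bs \<in> SH"
    using joint_basis_word_index True by blast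
  obtain As' Bs' where y: "y = word_index n (bits n (y Alice)) As' (bits n (y Bob)) Bs'" "As' \<in> SH" "Bs' \<in> SH"
    using joint_basis_word_index True by blast
  have "\<rho>n x y = 0" if "err x \<noteq> err y"
    using that power_entry_zero[of "bits n (x Alice)" "bits n (x Bob)" "bits n (y Alice)" "bits n (y Bob)" As Bs As' Bs'] x y
    by (simp add: err_def)
  then show ?thesis unfolding \<rho>good_def \<rho>bad_def by (cases "err x = err y") auto
next
  case False
  then have "\<rho>n x y = 0" using operatorsD[OF positive_opD(1)[OF \<rho>n_psd]] by blast
  then show ?thesis by (simp add: \<rho>good_def \<rho>bad_def)
qed

definition \<tau> :: real where
  "\<tau> = Re (joint_trace DD \<rho>good)"

lemma trace_good: "joint_trace DD \<rho>good = of_real \<tau>"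
  unfolding \<tau>_def using positive_op_trace(3)[OF finite_joint_basis \<rho>good_psd] .

lemma trace_bad: "joint_trace DD \<rho>bad = of_real (1 - \<tau>)"
proof -
  have "joint_trace DD \<rho>n = joint_trace DD \<rho>good + joint_trace DD \<rho>bad"
    unfolding op_trace_def \<rho>n_eq sum.distrib ..
  then show ?thesis using tensor_power_trace[of "key_shield 2 d d" n \<rho>] \<rho>(2) by (simp add: trace_good algebra_simps)
qed

text \<open>The row index fixes the branch: Alice's word determines the coset, her shield label
  determines e and z. Within the branch, decoding forces Bob's word to be Alice's word plus e, and
  uniqueness of the representative forces his label to be x1 and his key to equal hers.\<close>

lemma distill_term:
  assumes q: "q \<in> Q" and e: "e \<in> Good" and z: "z \<in> R e"
    and ij: "i < 2 ^ m" "j < 2 ^ m" "i' < 2 ^ m" "j' < 2 ^ m" and st: "s < a" "s' < a" "t < b" "t' < b"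
    and dA: "decA s = (e1, x1, As)" "decA s' = (e1', x1', As')"
    and dB: "decB t = (y1, Bs)" "decB t' = (y1', Bs')"
  shows "pull Bob (WB e) (gB e) (pull Alice (WA e z) gA
      (pull Bob (VB q e) (\<lambda>w. w) (pull Alice (VA q) (\<lambda>w. w) \<rho>good))) (ks_index i j (s, t)) (ks_index i' j' (s', t'))
    = (if q = sd (sd x1 (c e1 i)) ` C \<and> e = e1 \<and> z = x1 then
       (if e1' = e1 \<and> x1' = x1 \<and> y1 = x1 \<and> y1' = x1 \<and> i = j \<and> i' = j' then
         \<rho>n (word_index n (sd x1 (c e1 i)) As (sd (sd x1 (c e1 i)) e1) Bs)
            (word_index n (sd x1 (c e1 i')) As' (sd (sd x1 (c e1 i')) e1) Bs')
        else 0) else 0)"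
    (is "?lhs = _")
proof -
  note A = decA_in[OF st(1) dA(1)] decA_in[OF st(2) dA(2)]
  note B = decB_in[OF st(3) dB(1)] decB_in[OF st(4) dB(2)]
  let ?X = "sd x1 (c e1 i)" and ?X' = "sd x1' (c e1' i')" and ?Y = "sd (sd y1 (c e j)) e" and ?Y' = "sd (sd y1' (c e j')) e"
  have XP: "?X \<subseteq> {..<n}" "?X' \<subseteq> {..<n}" using A ij sd_sub by auto
  have YP: "?Y \<subseteq> {..<n}" "?Y' \<subseteq> {..<n}" using B ij c_sub[OF e] Good_sub[OF e] by (simp_all add: sd_Pow)
  have WA: "[i, s] \<in> WA e z \<longleftrightarrow> e1 = e \<and> x1 = z" "[i', s'] \<in> WA e z \<longleftrightarrow> e1' = e \<and> x1' = z"
    using ij st dA by (auto simp: WA_def party_basis_pair_iff)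
  have WB: "[j, t] \<in> WB e \<longleftrightarrow> y1 \<in> R e" "[j', t'] \<in> WB e \<longleftrightarrow> y1' \<in> R e"
    using ij st dB by (auto simp: WB_def party_basis_pair_iff)
  have gA: "gA [i, s] = word n ?X As" "gA [i', s'] = word n ?X' As'" using dA by (simp_all add: gA_def)
  have gB: "gB e [j, t] = word n ?Y Bs" "gB e [j', t'] = word n ?Y' Bs'" using dB by (simp_all add: gB_def)
  have VA: "word n ?X As \<in> VA q \<longleftrightarrow> ?X \<in> q" "word n ?X' As' \<in> VA q \<longleftrightarrow> ?X' \<in> q"
    using A XP by (simp_all add: VA_def word_in_party_basis)
  have VB: "word n ?Y Bs \<in> VB q e \<longleftrightarrow> dec q ?Y = e" "word n ?Y' Bs' \<in> VB q e \<longleftrightarrow> dec q ?Y' = e"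
    using B YP by (simp_all add: VB_def word_in_party_basis)
  have idx: "(ks_index i j (s, t))(Bob := gB e (ks_index i j (s, t) Bob), Alice := gA (ks_index i j (s, t) Alice)) = word_index n ?X As ?Y Bs"
    "(ks_index i' j' (s', t'))(Bob := gB e (ks_index i' j' (s', t') Bob), Alice := gA (ks_index i' j' (s', t') Alice)) = word_index n ?X' As' ?Y' Bs'"
    by (simp_all add: index_eq_iff gA gB)
  have lhs: "?lhs = (if e1 = e \<and> x1 = z \<and> e1' = e \<and> x1' = z \<and> y1 \<in> R e \<and> y1' \<in> R e \<and> ?X \<in> q \<and> ?X' \<in> q \<and> dec q ?Y = e \<and> dec q ?Y' = e
      then \<rho>good (word_index n ?X As ?Y Bs) (word_index n ?X' As' ?Y' Bs') else 0)"
  proof -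
    have "?lhs = (if [i, s] \<in> WA e z \<and> [i', s'] \<in> WA e z \<and> [j, t] \<in> WB e \<and> [j', t'] \<in> WB e
        \<and> gA [i, s] \<in> VA q \<and> gA [i', s'] \<in> VA q \<and> gB e [j, t] \<in> VB q e \<and> gB e [j', t'] \<in> VB q e
      then \<rho>good ((ks_index i j (s, t))(Bob := gB e (ks_index i j (s, t) Bob), Alice := gA (ks_index i j (s, t) Alice)))
         ((ks_index i' j' (s', t'))(Bob := gB e (ks_index i' j' (s', t') Bob), Alice := gA (ks_index i' j' (s', t') Alice))) else 0)"
      unfolding pull_def by (simp add: fun_upd_idem)
    then show ?thesis unfolding idx WA WB gA gB VA VB by (auto simp: conj_ac)
  qed
  have errw: "err (word_index n ?X As ?Y Bs) = sd ?X ?Y" "err (word_index n ?X' As' ?Y' Bs') = sd ?X' ?Y'"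
    using XP YP by (simp_all add: err_def)
  \<comment> \<open>Correct decoding read backwards: if the true error pattern is in
    \<open>Good\<close>, the announced e is that pattern.\<close>
  have dd: "W = sd V e" if "V \<in> q" "dec q W = e" "sd V W \<in> Good" for V W
  proof -
    have "dec q (sd V (sd V W)) = sd V W" using that by (intro dec_correct[OF q])
    then have "sd V W = e" using that(2) by simp
    then show ?thesis by auto
  qed
  show ?thesis
  proof (cases "q = sd ?X ` C \<and> e = e1 \<and> z = x1 \<and> e1' = e1 \<and> x1' = x1 \<and> y1 = x1 \<and> y1' = x1 \<and> i = j \<and> i' = j'")
    case True
    then have t: "q = sd ?X ` C" "e = e1" "z = x1" "e1' = e1" "x1' = x1" "y1 = x1" "y1' = x1" "j = i" "j' = i'" by auto
    have "sd ?X ?X' = sd (c e i) (c e i')" unfolding t by (auto simp: sd_def)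
    then have "?X' \<in> q" unfolding t(1) coset_mem_iff using c[OF e] ij linear_codeD(3)[OF C] by auto
    moreover have X: "?X \<in> q" unfolding t(1) by (rule self_in_coset)
    moreover have "dec q (sd ?X e) = e" by (rule dec_correct[OF q X e])
    moreover have "dec q (sd ?X' e) = e" by (rule dec_correct[OF q \<open>?X' \<in> q\<close> e])
    ultimately have "?lhs = \<rho>good (word_index n ?X As ?Y Bs) (word_index n ?X' As' ?Y' Bs')"
      unfolding lhs using t z by simp
    also have "\<dots> = \<rho>n (word_index n ?X As ?Y Bs) (word_index n ?X' As' ?Y' Bs')"
    proof -
      have "sd ?X ?Y = e" "sd ?X' ?Y' = e" unfolding t by (auto simp: sd_def)
      then show ?thesis unfolding \<rho>good_def errw using e by simp
    qed
    finally have l: "?lhs = \<rho>n (word_index n ?X As ?Y Bs) (word_index n ?X' As' ?Y' Bs')" .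
    show ?thesis unfolding l by (simp only: t simp_thms if_True)
  next
    case False
    have "?lhs = 0"
    proof (rule ccontr)
      assume "?lhs \<noteq> 0"
      then have h: "e1 = e" "x1 = z" "e1' = e" "x1' = z" "y1 \<in> R e" "y1' \<in> R e" "?X \<in> q" "?X' \<in> q" "dec q ?Y = e" "dec q ?Y' = e"
        and n0: "\<rho>good (word_index n ?X As ?Y Bs) (word_index n ?X' As' ?Y' Bs') \<noteq> 0"
        unfolding lhs by (simp_all split: if_splits)
      have g: "sd ?X ?Y \<in> Good" "sd ?X' ?Y' \<in> Good"
        using n0 unfolding \<rho>good_def errw by presburger+
      have "?Y = sd ?X e" "?Y' = sd ?X' e" using dd[OF h(7,9) g(1)] dd[OF h(8,10) g(2)] .
      then have "sd y1 (c e j) = sd z (c e i)" "sd y1' (c e j') = sd z (c e i')" using h by auto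
      then have "y1 = z \<and> j = i" "y1' = z \<and> j' = i'"
        using Rc_unique[OF e h(5) z ij(2,1)] Rc_unique[OF e h(6) z ij(4,3)] by blast+
      moreover have "q = sd ?X ` C" by (rule coset_eqI[OF h(7) q])
      ultimately show False using False h by auto
    qed
    then show ?thesis using False by auto
  qed
qed

lemma distill_good:
  assumes ij: "i < 2 ^ m" "j < 2 ^ m" "i' < 2 ^ m" "j' < 2 ^ m" and st: "s < a" "s' < a" "t < b" "t' < b"
    and dA: "decA s = (e1, x1, As)" "decA s' = (e1', x1', As')"
    and dB: "decB t = (y1, Bs)" "decB t' = (y1', Bs')"
  shows "distill \<rho>good (ks_index i j (s, t)) (ks_index i' j' (s', t'))
    = (if e1' = e1 \<and> x1' = x1 \<and> y1 = x1 \<and> y1' = x1 \<and> i = j \<and> i' = j' then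
         \<rho>n (word_index n (sd x1 (c e1 i)) As (sd (sd x1 (c e1 i)) e1) Bs)
            (word_index n (sd x1 (c e1 i')) As' (sd (sd x1 (c e1 i')) e1) Bs')
        else 0)" (is "_ = ?V")
proof -
  note A = decA_in[OF st(1) dA(1)]
  let ?q = "sd (sd x1 (c e1 i)) ` C"
  have q: "?q \<in> Q" using sd_sub[of e1 x1 i] A ij unfolding Q_def by (intro imageI) auto
  have finR: "finite (R e)" if "e \<in> Good" for e using R[OF that] by (rule finite_subset) simp
  have "distill \<rho>good (ks_index i j (s, t)) (ks_index i' j' (s', t'))
    = (\<Sum>q\<in>Q. \<Sum>e\<in>Good. \<Sum>z\<in>R e. if q = ?q \<and> e = e1 \<and> z = x1 then ?V else 0)"
    unfolding distill_def by (intro sum.cong refl distill_term assms)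
  also have "\<dots> = (\<Sum>q\<in>Q. if q = ?q then (\<Sum>e\<in>Good. if e = e1 then (\<Sum>z\<in>R e. if z = x1 then ?V else 0) else 0) else 0)"
    by (intro sum.cong refl) (auto intro!: sum.cong)
  also have "\<dots> = ?V"
    using q A finR[of e1] finite_Good by (simp add: Q_def)
  finally show ?thesis .
qed

section \<open>The output in monomial form\<close>

definition encA :: "nat set \<times> nat set \<times> nat list \<Rightarrow> nat" where
  "encA y = (SOME s. s < a \<and> decA s = y)"

definition encB :: "nat set \<times> nat list \<Rightarrow> nat" where
  "encB y = (SOME s. s < b \<and> decB s = y)"

lemma encA: "e \<in> Good \<Longrightarrow> x \<in> R e \<Longrightarrow> As \<in> SH \<Longrightarrow> encA (e, x, As) < a \<and> decA (encA (e, x, As)) = (e, x, As)"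
  unfolding encA_def using someI_ex[of "\<lambda>s. s < a \<and> decA s = (e, x, As)"] decA_ex by blast

lemma encB: "x \<subseteq> {..<n} \<Longrightarrow> Bs \<in> SH \<Longrightarrow> encB (x, Bs) < b \<and> decB (encB (x, Bs)) = (x, Bs)"
  unfolding encB_def using someI_ex[of "\<lambda>s. s < b \<and> decB s = (x, Bs)"] decB_ex by blast

lemma encA_dec: "s < a \<Longrightarrow> decA s = y \<Longrightarrow> encA y = s"
  unfolding encA_def using decA_inj by (intro some_equality) auto

lemma encB_dec: "s < b \<Longrightarrow> decB s = y \<Longrightarrow> encB y = s"
  unfolding encB_def using decB_inj by (intro some_equality) auto

text \<open>Alice's half of swapping the shields at the positions in \<open>T\<close>; with the two
  lists exchanged it is Bob's half.\<close>

definition mixl :: "nat set \<Rightarrow> nat list \<Rightarrow> nat list \<Rightarrow> nat list" where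
  "mixl T As Bs = map (\<lambda>k. if k \<in> T then Bs ! k else As ! k) [0..<n]"

lemma mixl_SH: "As \<in> SH \<Longrightarrow> Bs \<in> SH \<Longrightarrow> mixl T As Bs \<in> SH"
  by (simp add: party_basis_iff mixl_def)

lemma mixl_mixl: "As \<in> SH \<Longrightarrow> Bs \<in> SH \<Longrightarrow> mixl T (mixl T As Bs) (mixl T Bs As) = As"
  by (intro nth_equalityI) (auto simp: mixl_def SH_length)

lemma site_mixl: "k < n \<Longrightarrow> site (mixl T As Bs) (mixl T Bs As) k = sw (k \<in> T) (site As Bs k)"
  by (simp add: site_def mixl_def sw_def)

lemma mixl_eq_iff:
  assumes "As \<in> SH" "Bs \<in> SH" "As' \<in> SH" "Bs' \<in> SH"
  shows "mixl T As Bs = mixl T' As' Bs' \<and> mixl T Bs As = mixl T' Bs' As'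
    \<longleftrightarrow> (\<forall>k<n. sw (k \<in> T) (site As Bs k) = sw (k \<in> T') (site As' Bs' k))" (is "?l \<longleftrightarrow> ?r")
proof
  assume ?l
  then show ?r using site_mixl by (metis (no_types, lifting))
next
  assume r: ?r
  have "mixl T As Bs ! k = mixl T' As' Bs' ! k \<and> mixl T Bs As ! k = mixl T' Bs' As' ! k" if "k < n" for k
    using r that by (auto simp: mixl_def sw_def site_def split: if_splits)
  moreover have "length (mixl T As Bs) = n" for T As Bs by (simp add: mixl_def)
  ultimately show ?l by (simp add: list_eq_iff_nth_eq)
qed

text \<open>The positions with key bit 1 and no error, where the source swaps the shields and
  applies its phase.\<close>

definition twist_set :: "nat \<Rightarrow> nat \<Rightarrow> nat set" where
  "twist_set i s = (case decA s of (e, x, As) \<Rightarrow> sd x (c e i) - e)"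

definition perm :: "nat \<Rightarrow> nat \<times> nat \<Rightarrow> nat \<times> nat" where
  "perm i S = (case decA (fst S) of (e, x, As) \<Rightarrow> case decB (snd S) of (y, Bs) \<Rightarrow>
     (encA (e, x, mixl (twist_set i (fst S)) As Bs), encB (y, mixl (twist_set i (fst S)) Bs As)))"

definition total_phase :: "nat \<Rightarrow> nat \<times> nat \<Rightarrow> complex" where
  "total_phase i S = (case decA (fst S) of (e, x, As) \<Rightarrow> case decB (snd S) of (y, Bs) \<Rightarrow>
     (\<Prod>k<n. phase ph (k \<in> twist_set i (fst S)) (site As Bs k)))"

text \<open>The factor \<open>2 ^ m / \<tau>\<close> compensates for the 1 / 2^m of a private state
  and normalises the good part. Shields in which Bob's label is not Alice's representative get
  weight 0.\<close>

definition total_weight :: "nat \<times> nat \<Rightarrow> real" where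
  "total_weight S = (case decA (fst S) of (e, x, As) \<Rightarrow> case decB (snd S) of (y, Bs) \<Rightarrow>
     if y = x then 2 ^ m / \<tau> * (\<Prod>k<n. wt e k (site As Bs k)) else 0)"

lemma shield_cases:
  assumes "S \<in> {..<a} \<times> {..<b}"
  obtains s t e x As y Bs where "S = (s, t)" "s < a" "t < b" "decA s = (e, x, As)" "decB t = (y, Bs)"
    "e \<in> Good" "x \<in> R e" "As \<in> SH" "y \<subseteq> {..<n}" "Bs \<in> SH"
proof -
  obtain s t where st: "S = (s, t)" "s < a" "t < b" using assms by auto
  obtain e x As where dA: "decA s = (e, x, As)" by (cases "decA s")
  obtain y Bs where dB: "decB t = (y, Bs)" by (cases "decB t")
  show thesis using that[OF st dA dB] decA_in[OF st(2) dA] decB_in[OF st(3) dB] by blast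
qed

text \<open>The twist set depends on the shield label only through e and x, which
  \<open>perm\<close> keeps; swapping twice therefore restores the shields. The weights are
  invariant because \<kappa> is symmetric and error positions are never swapped.\<close>

lemma perm_props:
  assumes S: "S \<in> {..<a} \<times> {..<b}"
  shows "perm i S \<in> {..<a} \<times> {..<b}" "perm i (perm i S) = S" "total_weight (perm i S) = total_weight S"
proof -
  obtain s t e x As y Bs where d: "S = (s, t)" "s < a" "t < b" "decA s = (e, x, As)" "decB t = (y, Bs)"
    "e \<in> Good" "x \<in> R e" "As \<in> SH" "y \<subseteq> {..<n}" "Bs \<in> SH"
    using shield_cases[OF S] .
  let ?T = "sd x (c e i) - e"
  let ?s = "encA (e, x, mixl ?T As Bs)" and ?t = "encB (y, mixl ?T Bs As)"
  have p: "perm i S = (?s, ?t)" using d by (simp add: perm_def twist_set_def)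
  have s: "?s < a" "decA ?s = (e, x, mixl ?T As Bs)" using encA[OF d(6,7) mixl_SH[OF d(8,10)]] by auto
  have t: "?t < b" "decB ?t = (y, mixl ?T Bs As)" using encB[OF d(9) mixl_SH[OF d(10,8)]] by auto
  show "perm i S \<in> {..<a} \<times> {..<b}" using p s t by simp
  have "perm i (?s, ?t) = (encA (e, x, As), encB (y, Bs))"
    using s t d by (simp add: perm_def twist_set_def mixl_mixl)
  then show "perm i (perm i S) = S" unfolding p using encA_dec[OF d(2,4)] encB_dec[OF d(3,5)] d(1) by simp
  have "wt e k (site (mixl ?T As Bs) (mixl ?T Bs As) k) = wt e k (site As Bs k)" if "k < n" for k
    using that \<kappa>(2) by (auto simp: wt_def site_mixl sw_def[of False])
  then have "(\<Prod>k<n. wt e k (site (mixl ?T As Bs) (mixl ?T Bs As) k)) = (\<Prod>k<n. wt e k (site As Bs k))"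
    by (intro prod.cong) auto
  then show "total_weight (perm i S) = total_weight S"
    unfolding p using s t d by (simp add: total_weight_def)
qed

text \<open>The codewords used for e avoid e, so the words of two keys agree on e and
  \<open>power_entry\<close> applies; equality of the swapped shields at all positions is equality
  of the permuted labels. If Bob's label is not x, both sides vanish, the right one through its
  weight.\<close>

lemma distill_monomial:
  assumes \<tau>: "\<tau> > 0" and ij: "i < 2 ^ m" "j < 2 ^ m" "i' < 2 ^ m" "j' < 2 ^ m"
    and S: "S \<in> {..<a} \<times> {..<b}" "S' \<in> {..<a} \<times> {..<b}"
  shows "distill \<rho>good (ks_index i j S) (ks_index i' j' S')
    = (if i = j \<and> i' = j' \<and> perm i S = perm i' S'
       then \<tau> * (total_phase i S * cnj (total_phase i' S') * total_weight (perm i S) / 2 ^ m) else 0)"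
proof -
  obtain s t e x As y Bs where d: "S = (s, t)" "s < a" "t < b" "decA s = (e, x, As)" "decB t = (y, Bs)"
    "e \<in> Good" "x \<in> R e" "As \<in> SH" "y \<subseteq> {..<n}" "Bs \<in> SH"
    using shield_cases[OF S(1)] .
  obtain s' t' e' x' As' y' Bs' where d': "S' = (s', t')" "s' < a" "t' < b" "decA s' = (e', x', As')" "decB t' = (y', Bs')"
    "e' \<in> Good" "x' \<in> R e'" "As' \<in> SH" "y' \<subseteq> {..<n}" "Bs' \<in> SH"
    using shield_cases[OF S(2)] .
  note D = distill_good[OF ij d(2) d'(2) d(3) d'(3) d(4) d'(4) d(5) d'(5)]
  let ?T = "sd x (c e i) - e" and ?T' = "sd x' (c e' i') - e'"
  have p: "perm i S = (encA (e, x, mixl ?T As Bs), encB (y, mixl ?T Bs As))"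
    "perm i' S' = (encA (e', x', mixl ?T' As' Bs'), encB (y', mixl ?T' Bs' As'))"
    using d d' by (simp_all add: perm_def twist_set_def)
  have pe: "perm i S = perm i' S' \<longleftrightarrow> e = e' \<and> x = x' \<and> y = y' \<and> mixl ?T As Bs = mixl ?T' As' Bs' \<and> mixl ?T Bs As = mixl ?T' Bs' As'"
    unfolding p using encA[OF d(6,7) mixl_SH[OF d(8,10), of ?T]] encA[OF d'(6,7) mixl_SH[OF d'(8,10), of ?T']]
      encB[OF d(9) mixl_SH[OF d(10,8), of ?T]] encB[OF d'(9) mixl_SH[OF d'(10,8), of ?T']]
    by (metis prod.inject)
  show ?thesis
  proof (cases "e' = e \<and> x' = x \<and> y = x \<and> y' = x \<and> i = j \<and> i' = j'")
    case True
    then have t: "e' = e" "x' = x" "y = x" "y' = x" "j = i" "j' = i'" by auto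
    have agree: "k \<in> sd x (c e i) \<longleftrightarrow> k \<in> sd x (c e i')" if "k \<in> e" for k
    proof -
      have "k \<notin> c e i" "k \<notin> c e i'" using c[OF d(6) ij(1)] c[OF d(6) ij(3)] that by auto
      then show ?thesis by simp
    qed
    have pe': "perm i S = perm i' S' \<longleftrightarrow> (\<forall>k<n. sw (k \<in> sd x (c e i) - e) (site As Bs k) = sw (k \<in> sd x (c e i') - e) (site As' Bs' k))"
      unfolding pe mixl_eq_iff[OF d(8,10) d'(8,10), symmetric] using t by auto
    have tp: "total_phase i S = (\<Prod>k<n. phase ph (k \<in> sd x (c e i) - e) (site As Bs k))"
      "total_phase i' S' = (\<Prod>k<n. phase ph (k \<in> sd x (c e i') - e) (site As' Bs' k))"
      using d d' t by (simp_all add: total_phase_def twist_set_def)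
    have tw: "total_weight (perm i S) = 2 ^ m / \<tau> * (\<Prod>k<n. wt e k (site As Bs k))"
      unfolding perm_props(3)[OF S(1)] using d t by (simp add: total_weight_def)
    have "distill \<rho>good (ks_index i j S) (ks_index i' j' S')
      = \<rho>n (word_index n (sd x (c e i)) As (sd (sd x (c e i)) e) Bs) (word_index n (sd x (c e i')) As' (sd (sd x (c e i')) e) Bs')"
      unfolding d(1) d'(1) D using t by simp
    also have "\<dots> = (if perm i S = perm i' S' then of_real (\<Prod>k<n. wt e k (site As Bs k)) * total_phase i S * cnj (total_phase i' S') else 0)"
      unfolding pe' tp by (rule power_entry[OF d(8,10) d'(8,10)]) (rule agree)
    finally show ?thesis using \<tau> t unfolding tw by simp
  next
    case False
    have "total_weight (perm i S) = 0" if "perm i S = perm i' S'" "i = j" "i' = j'"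
    proof -
      have "y \<noteq> x" using that False pe by auto
      then show ?thesis unfolding perm_props(3)[OF S(1)] using d by (simp add: total_weight_def)
    qed
    then show ?thesis unfolding d(1) d'(1) D using False by auto
  qed
qed

lemma distill_private:
  assumes \<tau>: "\<tau> > 0"
  shows "(\<lambda>x y. distill \<rho>good x y / of_real \<tau>) \<in> private_states m a b"
proof (rule private_state_monomial[where S = "{..<a} \<times> {..<b}" and \<pi> = perm and \<phi> = total_phase and w = total_weight])
  let ?S = "{..<a} \<times> {..<b}"
  have ph1: "total_phase i S * cnj (total_phase i S) = 1" if "S \<in> ?S" for i S
  proof -
    obtain s t e x As y Bs where d: "S = (s, t)" "s < a" "t < b" "decA s = (e, x, As)" "decB t = (y, Bs)"
      by (rule shield_cases[OF \<open>S \<in> ?S\<close>]) (rule that)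
    have "total_phase i S * cnj (total_phase i S)
      = (\<Prod>k<n. phase ph (k \<in> twist_set i s) (site As Bs k) * cnj (phase ph (k \<in> twist_set i s) (site As Bs k)))"
      using d by (simp add: total_phase_def prod.distrib)
    then show ?thesis by (simp add: ph(3))
  qed
  show "total_phase i S * cnj (total_phase i S) = 1" if "i < 2 ^ m" "S \<in> ?S" for i S by (rule ph1[OF that(2)])
  show "perm i S \<in> ?S \<and> perm i (perm i S) = S" if "i < 2 ^ m" "S \<in> ?S" for i S using perm_props[OF that(2)] by blast
  show "total_weight S \<ge> 0" for S
  proof -
    have "wt e k s \<ge> 0" for e k s using \<kappa>(1,3) by (simp add: wt_def)
    then have "(\<Prod>k<n. wt e k (site As Bs k)) \<ge> 0" for e As Bs by (intro prod_nonneg) auto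
    then show ?thesis using \<tau> by (simp add: total_weight_def split: prod.split)
  qed
  have ops: "distill \<rho>good \<in> joint_ops EE" using positive_opD(1)[OF locc_psd[OF locc_distill \<rho>good_psd]] .
  then show "(\<lambda>x y. distill \<rho>good x y / of_real \<tau>) \<in> joint_ops EE" by (auto intro!: operatorsI dest: operatorsD)
  show "distill \<rho>good (ks_index i j S) (ks_index i' j' S') / of_real \<tau>
    = (if i = j \<and> i' = j' \<and> perm i S = perm i' S' then total_phase i S * cnj (total_phase i' S') * total_weight (perm i S) / 2 ^ m else 0)"
    if "i < 2 ^ m" "j < 2 ^ m" "i' < 2 ^ m" "j' < 2 ^ m" "S \<in> ?S" "S' \<in> ?S" for i j i' j' S S'
    using \<tau> unfolding distill_monomial[OF \<tau> that]
    by (cases "i = j \<and> i' = j' \<and> perm i S = perm i' S'") (simp_all only: if_P if_not_P, simp_all)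
  \<comment> \<open>Trace preservation yields the normalisation of the weights, which avoids summing
    them explicitly.\<close>
  have "complex_of_real \<tau> = joint_trace EE (distill \<rho>good)"
    unfolding locc_trace[OF locc_distill] trace_good ..
  also have "\<dots> = (\<Sum>i::nat<2 ^ m. \<Sum>j<2 ^ m. \<Sum>S\<in>?S. if j = i then of_real (\<tau> * total_weight S / 2 ^ m) else 0)"
    unfolding op_trace_def sum_joint_basis_key_shield
  proof (intro sum.cong refl)
    fix i j :: nat and S assume "i \<in> {..<2 ^ m}" "j \<in> {..<2 ^ m}" and S: "S \<in> ?S"
    then have ij: "i < 2 ^ m" "j < 2 ^ m" by auto
    show "distill \<rho>good (ks_index i j S) (ks_index i j S) = (if j = i then of_real (\<tau> * total_weight S / 2 ^ m) else 0)"
      unfolding distill_monomial[OF \<tau> ij ij S S] using ph1[OF S, of i] perm_props(3)[OF S] by auto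
  qed
  also have "\<dots> = (\<Sum>i::nat<2 ^ m. \<Sum>S\<in>?S. \<Sum>j<2 ^ m. if j = i then of_real (\<tau> * total_weight S / 2 ^ m) else 0)"
    by (intro sum.cong refl sum.swap)
  also have "\<dots> = (\<Sum>i::nat<2 ^ m. \<Sum>S\<in>?S. of_real (\<tau> * total_weight S / 2 ^ m))"
    by (intro sum.cong refl) simp
  also have "\<dots> = of_real (\<tau> * (\<Sum>S\<in>?S. total_weight S))"
    by (simp add: sum_distrib_left)
  finally have "\<tau> = \<tau> * (\<Sum>S\<in>?S. total_weight S)" by (simp only: of_real_eq_iff)
  then show "(\<Sum>S\<in>?S. total_weight S) = 1" using \<tau> by simp
qed simp

text \<open>The good part is mapped to \<tau> times a private state, so the difference is the image
  of the bad part minus (1 - \<tau>) times that state: two positive operators of trace 1 -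
  \<tau>.\<close>

theorem distill_close:
  assumes \<tau>: "\<tau> > 0"
  shows "\<exists>\<gamma>\<in>private_states m a b. close_ops EE (2 * (1 - \<tau>)) (distill \<rho>n) \<gamma>"
proof (rule bexI[OF _ distill_private[OF \<tau>]])
  let ?\<gamma> = "\<lambda>x y. distill \<rho>good x y / of_real \<tau>"
  have t1: "1 - \<tau> \<ge> 0" using positive_op_trace(2)[OF finite_joint_basis \<rho>bad_psd] by (simp add: trace_bad)
  have "distill \<rho>n x y = distill \<rho>good x y + distill \<rho>bad x y" for x y
  proof -
    have "\<rho>n = (\<lambda>x y. 1 * \<rho>good x y + 1 * \<rho>bad x y)" using \<rho>n_eq by (intro ext) simp
    then show ?thesis using linear_mapD[OF locc_linear[OF locc_distill], of 1 \<rho>good 1 \<rho>bad] by simp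
  qed
  then have eq: "distill \<rho>n x y - ?\<gamma> x y = distill \<rho>bad x y - of_real (1 - \<tau>) * ?\<gamma> x y" for x y
    using \<tau> by (simp add: field_simps)
  have bad: "joint_psd EE (distill \<rho>bad)" "joint_trace EE (distill \<rho>bad) = of_real (1 - \<tau>)"
    using locc_psd[OF locc_distill \<rho>bad_psd] locc_trace[OF locc_distill] trace_bad by simp_all
  have g: "joint_psd EE ?\<gamma>" by (rule private_state_psd[OF distill_private[OF \<tau>]])
  have gt: "joint_trace EE ?\<gamma> = 1"
  proof -
    have "joint_trace EE ?\<gamma> = joint_trace EE (distill \<rho>good) / of_real \<tau>"
      by (simp add: op_trace_def sum_divide_distrib)
    then show ?thesis using \<tau> unfolding locc_trace[OF locc_distill] trace_good by simp
  qed
  have "joint_trace EE (\<lambda>x y. of_real (1 - \<tau>) * ?\<gamma> x y) = of_real (1 - \<tau>) * joint_trace EE ?\<gamma>"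
    unfolding op_trace_def sum_distrib_left ..
  then have gt2: "joint_trace EE (\<lambda>x y. of_real (1 - \<tau>) * ?\<gamma> x y) = of_real (1 - \<tau>)"
    unfolding gt by simp
  show "close_ops EE (2 * (1 - \<tau>)) (distill \<rho>n) ?\<gamma>"
    unfolding close_ops_def
  proof (intro exI conjI allI)
    show "joint_psd EE (distill \<rho>bad)" by (rule bad(1))
    show "joint_psd EE (\<lambda>x y. of_real (1 - \<tau>) * ?\<gamma> x y)" by (rule positive_op_scale[OF g t1])
    show "distill \<rho>n x y - ?\<gamma> x y = distill \<rho>bad x y - of_real (1 - \<tau>) * ?\<gamma> x y" for x y by (rule eq)
    show "Re (joint_trace EE (distill \<rho>bad)) + Re (joint_trace EE (\<lambda>x y. of_real (1 - \<tau>) * ?\<gamma> x y)) \<le> 2 * (1 - \<tau>)"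
      unfolding bad(2) gt2 by simp
  qed
qed

text \<open>Markov's inequality for the number of bit errors: giving erroneous entries the weight z
  turns the trace 1 of a copy into 1 - p + p z, and a bad pattern contains at least r + 1
  errors.\<close>

lemma failure_probability:
  assumes z: "z \<ge> 1" and p: "p = 2 * (\<Sum>s\<in>{..<d} \<times> {..<d}. \<kappa>e s)"
  shows "1 - \<tau> \<le> (1 - p + p * z) ^ n / z ^ Suc r"
proof -
  let ?D = "key_shield 2 d d"
  define h where "h = (\<lambda>x :: index. if x Alice ! 0 \<noteq> x Bob ! 0 then z else 1)"
  define \<rho>z where "\<rho>z = (\<lambda>x y. complex_of_real (h x) * \<rho> x y)"
  have sum2: "(\<Sum>i<2. f i) = f (of_bool False) + f (of_bool True)" for f :: "nat \<Rightarrow> complex"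
    by (simp add: numeral_2_eq_2)
  have tr: "joint_trace ?D \<rho>z' = (\<Sum>s\<in>{..<d} \<times> {..<d}. 2 * of_real (\<kappa> s) + 2 * of_real (c * \<kappa>e s))"
    if h: "\<And>x. \<rho>z' x x = complex_of_real (if x Alice ! 0 \<noteq> x Bob ! 0 then c else 1) * \<rho> x x" for \<rho>z' :: joint_op and c
  proof -
    have "joint_trace ?D \<rho>z' = (\<Sum>i<2. \<Sum>j<2. \<Sum>s\<in>{..<d} \<times> {..<d}. \<rho>z' (ks_index i j s) (ks_index i j s))"
      unfolding op_trace_def sum_joint_basis_key_shield ..
    also have "\<dots> = (\<Sum>s\<in>{..<d} \<times> {..<d}. 2 * of_real (\<kappa> s) + 2 * of_real (c * \<kappa>e s))"
      unfolding sum2 h sum.distrib[symmetric]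
    proof (intro sum.cong refl)
      fix s assume s: "s \<in> {..<d} \<times> {..<d}"
      have e: "\<rho> (ks_index (of_bool x) (of_bool y) s) (ks_index (of_bool x) (of_bool y) s) = of_real (if x = y then \<kappa> s else \<kappa>e s)" for x y
        using ph(3)[of x s] by (subst entry[OF s s]) (cases "x = y"; simp add: mult.assoc)
      show "complex_of_real (if ks_index (of_bool False) (of_bool False) s Alice ! 0 \<noteq> ks_index (of_bool False) (of_bool False) s Bob ! 0 then c else 1) * \<rho> (ks_index (of_bool False) (of_bool False) s) (ks_index (of_bool False) (of_bool False) s)
         + complex_of_real (if ks_index (of_bool False) (of_bool True) s Alice ! 0 \<noteq> ks_index (of_bool False) (of_bool True) s Bob ! 0 then c else 1) * \<rho> (ks_index (of_bool False) (of_bool True) s) (ks_index (of_bool False) (of_bool True) s)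
         + (complex_of_real (if ks_index (of_bool True) (of_bool False) s Alice ! 0 \<noteq> ks_index (of_bool True) (of_bool False) s Bob ! 0 then c else 1) * \<rho> (ks_index (of_bool True) (of_bool False) s) (ks_index (of_bool True) (of_bool False) s)
         + complex_of_real (if ks_index (of_bool True) (of_bool True) s Alice ! 0 \<noteq> ks_index (of_bool True) (of_bool True) s Bob ! 0 then c else 1) * \<rho> (ks_index (of_bool True) (of_bool True) s) (ks_index (of_bool True) (of_bool True) s))
        = 2 * of_real (\<kappa> s) + 2 * of_real (c * \<kappa>e s)"
        unfolding e by (simp add: algebra_simps)
    qed
    finally show ?thesis .
  qed
  have t1: "(\<Sum>s\<in>{..<d} \<times> {..<d}. 2 * complex_of_real (\<kappa> s) + 2 * of_real (1 * \<kappa>e s)) = 1"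
    using tr[of \<rho> 1] \<rho>(2) by simp
  have "complex_of_real (2 * (\<Sum>s\<in>{..<d} \<times> {..<d}. \<kappa> s)) = 1 - of_real p"
    using t1 unfolding p by (simp add: sum.distrib sum_distrib_left eq_diff_eq)
  then have "complex_of_real (2 * (\<Sum>s\<in>{..<d} \<times> {..<d}. \<kappa> s)) = of_real (1 - p)" by simp
  then have k: "2 * (\<Sum>s\<in>{..<d} \<times> {..<d}. \<kappa> s) = 1 - p" by (simp only: of_real_eq_iff)
  have "joint_trace ?D \<rho>z = of_real (2 * (\<Sum>s\<in>{..<d} \<times> {..<d}. \<kappa> s) + z * (2 * (\<Sum>s\<in>{..<d} \<times> {..<d}. \<kappa>e s)))"
    by (subst tr[of \<rho>z z]) (simp_all add: \<rho>z_def h_def sum.distrib sum_distrib_left mult_ac)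
  then have trz: "joint_trace ?D \<rho>z = of_real (1 - p + p * z)" unfolding k p[symmetric] by (simp add: mult.commute)
  have diag: "tensor_power ?D \<rho>z n x x = of_real (z ^ card (err x)) * \<rho>n x x" if x: "x \<in> joint_basis DD" for x
  proof -
    obtain As Bs where w: "x = word_index n (bits n (x Alice)) As (bits n (x Bob)) Bs" "As \<in> SH" "Bs \<in> SH"
      using joint_basis_word_index[OF x] by blast
    let ?X = "bits n (x Alice)" and ?Y = "bits n (x Bob)"
    have "(\<Prod>i<n. h (ks_index (of_bool (i \<in> ?X)) (of_bool (i \<in> ?Y)) (As ! i, Bs ! i))) = (\<Prod>i<n. if i \<in> err x then z else 1)"
      by (intro prod.cong refl) (auto simp: h_def err_def)
    also have "\<dots> = (\<Prod>i\<in>{..<n} \<inter> err x. z)" by (simp only: prod.inter_restrict[OF finite_lessThan])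
    also have "{..<n} \<inter> err x = err x" using err_sub by auto
    finally have hp: "(\<Prod>i<n. h (ks_index (of_bool (i \<in> ?X)) (of_bool (i \<in> ?Y)) (As ! i, Bs ! i))) = z ^ card (err x)" by simp
    have "tensor_power ?D \<rho>z n (word_index n ?X As ?Y Bs) (word_index n ?X As ?Y Bs)
      = of_real (\<Prod>i<n. h (ks_index (of_bool (i \<in> ?X)) (of_bool (i \<in> ?Y)) (As ! i, Bs ! i))) * \<rho>n (word_index n ?X As ?Y Bs) (word_index n ?X As ?Y Bs)"
      unfolding tensor_power_word \<rho>z_def prod.distrib of_real_prod ..
    then show ?thesis unfolding hp using w(1) by simp
  qed
  have nn: "Re (\<rho>n x x) \<ge> 0" for x using positive_op_diag_entry(2)[OF finite_joint_basis \<rho>n_psd] .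
  have "z ^ Suc r * (1 - \<tau>) = (\<Sum>x\<in>joint_basis DD. z ^ Suc r * Re (\<rho>bad x x))"
    using trace_bad unfolding op_trace_def sum_distrib_left[symmetric] by (metis Re_complex_of_real Re_sum)
  also have "\<dots> \<le> (\<Sum>x\<in>joint_basis DD. z ^ card (err x) * Re (\<rho>n x x))"
  proof (rule sum_mono)
    fix x assume "x \<in> joint_basis DD"
    show "z ^ Suc r * Re (\<rho>bad x x) \<le> z ^ card (err x) * Re (\<rho>n x x)"
    proof (cases "err x \<in> Good")
      case True then show ?thesis using nn z by (simp add: \<rho>bad_def)
    next
      case False
      then have "Suc r \<le> card (err x)" using err_sub by (auto simp: Good)
      then have "z ^ Suc r \<le> z ^ card (err x)" using z by (intro power_increasing) auto
      then show ?thesis using False nn by (simp add: \<rho>bad_def mult_right_mono del: power_Suc)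
    qed
  qed
  also have "\<dots> = Re (joint_trace DD (tensor_power ?D \<rho>z n))"
    unfolding op_trace_def Re_sum by (intro sum.cong refl) (simp add: diag)
  also have "\<dots> = (1 - p + p * z) ^ n"
    unfolding tensor_power_trace trz by (simp flip: of_real_power)
  finally show ?thesis using z by (simp add: field_simps)
qed

end

subsection \<open>A lower bound on the key of twisted states\<close>

text \<open>For each e the cosets of a subcode avoiding e supply the representatives; the shield
  dimensions are simply the numbers of labels to be stored.\<close>

lemma protocol_exists:
  assumes C: "linear_code n C" "card C = 2 ^ k" and dist: "\<And>w. w \<in> C \<Longrightarrow> w \<noteq> {} \<Longrightarrow> 2 * r < card w" and r: "r \<le> k"
  shows "\<exists>a b R c decA decB. protocol d n r (k - r) a b C R c {e \<in> Pow {..<n}. card e \<le> r} decA decB"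
proof -
  define Good where "Good = {e \<in> Pow {..<n}. card e \<le> r}"
  have "\<exists>Rc. fst Rc \<subseteq> Pow {..<n} \<and> bij_betw (\<lambda>(x, i). sd x (snd Rc i)) (fst Rc \<times> {..<(2 :: nat) ^ (k - r)}) (Pow {..<n})
      \<and> (\<forall>i<(2 :: nat) ^ (k - r). snd Rc i \<in> C \<and> snd Rc i \<inter> e = {})" if e: "e \<in> Good" for e
  proof -
    have "finite e" "card e \<le> r" using e finite_subset[of e "{..<n}"] by (auto simp: Good_def)
    then obtain C' where C': "linear_code n C'" "C' \<subseteq> C" "card C' = 2 ^ (k - r)" "\<forall>c\<in>C'. c \<inter> e = {}"
      using subcode_avoiding[OF C r] by blast
    obtain R where R: "R \<subseteq> Pow {..<n}" "bij_betw (\<lambda>(x, c). sd x c) (R \<times> C') (Pow {..<n})"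
      using coset_representatives[OF C'(1)] by blast
    obtain h where h: "bij_betw h {..<(2 :: nat) ^ (k - r)} C'"
      using ex_bij_betw_nat_finite[OF linear_codeD(4)[OF C'(1)]] unfolding C'(3) lessThan_atLeast0 by blast
    have "bij_betw (map_prod id h) (R \<times> {..<(2 :: nat) ^ (k - r)}) (R \<times> C')"
      using h by (intro bij_betw_map_prod) auto
    then have "bij_betw ((\<lambda>(x, c). sd x c) \<circ> map_prod id h) (R \<times> {..<(2 :: nat) ^ (k - r)}) (Pow {..<n})"
      by (rule bij_betw_trans[OF _ R(2)])
    then have "bij_betw (\<lambda>(x, i). sd x (h i)) (R \<times> {..<(2 :: nat) ^ (k - r)}) (Pow {..<n})"
      by (simp add: comp_def case_prod_unfold map_prod_def)
    moreover have "h i \<in> C'" if "i < 2 ^ (k - r)" for i using bij_betw_apply[OF h] that by blast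
    ultimately show ?thesis using R(1) C'(2,4) by (intro exI[of _ "(R, h)"]) auto
  qed
  then obtain Rc where Rc: "\<And>e. e \<in> Good \<Longrightarrow> fst (Rc e) \<subseteq> Pow {..<n}
      \<and> bij_betw (\<lambda>(x, i). sd x (snd (Rc e) i)) (fst (Rc e) \<times> {..<(2 :: nat) ^ (k - r)}) (Pow {..<n})
      \<and> (\<forall>i<(2 :: nat) ^ (k - r). snd (Rc e) i \<in> C \<and> snd (Rc e) i \<inter> e = {})" by metis
  let ?SH = "party_basis (replicate n d)"
  have "finite (fst (Rc e))" if "e \<in> Good" for e using Rc[OF that] finite_subset by blast
  then have fA: "finite (SIGMA e:Good. fst (Rc e) \<times> ?SH)" by (intro finite_SigmaI) (auto simp: Good_def)
  obtain decA where decA: "bij_betw decA {..<card (SIGMA e:Good. fst (Rc e) \<times> ?SH)} (SIGMA e:Good. fst (Rc e) \<times> ?SH)"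
    using ex_bij_betw_nat_finite[OF fA] unfolding lessThan_atLeast0 by blast
  have fB: "finite (Pow {..<n} \<times> ?SH)" by simp
  obtain decB where decB: "bij_betw decB {..<card (Pow {..<n} \<times> ?SH)} (Pow {..<n} \<times> ?SH)"
    using ex_bij_betw_nat_finite[OF fB] unfolding lessThan_atLeast0 by blast
  have "protocol d n r (k - r) (card (SIGMA e:Good. fst (Rc e) \<times> ?SH)) (card (Pow {..<n} \<times> ?SH)) C
      (\<lambda>e. fst (Rc e)) (\<lambda>e. snd (Rc e)) Good decA decB"
    by (intro protocol.intro C dist Good_def decA decB) (use Rc in auto)
  then show ?thesis unfolding Good_def by blast
qed

text \<open>For r = floor(q n), a Gilbert-Varshamov code with weights above 2 r has at least (1 -
  h(2 q)) n bits, where q \<le> 1 / 4 keeps the radius in the range of the entropy bound. Avoiding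
  the error positions costs r \<le> q n bits, available because q \<le> 1 - h(2 q). Since p < q,
  more than r errors are exponentially unlikely.\<close>

theorem distillable_key_twisted_state:
  assumes \<rho>: "density_op (joint_basis (key_shield 2 d d)) \<rho>" and tw: "twisted_state d \<kappa> \<kappa>e ph \<rho>"
    and p: "p = 2 * (\<Sum>s\<in>{..<d} \<times> {..<d}. \<kappa>e s)" "0 \<le> p" "p < q" and q: "q \<le> 1 / 4" "q \<le> 1 - binary_entropy (2 * q)"
  shows "ereal (1 - binary_entropy (2 * q) - q) \<le> distillable_key (key_shield 2 d d) \<rho>"
  unfolding distillable_key_eq
proof (rule rate_ge)
  fix \<epsilon> :: real assume \<epsilon>: "\<epsilon> > 0"
  have pq: "p \<le> 1" "q - p > 0" "0 < q" using p q by auto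
  obtain z where z: "z \<ge> 1" "\<And>\<epsilon>. \<epsilon> > 0 \<Longrightarrow> \<forall>\<^sub>F n in sequentially. \<forall>k. (p + (q - p)) * real n \<le> real k \<longrightarrow> (1 - p + p * z) ^ n / z ^ k \<le> \<epsilon>"
    using chernoff_upper[OF p(2) pq(1,2)] by blast
  \<comment> \<open>The cap 1 / 2 keeps \<tau> positive, so that the good part can be
    normalised.\<close>
  have "min (\<epsilon> / 2) (1 / 2) > 0" using \<epsilon> by simp
  from z(2)[OF this]
  show "\<forall>\<^sub>F n in sequentially. \<exists>m\<in>key_achievable (key_shield 2 d d) \<rho> n \<epsilon>. (1 - binary_entropy (2 * q) - q) * real n \<le> real m"
  proof eventually_elim
    case (elim n)
    define r where "r = nat \<lfloor>q * real n\<rfloor>"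
    have r: "real r \<le> q * real n" "q * real n \<le> real (Suc r)" using pq by (auto simp: r_def) linarith+
    obtain C k where C: "linear_code n C" "card C = 2 ^ k" "\<forall>c\<in>C. c \<noteq> {} \<longrightarrow> 2 * r < card c" "2 ^ n \<le> 2 ^ k * ball_size n (2 * r)"
      using gilbert_varshamov by blast
    have "real n \<le> real k + real n * binary_entropy (2 * q)"
    proof -
      have b: "ball_size n (2 * r) > 0" using C(4) by (cases "ball_size n (2 * r)") auto
      have "(2 :: real) ^ n \<le> 2 ^ k * real (ball_size n (2 * r))"
        using of_nat_mono[OF C(4), where 'a = real] by simp
      then have "log 2 (2 ^ n) \<le> log 2 (2 ^ k * real (ball_size n (2 * r)))" using b by (subst log_le_cancel_iff) auto
      also have "\<dots> = real k + log 2 (ball_size n (2 * r))" using b by (simp add: log_mult log_nat_power)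
      also have "log 2 (ball_size n (2 * r)) \<le> real n * binary_entropy (2 * q)"
        using pq q r by (intro ball_size_le) auto
      finally show ?thesis by (simp add: log_nat_power)
    qed
    then have k: "real n * (1 - binary_entropy (2 * q)) \<le> real k" by (simp add: algebra_simps)
    have "real n * q \<le> real n * (1 - binary_entropy (2 * q))" using q by (intro mult_left_mono) auto
    then have rk: "r \<le> k" using k r by (simp add: mult.commute)
    have "\<exists>a b R c decA decB. protocol d n r (k - r) a b C R c {e \<in> Pow {..<n}. card e \<le> r} decA decB"
      by (rule protocol_exists[OF C(1,2) C(3)[rule_format] rk])
    then obtain a b R c decA decB where P: "protocol d n r (k - r) a b C R c {e \<in> Pow {..<n}. card e \<le> r} decA decB"
      by (elim exE) (rule that)
    interpret private_source d n r "k - r" a b C R c "{e \<in> Pow {..<n}. card e \<le> r}" decA decB \<rho> \<kappa> \<kappa>e ph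
      using P \<rho> tw by (intro private_source.intro private_source_axioms.intro) (auto simp: density_op_def)
    have "1 - \<tau> \<le> (1 - p + p * z) ^ n / z ^ Suc r" by (rule failure_probability[OF z(1) p(1)])
    also have "\<dots> \<le> min (\<epsilon> / 2) (1 / 2)" using elim[rule_format, of "Suc r"] r(2) by simp
    finally have \<tau>: "\<tau> > 0" "2 * (1 - \<tau>) \<le> \<epsilon>" by auto
    obtain \<gamma> where \<gamma>: "\<gamma> \<in> private_states (k - r) a b" "close_ops EE (2 * (1 - \<tau>)) (distill \<rho>n) \<gamma>"
      using distill_close[OF \<tau>(1)] by blast
    have "k - r \<in> key_achievable (key_shield 2 d d) \<rho> n \<epsilon>"
      unfolding key_achievable_iff[OF \<rho>(1)] using locc_distill \<gamma>(1) close_ops_mono[OF \<gamma>(2) \<tau>(2)] by blast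
    moreover have "(1 - binary_entropy (2 * q) - q) * real n \<le> real (k - r)"
      using k r(1) rk by (simp add: algebra_simps)
    ultimately show ?case by blast
  qed
qed

subsection \<open>Entropy estimates\<close>

lemma ln_ge_one_minus_inverse:
  fixes x :: real assumes "x > 0" shows "1 - 1 / x \<le> ln x"
  using ln_le_minus_one[of "1 / x"] assms by (simp add: ln_div)

lemma binary_entropy_nats:
  "binary_entropy p * ln 2 = - p * ln p - (1 - p) * ln (1 - p)"
  by (simp add: binary_entropy_def log_def field_simps)

text \<open>Turns nonnegativity of the target rate into the working range p < 1 / 5, that is, sqrt d
  > 4. On [1/4, 1/2] both entropy terms are estimated by - ln x \<ge> 1 - x; near 1/5 this is too
  weak, and below 1/4 the first term is estimated by - ln p \<ge> 2 ln 2.\<close>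

lemma binary_entropy_half_imp:
  assumes p: "0 < p" "p \<le> 1 / 2" and h: "binary_entropy p \<le> 1 / 2"
  shows "p < 1 / 5"
proof (rule ccontr)
  assume "\<not> p < 1 / 5"
  then have p5: "p \<ge> 1 / 5" by simp
  have "- ln (1 - p) \<ge> p" using ln_le_minus_one[of "1 - p"] p by simp
  then have b: "- (1 - p) * ln (1 - p) \<ge> (1 - p) * p" using mult_left_mono[of p "- ln (1 - p)" "1 - p"] p by (simp add: algebra_simps)
  have l2: "ln 2 \<le> (25 / 36 :: real)" "ln 2 \<ge> (2 / 3 :: real)" using ln2_le_25_over_36 ln2_ge_two_thirds by auto
  have H: "- p * ln p - (1 - p) * ln (1 - p) \<le> ln 2 / 2"
    using mult_right_mono[OF h, of "ln 2"] binary_entropy_nats[of p] by simp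
  show False
  proof (cases "p \<ge> 1 / 4")
    case True
    have "- ln p \<ge> 1 - p" using ln_le_minus_one[of p] p by simp
    then have "- p * ln p \<ge> p * (1 - p)" using mult_left_mono[of "1 - p" "- ln p" p] p by simp
    then have "2 * (p * (1 - p)) \<le> 25 / 72" using b H l2 by (simp add: algebra_simps)
    \<comment> \<open>Gives 2 p (1 - p) \<ge> 27 / 72, against the upper bound 25 / 72.\<close>
    moreover have "(p - 1 / 4) * (3 / 4 - p) \<ge> 0" using True p by (intro mult_nonneg_nonneg) auto
    then have "p * (1 - p) \<ge> 3 / 16" by (simp add: algebra_simps diff_divide_distrib)
    ultimately show False by linarith
  next
    case False
    have "ln p \<le> ln (1 / 4)" using False p by (intro ln_mono) auto
    also have "ln (1 / 4 :: real) = - (2 * ln 2)" using ln_realpow[of 2 2] by (simp add: ln_div)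
    finally have "p * (2 * ln 2) \<le> p * (- ln p)" using p by (intro mult_left_mono) auto
    moreover have "1 / 5 * (2 * ln 2) \<le> p * (2 * ln 2)" using p5 by (intro mult_right_mono) auto
    moreover have "(1 - p) * p \<ge> 1 / 2 * (1 / 5)" using p p5 by (intro mult_mono) auto
    ultimately show False using b H l2 by simp
  qed
qed

text \<open>The summand \<open>p\<^sup>3\<close> pays for replacing \<open>d\<close> by \<open>d - 1\<close> in the error probability.\<close>

lemma binary_entropy_double:
  fixes p :: real
  assumes p: "0 < p" "p \<le> 1 / 5"
  defines "q \<equiv> p + p ^ 3"
  shows "binary_entropy (2 * q) + q \<le> 2 * binary_entropy p"
proof -
  have q: "q = p * (1 + p\<^sup>2)" by (simp add: q_def algebra_simps power2_eq_square power3_eq_cube)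
  have "p ^ 3 \<le> (1 / 5) ^ 3" using p by (intro power_mono) auto
  then have q2: "0 < q" "2 * q < 1" using p by (auto simp: q_def power3_eq_cube intro: add_pos_pos)
  have "1 + p\<^sup>2 \<noteq> 0" using zero_le_power2[of p] by linarith
  then have lq: "ln (2 * q) = ln 2 + ln p + ln (1 + p\<^sup>2)"
    unfolding q using p by (simp add: ln_mult add_pos_nonneg)
  have "2 * binary_entropy p * ln 2 - (binary_entropy (2 * q) + q) * ln 2
    = 2 * (- p * ln p - (1 - p) * ln (1 - p)) - (- (2 * q) * ln (2 * q) - (1 - 2 * q) * ln (1 - 2 * q)) - q * ln 2"
    unfolding binary_entropy_nats[symmetric] by (simp add: algebra_simps)
  \<comment> \<open>The main terms 2 p ln p cancel; only 2 p^3 ln p is left of the logarithm of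
    p.\<close>
  also have "\<dots> = 2 * p ^ 3 * ln p + q * ln 2 + 2 * q * ln (1 + p\<^sup>2) + 2 * (- (1 - p) * ln (1 - p)) + (1 - 2 * q) * ln (1 - 2 * q)"
    unfolding lq by (simp add: q_def algebra_simps)
  finally have eq: "2 * binary_entropy p * ln 2 - (binary_entropy (2 * q) + q) * ln 2
    = 2 * p ^ 3 * ln p + q * ln 2 + 2 * q * ln (1 + p\<^sup>2) + 2 * (- (1 - p) * ln (1 - p)) + (1 - 2 * q) * ln (1 - 2 * q)" .
  have "- ln (1 - p) \<ge> p" using ln_le_minus_one[of "1 - p"] p by simp
  then have a1: "- (1 - p) * ln (1 - p) \<ge> (1 - p) * p" using mult_left_mono[of p "- ln (1 - p)" "1 - p"] p by (simp add: algebra_simps)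
  have "(1 - 2 * q) * (1 - 1 / (1 - 2 * q)) \<le> (1 - 2 * q) * ln (1 - 2 * q)"
    using q2 by (intro mult_left_mono ln_ge_one_minus_inverse) auto
  moreover have "(1 - 2 * q) * (1 - 1 / (1 - 2 * q)) = - 2 * q" using q2 by (simp add: field_simps)
  ultimately have a2: "- 2 * q \<le> (1 - 2 * q) * ln (1 - 2 * q)" by simp
  have a3: "0 \<le> 2 * q * ln (1 + p\<^sup>2)" using q2 by (intro mult_nonneg_nonneg) auto
  have "q * (2 / 3) \<le> q * ln 2" using q2 ln2_ge_two_thirds by (intro mult_left_mono) auto
  then have a4: "p * (2 / 3) + p ^ 3 * (2 / 3) \<le> q * ln 2" by (simp add: q_def algebra_simps)
  \<comment> \<open>The bound ln p \<ge> 1 - 1 / p is too weak near p = 1 / 5; applied to the root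
    it becomes ln p \<ge> 2 (1 - 1 / u), which is enough. The constant 4473 / 10000 lies just above
    sqrt (1 / 5).\<close>
  define u where "u = sqrt p"
  have u: "u > 0" "u\<^sup>2 = p" using p by (auto simp: u_def)
  have "u \<le> 4473 / 10000" using p unfolding u_def by (intro real_le_lsqrt) (auto simp: power2_eq_square)
  have "ln p = 2 * ln u" using p by (simp add: u_def ln_sqrt)
  then have "ln p \<ge> 2 * (1 - 1 / u)" using ln_ge_one_minus_inverse[OF u(1)] by simp
  then have "2 * p ^ 3 * ln p \<ge> 2 * p ^ 3 * (2 * (1 - 1 / u))" using p by (intro mult_left_mono) auto
  also have "2 * p ^ 3 * (2 * (1 - 1 / u)) = 4 * p ^ 3 - 4 * (p\<^sup>2 * u)"
    using u by (simp add: u(2)[symmetric] field_simps power2_eq_square power3_eq_cube)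
  finally have a5: "4 * p ^ 3 - 4 * (p\<^sup>2 * u) \<le> 2 * p ^ 3 * ln p" .
  have a6: "p\<^sup>2 * u \<le> p\<^sup>2 * (4473 / 10000)" using \<open>u \<le> 4473 / 10000\<close> by (intro mult_left_mono) auto
  have "p * (2 / 3 + (8 / 3) * p\<^sup>2 - (2 + 4 * (4473 / 10000)) * p) \<ge> 0"
  proof (intro mult_nonneg_nonneg)
    \<comment> \<open>The square is replaced by its tangent at the endpoint 1 / 5, where the
      estimate is tightest.\<close>
    have "(p - 1 / 5)\<^sup>2 \<ge> 0" by simp
    then have "p\<^sup>2 \<ge> 2 / 5 * p - 1 / 25" by (simp add: power2_diff power_divide)
    then show "0 \<le> 2 / 3 + (8 / 3) * p\<^sup>2 - (2 + 4 * (4473 / 10000)) * p" using p by simp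
  qed (use p in simp)
  then have a7: "p * (2 / 3) + (8 / 3) * p ^ 3 - 2 * p\<^sup>2 - 4 * (p\<^sup>2 * (4473 / 10000)) \<ge> 0"
    by (simp add: algebra_simps power2_eq_square power3_eq_cube)
  have "0 \<le> 2 * binary_entropy p * ln 2 - (binary_entropy (2 * q) + q) * ln 2"
    unfolding eq using a1 a2 a3 a4 a5 a6 a7 by (simp add: q_def algebra_simps power2_eq_square)
  then have "(binary_entropy (2 * q) + q) * ln 2 \<le> (2 * binary_entropy p) * ln 2" by simp
  then show ?thesis by (rule mult_right_le_imp_le) simp
qed

text \<open>With a = sqrt d and b = sqrt (d - 1) the claim is (a - b) (a + 1)^2 < b + 1. As (a - b)
  (a + b) = 1, this is (a + 1)^2 < (a + b) (b + 1), and b \<ge> a - 1 / 4 suffices for a \<ge>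
  4.\<close>

lemma error_probability_less:
  assumes "real d > 16"
  defines "p \<equiv> 1 / (sqrt (real d) + 1)"
  shows "1 / (sqrt (real (d - 1)) + 1) < p + p ^ 3"
proof -
  define a where "a = sqrt (real d)"
  define b where "b = sqrt (real (d - 1))"
  have ab: "a\<^sup>2 = real d" "b\<^sup>2 = real d - 1" "a \<ge> 0" "b \<ge> 0" using assms by (auto simp: a_def b_def of_nat_diff)
  have a4: "a \<ge> 4" unfolding a_def using assms by (intro real_le_rsqrt) auto
  have b3: "b \<ge> 15 / 4" unfolding b_def using assms by (intro real_le_rsqrt) (auto simp: power2_eq_square of_nat_diff)
  have d: "(a - b) * (a + b) = 1" using ab by (simp add: algebra_simps power2_eq_square)
  have "(a - b) * 4 \<le> (a - b) * (a + b)"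
    using a4 ab b3 by (intro mult_left_mono) (auto simp: a_def b_def)
  then have b4: "b \<ge> a - 1 / 4" using d by simp
  have ba: "b \<le> a" by (simp add: a_def b_def)
  have "(a + 1)\<^sup>2 < (2 * a - 1 / 4) * (a + 3 / 4)"
  proof -
    have "a * (a - 3 / 4) \<ge> 4 * (13 / 4)" using a4 by (intro mult_mono) auto
    then show ?thesis by (simp add: algebra_simps power2_eq_square)
  qed
  also have "\<dots> \<le> (a + b) * (b + 1)" using a4 b4 by (intro mult_mono) auto
  finally have "(a - b) * (a + 1)\<^sup>2 < (a - b) * ((a + b) * (b + 1))"
  proof (intro mult_strict_left_mono)
    have "a \<noteq> b" using d by auto
    then show "0 < a - b" using ba by simp
  qed
  also have "\<dots> = b + 1" using d by (simp add: mult.assoc[symmetric])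
  finally have "(a + 1) ^ 3 < (b + 1) * ((a + 1)\<^sup>2 + 1)" by (simp add: algebra_simps power2_eq_square power3_eq_cube)
  then have "(a + 1) ^ 3 / ((b + 1) * (a + 1) ^ 3) < (b + 1) * ((a + 1)\<^sup>2 + 1) / ((b + 1) * (a + 1) ^ 3)"
    using ab by (intro divide_strict_right_mono) (auto intro!: mult_pos_pos)
  also have "\<dots> = ((a + 1)\<^sup>2 + 1) / (a + 1) ^ 3" using ab by simp
  also have "\<dots> = 1 / (a + 1) + 1 / (a + 1) ^ 3" using ab by (simp add: add_divide_distrib power2_eq_square power3_eq_cube)
  finally show ?thesis using ab unfolding p_def a_def[symmetric] b_def[symmetric] by (simp add: power_divide)
qed

text \<open>There is much room: the left side is at most 6 p, because the error probability for d -
  1 is at most 2 p, while log (2 d) \<ge> 5 makes the right side at least 10 p.\<close>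

lemma repeater_bound_numeric:
  assumes d: "real d > 16" and t: "0 \<le> t" "t \<le> 1"
  defines "p \<equiv> 1 / (sqrt (real d) + 1)"
  shows "2 * log 2 (1 + t * (1 / (sqrt (real (d - 1)) + 1))) \<le> 2 * p * log 2 (2 * real d) + eta p"
proof -
  let ?p' = "1 / (sqrt (real (d - 1)) + 1)"
  have s4: "sqrt (real d) \<ge> 4" using d by (intro real_le_rsqrt) auto
  then have p: "0 < p" "p \<le> 1 / 5" by (auto simp: p_def field_simps)
  have "?p' \<ge> 0" by simp
  have "t * ?p' \<le> p + p ^ 3"
    using mult_right_mono[OF t(2) \<open>?p' \<ge> 0\<close>] error_probability_less[OF d] by (simp add: p_def)
  moreover have "p ^ 3 \<le> p" using p by (simp add: power_le_one_iff power3_eq_cube mult_le_one mult_left_le)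
  ultimately have x: "0 \<le> t * ?p'" "t * ?p' \<le> 2 * p" using t by auto
  have "ln (1 + t * ?p') \<le> t * ?p'" using x by (intro ln_add_one_self_le_self)
  then have "ln (1 + t * ?p') \<le> 2 * p" using x by linarith
  moreover have "2 * p \<le> (3 * p) * ln 2" using p ln2_ge_two_thirds mult_left_mono[of "2 / 3" "ln 2" "3 * p"] by simp
  ultimately have "log 2 (1 + t * ?p') \<le> 3 * p" by (simp add: log_def field_simps)
  moreover have "log 2 (2 * real d) \<ge> 5"
  proof -
    have "log 2 (2 ^ 5) = (5 :: real)" by (subst log_nat_power) auto
    moreover have "log 2 (2 ^ 5) \<le> log 2 (2 * real d)" using d by (subst log_le_cancel_iff) auto
    ultimately show ?thesis by linarith
  qed
  then have "2 * p * 5 \<le> 2 * p * log 2 (2 * real d)" using p by (intro mult_left_mono) auto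
  ultimately have "2 * log 2 (1 + t * ?p') \<le> 2 * p * log 2 (2 * real d)" using p by linarith
  moreover have "eta p \<ge> 0" using p by (simp add: eta_def mult_nonneg_nonpos)
  ultimately show ?thesis by linarith
qed

lemma repeater_bound_nonneg:
  assumes "d \<ge> 1" "p = 1 / (sqrt (real d) + 1)"
  shows "0 \<le> 2 * p * log 2 (2 * real d) + eta p"
proof -
  have p: "0 < p" "p \<le> 1" using assms by (auto simp: field_simps add_pos_nonneg)
  then have "eta p \<ge> 0" by (simp add: eta_def mult_nonneg_nonpos)
  moreover have "0 \<le> log 2 (2 * real d)" using assms(1) by simp
  ultimately show ?thesis using p by simp
qed

lemma key_limit: "(\<lambda>d. 1 - 2 * binary_entropy (1 / (sqrt (real d) + 1))) \<longlonglongrightarrow> 1"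
  unfolding binary_entropy_def log_def by real_asymp

lemma repeater_limit:
  "(\<lambda>d. 2 * (1 / (sqrt (real d) + 1)) * log 2 (2 * real d) + eta (1 / (sqrt (real d) + 1))) \<longlonglongrightarrow> 0"
  unfolding eta_def log_def by real_asymp

subsection \<open>Partial transposes of twisted states\<close>

abbreviation bit_index :: "bool \<Rightarrow> bool \<Rightarrow> nat \<times> nat \<Rightarrow> index" where
  "bit_index i j s \<equiv> ks_index (of_bool i) (of_bool j) s"

lemma joint_basis_bits_iff:
  "x \<in> joint_basis (key_shield 2 a b) \<longleftrightarrow> (\<exists>i j. \<exists>s\<in>{..<a} \<times> {..<b}. x = bit_index i j s)"
proof
  assume "x \<in> joint_basis (key_shield 2 a b)"
  then obtain i j s where x: "i < 2" "j < 2" "s \<in> {..<a} \<times> {..<b}" "x = ks_index i j s"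
    unfolding joint_basis_key_shield_iff by blast
  have "i = of_bool (i = 1)" "j = of_bool (j = 1)" using x by auto
  then have "x = bit_index (i = 1) (j = 1) s" using x(4) by simp
  then show "\<exists>i j. \<exists>s\<in>{..<a} \<times> {..<b}. x = bit_index i j s" using x(3) by blast
next
  assume "\<exists>i j. \<exists>s\<in>{..<a} \<times> {..<b}. x = bit_index i j s"
  then show "x \<in> joint_basis (key_shield 2 a b)" unfolding joint_basis_key_shield_iff
    by (elim exE bexE) (intro exI conjI bexI, auto)
qed

lemma bit_index_in: "s \<in> {..<a} \<times> {..<b} \<Longrightarrow> bit_index i j s \<in> joint_basis (key_shield 2 a b)"
  unfolding joint_basis_bits_iff by blast

lemma joint_ops_eqI:
  assumes A: "A \<in> joint_ops (key_shield 2 a b)" "B \<in> joint_ops (key_shield 2 a b)"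
    and eq: "\<And>i j s i' j' s'. s \<in> {..<a} \<times> {..<b} \<Longrightarrow> s' \<in> {..<a} \<times> {..<b} \<Longrightarrow>
      A (bit_index i j s) (bit_index i' j' s') = B (bit_index i j s) (bit_index i' j' s')"
  shows "A = B"
proof (intro ext)
  fix x y
  show "A x y = B x y"
  proof (cases "x \<in> joint_basis (key_shield 2 a b) \<and> y \<in> joint_basis (key_shield 2 a b)")
    case True
    then show ?thesis using eq unfolding joint_basis_bits_iff by auto
  next
    case False
    then show ?thesis using operatorsD[OF A(1)] operatorsD[OF A(2)] by auto
  qed
qed

lemma sum_joint_basis_bits:
  fixes f :: "index \<Rightarrow> 'a :: comm_monoid_add"
  shows "(\<Sum>x\<in>joint_basis (key_shield 2 a b). f x) = (\<Sum>s\<in>{..<a} \<times> {..<b}.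
    (f (bit_index False False s) + f (bit_index False True s)) + (f (bit_index True False s) + f (bit_index True True s)))"
proof -
  have two: "(\<Sum>i<2. g i) = g (of_bool False) + g (of_bool True)" for g :: "nat \<Rightarrow> 'a"
    by (simp add: numeral_2_eq_2)
  show ?thesis unfolding sum_joint_basis_key_shield two sum.distrib by (simp only: add_ac)
qed

definition twisted_op :: "nat \<Rightarrow> (nat \<times> nat \<Rightarrow> real) \<Rightarrow> (nat \<times> nat \<Rightarrow> real) \<Rightarrow> (nat \<times> nat \<Rightarrow> complex) \<Rightarrow> joint_op" where
  "twisted_op d \<kappa> \<kappa>e ph = (\<lambda>x y.
     if x \<in> joint_basis (key_shield 2 d d) \<and> y \<in> joint_basis (key_shield 2 d d)
     then if x Alice ! 0 = x Bob ! 0 \<and> y Alice ! 0 = y Bob ! 0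
              \<and> sw (x Alice ! 0 = 1) (shield_index x) = sw (y Alice ! 0 = 1) (shield_index y)
          then of_real (\<kappa> (shield_index x)) * phase ph (x Alice ! 0 = 1) (shield_index x) * cnj (phase ph (y Alice ! 0 = 1) (shield_index y))
          else if x Alice ! 0 \<noteq> x Bob ! 0 \<and> x = y then of_real (\<kappa>e (shield_index x)) else 0
     else 0)"

lemma twisted_op_entry:
  assumes "s \<in> {..<d} \<times> {..<d}" "s' \<in> {..<d} \<times> {..<d}"
  shows "twisted_op d \<kappa> \<kappa>e ph (bit_index i j s) (bit_index i' j' s')
    = (if i = j \<and> i' = j' \<and> sw i s = sw i' s' then of_real (\<kappa> s) * phase ph i s * cnj (phase ph i' s')
       else if i \<noteq> j \<and> i' = i \<and> j' = j \<and> s = s' then of_real (\<kappa>e s) else 0)"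
proof -
  have c: "(i \<noteq> j \<and> i = i' \<and> j = j' \<and> s = s') \<longleftrightarrow> (i \<noteq> j \<and> i' = i \<and> j' = j \<and> s = s')" by blast
  show ?thesis unfolding twisted_op_def if_P[OF conjI[OF bit_index_in[OF assms(1)] bit_index_in[OF assms(2)]]]
    by (simp only: ks_index_simps nth_Cons_0 of_bool_eq_iff of_bool_eq_1_iff ks_index_inject c)
qed

lemma twisted_op_operators: "twisted_op d \<kappa> \<kappa>e ph \<in> joint_ops (key_shield 2 d d)"
  by (intro operatorsI) (auto simp: twisted_op_def)

text \<open>The operator is the sum of the rank-one operators of sqrt (\<kappa> u) (|00>|u> + ph
  (swap u) |11>|swap u>) over all u, plus a nonnegative diagonal on the erroneous bits.\<close>

lemma twisted_op_psd:
  assumes \<kappa>: "\<And>s. 0 \<le> \<kappa> s" "\<And>s. \<kappa> (prod.swap s) = \<kappa> s" "\<And>s. 0 \<le> \<kappa>e s"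
  shows "joint_psd (key_shield 2 d d) (twisted_op d \<kappa> \<kappa>e ph)"
proof -
  let ?J = "joint_basis (key_shield 2 d d)" and ?S = "{..<d} \<times> {..<d}"
  define v where "v = (\<lambda>u x. if x \<in> ?J \<and> x Alice ! 0 = x Bob ! 0 \<and> sw (x Alice ! 0 = 1) (shield_index x) = u
    then of_real (sqrt (\<kappa> u)) * phase ph (x Alice ! 0 = 1) (shield_index x) else 0)"
  define l where "l = (\<lambda>x :: index. if x Alice ! 0 = x Bob ! 0 then 0 else \<kappa>e (shield_index x))"
  have \<kappa>sw: "\<kappa> (sw i s) = \<kappa> s" for i s using \<kappa>(2) by (simp add: sw_def)
  have v: "v u (bit_index i j s) = (if i = j \<and> sw i s = u then of_real (sqrt (\<kappa> s)) * phase ph i s else 0)" if "s \<in> ?S" for u i j s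
    unfolding v_def using bit_index_in[OF that] \<kappa>sw[of i s] by (cases "sw i s = u") auto
  have p: "joint_psd (key_shield 2 d d) (\<lambda>x y. (\<Sum>u\<in>?S. v u x * cnj (v u y)) + diag_op ?J (\<lambda>x. complex_of_real (l x)) x y)"
    using \<kappa>(3) by (intro positive_op_add positive_opI positive_diag_op finite_joint_basis) (auto simp: v_def l_def)
  have "twisted_op d \<kappa> \<kappa>e ph = (\<lambda>x y. (\<Sum>u\<in>?S. v u x * cnj (v u y)) + diag_op ?J (\<lambda>x. complex_of_real (l x)) x y)"
  proof (rule joint_ops_eqI[OF twisted_op_operators positive_opD(1)[OF p]])
    fix i j s i' j' s' assume s: "s \<in> ?S" "s' \<in> ?S"
    have swS: "sw i s \<in> ?S" using s by (auto simp: sw_def)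
    have "(\<Sum>u\<in>?S. v u (bit_index i j s) * cnj (v u (bit_index i' j' s')))
      = (\<Sum>u\<in>?S. if u = sw i s then (if i = j \<and> i' = j' \<and> sw i s = sw i' s' then of_real (\<kappa> s) * phase ph i s * cnj (phase ph i' s') else 0) else 0)"
    proof (intro sum.cong refl)
      fix u
      have "\<kappa> s' = \<kappa> s" if "sw i s = sw i' s'" using that \<kappa>sw by metis
      moreover have "complex_of_real (sqrt (\<kappa> s)) * complex_of_real (sqrt (\<kappa> s)) = of_real (\<kappa> s)"
        using \<kappa>(1) by (simp flip: of_real_mult)
      ultimately show "v u (bit_index i j s) * cnj (v u (bit_index i' j' s'))
        = (if u = sw i s then (if i = j \<and> i' = j' \<and> sw i s = sw i' s' then of_real (\<kappa> s) * phase ph i s * cnj (phase ph i' s') else 0) else 0)"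
        unfolding v[OF s(1)] v[OF s(2)] by (auto simp: mult_ac)
    qed
    also have "\<dots> = (if i = j \<and> i' = j' \<and> sw i s = sw i' s' then of_real (\<kappa> s) * phase ph i s * cnj (phase ph i' s') else 0)"
      using swS by simp
    finally have sum: "(\<Sum>u\<in>?S. v u (bit_index i j s) * cnj (v u (bit_index i' j' s')))
      = (if i = j \<and> i' = j' \<and> sw i s = sw i' s' then of_real (\<kappa> s) * phase ph i s * cnj (phase ph i' s') else 0)" .
    have l: "l (bit_index i j s) = (if i = j then 0 else \<kappa>e s)"
      unfolding l_def by (simp only: ks_index_simps nth_Cons_0 of_bool_eq_iff)
    have "bit_index i j s = bit_index i' j' s' \<and> bit_index i j s \<in> ?J \<longleftrightarrow> i' = i \<and> j' = j \<and> s = s'"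
      unfolding ks_index_inject of_bool_eq_iff using bit_index_in[OF s(1)] by blast
    then have diag: "diag_op ?J (\<lambda>x. complex_of_real (l x)) (bit_index i j s) (bit_index i' j' s')
      = (if i' = i \<and> j' = j \<and> s = s' then of_real (if i = j then 0 else \<kappa>e s) else 0)"
      unfolding diag_op_def l by (simp only:)
    show "twisted_op d \<kappa> \<kappa>e ph (bit_index i j s) (bit_index i' j' s')
      = (\<Sum>u\<in>?S. v u (bit_index i j s) * cnj (v u (bit_index i' j' s'))) + diag_op ?J (\<lambda>x. complex_of_real (l x)) (bit_index i j s) (bit_index i' j' s')"
      unfolding twisted_op_entry[OF s] sum diag by (cases "i = j") simp_all
  qed
  then show ?thesis using p by simp
qed

lemma twisted_op_trace:
  assumes "\<And>s. ph s * cnj (ph s) = 1"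
  shows "joint_trace (key_shield 2 d d) (twisted_op d \<kappa> \<kappa>e ph) = of_real (\<Sum>s\<in>{..<d} \<times> {..<d}. 2 * \<kappa> s + 2 * \<kappa>e s)"
proof -
  have "twisted_op d \<kappa> \<kappa>e ph (bit_index i j s) (bit_index i j s) = of_real (if i = j then \<kappa> s else \<kappa>e s)" if "s \<in> {..<d} \<times> {..<d}" for i j s
    unfolding twisted_op_entry[OF that that] using assms by (simp add: phase_def mult.assoc)
  note e = this
  show ?thesis unfolding op_trace_def sum_joint_basis_bits of_real_sum
  proof (rule sum.cong[OF refl])
    fix s assume "s \<in> {..<d} \<times> {..<d}"
    from e[OF this] show "twisted_op d \<kappa> \<kappa>e ph (bit_index False False s) (bit_index False False s)
        + twisted_op d \<kappa> \<kappa>e ph (bit_index False True s) (bit_index False True s)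
      + (twisted_op d \<kappa> \<kappa>e ph (bit_index True False s) (bit_index True False s)
        + twisted_op d \<kappa> \<kappa>e ph (bit_index True True s) (bit_index True True s)) = of_real (2 * \<kappa> s + 2 * \<kappa>e s)"
      by (simp only:) simp
  qed
qed

text \<open>Transposition exchanges Bob's bits and shield indices, so the coherence |00><11| becomes
  |01><10|. The swap had matched a with b' and b with a'; after the exchange this says that both
  shields are diagonal, (a, a) and (a', a'). The key block is left diagonal.\<close>

lemma transpose_Bob_twisted_op:
  assumes "(a, b) \<in> {..<d} \<times> {..<d}" "(a', b') \<in> {..<d} \<times> {..<d}" and sym: "\<And>s. ph (prod.swap s) = ph s" and u: "\<And>s. ph s * cnj (ph s) = 1"
  shows "transpose_Bob (twisted_op d \<kappa> \<kappa>e ph) (bit_index i j (a, b)) (bit_index i' j' (a', b'))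
    = (if i = i' \<and> j = j' \<and> a = a' \<and> b = b' then of_real (if i = j then \<kappa> (a, b) else \<kappa>e (a, b)) else 0)
    + (if i \<noteq> j \<and> i' \<noteq> i \<and> j' \<noteq> j \<and> a = b \<and> a' = b'
       then of_real (\<kappa> (a, a')) * (if i then ph (a, a') else cnj (ph (a, a'))) else 0)"
proof -
  have idx: "(bit_index i j (a, b))(Bob := bit_index i' j' (a', b') Bob) = bit_index i j' (a, b')"
    "(bit_index i' j' (a', b'))(Bob := bit_index i j (a, b) Bob) = bit_index i' j (a', b)"
    by (simp_all add: index_eq_iff)
  have s: "ph (y, x) = ph (x, y)" for x y using sym[of "(x, y)"] by simp
  have S: "(a, b') \<in> {..<d} \<times> {..<d}" "(a', b) \<in> {..<d} \<times> {..<d}" using assms by auto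
  show ?thesis
    unfolding transpose_Bob_def idx twisted_op_entry[OF S] using u
    by (cases i; cases j; cases i'; cases j') (auto simp: sw_def phase_def s mult.assoc)
qed

subsection \<open>The Fourier states\<close>

definition error_prob :: "nat \<Rightarrow> real" where
  "error_prob N = 1 / (sqrt (real N) + 1)"

text \<open>An entry of the discrete Fourier matrix: symmetric in the two indices, as
  \<open>twisted_state\<close> demands, and with orthogonal rows.\<close>

definition fourier_phase :: "nat \<Rightarrow> nat \<times> nat \<Rightarrow> complex" where
  "fourier_phase N s = cnj (cis (2 * pi * real (fst s) / real N) ^ snd s)"

text \<open>The shields have dimension N + 1, but the index N carries no weight; it is reserved for
  the flag.\<close>

definition key_weight :: "nat \<Rightarrow> nat \<times> nat \<Rightarrow> real" where
  "key_weight N s = (if fst s < N \<and> snd s < N then (1 - error_prob N) / (2 * (real N)\<^sup>2) else 0)"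

text \<open>Errors are confined to the shields (a, a), the only place where the transposed
  coherences end up. Spreading them over N instead of N^2 shields is what makes a small error
  probability enough.\<close>

definition error_weight :: "nat \<Rightarrow> nat \<times> nat \<Rightarrow> real" where
  "error_weight N s = (if fst s = snd s \<and> fst s < N then error_prob N / (2 * real N) else 0)"

lemma error_prob_bounds: "0 < error_prob N" "error_prob N \<le> 1"
  by (auto simp: error_prob_def field_simps add_pos_nonneg intro: less_le_trans)

text \<open>The equation that matches the error weights with the transposed coherences in
  \<open>dft_op_bits\<close>.\<close>

lemma error_prob_balance: "error_prob N * sqrt (real N) = 1 - error_prob N"
proof -
  have "sqrt (real N) + 1 > 0" by (simp add: add_nonneg_pos)
  then show ?thesis by (simp add: error_prob_def field_simps)
qed

lemma fourier_phase_swap: "fourier_phase N (prod.swap s) = fourier_phase N s"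
proof -
  have "real (fst s) * (2 * pi * real (snd s) / real N) = real (snd s) * (2 * pi * real (fst s) / real N)" by simp
  then show ?thesis unfolding fourier_phase_def Complex.DeMoivre fst_swap snd_swap by (simp only:)
qed

lemma fourier_phase_unit: "fourier_phase N s * cnj (fourier_phase N s) = 1"
  unfolding fourier_phase_def Complex.DeMoivre by (simp add: cis_cnj cis_mult)

text \<open>For different rows the terms are the powers of an N-th root of unity other than 1, and
  their geometric sum vanishes.\<close>

lemma fourier_phase_orthogonal:
  assumes "a < N" "b < N"
  shows "(\<Sum>c<N. fourier_phase N (a, c) * cnj (fourier_phase N (b, c))) = (if a = b then of_nat N else 0)"
proof (cases "a = b")
  case True
  then show ?thesis by (simp add: fourier_phase_unit)
next
  case False
  define w where "w = (\<lambda>k. cis (2 * pi * real k / real N))"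
  define z where "z = cnj (w a) * w b"
  have N: "N > 0" using assms by simp
  have wN: "w k ^ N = 1" for k
    unfolding w_def Complex.DeMoivre using N cis_multiple_2pi[of "real k"] by (simp add: mult_ac)
  have "inj_on w {..<N}" unfolding w_def by (rule bij_betw_imp_inj_on[OF Complex.bij_betw_roots_unity[OF N]])
  then have "w a \<noteq> w b" using False assms by (auto dest: inj_onD)
  moreover have "w a * cnj (w a) = 1" by (simp add: w_def cis_cnj cis_mult)
  then have "w a * z = w b" by (simp add: z_def mult.assoc[symmetric])
  ultimately have z1: "z \<noteq> 1" by auto
  have zN: "z ^ N = 1" by (simp add: z_def power_mult_distrib wN flip: complex_cnj_power)
  have "(\<Sum>c<N. fourier_phase N (a, c) * cnj (fourier_phase N (b, c))) = (\<Sum>c<N. z ^ c)"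
    by (intro sum.cong refl) (simp add: fourier_phase_def z_def w_def power_mult_distrib)
  also have "\<dots> = 0" using geometric_sum[OF z1, of N] zN by simp
  finally show ?thesis using False by simp
qed

definition fourier_state :: "nat \<Rightarrow> joint_op" where
  "fourier_state N = twisted_op (Suc N) (key_weight N) (error_weight N) (fourier_phase N)"

lemma weights_nonneg: "0 \<le> key_weight N s" "key_weight N (prod.swap s) = key_weight N s" "0 \<le> error_weight N s"
  using error_prob_bounds[of N] by (auto simp: key_weight_def error_weight_def)

lemma sum_weights:
  assumes "N > 0"
  shows "(\<Sum>s\<in>{..<Suc N} \<times> {..<Suc N}. key_weight N s) = (1 - error_prob N) / 2"
    and "(\<Sum>s\<in>{..<Suc N} \<times> {..<Suc N}. error_weight N s) = error_prob N / 2"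
proof -
  have "(\<Sum>s\<in>{..<Suc N} \<times> {..<Suc N}. key_weight N s) = (\<Sum>s\<in>{..<N} \<times> {..<N}. (1 - error_prob N) / (2 * (real N)\<^sup>2))"
    by (intro sum.mono_neutral_cong_right) (auto simp: key_weight_def)
  then show "(\<Sum>s\<in>{..<Suc N} \<times> {..<Suc N}. key_weight N s) = (1 - error_prob N) / 2"
    using assms by (simp add: card_cartesian_product power2_eq_square)
  have "(\<Sum>s\<in>{..<Suc N} \<times> {..<Suc N}. error_weight N s) = (\<Sum>s\<in>(\<lambda>a. (a, a)) ` {..<N}. error_prob N / (2 * real N))"
    by (intro sum.mono_neutral_cong_right) (auto simp: error_weight_def)
  also have "\<dots> = error_prob N / 2" using assms by (simp add: card_image inj_on_def)
  finally show "(\<Sum>s\<in>{..<Suc N} \<times> {..<Suc N}. error_weight N s) = error_prob N / 2" .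
qed

lemma fourier_state_density:
  assumes "N > 0" shows "density_op (joint_basis (key_shield 2 (Suc N) (Suc N))) (fourier_state N)"
  unfolding density_op_def fourier_state_def
proof
  show "joint_psd (key_shield 2 (Suc N) (Suc N)) (twisted_op (Suc N) (key_weight N) (error_weight N) (fourier_phase N))"
    by (intro twisted_op_psd weights_nonneg)
  have "(\<Sum>s\<in>{..<Suc N} \<times> {..<Suc N}. 2 * key_weight N s + 2 * error_weight N s)
    = 2 * (\<Sum>s\<in>{..<Suc N} \<times> {..<Suc N}. key_weight N s) + 2 * (\<Sum>s\<in>{..<Suc N} \<times> {..<Suc N}. error_weight N s)"
    by (simp only: sum.distrib sum_distrib_left)
  also have "\<dots> = 1" unfolding sum_weights[OF assms] by (simp add: field_simps)
  finally have s: "(\<Sum>s\<in>{..<Suc N} \<times> {..<Suc N}. 2 * key_weight N s + 2 * error_weight N s) = 1" .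
  show "joint_trace (key_shield 2 (Suc N) (Suc N)) (twisted_op (Suc N) (key_weight N) (error_weight N) (fourier_phase N)) = 1"
    unfolding twisted_op_trace[OF fourier_phase_unit] s by simp
qed

lemma fourier_state_twisted: "twisted_state (Suc N) (key_weight N) (error_weight N) (fourier_phase N) (fourier_state N)"
  unfolding twisted_state_def fourier_state_def
  using weights_nonneg fourier_phase_swap fourier_phase_unit by (intro conjI allI ballI twisted_op_entry) blast+

text \<open>The vector sqrt (p / (2 N)) (|01>|cc> + (\<epsilon> / sqrt N) sum_a F(a, c) |10>|aa>),
  where F is the Fourier matrix. Since F / sqrt N is unitary, the sum over c has the error weights
  on the diagonal and \<epsilon> times the transposed coherences off it. The sign 1 yields PPT, the
  sign -1 the diagonal bound.\<close>

definition dft_vec :: "nat \<Rightarrow> real \<Rightarrow> nat \<Rightarrow> index \<Rightarrow> complex" where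
  "dft_vec N \<epsilon> c x = (if x \<in> joint_basis (key_shield 2 (Suc N) (Suc N)) \<and> x Alice ! 0 \<noteq> x Bob ! 0 \<and> x Alice ! 1 = x Bob ! 1 \<and> x Alice ! 1 < N
     then of_real (sqrt (error_prob N / (2 * real N)))
       * (if x Alice ! 0 = 1 then of_real (\<epsilon> / sqrt (real N)) * fourier_phase N (x Alice ! 1, c) else of_bool (x Alice ! 1 = c))
     else 0)"

definition dft_op :: "nat \<Rightarrow> real \<Rightarrow> joint_op" where
  "dft_op N \<epsilon> = (\<lambda>x y. \<Sum>c<N. dft_vec N \<epsilon> c x * cnj (dft_vec N \<epsilon> c y))"

lemma dft_op_psd: "joint_psd (key_shield 2 (Suc N) (Suc N)) (dft_op N \<epsilon>)"
  unfolding dft_op_def by (intro positive_opI finite_joint_basis) (simp add: dft_vec_def)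

lemma dft_vec_bits:
  assumes "(a, b) \<in> {..<Suc N} \<times> {..<Suc N}"
  shows "dft_vec N \<epsilon> c (bit_index i j (a, b)) = (if i \<noteq> j \<and> a = b \<and> a < N
     then of_real (sqrt (error_prob N / (2 * real N))) * (if i then of_real (\<epsilon> / sqrt (real N)) * fourier_phase N (a, c) else of_bool (a = c)) else 0)"
proof -
  have "bit_index i j (a, b) \<in> joint_basis (key_shield 2 (Suc N) (Suc N)) \<longleftrightarrow> True"
    using bit_index_in[OF assms] by simp
  moreover have "[x, y] ! 1 = y" for x y :: nat by simp
  ultimately show ?thesis unfolding dft_vec_def
    by (simp only: ks_index_simps nth_Cons_0 of_bool_eq_iff of_bool_eq_1_iff fst_conv snd_conv simp_thms)
qed

lemma dft_op_bits:
  assumes N: "N > 0" and s: "(a, b) \<in> {..<Suc N} \<times> {..<Suc N}" "(a', b') \<in> {..<Suc N} \<times> {..<Suc N}" and \<epsilon>: "\<epsilon>\<^sup>2 = 1"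
  shows "dft_op N \<epsilon> (bit_index i j (a, b)) (bit_index i' j' (a', b'))
    = (if i = i' \<and> j = j' \<and> a = a' \<and> b = b' then of_real (if i = j then 0 else error_weight N (a, b)) else 0)
    + of_real \<epsilon> * (if i \<noteq> j \<and> i' \<noteq> i \<and> j' \<noteq> j \<and> a = b \<and> a' = b'
       then of_real (key_weight N (a, a')) * (if i then fourier_phase N (a, a') else cnj (fourier_phase N (a, a'))) else 0)"
proof (cases "i \<noteq> j \<and> i' \<noteq> j' \<and> a = b \<and> a' = b' \<and> a < N \<and> a' < N")
  case False
  have "dft_op N \<epsilon> (bit_index i j (a, b)) (bit_index i' j' (a', b')) = 0"
    unfolding dft_op_def dft_vec_bits[OF s(1)] dft_vec_bits[OF s(2)] using False by (intro sum.neutral) auto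
  then show ?thesis using False by (auto simp: error_weight_def key_weight_def)
next
  case True
  then have j: "j = (\<not> i)" "j' = (\<not> i')" and ab: "b = a" "b' = a'" "a < N" "a' < N" by auto
  define e where "e = error_prob N / (2 * real N)"
  define g where "g = sqrt e"
  define h where "h = 1 / sqrt (real N)"
  have e0: "e \<ge> 0" using error_prob_bounds[of N] by (simp add: e_def)
  have gg: "g * g = e" using e0 by (simp add: g_def)
  have hh: "h * h * real N = 1" using N by (simp add: h_def)
  have sN: "sqrt (real N) > 0" "sqrt (real N) * sqrt (real N) = real N" using N by auto
  have cancel: "p / (2 * n) * (1 / x) = p * x / (2 * (n * (x * x)))" if "x > 0" for p n x :: real
    using that by simp
  \<comment> \<open>The off-diagonal coefficient is p / (2 N sqrt N), which by the balance equation
    equals (1 - p) / (2 N^2), the key weight.\<close>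
  have "e * h = (error_prob N * sqrt (real N)) / (2 * (real N * (sqrt (real N) * sqrt (real N))))"
    unfolding e_def h_def by (rule cancel[OF sN(1)])
  then have gh: "e * h = key_weight N (a, a')"
    using ab unfolding error_prob_balance sN(2) by (simp add: key_weight_def power2_eq_square)
  have ph: "fourier_phase N (a', a) = fourier_phase N (a, a')" using fourier_phase_swap[of N "(a, a')"] by simp
  have v: "dft_vec N \<epsilon> c (bit_index i j (a, b)) = of_real g * (if i then of_real (\<epsilon> * h) * fourier_phase N (a, c) else of_bool (a = c))"
    "dft_vec N \<epsilon> c (bit_index i' j' (a', b')) = of_real g * (if i' then of_real (\<epsilon> * h) * fourier_phase N (a', c) else of_bool (a' = c))" for c
    unfolding dft_vec_bits[OF s(1)] dft_vec_bits[OF s(2)] using True by (simp_all add: g_def e_def h_def)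
  have ew: "error_weight N (x, x) = e" if "x < N" for x using that by (simp add: error_weight_def e_def)
  consider "\<not> i" "\<not> i'" | "\<not> i" "i'" | "i" "\<not> i'" | "i" "i'" by blast
  then show ?thesis
  proof cases
    case 1
    have "dft_op N \<epsilon> (bit_index i j (a, b)) (bit_index i' j' (a', b')) = (\<Sum>c<N. if c = a then (if a = a' then of_real (g * g) else 0) else 0)"
      unfolding dft_op_def v using 1 by (intro sum.cong) auto
    then show ?thesis using 1 ab j by (simp add: gg ew)
  next
    case 2
    have "dft_op N \<epsilon> (bit_index i j (a, b)) (bit_index i' j' (a', b'))
      = (\<Sum>c<N. if c = a then of_real (\<epsilon> * ((g * g) * h)) * cnj (fourier_phase N (a', a)) else 0)"
      unfolding dft_op_def v using 2 by (intro sum.cong) auto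
    then show ?thesis using 2 ab j by (simp add: gg gh ph)
  next
    case 3
    have "dft_op N \<epsilon> (bit_index i j (a, b)) (bit_index i' j' (a', b'))
      = (\<Sum>c<N. if c = a' then of_real (\<epsilon> * ((g * g) * h)) * fourier_phase N (a, a') else 0)"
      unfolding dft_op_def v using 3 by (intro sum.cong) auto
    then show ?thesis using 3 ab j by (simp add: gg gh)
  next
    case 4
    have "dft_op N \<epsilon> (bit_index i j (a, b)) (bit_index i' j' (a', b'))
      = (\<Sum>c<N. of_real (g * g * (\<epsilon>\<^sup>2 * (h * h))) * (fourier_phase N (a, c) * cnj (fourier_phase N (a', c))))"
      unfolding dft_op_def v using 4 by (intro sum.cong) (auto simp: power2_eq_square)
    also have "\<dots> = of_real (e * (h * h)) * (if a = a' then of_nat N else 0)"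
      unfolding sum_distrib_left[symmetric] fourier_phase_orthogonal[OF ab(3,4)] gg \<epsilon> by simp
    also have "\<dots> = (if a = a' then of_real (e * (h * h * real N)) else 0)" by simp
    finally show ?thesis using 4 ab j unfolding hh by (simp add: ew)
  qed
qed

section \<open>Partial transposition of supported operators and of flags\<close>

lemma transpose_Bob_operators:
  assumes "A \<in> joint_ops D" shows "transpose_Bob A \<in> joint_ops D"
proof (rule operatorsI)
  fix x y assume xy: "x \<notin> joint_basis D \<or> y \<notin> joint_basis D"
  show "transpose_Bob A x y = 0"
  proof (rule ccontr)
    assume "transpose_Bob A x y \<noteq> 0"
    then have "x(Bob := y Bob) \<in> joint_basis D" "y(Bob := x Bob) \<in> joint_basis D"
      using operatorsD[OF assms] unfolding transpose_Bob_def by blast+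
    then have "(x(Bob := y Bob)) p \<in> party_basis (D p)" "(y(Bob := x Bob)) p \<in> party_basis (D p)" for p
      by (auto simp: joint_basis_def simp del: fun_upd_apply)
    then have "x p \<in> party_basis (D p) \<and> y p \<in> party_basis (D p)" for p
      by (cases "p = Bob") (metis fun_upd_same, metis fun_upd_other)
    then show False using xy by (simp add: joint_basis_def)
  qed
qed

lemma transpose_Bob_basis_op: "transpose_Bob (basis_op f) = basis_op f"
proof (intro ext)
  fix x y
  have "x(Bob := y Bob) = f \<and> y(Bob := x Bob) = f \<longleftrightarrow> x = f \<and> y = f"
  proof
    assume h: "x(Bob := y Bob) = f \<and> y(Bob := x Bob) = f"
    then have "x Bob = f Bob" "y Bob = f Bob" by (metis fun_upd_same)+
    then show "x = f \<and> y = f" using h by (metis fun_upd_triv)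
  qed auto
  then show "transpose_Bob (basis_op f) x y = basis_op f x y"
    unfolding transpose_Bob_def basis_op_def by (simp only:)
qed

lemma transpose_Bob_flag_mix:
  "transpose_Bob (flag_mix t \<rho> f) = flag_mix t (transpose_Bob \<rho>) f"
proof (intro ext)
  fix x y
  have "basis_op f (x(Bob := y Bob)) (y(Bob := x Bob)) = basis_op f x y"
    using fun_cong[OF fun_cong[OF transpose_Bob_basis_op[of f]], of x y] by (simp only: transpose_Bob_def)
  then show "transpose_Bob (flag_mix t \<rho> f) x y = flag_mix t (transpose_Bob \<rho>) f x y"
    unfolding transpose_Bob_def flag_mix_def by (simp only:)
qed

subsection \<open>Rates of the flagged Fourier states\<close>

text \<open>The key weights already are the transposed key block; the error weights are doubled
  because the operators \<open>dft_op N 1\<close> and \<open>dft_op N (- 1)\<close> add up to twice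
  their diagonal.\<close>

definition diag_weight :: "nat \<Rightarrow> index \<Rightarrow> real" where
  "diag_weight N x = (if x Alice ! 0 = x Bob ! 0 then key_weight N (shield_index x) else 2 * error_weight N (shield_index x))"

lemma diag_op_bits:
  assumes s: "s \<in> {..<d} \<times> {..<d}"
  shows "diag_op (joint_basis (key_shield 2 d d)) l (bit_index i j s) (bit_index i' j' s')
    = (if i = i' \<and> j = j' \<and> s = s' then l (bit_index i j s) else 0)"
proof -
  have "bit_index i j s = bit_index i' j' s' \<and> bit_index i j s \<in> joint_basis (key_shield 2 d d) \<longleftrightarrow> i = i' \<and> j = j' \<and> s = s'"
    unfolding ks_index_inject of_bool_eq_iff using bit_index_in[OF s] by blast
  then show ?thesis unfolding diag_op_def by (simp only:)
qed

text \<open>The partial transpose is the diagonal key block plus \<open>dft_op N 1\<close>, and what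
  it lacks to the diagonal bound is \<open>dft_op N (- 1)\<close>. Both are positive as sums of
  rank-one operators.\<close>

lemma fourier_transpose:
  fixes N :: nat
  assumes N: "N > 0"
  defines "D \<equiv> key_shield 2 (Suc N) (Suc N)"
  shows "joint_psd D (transpose_Bob (fourier_state N))"
    and "joint_psd D (\<lambda>x y. diag_op (joint_basis D) (\<lambda>x. complex_of_real (diag_weight N x)) x y - transpose_Bob (fourier_state N) x y)"
proof -
  let ?S = "{..<Suc N} \<times> {..<Suc N}"
  define l where "l = (\<lambda>x :: index. if x Alice ! 0 = x Bob ! 0 then key_weight N (shield_index x) else 0)"
  have l: "l (bit_index i j s) = (if i = j then key_weight N s else 0)"
    and w: "diag_weight N (bit_index i j s) = (if i = j then key_weight N s else 2 * error_weight N s)" for i j s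
    unfolding l_def diag_weight_def by (simp_all only: ks_index_simps nth_Cons_0 of_bool_eq_iff)
  have T: "transpose_Bob (fourier_state N) \<in> joint_ops D"
    unfolding fourier_state_def D_def by (intro transpose_Bob_operators twisted_op_operators)
  have L: "joint_psd D (diag_op (joint_basis D) (\<lambda>x. complex_of_real (l x)))"
    using weights_nonneg by (intro positive_diag_op finite_joint_basis) (auto simp: l_def)
  note tb = transpose_Bob_twisted_op[where d = "Suc N" and ph = "fourier_phase N", OF _ _ fourier_phase_swap fourier_phase_unit]
  have p: "joint_psd D (\<lambda>x y. diag_op (joint_basis D) (\<lambda>x. complex_of_real (l x)) x y + dft_op N 1 x y)"
    unfolding D_def by (intro positive_op_add dft_op_psd L[unfolded D_def])
  have "transpose_Bob (fourier_state N) = (\<lambda>x y. diag_op (joint_basis D) (\<lambda>x. complex_of_real (l x)) x y + dft_op N 1 x y)"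
    unfolding D_def
  proof (rule joint_ops_eqI[OF T[unfolded D_def] positive_opD(1)[OF p[unfolded D_def]]])
    fix i j s i' j' s' assume "s \<in> ?S" "s' \<in> ?S"
    moreover obtain a b a' b' where s: "s = (a, b)" "s' = (a', b')" by (cases s; cases s')
    ultimately have S: "(a, b) \<in> ?S" "(a', b') \<in> ?S" by auto
    have one: "(1 :: real)\<^sup>2 = 1" by simp
    show "transpose_Bob (fourier_state N) (bit_index i j s) (bit_index i' j' s')
      = diag_op (joint_basis (key_shield 2 (Suc N) (Suc N))) (\<lambda>x. complex_of_real (l x)) (bit_index i j s) (bit_index i' j' s') + dft_op N 1 (bit_index i j s) (bit_index i' j' s')"
      unfolding fourier_state_def s tb[OF S] dft_op_bits[OF N S one] diag_op_bits[OF S(1)] l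
      by (simp add: add.assoc[symmetric] split del: if_split) (simp)
  qed
  then show "joint_psd D (transpose_Bob (fourier_state N))" using p by simp
  have "(\<lambda>x y. diag_op (joint_basis D) (\<lambda>x. complex_of_real (diag_weight N x)) x y - transpose_Bob (fourier_state N) x y) = dft_op N (- 1)"
  proof (rule joint_ops_eqI)
    show "(\<lambda>x y. diag_op (joint_basis D) (\<lambda>x. complex_of_real (diag_weight N x)) x y - transpose_Bob (fourier_state N) x y) \<in> joint_ops (key_shield 2 (Suc N) (Suc N))"
      using operatorsD[OF T] unfolding D_def by (intro operatorsI) (auto simp: diag_op_def)
    show "dft_op N (- 1) \<in> joint_ops (key_shield 2 (Suc N) (Suc N))" by (rule positive_opD(1)[OF dft_op_psd])
    fix i j s i' j' s' assume "s \<in> ?S" "s' \<in> ?S"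
    moreover obtain a b a' b' where s: "s = (a, b)" "s' = (a', b')" by (cases s; cases s')
    ultimately have S: "(a, b) \<in> ?S" "(a', b') \<in> ?S" by auto
    have one: "(- 1 :: real)\<^sup>2 = 1" by simp
    show "diag_op (joint_basis D) (\<lambda>x. complex_of_real (diag_weight N x)) (bit_index i j s) (bit_index i' j' s')
        - transpose_Bob (fourier_state N) (bit_index i j s) (bit_index i' j' s') = dft_op N (- 1) (bit_index i j s) (bit_index i' j' s')"
      unfolding fourier_state_def D_def s tb[OF S] dft_op_bits[OF N S one] diag_op_bits[OF S(1)] w
      by simp
  qed
  then show "joint_psd D (\<lambda>x y. diag_op (joint_basis D) (\<lambda>x. complex_of_real (diag_weight N x)) x y - transpose_Bob (fourier_state N) x y)"
    using dft_op_psd unfolding D_def by simp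
qed

lemma sum_diag_weight:
  assumes N: "N > 0"
  shows "(\<Sum>x\<in>joint_basis (key_shield 2 (Suc N) (Suc N)). diag_weight N x) = 1 + error_prob N"
proof -
  have w: "diag_weight N (bit_index i j s) = (if i = j then key_weight N s else 2 * error_weight N s)" for i j s
    unfolding diag_weight_def by (simp only: ks_index_simps nth_Cons_0 of_bool_eq_iff)
  have "(\<Sum>x\<in>joint_basis (key_shield 2 (Suc N) (Suc N)). diag_weight N x)
    = (\<Sum>s\<in>{..<Suc N} \<times> {..<Suc N}. 2 * key_weight N s + 4 * error_weight N s)"
    unfolding sum_joint_basis_bits w by (intro sum.cong refl) simp
  also have "\<dots> = 2 * (\<Sum>s\<in>{..<Suc N} \<times> {..<Suc N}. key_weight N s) + 4 * (\<Sum>s\<in>{..<Suc N} \<times> {..<Suc N}. error_weight N s)"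
    by (simp only: sum.distrib sum_distrib_left)
  also have "\<dots> = 1 + error_prob N" unfolding sum_weights[OF N] by (simp add: field_simps)
  finally show ?thesis .
qed

text \<open>No entry involves Alice's shield index N, so she recognises the flag on her own.\<close>

lemma fourier_state_support:
  assumes "fourier_state N x y \<noteq> 0"
  shows "x Alice \<in> {v. v ! 1 < N} \<and> y Alice \<in> {v. v ! 1 < N}"
proof -
  let ?D = "key_shield 2 (Suc N) (Suc N)"
  have "x \<in> joint_basis ?D" "y \<in> joint_basis ?D"
    using assms operatorsD[OF twisted_op_operators] unfolding fourier_state_def by blast+
  then obtain i j s i' j' s' where xy: "x = bit_index i j s" "y = bit_index i' j' s'" "s \<in> {..<Suc N} \<times> {..<Suc N}" "s' \<in> {..<Suc N} \<times> {..<Suc N}"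
    unfolding joint_basis_bits_iff by blast
  have "fst s < N \<and> snd s < N \<and> (sw i s = sw i' s' \<or> s = s')"
    using assms unfolding fourier_state_def xy(1,2) twisted_op_entry[OF xy(3,4)]
    by (auto simp: key_weight_def error_weight_def split: if_splits)
  then have "fst s < N \<and> fst s' < N" by (cases s; cases s') (auto simp: sw_def split: if_splits)
  then show ?thesis using xy by simp
qed

text \<open>The flag is diagonal and invariant under partial transposition, so it adds just its own
  weight to the diagonal bound and the positive remainder is scaled by t: K = t (1 + p) + (1 - t) =
  1 + t p.\<close>

lemma fourier_flag:
  fixes N :: nat and t :: real
  assumes N: "N > 0" and t: "0 \<le> t" "t \<le> 1"
  defines "D \<equiv> key_shield 2 (Suc N) (Suc N)" and "\<rho> \<equiv> flag_mix t (fourier_state N) (ks_index 0 0 (N, N))"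
  shows "density_op (joint_basis D) \<rho>" "PPT D \<rho>"
    and "distillable_key D (fourier_state N) = ereal k \<Longrightarrow> distillable_key D \<rho> = ereal (t * k)"
    and "0 \<le> repeater_rate D D \<rho> \<rho>" "repeater_rate D D \<rho> \<rho> \<le> ereal (2 * log 2 (1 + t * error_prob N))"
proof -
  let ?f = "ks_index 0 0 (N, N)" and ?J = "joint_basis D"
  let ?w = "\<lambda>x. t * diag_weight N x + (1 - t) * of_bool (x = ?f)"
  have C: "D Charlie = []" by (simp add: D_def)
  have f: "?f \<in> ?J" unfolding D_def using bit_index_in[of "(N, N)" "Suc N" "Suc N" False False] by simp
  have F: "joint_psd D (fourier_state N)" "joint_trace D (fourier_state N) = 1"
    using fourier_state_density[OF N] unfolding density_op_def D_def by auto
  show d: "density_op ?J \<rho>"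
    unfolding \<rho>_def density_op_def using flag_mix_density[OF F f t] by blast
  have b: "joint_psd D (basis_op ?f)" by (rule basis_op_density[OF f])
  show ppt: "PPT D \<rho>"
    unfolding PPT_def \<rho>_def transpose_Bob_flag_mix unfolding flag_mix_def using t
    by (intro positive_op_add positive_op_scale fourier_transpose(1)[OF N, folded D_def] b) auto
  show "distillable_key D (fourier_state N) = ereal k \<Longrightarrow> distillable_key D \<rho> = ereal (t * k)"
    unfolding \<rho>_def
    by (rule distillable_key_flag_mix[where D = D and G = "{v. v ! 1 < N}", OF C F f t])
      (use fourier_state_support in \<open>blast, simp\<close>)
  have nn: "0 \<le> ?w x" for x
    using t weights_nonneg by (auto simp: diag_weight_def)
  have eq: "diag_op ?J (\<lambda>x. complex_of_real (?w x)) x y - transpose_Bob \<rho> x y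
    = of_real t * (diag_op ?J (\<lambda>x. complex_of_real (diag_weight N x)) x y - transpose_Bob (fourier_state N) x y)" for x y
    unfolding \<rho>_def transpose_Bob_flag_mix unfolding flag_mix_def using f by (auto simp: diag_op_def basis_op_def algebra_simps)
  have le: "joint_psd D (\<lambda>x y. diag_op ?J (\<lambda>x. complex_of_real (?w x)) x y - transpose_Bob \<rho> x y)"
    unfolding eq by (rule positive_op_scale[OF fourier_transpose(2)[OF N, folded D_def] t(1)])
  have "(\<Sum>x\<in>?J. ?w x) = t * (\<Sum>x\<in>?J. diag_weight N x) + (1 - t) * (\<Sum>x\<in>?J. of_bool (x = ?f))"
    by (simp only: sum.distrib sum_distrib_left)
  also have "(\<Sum>x\<in>?J. of_bool (x = ?f)) = (\<Sum>x\<in>?J. if x = ?f then 1 else 0 :: real)" by (intro sum.cong) auto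
  also have "\<dots> = 1" using f finite_joint_basis by simp
  finally have K: "(\<Sum>x\<in>?J. ?w x) = 1 + t * error_prob N"
    unfolding D_def sum_diag_weight[OF N] by (simp add: algebra_simps)
  have "1 + t * error_prob N > 0" using t error_prob_bounds[of N] by (simp add: add_pos_nonneg)
  note repeater_rate_bounds[where D = D, OF C d ppt nn le K this]
  then show "0 \<le> repeater_rate D D \<rho> \<rho>" "repeater_rate D D \<rho> \<rho> \<le> ereal (2 * log 2 (1 + t * error_prob N))" .
qed

text \<open>A product basis state is its own partial transpose and its own diagonal bound, so K = 1.
  It covers the dimensions in which the target for the key is negative.\<close>

lemma basis_op_rates:
  fixes D :: dims
  assumes C: "D Charlie = []" and f: "f \<in> joint_basis D"
  shows "density_op (joint_basis D) (basis_op f)" "PPT D (basis_op f)"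
    and "0 \<le> repeater_rate D D (basis_op f) (basis_op f)" "repeater_rate D D (basis_op f) (basis_op f) \<le> 0"
proof -
  show d: "density_op (joint_basis D) (basis_op f)"
    unfolding density_op_def using basis_op_density[OF f] by blast
  show ppt: "PPT D (basis_op f)"
    unfolding PPT_def transpose_Bob_basis_op by (rule basis_op_density[OF f])
  have "diag_op (joint_basis D) (\<lambda>x. complex_of_real (of_bool (x = f))) x y - transpose_Bob (basis_op f) x y = 0" for x y
    unfolding transpose_Bob_basis_op using f by (auto simp: diag_op_def basis_op_def)
  then have le: "joint_psd D (\<lambda>x y. diag_op (joint_basis D) (\<lambda>x. complex_of_real (of_bool (x = f))) x y - transpose_Bob (basis_op f) x y)"
    using positive_op_zero by simp
  have "(\<Sum>x\<in>joint_basis D. of_bool (x = f)) = (\<Sum>x\<in>joint_basis D. if x = f then 1 else 0 :: real)" by (intro sum.cong) auto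
  then have K: "(\<Sum>x\<in>joint_basis D. of_bool (x = f)) = (1 :: real)" using f finite_joint_basis by simp
  show "0 \<le> repeater_rate D D (basis_op f) (basis_op f)"
    by (rule repeater_rate_bounds(1)[where D = D, OF C d ppt _ le K]) simp_all
  have "repeater_rate D D (basis_op f) (basis_op f) \<le> ereal (2 * log 2 1)"
    by (rule repeater_rate_bounds(2)[where D = D, OF C d ppt _ le K]) simp_all
  then show "repeater_rate D D (basis_op f) (basis_op f) \<le> 0" by (simp add: zero_ereal_def)
qed

lemma example_state:
  fixes d :: nat
  assumes d: "d \<ge> 1"
  defines "D \<equiv> key_shield 2 d d" and "p \<equiv> 1 / (sqrt (real d) + 1)"
  shows "\<exists>\<rho>. density_op (joint_basis D) \<rho> \<and> PPT D \<rho>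
    \<and> (0 \<le> 1 - 2 * binary_entropy p \<longrightarrow> distillable_key D \<rho> = ereal (1 - 2 * binary_entropy p))
    \<and> 0 \<le> repeater_rate D D \<rho> \<rho> \<and> repeater_rate D D \<rho> \<rho> \<le> ereal (2 * p * log 2 (2 * real d) + eta p)"
proof (cases "0 \<le> 1 - 2 * binary_entropy p")
  \<comment> \<open>The claim on the key is vacuous here, and the repeater rate 0 of a product state
    is within the nonnegative bound.\<close>
  case False
  have f: "ks_index 0 0 (0, 0) \<in> joint_basis D"
    unfolding D_def using d bit_index_in[of "(0, 0)" d d False False] by simp
  have C: "D Charlie = []" by (simp add: D_def)
  note b = basis_op_rates[where D = D, OF C f]
  have "repeater_rate D D (basis_op (ks_index 0 0 (0, 0))) (basis_op (ks_index 0 0 (0, 0))) \<le> ereal (2 * p * log 2 (2 * real d) + eta p)"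
    using b(4) repeater_bound_nonneg[OF d p_def[THEN meta_eq_to_obj_eq]] by (auto intro: order_trans)
  then show ?thesis using b False by blast
next
  case True
  let ?c = "1 - 2 * binary_entropy p"
  have s1: "sqrt (real d) \<ge> 1" using d by simp
  then have s2: "sqrt (real d) + 1 \<ge> 2" by simp
  then have p: "0 < p" unfolding p_def by (intro divide_pos_pos) linarith+
  have "p \<le> 1 / 2" using frac_le[OF _ _ _ s2, of 1 1] by (simp add: p_def)
  then have p5: "p < 1 / 5" using binary_entropy_half_imp[OF p] True by simp
  have "p * (sqrt (real d) + 1) = 1"
    unfolding p_def by (rule nonzero_eq_divide_eq[THEN iffD1, OF _ refl]) (use s2 in linarith)
  moreover have "p * (sqrt (real d) + 1) < 1 / 5 * (sqrt (real d) + 1)" using p5 s2 by (intro mult_strict_right_mono) linarith+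
  ultimately have "sqrt (real d) > 4" by simp
  moreover have "sqrt 16 = (4 :: real)" by (rule real_sqrt_unique) auto
  ultimately have d16: "real d > 16" using real_sqrt_less_iff[of 16 "real d"] by linarith
  define N where "N = d - 1"
  have N: "N > 0" "d = Suc N" using d16 by (auto simp: N_def)
  define q where "q = p + p ^ 3"
  have pq: "error_prob N < q" using error_probability_less[OF d16] by (simp add: q_def p_def error_prob_def N_def)
  have h: "?c \<le> 1 - binary_entropy (2 * q) - q"
    using binary_entropy_double[of p] p p5 by (simp add: q_def)
  have "p ^ 3 \<le> (1 / 5) ^ 3" using p p5 by (intro power_mono) auto
  then have q4: "q \<le> 1 / 4" using p5 by (simp add: q_def power3_eq_cube)
  have err: "error_prob N = 2 * (\<Sum>s\<in>{..<Suc N} \<times> {..<Suc N}. error_weight N s)"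
    unfolding sum_weights(2)[OF N(1)] by simp
  note F = fourier_state_density[OF N(1), folded N(2), folded D_def]
  have C: "D Charlie = []" by (simp add: D_def)
  have lower: "ereal (1 - binary_entropy (2 * q) - q) \<le> distillable_key D (fourier_state N)"
    unfolding D_def N(2)
    using fourier_state_density[OF N(1)] fourier_state_twisted err error_prob_bounds[of N] pq q4 h True
    by (intro distillable_key_twisted_state[where p = "error_prob N"]) auto
  have "distillable_key D (fourier_state N) \<le> ereal (log 2 (card (joint_basis D)))"
    by (rule distillable_key_finite[where D = D, OF C F])
  moreover have "0 \<le> distillable_key D (fourier_state N)" by (rule distillable_key_nonneg[where D = D, OF C F])
  ultimately obtain k where k: "distillable_key D (fourier_state N) = ereal k" "k \<ge> 0"
    by (cases "distillable_key D (fourier_state N)") auto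
  have ck: "?c \<le> k" using lower h unfolding k(1) by simp
  \<comment> \<open>If k = 0, the target is 0 as well by \<open>ck\<close>, and division by zero
    gives t = 0, which is the right value.\<close>
  define t where "t = ?c / k"
  have t: "0 \<le> t" "t \<le> 1" "t * k = ?c"
    using True ck k(2) unfolding t_def by (cases "k = 0"; simp add: divide_le_eq)+
  note R = fourier_flag[OF N(1) t(1,2), folded N(2), folded D_def]
  have "2 * log 2 (1 + t * error_prob N) \<le> 2 * p * log 2 (2 * real d) + eta p"
    using repeater_bound_numeric[OF d16 t(1,2)] by (simp add: p_def error_prob_def N_def)
  then have "repeater_rate D D (flag_mix t (fourier_state N) (ks_index 0 0 (N, N))) (flag_mix t (fourier_state N) (ks_index 0 0 (N, N)))
    \<le> ereal (2 * p * log 2 (2 * real d) + eta p)"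
    using R(5) by (auto intro: order_trans)
  then show ?thesis using R(1,2,4) R(3)[OF k(1)] t(3) by (intro exI[of _ "flag_mix t (fourier_state N) (ks_index 0 0 (N, N))"]) simp
qed

text \<open>The key rate of a state is never negative, so its value can be prescribed only where 1 -
  2 h(p) \<ge> 0. This holds for all large d, so the limits and the strict separation carry no such
  premise.\<close>

theorem theorem16:
  shows "\<exists>\<rho> :: nat \<Rightarrow> joint_op.
    (\<forall>d\<ge>1. \<forall>p. p = 1 / (sqrt (real d) + 1) \<longrightarrow>
        density_op (joint_basis (key_shield 2 d d)) (\<rho> d)
      \<and> PPT (key_shield 2 d d) (\<rho> d)
      \<and> (0 \<le> 1 - 2 * binary_entropy p \<longrightarrow>
           distillable_key (key_shield 2 d d) (\<rho> d) = ereal (1 - 2 * binary_entropy p))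
      \<and> repeater_rate (key_shield 2 d d) (key_shield 2 d d) (\<rho> d) (\<rho> d)
          \<le> ereal (2 * p * log 2 (2 * real d) + eta p))
    \<and> (\<lambda>d. distillable_key (key_shield 2 d d) (\<rho> d)) \<longlonglongrightarrow> 1
    \<and> (\<lambda>d. repeater_rate (key_shield 2 d d) (key_shield 2 d d) (\<rho> d) (\<rho> d)) \<longlonglongrightarrow> 0
    \<and> (\<forall>\<^sub>F d in sequentially.
          repeater_rate (key_shield 2 d d) (key_shield 2 d d) (\<rho> d) (\<rho> d)
            < distillable_key (key_shield 2 d d) (\<rho> d))"
proof -
  let ?p = "\<lambda>d :: nat. 1 / (sqrt (real d) + 1)"
  let ?D = "\<lambda>d :: nat. key_shield 2 d d"
  have "\<forall>d. \<exists>\<rho>. d \<ge> 1 \<longrightarrow> density_op (joint_basis (?D d)) \<rho> \<and> PPT (?D d) \<rho>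
    \<and> (0 \<le> 1 - 2 * binary_entropy (?p d) \<longrightarrow> distillable_key (?D d) \<rho> = ereal (1 - 2 * binary_entropy (?p d)))
    \<and> 0 \<le> repeater_rate (?D d) (?D d) \<rho> \<rho> \<and> repeater_rate (?D d) (?D d) \<rho> \<rho> \<le> ereal (2 * ?p d * log 2 (2 * real d) + eta (?p d))"
    using example_state by blast
  then obtain \<rho> where \<rho>: "\<And>d. d \<ge> 1 \<Longrightarrow> density_op (joint_basis (?D d)) (\<rho> d) \<and> PPT (?D d) (\<rho> d)
    \<and> (0 \<le> 1 - 2 * binary_entropy (?p d) \<longrightarrow> distillable_key (?D d) (\<rho> d) = ereal (1 - 2 * binary_entropy (?p d)))
    \<and> 0 \<le> repeater_rate (?D d) (?D d) (\<rho> d) (\<rho> d)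
    \<and> repeater_rate (?D d) (?D d) (\<rho> d) (\<rho> d) \<le> ereal (2 * ?p d * log 2 (2 * real d) + eta (?p d))"
    by (drule_tac choice) blast
  let ?K = "\<lambda>d. distillable_key (?D d) (\<rho> d)" and ?R = "\<lambda>d. repeater_rate (?D d) (?D d) (\<rho> d) (\<rho> d)"
  have "\<forall>\<^sub>F d in sequentially. 0 < 1 - 2 * binary_entropy (?p d)"
    by (rule order_tendstoD(1)[OF key_limit]) simp
  then have "\<forall>\<^sub>F d in sequentially. ?K d = ereal (1 - 2 * binary_entropy (?p d))"
    using eventually_ge_at_top[of 1]
  proof eventually_elim
    case (elim d)
    then show ?case using \<rho>[of d] by simp
  qed
  moreover have "(\<lambda>d. ereal (1 - 2 * binary_entropy (?p d))) \<longlonglongrightarrow> 1"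
    using tendsto_ereal[OF key_limit] by (simp add: one_ereal_def)
  ultimately have K: "?K \<longlonglongrightarrow> 1" by (simp add: tendsto_cong)
  have R: "?R \<longlonglongrightarrow> 0"
  proof (rule tendsto_sandwich[OF _ _ tendsto_const])
    \<comment> \<open>Without this lower bound the extended real rates could tend to minus
      infinity.\<close>
    show "\<forall>\<^sub>F d in sequentially. 0 \<le> ?R d"
      using eventually_ge_at_top[of 1] by eventually_elim (use \<rho> in blast)
    show "\<forall>\<^sub>F d in sequentially. ?R d \<le> ereal (2 * ?p d * log 2 (2 * real d) + eta (?p d))"
      using eventually_ge_at_top[of 1] by eventually_elim (use \<rho> in blast)
    show "(\<lambda>d. ereal (2 * ?p d * log 2 (2 * real d) + eta (?p d))) \<longlonglongrightarrow> 0"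
      using tendsto_ereal[OF repeater_limit] by (simp add: zero_ereal_def)
  qed
  \<comment> \<open>The value 1 / 2 separates the limits 0 and 1.\<close>
  have "\<forall>\<^sub>F d in sequentially. ?R d < ereal (1 / 2)" by (rule order_tendstoD(2)[OF R]) simp
  moreover have "\<forall>\<^sub>F d in sequentially. ereal (1 / 2) < ?K d" by (rule order_tendstoD(1)[OF K]) (simp add: one_ereal_def)
  ultimately have "\<forall>\<^sub>F d in sequentially. ?R d < ?K d" by eventually_elim (rule less_trans)
  then show ?thesis using \<rho> K R by (intro exI[of _ \<rho>]) blast
qed

end
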